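(* Let $K$ be an algebraically closed field of characteristic zero. Let $Q=L\ltimes\exp(V)$ be a semi-direct product, where $Q$ is a connected affine algebraic group over $K$ and $\exp(V)$ is a normal Abelian unipotent subgroup with Lie algebra $V$. Let $\mathfrak q=\mathrm{Lie}\,Q$ and suppose that $\mathrm{ind}\,\mathfrak q=1$ and that $\gamma\in V^*$ is such that the orbit $L\gamma\subset V^*$ is open. Let $\mathfrak l_\gamma$ be the Lie algebra of the stabiliser $L_\gamma$ and $\mathfrak l_{<\gamma>}$ the Lie algebra of the normaliser $L_{<\gamma>}\subset L$ of the line $K\gamma$. (i) Suppose that $\mathfrak l_\gamma$ is not contact. Then $\mathfrak q$ is contact if and only if $\mathrm{ind}\,\mathfrak l_{<\gamma>}=0$. (ii) If $\mathfrak l_\gamma$ is contact, but $\mathfrak q$ is not contact, then $\mathrm{ind}\,\mathfrak l_{<\gamma>}=0$.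
   Context: A finite-dimensional Lie algebra $\mathfrak h$ is called contact if $\dim\mathfrak h=2n+1$ is odd and there is $\alpha\in\mathfrak h^*$ with $(d_{\mathfrak h}\alpha)^{\wedge n}\wedge\alpha\neq 0$, where $d_{\mathfrak h}\alpha\in\wedge^2\mathfrak h^*$ is the Chevalley--Eilenberg differential, $d_{\mathfrak h}\alpha(\xi,\eta)=-\alpha([\xi,\eta])$ (up to an irrelevant sign convention). The index is $\mathrm{ind}\,\mathfrak h=\min_{\gamma\in\mathfrak h^*}\dim\mathfrak h_\gamma$, where $\mathfrak h_\gamma=\{\xi\in\mathfrak h\mid\gamma([\xi,\mathfrak h])=0\}$. In the semi-direct product, $V$ is an Abelian ideal of $\mathfrak q=\mathfrak l\ltimes V$, $\mathfrak l=\mathrm{Lie}\,L$, and $L$ acts on $V$ (adjoint action) and on $V^*$ (dual action). Explicitly, $L_{<\gamma>}=\{g\in L\mid g\gamma\in K\gamma\}$, so $\mathfrak l_{<\gamma>}=\{x\in\mathfrak l\mid x\cdot\gamma\in K\gamma\}$ and $\mathfrak l_\gamma=\{x\in\mathfrak l\mid x\cdot\gamma=0\}$. *)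

theory Defs
  imports "HOL-Analysis.Analysis" "HOL-Algebra.Coset" "HOL-Combinatorics.Permutations"
    "HOL-Computational_Algebra.Polynomial" "HOL-Library.Function_Algebras"
begin

section \<open>Index and contact structures\<close>

text \<open>
  A Lie algebra is given by a scalar multiplication \<open>sc\<close> and a bracket \<open>br\<close> on an ambient
  additive group, and the subset \<open>h\<close> on which it lives. Elements of \<open>h\<^sup>*\<close> are represented
  by functions that are \<open>0\<close> outside \<open>h\<close>, so that equality in \<open>h\<^sup>*\<close> is equality of functions.
\<close>

definition dual_space ::
    "('k::field \<Rightarrow> 'v::ab_group_add \<Rightarrow> 'v) \<Rightarrow> 'v set \<Rightarrow> ('v \<Rightarrow> 'k) set" where
  "dual_space sc h =
     {\<phi>. (\<forall>x\<in>h. \<forall>y\<in>h. \<phi> (x + y) = \<phi> x + \<phi> y) \<and> (\<forall>c. \<forall>x\<in>h. \<phi> (sc c x) = c * \<phi> x) \<and>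
         (\<forall>x. x \<notin> h \<longrightarrow> \<phi> x = 0)}"

definition coadjoint_stabiliser ::
    "('v \<Rightarrow> 'v \<Rightarrow> 'v) \<Rightarrow> 'v set \<Rightarrow> ('v \<Rightarrow> 'k::field) \<Rightarrow> 'v set" where
  "coadjoint_stabiliser br h \<phi> = {x \<in> h. \<forall>y\<in>h. \<phi> (br x y) = 0}"

definition lie_index ::
    "('k::field \<Rightarrow> 'v::ab_group_add \<Rightarrow> 'v) \<Rightarrow> ('v \<Rightarrow> 'v \<Rightarrow> 'v) \<Rightarrow> 'v set \<Rightarrow> nat" where
  "lie_index sc br h =
     (INF \<phi>\<in>dual_space sc h. vector_space.dim sc (coadjoint_stabiliser br h \<phi>))"

text \<open>
  A \<open>p\<close>-form is a function of sequences of vectors that depends on the first \<open>p\<close> entries only.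
\<close>

definition wedge ::
    "nat \<Rightarrow> nat \<Rightarrow> ((nat \<Rightarrow> 'v) \<Rightarrow> 'k::field_char_0) \<Rightarrow> ((nat \<Rightarrow> 'v) \<Rightarrow> 'k) \<Rightarrow> (nat \<Rightarrow> 'v) \<Rightarrow> 'k" where
  "wedge p q \<omega> \<eta> v =
     (\<Sum>\<sigma> | \<sigma> permutes {..<p + q}.
        of_int (sign \<sigma>) * \<omega> (\<lambda>i. v (\<sigma> i)) * \<eta> (\<lambda>i. v (\<sigma> (p + i)))) / (fact p * fact q)"

primrec wedge_power ::
    "nat \<Rightarrow> ((nat \<Rightarrow> 'v) \<Rightarrow> 'k::field_char_0) \<Rightarrow> nat \<Rightarrow> (nat \<Rightarrow> 'v) \<Rightarrow> 'k" where
  "wedge_power p \<omega> 0 = (\<lambda>_. 1)"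
| "wedge_power p \<omega> (Suc n) = wedge p (p * n) \<omega> (wedge_power p \<omega> n)"

definition ce_differential ::
    "('v \<Rightarrow> 'v \<Rightarrow> 'v) \<Rightarrow> ('v \<Rightarrow> 'k::field_char_0) \<Rightarrow> (nat \<Rightarrow> 'v) \<Rightarrow> 'k" where
  "ce_differential br \<alpha> v = - \<alpha> (br (v 0) (v 1))"

text \<open>
  \<^const>\<open>vector_space.dim\<close> is \<open>0\<close> on infinite-dimensional spaces, so the condition on the dimension
  includes finiteness.
\<close>

definition contact ::
    "('k::field_char_0 \<Rightarrow> 'v::ab_group_add \<Rightarrow> 'v) \<Rightarrow> ('v \<Rightarrow> 'v \<Rightarrow> 'v) \<Rightarrow> 'v set \<Rightarrow> bool" where
  "contact sc br h \<longleftrightarrow>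
     (\<exists>n. vector_space.dim sc h = 2 * n + 1 \<and>
       (\<exists>\<alpha>\<in>dual_space sc h. \<exists>v. (\<forall>i. v i \<in> h) \<and>
          wedge (2 * n) 1 (wedge_power 2 (ce_differential br \<alpha>) n) (\<lambda>v. \<alpha> (v 0)) v \<noteq> 0))"


section \<open>Affine varieties\<close>

text \<open>
  Over an algebraically closed field, an affine variety is presented intrinsically (as in
  Hochschild's book on algebraic groups) by its set of points \<open>X\<close> and its coordinate ring \<open>A\<close>, a
  finitely generated algebra of functions on \<open>X\<close> such that evaluation identifies \<open>X\<close> with the set
  of algebra homomorphisms from \<open>A\<close> to the base field. Functions on \<open>X\<close> are \<open>0\<close> outside \<open>X\<close>.
\<close>

abbreviation restr :: "'a set \<Rightarrow> ('a \<Rightarrow> 'k::zero) \<Rightarrow> 'a \<Rightarrow> 'k" where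
  "restr X f \<equiv> (\<lambda>x. if x \<in> X then f x else 0)"

inductive_set generated_algebra :: "'a set \<Rightarrow> ('a \<Rightarrow> 'k::field) set \<Rightarrow> ('a \<Rightarrow> 'k) set"
  for X :: "'a set" and F :: "('a \<Rightarrow> 'k) set" where
  const: "restr X (\<lambda>_. c) \<in> generated_algebra X F"
| gen: "f \<in> F \<Longrightarrow> restr X f \<in> generated_algebra X F"
| add: "f \<in> generated_algebra X F \<Longrightarrow> g \<in> generated_algebra X F \<Longrightarrow> f + g \<in> generated_algebra X F"
| mult: "f \<in> generated_algebra X F \<Longrightarrow> g \<in> generated_algebra X F \<Longrightarrow> f * g \<in> generated_algebra X F"

definition affine_variety :: "'a set \<Rightarrow> ('a \<Rightarrow> 'k::field) set \<Rightarrow> bool" where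
  "affine_variety X A \<longleftrightarrow>
     (\<exists>F. finite F \<and> A = generated_algebra X F) \<and>
     (\<forall>x\<in>X. \<forall>y\<in>X. x \<noteq> y \<longrightarrow> (\<exists>f\<in>A. f x \<noteq> f y)) \<and>
     (\<forall>\<phi>. (\<forall>c. \<phi> (restr X (\<lambda>_. c)) = c) \<and>
          (\<forall>f\<in>A. \<forall>g\<in>A. \<phi> (f + g) = \<phi> f + \<phi> g \<and> \<phi> (f * g) = \<phi> f * \<phi> g) \<longrightarrow>
          (\<exists>x\<in>X. \<forall>f\<in>A. \<phi> f = f x))"

definition zariski :: "'a set \<Rightarrow> ('a \<Rightarrow> 'k::field) set \<Rightarrow> 'a topology" where
  "zariski X A = topology_generated_by ((\<lambda>f. {x \<in> X. f x \<noteq> 0}) ` A)"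

text \<open>The coordinate ring \<open>A \<otimes> B\<close> of a product.\<close>

definition product_ring ::
    "('a \<Rightarrow> 'k::field) set \<Rightarrow> ('b \<Rightarrow> 'k) set \<Rightarrow> ('a \<times> 'b \<Rightarrow> 'k) set" where
  "product_ring A B =
     {\<lambda>(x, y). \<Sum>i<n. f i x * g i y | (n::nat) f g. \<forall>i<n. f i \<in> A \<and> g i \<in> B}"

definition morphism ::
    "'a set \<Rightarrow> ('a \<Rightarrow> 'k::field) set \<Rightarrow> 'b set \<Rightarrow> ('b \<Rightarrow> 'k) set \<Rightarrow> ('a \<Rightarrow> 'b) \<Rightarrow> bool" where
  "morphism X A Y B \<phi> \<longleftrightarrow> \<phi> ` X \<subseteq> Y \<and> (\<forall>g\<in>B. restr X (\<lambda>x. g (\<phi> x)) \<in> A)"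

definition isomorphism ::
    "'a set \<Rightarrow> ('a \<Rightarrow> 'k::field) set \<Rightarrow> 'b set \<Rightarrow> ('b \<Rightarrow> 'k) set \<Rightarrow> ('a \<Rightarrow> 'b) \<Rightarrow> bool" where
  "isomorphism X A Y B \<phi> \<longleftrightarrow>
     morphism X A Y B \<phi> \<and>
     (\<exists>\<psi>. morphism Y B X A \<psi> \<and> (\<forall>x\<in>X. \<psi> (\<phi> x) = x) \<and> (\<forall>y\<in>Y. \<phi> (\<psi> y) = y))"


section \<open>Affine algebraic groups\<close>

definition affine_algebraic_group :: "'g monoid \<Rightarrow> ('g \<Rightarrow> 'k::field) set \<Rightarrow> bool" where
  "affine_algebraic_group G A \<longleftrightarrow>
     group G \<and> affine_variety (carrier G) A \<and>
     morphism (carrier G \<times> carrier G) (product_ring A A) (carrier G) A (\<lambda>(x, y). x \<otimes>\<^bsub>G\<^esub> y) \<and>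
     morphism (carrier G) A (carrier G) A (\<lambda>x. inv\<^bsub>G\<^esub> x)"

definition closed_subgroup :: "'g monoid \<Rightarrow> ('g \<Rightarrow> 'k::field) set \<Rightarrow> 'g set \<Rightarrow> bool" where
  "closed_subgroup G A H \<longleftrightarrow> subgroup H G \<and> closedin (zariski (carrier G) A) H"

text \<open>
  Semi-direct products are meant in the category of algebraic groups: multiplication is an
  isomorphism of varieties \<open>L \<times> N \<rightarrow> G\<close>.
\<close>

definition semidirect_product ::
    "'g monoid \<Rightarrow> ('g \<Rightarrow> 'k::field) set \<Rightarrow> 'g set \<Rightarrow> 'g set \<Rightarrow> bool" where
  "semidirect_product G A L N \<longleftrightarrow>
     closed_subgroup G A L \<and> closed_subgroup G A N \<and> N \<lhd> G \<and>
     isomorphism (L \<times> N) (product_ring (restr L ` A) (restr N ` A)) (carrier G) A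
       (\<lambda>(l, n). l \<otimes>\<^bsub>G\<^esub> n)"

definition left_translation :: "'g monoid \<Rightarrow> 'g \<Rightarrow> ('g \<Rightarrow> 'k::field) \<Rightarrow> 'g \<Rightarrow> 'k" where
  "left_translation G x f = restr (carrier G) (\<lambda>y. f (inv\<^bsub>G\<^esub> x \<otimes>\<^bsub>G\<^esub> y))"

definition right_translation :: "'g monoid \<Rightarrow> 'g \<Rightarrow> ('g \<Rightarrow> 'k::field) \<Rightarrow> 'g \<Rightarrow> 'k" where
  "right_translation G x f = restr (carrier G) (\<lambda>y. f (y \<otimes>\<^bsub>G\<^esub> x))"

text \<open>An element is unipotent if its right translation acts locally unipotently on \<open>A\<close>.\<close>

definition unipotent_subgroup :: "'g monoid \<Rightarrow> ('g \<Rightarrow> 'k::field) set \<Rightarrow> 'g set \<Rightarrow> bool" where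
  "unipotent_subgroup G A N \<longleftrightarrow>
     (\<forall>u\<in>N. \<forall>f\<in>A. \<exists>n. ((\<lambda>f. right_translation G u f - f) ^^ n) f = 0)"


section \<open>The Lie algebra of an affine algebraic group\<close>

type_synonym ('g, 'k) operator = "('g \<Rightarrow> 'k) \<Rightarrow> ('g \<Rightarrow> 'k)"

definition op_scale :: "'k::field \<Rightarrow> ('g, 'k) operator \<Rightarrow> ('g, 'k) operator" where
  "op_scale c D = (\<lambda>f x. c * D f x)"

definition commutator ::
    "('g, 'k::field) operator \<Rightarrow> ('g, 'k) operator \<Rightarrow> ('g, 'k) operator" where
  "commutator D E = (\<lambda>f. D (E f) - E (D f))"

text \<open>Left-invariant derivations of \<open>A\<close>, extended by \<open>0\<close> outside \<open>A\<close>.\<close>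

definition Lie :: "'g monoid \<Rightarrow> ('g \<Rightarrow> 'k::field) set \<Rightarrow> ('g, 'k) operator set" where
  "Lie G A =
     {D. (\<forall>f. f \<notin> A \<longrightarrow> D f = 0) \<and> (\<forall>f\<in>A. D f \<in> A) \<and>
         (\<forall>f\<in>A. \<forall>g\<in>A. D (f + g) = D f + D g) \<and>
         (\<forall>c. \<forall>f\<in>A. D (\<lambda>x. c * f x) = (\<lambda>x. c * D f x)) \<and>
         (\<forall>f\<in>A. \<forall>g\<in>A. D (f * g) = D f * g + f * D g) \<and>
         (\<forall>x\<in>carrier G. \<forall>f\<in>A. D (left_translation G x f) = left_translation G x (D f))}"

text \<open>
  The Lie algebra of a closed subgroup \<open>H\<close>, embedded in \<^term>\<open>Lie G A\<close> by the differential of the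
  inclusion: the derivations whose value at \<open>1\<close> is a tangent vector of \<open>H\<close>, i.e. kills the ideal
  of functions vanishing on \<open>H\<close>.
\<close>

definition Lie_subgroup ::
    "'g monoid \<Rightarrow> ('g \<Rightarrow> 'k::field) set \<Rightarrow> 'g set \<Rightarrow> ('g, 'k) operator set" where
  "Lie_subgroup G A H =
     {D \<in> Lie G A. \<forall>f\<in>A. (\<forall>x\<in>H. f x = 0) \<longrightarrow> D f \<one>\<^bsub>G\<^esub> = 0}"

definition Ad ::
    "'g monoid \<Rightarrow> ('g \<Rightarrow> 'k::field) set \<Rightarrow> 'g \<Rightarrow> ('g, 'k) operator \<Rightarrow> ('g, 'k) operator" where
  "Ad G A g D =
     (\<lambda>f. if f \<in> A then right_translation G g (D (right_translation G (inv\<^bsub>G\<^esub> g) f)) else 0)"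

definition dual_action ::
    "'g monoid \<Rightarrow> ('g \<Rightarrow> 'k::field) set \<Rightarrow> ('g, 'k) operator set \<Rightarrow> 'g \<Rightarrow>
     (('g, 'k) operator \<Rightarrow> 'k) \<Rightarrow> (('g, 'k) operator \<Rightarrow> 'k)" where
  "dual_action G A V g \<phi> = restr V (\<lambda>v. \<phi> (Ad G A (inv\<^bsub>G\<^esub> g) v))"

text \<open>The Zariski topology on \<open>V\<^sup>*\<close>, whose polynomial functions are generated by the elements of \<open>V\<close>.\<close>

definition zariski_dual ::
    "('k::field \<Rightarrow> 'v::ab_group_add \<Rightarrow> 'v) \<Rightarrow> 'v set \<Rightarrow> ('v \<Rightarrow> 'k) topology" where
  "zariski_dual sc V =
     zariski (dual_space sc V) (generated_algebra (dual_space sc V) ((\<lambda>v \<phi>. \<phi> v) ` V))"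

definition point_stabiliser ::
    "'g monoid \<Rightarrow> ('g \<Rightarrow> 'k::field) set \<Rightarrow> 'g set \<Rightarrow> ('g, 'k) operator set \<Rightarrow>
     (('g, 'k) operator \<Rightarrow> 'k) \<Rightarrow> 'g set" where
  "point_stabiliser G A L V \<gamma> = {g \<in> L. dual_action G A V g \<gamma> = \<gamma>}"

definition line_normaliser ::
    "'g monoid \<Rightarrow> ('g \<Rightarrow> 'k::field) set \<Rightarrow> 'g set \<Rightarrow> ('g, 'k) operator set \<Rightarrow>
     (('g, 'k) operator \<Rightarrow> 'k) \<Rightarrow> 'g set" where
  "line_normaliser G A L V \<gamma> = {g \<in> L. \<exists>c. dual_action G A V g \<gamma> = (\<lambda>v. c * \<gamma> v)}"


section \<open>Well-definedness\<close>

lemma vector_space_op_scale: "vector_space op_scale"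
  by (unfold_locales; rule ext; rule ext; simp add: op_scale_def algebra_simps)

lemma topspace_zariski: "topspace (zariski X (generated_algebra X F)) = X"
proof -
  have "restr X (\<lambda>_. 1) \<in> generated_algebra X F"
    by (rule generated_algebra.const)
  then have "X \<subseteq> (\<Union>f\<in>generated_algebra X F. {x \<in> X. f x \<noteq> 0})"
    by (intro subsetI UN_I[where a = "restr X (\<lambda>_. 1)"]) simp_all
  then show ?thesis
    unfolding zariski_def topology_generated_by_topspace by blast
qed

lemma closedin_zariski_zero_set:
  assumes "S \<subseteq> generated_algebra X F"
  shows "closedin (zariski X (generated_algebra X F)) {x \<in> X. \<forall>f\<in>S. f x = 0}"
proof -
  have op: "openin (zariski X (generated_algebra X F)) {x \<in> X. f x \<noteq> 0}" if "f \<in> S" for f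
    unfolding zariski_def
    by (rule topology_generated_by_Basis) (rule imageI, use that assms in blast)
  have "X - {x \<in> X. \<forall>f\<in>S. f x = 0} = (\<Union>f\<in>S. {x \<in> X. f x \<noteq> 0})"
    by blast
  moreover have "openin (zariski X (generated_algebra X F)) (\<Union>f\<in>S. {x \<in> X. f x \<noteq> 0})"
    using op by (intro openin_Union) blast
  ultimately show ?thesis
    unfolding closedin_def topspace_zariski by simp
qed

lemma generated_algebra_scale:
  assumes "f \<in> generated_algebra X F"
  shows "(\<lambda>x. c * f x) \<in> generated_algebra X F"
proof -
  have "f x = 0" if "x \<notin> X" for x
    using assms that by (induction rule: generated_algebra.induct) simp_all
  then have "(\<lambda>x. c * f x) = restr X (\<lambda>_. c) * f"
    by (intro ext) simp
  then show ?thesis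
    using generated_algebra.mult[OF generated_algebra.const assms] by simp
qed

lemma generated_algebra_diff:
  assumes "f \<in> generated_algebra X F" "g \<in> generated_algebra X F"
  shows "f - g \<in> generated_algebra X F"
proof -
  have "f - g = f + (\<lambda>x. - 1 * g x)"
    by (intro ext) simp
  then show ?thesis
    by (simp only: generated_algebra.add[OF assms(1) generated_algebra_scale[OF assms(2)]])
qed

lemma commutator_in_Lie:
  assumes A: "A = generated_algebra X F" and D: "D \<in> Lie G A" and E: "E \<in> Lie G A"
  shows "commutator D E \<in> Lie G A"
proof -
  have props: "\<And>f. f \<notin> A \<Longrightarrow> T f = 0" "\<And>f. f \<in> A \<Longrightarrow> T f \<in> A"
    "\<And>f g. f \<in> A \<Longrightarrow> g \<in> A \<Longrightarrow> T (f + g) = T f + T g"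
    "\<And>f g. f \<in> A \<Longrightarrow> g \<in> A \<Longrightarrow> T (f * g) = T f * g + f * T g"
    "\<And>c f. f \<in> A \<Longrightarrow> T (\<lambda>x. c * f x) = (\<lambda>x. c * T f x)"
    "\<And>x f. x \<in> carrier G \<Longrightarrow> f \<in> A \<Longrightarrow> T (left_translation G x f) = left_translation G x (T f)"
    if "T \<in> Lie G A" for T
    using that unfolding Lie_def mem_Collect_eq by simp_all
  note DE = props[OF D] props[OF E]
  have closed: "\<And>f g. f \<in> A \<Longrightarrow> g \<in> A \<Longrightarrow> f + g \<in> A" "\<And>f g. f \<in> A \<Longrightarrow> g \<in> A \<Longrightarrow> f * g \<in> A"
    "\<And>f g. f \<in> A \<Longrightarrow> g \<in> A \<Longrightarrow> f - g \<in> A"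
    unfolding A by (fact generated_algebra.add generated_algebra.mult generated_algebra_diff)+
  have "restr X (\<lambda>_. 0) \<in> A"
    unfolding A by (rule generated_algebra.const)
  then have zero: "0 \<in> A"
    by (simp add: zero_fun_def)
  have zero': "D 0 = 0" "E 0 = 0"
    using DE(3)[OF zero zero] DE(9)[OF zero zero] by simp_all
  show ?thesis
    unfolding Lie_def
  proof (intro CollectI conjI allI ballI impI)
    fix f assume "f \<notin> A"
    then show "commutator D E f = 0"
      by (simp add: commutator_def DE(1,7) zero')
  next
    fix f assume f: "f \<in> A"
    show "commutator D E f \<in> A"
      unfolding commutator_def by (intro closed DE(2,8) f)
  next
    fix f g assume f: "f \<in> A" and g: "g \<in> A"
    show "commutator D E (f + g) = commutator D E f + commutator D E g"
      using f g by (simp add: commutator_def DE(2,3,8,9))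
    show "commutator D E (f * g) = commutator D E f * g + f * commutator D E g"
      using f g by (simp add: commutator_def DE(2-4,8-10) closed) (simp add: algebra_simps)
  next
    fix c f assume f: "f \<in> A"
    show "commutator D E (\<lambda>x. c * f x) = (\<lambda>x. c * commutator D E f x)"
      using f by (intro ext) (simp add: commutator_def DE(2,5,8,11) right_diff_distrib)
  next
    fix x f assume x: "x \<in> carrier G" and f: "f \<in> A"
    show "commutator D E (left_translation G x f) = left_translation G x (commutator D E f)"
      unfolding commutator_def DE(6)[OF x f] DE(12)[OF x f] DE(6)[OF x DE(8)[OF f]]
        DE(12)[OF x DE(2)[OF f]]
      by (intro ext) (simp add: left_translation_def)
  qed
qed

lemma generated_algebra_sum:
  assumes "\<And>i. i < n \<Longrightarrow> f i \<in> generated_algebra X F"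
  shows "(\<lambda>x. \<Sum>i<(n::nat). c i * f i x) \<in> generated_algebra X F"
  using assms
proof (induction n)
  case 0
  then show ?case
    using generated_algebra.const[of X 0 F] by simp
next
  case (Suc n)
  have "(\<lambda>x. \<Sum>i<Suc n. c i * f i x) = (\<lambda>x. \<Sum>i<n. c i * f i x) + (\<lambda>x. c n * f n x)"
    by (intro ext) simp
  moreover have "(\<lambda>x. \<Sum>i<n. c i * f i x) \<in> generated_algebra X F"
    using Suc by simp
  moreover have "(\<lambda>x. c n * f n x) \<in> generated_algebra X F"
    using Suc.prems by (simp add: generated_algebra_scale)
  ultimately show ?case
    by (simp only: generated_algebra.add)
qed

lemma left_translation_in:
  assumes "affine_algebraic_group G A" "x \<in> carrier G" "f \<in> A"
  shows "left_translation G x f \<in> A"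
proof -
  obtain F where A: "A = generated_algebra (carrier G) F"
    using assms(1) unfolding affine_algebraic_group_def affine_variety_def by blast
  have G: "group G"
    using assms(1) unfolding affine_algebraic_group_def by blast
  have "restr (carrier G \<times> carrier G) (\<lambda>p. f ((\<lambda>(x, y). x \<otimes>\<^bsub>G\<^esub> y) p)) \<in> product_ring A A"
    using assms(1,3) unfolding affine_algebraic_group_def morphism_def by blast
  then obtain n :: nat and a b where ab: "\<And>i. i < n \<Longrightarrow> b i \<in> A"
    and eq: "restr (carrier G \<times> carrier G) (\<lambda>p. f ((\<lambda>(x, y). x \<otimes>\<^bsub>G\<^esub> y) p)) =
      (\<lambda>(x, y). \<Sum>i<n. a i x * b i y)"
    unfolding product_ring_def by blast
  have inv: "inv\<^bsub>G\<^esub> x \<in> carrier G"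
    using G assms(2) by (rule group.inv_closed)
  have "left_translation G x f = (\<lambda>y. \<Sum>i<n. a i (inv\<^bsub>G\<^esub> x) * b i y)"
  proof
    fix y
    show "left_translation G x f y = (\<Sum>i<n. a i (inv\<^bsub>G\<^esub> x) * b i y)"
      using fun_cong[OF eq, of "(inv\<^bsub>G\<^esub> x, y)"] inv
      by (simp add: left_translation_def split: if_splits)
  qed
  then show ?thesis
    unfolding A by (simp only:) (rule generated_algebra_sum, use ab A in simp)
qed

lemma commutator_in_Lie_subgroup:
  assumes G: "affine_algebraic_group G A" and H: "subgroup H G"
    and D: "D \<in> Lie_subgroup G A H" and E: "E \<in> Lie_subgroup G A H"
  shows "commutator D E \<in> Lie_subgroup G A H"
proof -
  obtain F where A: "A = generated_algebra (carrier G) F"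
    using G unfolding affine_algebraic_group_def affine_variety_def by blast
  have grp: "group G"
    using G unfolding affine_algebraic_group_def by blast
  have ideal: "\<forall>x\<in>H. T f x = 0"
    if T: "T \<in> Lie_subgroup G A H" and f: "f \<in> A" "\<forall>x\<in>H. f x = 0" for T f
  proof
    fix x assume x: "x \<in> H"
    have xG: "x \<in> carrier G" and ix: "inv\<^bsub>G\<^esub> x \<in> H"
      using H x by (auto simp: subgroup.mem_carrier subgroup.m_inv_closed)
    have ixG: "inv\<^bsub>G\<^esub> x \<in> carrier G"
      using grp xG by (rule group.inv_closed)
    have one: "\<one>\<^bsub>G\<^esub> \<in> carrier G"
      using H subgroup.mem_carrier subgroup.one_closed by metis
    have lt: "left_translation G (inv\<^bsub>G\<^esub> x) g y = (if y \<in> carrier G then g (x \<otimes>\<^bsub>G\<^esub> y) else 0)" for g :: "'a \<Rightarrow> 'b" and y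
      using grp xG by (simp add: left_translation_def group.inv_inv)
    have "\<forall>y\<in>H. left_translation G (inv\<^bsub>G\<^esub> x) f y = 0"
      using f(2) H x by (simp add: lt subgroup.m_closed)
    moreover have "left_translation G (inv\<^bsub>G\<^esub> x) f \<in> A"
      using G ixG f(1) by (rule left_translation_in)
    ultimately have "T (left_translation G (inv\<^bsub>G\<^esub> x) f) \<one>\<^bsub>G\<^esub> = 0"
      using T unfolding Lie_subgroup_def by blast
    moreover have "T (left_translation G (inv\<^bsub>G\<^esub> x) f) = left_translation G (inv\<^bsub>G\<^esub> x) (T f)"
      using T ixG f(1) unfolding Lie_subgroup_def Lie_def by blast
    ultimately show "T f x = 0"
      using grp xG one by (simp add: lt group.is_monoid monoid.r_one)
  qed
  have L: "D \<in> Lie G A" "E \<in> Lie G A"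
    using D E unfolding Lie_subgroup_def by blast+
  have in_A: "D f \<in> A" "E f \<in> A" if "f \<in> A" for f
    using L that unfolding Lie_def by blast+
  have at_one: "T f \<one>\<^bsub>G\<^esub> = 0" if "T \<in> Lie_subgroup G A H" "f \<in> A" "\<forall>x\<in>H. f x = 0" for T f
    using that unfolding Lie_subgroup_def by blast
  have "commutator D E f \<one>\<^bsub>G\<^esub> = 0" if f: "f \<in> A" "\<forall>x\<in>H. f x = 0" for f
    using at_one[OF D in_A(2)[OF f(1)] ideal[OF E f]] at_one[OF E in_A(1)[OF f(1)] ideal[OF D f]]
    by (simp add: commutator_def)
  then show ?thesis
    unfolding Lie_subgroup_def using commutator_in_Lie[OF A L] by blast
qed

end

theory Submission
  imports Defs "HOL-Computational_Algebra.Formal_Power_Series"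
begin

text \<open>
  A Lie algebra is contact iff it has a functional \<open>\<phi>\<close> whose stabiliser is a line on which \<open>\<phi>\<close>
  does not vanish. Since the orbit of \<open>\<gamma>\<close> is open, \<open>x \<mapsto> x \<cdot> \<gamma>\<close> maps \<open>l\<close> onto \<open>V\<^sup>*\<close>; choose \<open>x\<^sub>0\<close> with
  \<open>\<gamma>[x\<^sub>0, v] = \<gamma> v\<close>, so that the normaliser of the line \<open>K\<gamma>\<close> is the span of \<open>l\<^sub>\<gamma>\<close> and \<open>x\<^sub>0\<close>. If \<open>\<phi>\<close> extends \<open>\<gamma>\<close> to
  \<open>l + V\<close>, then every \<open>z\<close> in the stabiliser of \<open>\<phi>|l\<^sub>\<gamma>\<close> has a unique lift \<open>w = z + v\<close> to the stabiliser of \<open>\<phi>\<close>, and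
  \<open>\<phi> w = \<phi> z + \<phi>[z, x\<^sub>0]\<close>. When the stabiliser of \<open>\<phi>|l\<^sub>\<gamma>\<close> is the line \<open>Kz\<close>, the three
  properties ``\<open>\<phi>\<close> is a contact form'', ``\<open>\<phi>|l\<^sub>\<gamma>\<close> is a contact form'' and ``the normaliser has index
  \<open>0\<close>'' thus amount to \<open>\<phi> w \<noteq> 0\<close>, \<open>\<phi> z \<noteq> 0\<close> and \<open>\<phi>[z, x\<^sub>0] \<noteq> 0\<close>. A contact form on \<open>q\<close> may be assumed to
  extend \<open>\<gamma>\<close>: being a contact form is an open condition, so it can be moved until its restriction to \<open>V\<close>
  lies in the open orbit, and then conjugated.
\<close>

section \<open>Contact forms\<close>

text \<open>Two steps of the outline belong to algebraic geometry, and both rely on characteristic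
  zero. An open orbit says only that the orbit map of \<open>L\<close> is dominant; that its
  differential at 1 is onto is a statement of generic smoothness. And
  \<open>l\<^sub>\<gamma>\<close> is the tangent space of a set of points, cut out by every function
  that vanishes on the set, whereas the condition \<open>\<gamma>[x, v] = 0\<close> comes from
  particular equations; that these suffice is Cartier's theorem. Both rest on one elementary lifting
  statement: when a generator is adjoined to a coordinate ring, a general point lifts together with
  all its tangent vectors. It yields the Nullstellensatz, hence points of the group from ideals, and
  the surjectivity of the differential. On the Lie side everything is read off from the skew forms
  \<open>\<phi>[x, y]\<close>, so contact forms, which are given by alternating sums over
  permutations, have to be translated into kernels of such forms; the constants in these sums only
  have to be nonzero.\<close>

lemma self_eq_minus_imp_zero:
  assumes "x = - x"
  shows "x = (0 :: 'k::field_char_0)"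
proof -
  have "2 * x = 0"
    using assms by (metis add.right_inverse mult_2)
  then show ?thesis
    by simp
qed

section \<open>Signs, slots and multilinearity of wedge products\<close>

lemma wedge_permute:
  fixes \<omega> \<eta> :: "(nat \<Rightarrow> 'v) \<Rightarrow> 'k::field_char_0"
  assumes "\<tau> permutes {..<p + q}"
  shows "wedge p q \<omega> \<eta> (\<lambda>i. v (\<tau> i)) = of_int (sign \<tau>) * wedge p q \<omega> \<eta> v"
proof -
  let ?S = "{\<sigma>. \<sigma> permutes {..<p + q}}"
  let ?t = "\<lambda>\<sigma>. of_int (sign \<sigma>) * \<omega> (\<lambda>i. v (\<sigma> i)) * \<eta> (\<lambda>i. v (\<sigma> (p + i)))"
  have sg: "of_int (sign (\<tau> \<circ> \<sigma>)) = of_int (sign \<tau>) * (of_int (sign \<sigma>) :: 'k)" if "\<sigma> \<in> ?S" for \<sigma>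
    using that assms permutation_permutes[of \<sigma>] permutation_permutes[of \<tau>]
    by (metis finite_lessThan mem_Collect_eq of_int_mult sign_compose)
  have sg2: "of_int (sign \<tau>) * of_int (sign \<tau>) = (1 :: 'k)"
    by (simp add: sign_def)
  \<comment> \<open>The sign comes from the summation alone, by left multiplication of the index
    with \<open>\<tau>\<close>; the factors may be arbitrary functions.\<close>
  have "(\<Sum>\<sigma>\<in>?S. ?t \<sigma>) = (\<Sum>\<sigma>\<in>?S. ?t (\<tau> \<circ> \<sigma>))"
    by (rule setum_permutations_compose_left[OF assms])
  also have "\<dots> = (\<Sum>\<sigma>\<in>?S. of_int (sign \<tau>) * (of_int (sign \<sigma>) *
      \<omega> (\<lambda>i. v (\<tau> (\<sigma> i))) * \<eta> (\<lambda>i. v (\<tau> (\<sigma> (p + i))))))"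
    by (rule sum.cong) (auto simp: sg mult.assoc)
  finally have "(\<Sum>\<sigma>\<in>?S. ?t \<sigma>) = of_int (sign \<tau>) * (\<Sum>\<sigma>\<in>?S. of_int (sign \<sigma>) *
      \<omega> (\<lambda>i. v (\<tau> (\<sigma> i))) * \<eta> (\<lambda>i. v (\<tau> (\<sigma> (p + i)))))"
    by (simp add: sum_distrib_left)
  then have "of_int (sign \<tau>) * (\<Sum>\<sigma>\<in>?S. ?t \<sigma>) = (\<Sum>\<sigma>\<in>?S. of_int (sign \<sigma>) *
      \<omega> (\<lambda>i. v (\<tau> (\<sigma> i))) * \<eta> (\<lambda>i. v (\<tau> (\<sigma> (p + i)))))"
    by (simp only: mult.assoc[symmetric] sg2 mult_1)
  then show ?thesis
    unfolding wedge_def by simp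
qed

lemma wedge_repeated:
  assumes "i < p + q" "j < p + q" "i \<noteq> j" "v i = v j"
  shows "wedge p q \<omega> \<eta> v = (0 :: 'k::field_char_0)"
proof -
  let ?\<tau> = "Transposition.transpose i j"
  have perm: "?\<tau> permutes {..<p + q}"
    using assms by (simp add: permutes_swap_id)
  have "(\<lambda>k. v (?\<tau> k)) = v"
    using assms(4) by (auto simp: Transposition.transpose_def)
  with wedge_permute[OF perm, of \<omega> \<eta> v] have "wedge p q \<omega> \<eta> v = - wedge p q \<omega> \<eta> v"
    using assms(3) by (simp add: sign_swap_id)
  then show ?thesis
    by (rule self_eq_minus_imp_zero)
qed

text \<open>Linearity is asked for arguments in \<open>h\<close> only, because elements of
  \<open>dual_space\<close> are 0 off \<open>h\<close> and so need not be additive on the whole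
  group.\<close>

definition multilinear ::
    "('k::field \<Rightarrow> 'v::ab_group_add \<Rightarrow> 'v) \<Rightarrow> 'v set \<Rightarrow> nat \<Rightarrow> ((nat \<Rightarrow> 'v) \<Rightarrow> 'k) \<Rightarrow> bool" where
  "multilinear sc h p \<omega> \<longleftrightarrow>
     (\<forall>v w. (\<forall>i<p. v i = w i) \<longrightarrow> \<omega> v = \<omega> w) \<and>
     (\<forall>v j x y. range v \<subseteq> h \<and> x \<in> h \<and> y \<in> h \<and> j < p \<longrightarrow>
        \<omega> (v(j := x + y)) = \<omega> (v(j := x)) + \<omega> (v(j := y))) \<and>
     (\<forall>v j c x. range v \<subseteq> h \<and> x \<in> h \<and> j < p \<longrightarrow> \<omega> (v(j := sc c x)) = c * \<omega> (v(j := x)))"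

lemma upd_compose:
  assumes "\<sigma> permutes S"
  shows "(\<lambda>i. (v(j := x)) (\<sigma> i)) = (\<lambda>i. v (\<sigma> i))((inv_into UNIV \<sigma> j) := x)"
proof
  fix i
  have "\<sigma> i = j \<longleftrightarrow> i = inv_into UNIV \<sigma> j"
    using permutes_inverses[OF assms] by metis
  then show "(v(j := x)) (\<sigma> i) = ((\<lambda>i. v (\<sigma> i))((inv_into UNIV \<sigma> j) := x)) i"
    by simp
qed

lemma upd_shift:
  "(\<lambda>i. (v(j := x)) (p + i)) = (if j < (p::nat) then (\<lambda>i. v (p + i)) else (\<lambda>i. v (p + i))(j - p := x))"
  by (auto simp: fun_eq_iff)

lemma multilinear_wedge:
  assumes om: "multilinear sc h p \<omega>" and et: "multilinear sc h q \<eta>"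
  shows "multilinear sc h (p + q) (wedge p q \<omega> (\<eta> :: (nat \<Rightarrow> 'v::ab_group_add) \<Rightarrow> 'k::field_char_0))"
proof -
  let ?S = "{\<sigma>. \<sigma> permutes {..<p + q}}"
  have loc: "\<omega> v = \<omega> w" if "\<And>i. i < p \<Longrightarrow> v i = w i" for v w
    using om that unfolding multilinear_def by blast
  have loc': "\<eta> v = \<eta> w" if "\<And>i. i < q \<Longrightarrow> v i = w i" for v w
    using et that unfolding multilinear_def by blast
  define T where "T \<sigma> v = of_int (sign \<sigma>) * \<omega> (\<lambda>i. v (\<sigma> i)) * \<eta> (\<lambda>i. v (\<sigma> (p + i)))" for \<sigma> v
  have W: "wedge p q \<omega> \<eta> v = (\<Sum>\<sigma>\<in>?S. T \<sigma> v) / (fact p * fact q)" for v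
    unfolding wedge_def T_def ..
  have Tloc: "T \<sigma> v = T \<sigma> w" if "\<sigma> \<in> ?S" "\<forall>i<p + q. v i = w i" for \<sigma> v w
  proof -
    have lt: "\<sigma> i < p + q" if "i < p + q" for i
      using permutes_in_image[of \<sigma> "{..<p + q}" i] \<open>\<sigma> \<in> ?S\<close> that by simp
    have "\<omega> (\<lambda>i. v (\<sigma> i)) = \<omega> (\<lambda>i. w (\<sigma> i))"
      by (rule loc) (use lt that in auto)
    moreover have "\<eta> (\<lambda>i. v (\<sigma> (p + i))) = \<eta> (\<lambda>i. w (\<sigma> (p + i)))"
      by (rule loc') (use lt that in auto)
    ultimately show ?thesis
      by (simp add: T_def)
  qed
  \<comment> \<open>After permuting, the slot \<open>j\<close> is read by exactly one of the two
    factors, so each summand is a constant times a map that is linear on \<open>h\<close>.\<close>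
  have Tslot: "\<exists>C g. (\<forall>x. T \<sigma> (v(j := x)) = C * g x) \<and>
      (\<forall>x\<in>h. \<forall>y\<in>h. g (x + y) = g x + g y) \<and> (\<forall>c. \<forall>x\<in>h. g (sc c x) = c * g x)"
    if \<sigma>: "\<sigma> \<in> ?S" and v: "range v \<subseteq> h" and j: "j < p + q" for \<sigma> v j
  proof -
    define k where "k = inv_into UNIV \<sigma> j"
    have \<sigma>': "\<sigma> permutes {..<p + q}"
      using \<sigma> by simp
    have k: "k < p + q"
      using permutes_in_image[OF permutes_inv[OF \<sigma>'], of j] j unfolding k_def by simp
    let ?u = "\<lambda>i. v (\<sigma> i)"
    have u: "range ?u \<subseteq> h" "range (\<lambda>i. ?u (p + i)) \<subseteq> h"
      using v by auto
    have eq: "T \<sigma> (v(j := x)) = of_int (sign \<sigma>) * \<omega> (?u(k := x)) * \<eta> (\<lambda>i. (?u(k := x)) (p + i))" for x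
      unfolding T_def k_def upd_compose[OF \<sigma>', symmetric] ..
    show ?thesis
    proof (cases "k < p")
      case True
      have "T \<sigma> (v(j := x)) = (of_int (sign \<sigma>) * \<eta> (\<lambda>i. ?u (p + i))) * \<omega> (?u(k := x))" for x
        using True by (simp add: eq upd_shift)
      moreover have "\<forall>x\<in>h. \<forall>y\<in>h. \<omega> (?u(k := x + y)) = \<omega> (?u(k := x)) + \<omega> (?u(k := y))"
        "\<forall>c. \<forall>x\<in>h. \<omega> (?u(k := sc c x)) = c * \<omega> (?u(k := x))"
        using om u True unfolding multilinear_def by blast+
      ultimately show ?thesis
        by (rule_tac exI[of _ "of_int (sign \<sigma>) * \<eta> (\<lambda>i. ?u (p + i))"],
          rule_tac exI[of _ "\<lambda>x. \<omega> (?u(k := x))"]) simp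
    next
      case False
      then have kq: "k - p < q"
        using k by simp
      have "\<omega> (?u(k := x)) = \<omega> ?u" for x
        by (rule loc) (use False in auto)
      then have "T \<sigma> (v(j := x)) = (of_int (sign \<sigma>) * \<omega> ?u) * \<eta> ((\<lambda>i. ?u (p + i))(k - p := x))" for x
        unfolding eq upd_shift using False by simp
      moreover have "\<forall>x\<in>h. \<forall>y\<in>h. \<eta> ((\<lambda>i. ?u (p + i))(k - p := x + y)) =
          \<eta> ((\<lambda>i. ?u (p + i))(k - p := x)) + \<eta> ((\<lambda>i. ?u (p + i))(k - p := y))"
        "\<forall>c. \<forall>x\<in>h. \<eta> ((\<lambda>i. ?u (p + i))(k - p := sc c x)) = c * \<eta> ((\<lambda>i. ?u (p + i))(k - p := x))"
        using et u(2) kq unfolding multilinear_def by blast+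
      ultimately show ?thesis
        by (rule_tac exI[of _ "of_int (sign \<sigma>) * \<omega> ?u"],
          rule_tac exI[of _ "\<lambda>x. \<eta> ((\<lambda>i. ?u (p + i))(k - p := x))"]) simp
    qed
  qed
  show ?thesis
    unfolding multilinear_def
  proof (intro conjI allI impI)
    fix v w :: "nat \<Rightarrow> 'v" assume "\<forall>i<p + q. v i = w i"
    then have "(\<Sum>\<sigma>\<in>?S. T \<sigma> v) = (\<Sum>\<sigma>\<in>?S. T \<sigma> w)"
      by (intro sum.cong refl Tloc)
    then show "wedge p q \<omega> \<eta> v = wedge p q \<omega> \<eta> w"
      unfolding W by simp
  next
    fix v :: "nat \<Rightarrow> 'v" and j x y assume *: "range v \<subseteq> h \<and> x \<in> h \<and> y \<in> h \<and> j < p + q"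
    have "T \<sigma> (v(j := x + y)) = T \<sigma> (v(j := x)) + T \<sigma> (v(j := y))" if \<sigma>: "\<sigma> \<in> ?S" for \<sigma>
    proof -
      obtain C g where "\<forall>x. T \<sigma> (v(j := x)) = C * g x" "\<forall>x\<in>h. \<forall>y\<in>h. g (x + y) = g x + g y"
        using Tslot[OF \<sigma>, of v j] * by blast
      then show ?thesis
        using * by (simp add: distrib_left)
    qed
    then show "wedge p q \<omega> \<eta> (v(j := x + y)) = wedge p q \<omega> \<eta> (v(j := x)) + wedge p q \<omega> \<eta> (v(j := y))"
      unfolding W by (simp add: sum.distrib add_divide_distrib)
  next
    fix v :: "nat \<Rightarrow> 'v" and j c x assume *: "range v \<subseteq> h \<and> x \<in> h \<and> j < p + q"
    have "T \<sigma> (v(j := sc c x)) = c * T \<sigma> (v(j := x))" if \<sigma>: "\<sigma> \<in> ?S" for \<sigma>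
    proof -
      obtain C g where "\<forall>x. T \<sigma> (v(j := x)) = C * g x" "\<forall>c. \<forall>x\<in>h. g (sc c x) = c * g x"
        using Tslot[OF \<sigma>, of v j] * by blast
      then show ?thesis
        using * by simp
    qed
    then show "wedge p q \<omega> \<eta> (v(j := sc c x)) = c * wedge p q \<omega> \<eta> (v(j := x))"
      unfolding W by (simp add: sum_distrib_left[symmetric])
  qed
qed

lemma multilinear_wedge_power:
  "multilinear sc h p \<omega> \<Longrightarrow> multilinear sc h (p * n) (wedge_power p \<omega> n)"
proof (induction n)
  case 0
  show ?case
    by (simp add: multilinear_def)
next
  case (Suc n)
  then show ?case
    using multilinear_wedge[of sc h p \<omega> "p * n" "wedge_power p \<omega> n"] by simp
qed

text \<open>In every summand the entry \<open>x\<close> falls into one of the two factors and kills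
  it. With \<open>\<omega>\<close> a power of \<open>d\<alpha>\<close> and \<open>\<eta>\<close>
  given by \<open>\<alpha>\<close>, a common kernel vector of \<open>\<alpha>\<close> and
  \<open>d\<alpha>\<close> is seen to kill the contact volume.\<close>

lemma wedge_annihilates:
  fixes \<omega> \<eta> :: "(nat \<Rightarrow> 'v) \<Rightarrow> 'k::field_char_0"
  assumes om: "\<And>v i. range v \<subseteq> h \<Longrightarrow> i < p \<Longrightarrow> v i = x \<Longrightarrow> \<omega> v = 0"
    and et: "\<And>v i. range v \<subseteq> h \<Longrightarrow> i < q \<Longrightarrow> v i = x \<Longrightarrow> \<eta> v = 0"
    and v: "range v \<subseteq> h" "j < p + q" "v j = x"
  shows "wedge p q \<omega> \<eta> v = 0"
proof -
  have "of_int (sign \<sigma>) * \<omega> (\<lambda>i. v (\<sigma> i)) * \<eta> (\<lambda>i. v (\<sigma> (p + i))) = 0"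
    if \<sigma>: "\<sigma> permutes {..<p + q}" for \<sigma>
  proof -
    define k where "k = inv_into UNIV \<sigma> j"
    have k: "k < p + q" "\<sigma> k = j"
      using permutes_in_image[OF permutes_inv[OF \<sigma>], of j] v(2) permutes_inverses(1)[OF \<sigma>]
      unfolding k_def by simp_all
    show ?thesis
    proof (cases "k < p")
      case True
      then have "\<omega> (\<lambda>i. v (\<sigma> i)) = 0"
        using om[of "\<lambda>i. v (\<sigma> i)" k] v k by auto
      then show ?thesis by simp
    next
      case False
      then have "\<eta> (\<lambda>i. v (\<sigma> (p + i))) = 0"
        using et[of "\<lambda>i. v (\<sigma> (p + i))" "k - p"] v k by (simp add: image_subset_iff)
      then show ?thesis by simp
    qed
  qed
  then have "(\<Sum>\<sigma> | \<sigma> permutes {..<p + q}.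
      of_int (sign \<sigma>) * \<omega> (\<lambda>i. v (\<sigma> i)) * \<eta> (\<lambda>i. v (\<sigma> (p + i)))) = 0"
    by (intro sum.neutral) blast
  then show ?thesis
    by (simp add: wedge_def)
qed

lemma wedge_power_annihilates:
  fixes \<omega> :: "(nat \<Rightarrow> 'v) \<Rightarrow> 'k::field_char_0"
  assumes "\<And>v i. range v \<subseteq> h \<Longrightarrow> i < p \<Longrightarrow> v i = x \<Longrightarrow> \<omega> v = 0"
    and "range v \<subseteq> h" "j < p * n" "v j = x"
  shows "wedge_power p \<omega> n v = 0"
  using assms(2-)
proof (induction n arbitrary: v j)
  case (Suc n)
  show ?case
    unfolding wedge_power.simps
  proof (rule wedge_annihilates[where h = h and x = x and j = j])
    show "\<omega> v = 0" if "range v \<subseteq> h" "i < p" "v i = x" for v i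
      using assms(1) that .
    show "wedge_power p \<omega> n v = 0" if "range v \<subseteq> h" "i < p * n" "v i = x" for v i
      using Suc.IH that .
  qed (use Suc.prems in simp_all)
qed simp

section \<open>Merging nested permutation sums; the Pfaffian of the standard form\<close>

lemma sign_permutes_compose:
  assumes "finite S" "p permutes S" "q permutes S"
  shows "sign (p \<circ> q) = sign p * sign q"
  using assms permutation_permutes sign_compose by blast

text \<open>The copy of the permutations of \<open>q\<close> letters that acts on the last
  \<open>q\<close> of \<open>p + q\<close> letters. A wedge power antisymmetrises over such copies
  repeatedly, and the outermost sum absorbs them.\<close>

definition shift_perm :: "nat \<Rightarrow> (nat \<Rightarrow> nat) \<Rightarrow> nat \<Rightarrow> nat" where
  "shift_perm p \<tau> k = (if k < p then k else p + \<tau> (k - p))"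

lemma shift_perm_permutes:
  assumes "\<tau> permutes {..<q}"
  shows "shift_perm p \<tau> permutes {..<p + q} \<and> sign (shift_perm p \<tau>) = sign \<tau>"
  using assms finite_lessThan
proof (induction rule: permutes_induct)
  case id
  have "shift_perm p id = id"
    by (auto simp: shift_perm_def fun_eq_iff)
  then show ?case
    by (metis permutes_id sign_id)
next
  case (swap a b \<tau>)
  have eq: "shift_perm p (Transposition.transpose a b \<circ> \<tau>) =
      Transposition.transpose (p + a) (p + b) \<circ> shift_perm p \<tau>"
    by (auto simp: shift_perm_def fun_eq_iff Transposition.transpose_def)
  have tr: "Transposition.transpose (p + a) (p + b) permutes {..<p + q}"
    using swap by (intro permutes_swap_id) auto
  have tr': "Transposition.transpose a b permutes {..<q}"
    using swap by (intro permutes_swap_id) auto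
  have "sign (Transposition.transpose (p + a) (p + b) \<circ> shift_perm p \<tau>) =
      sign (Transposition.transpose a b \<circ> \<tau>)"
    unfolding sign_permutes_compose[OF finite_lessThan tr conjunct1[OF swap.IH]]
      sign_permutes_compose[OF finite_lessThan tr' swap.hyps(4)] using swap by (simp add: sign_swap_id)
  then show ?case
    unfolding eq using permutes_compose[OF conjunct1[OF swap.IH] tr] by (intro conjI)
qed

text \<open>For fixed \<open>\<tau>\<close> the product \<open>\<sigma> \<circ> e \<tau>\<close>
  runs through all permutations and its sign is the product of the two signs, so every inner term
  contributes the same full sum.\<close>

lemma sum_perm_absorb:
  fixes G :: "('a \<Rightarrow> 'a) \<Rightarrow> 'k::comm_ring_1"
  assumes "finite S" "\<And>\<tau>. \<tau> \<in> T \<Longrightarrow> e \<tau> permutes S" "\<And>\<tau>. \<tau> \<in> T \<Longrightarrow> sign (e \<tau>) = sign \<tau>"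
  shows "(\<Sum>\<sigma> | \<sigma> permutes S. of_int (sign \<sigma>) * (\<Sum>\<tau>\<in>T. of_int (sign \<tau>) * G (\<sigma> \<circ> e \<tau>))) =
    of_nat (card T) * (\<Sum>\<sigma> | \<sigma> permutes S. of_int (sign \<sigma>) * G \<sigma>)"
proof -
  have "(\<Sum>\<sigma> | \<sigma> permutes S. of_int (sign \<sigma>) * (\<Sum>\<tau>\<in>T. of_int (sign \<tau>) * G (\<sigma> \<circ> e \<tau>))) =
      (\<Sum>\<tau>\<in>T. \<Sum>\<sigma> | \<sigma> permutes S. of_int (sign \<sigma> * sign \<tau>) * G (\<sigma> \<circ> e \<tau>))"
    unfolding sum_distrib_left by (subst sum.swap) (simp add: mult.assoc)
  also have "\<dots> = (\<Sum>\<tau>\<in>T. \<Sum>\<sigma> | \<sigma> permutes S. of_int (sign \<sigma>) * G \<sigma>)"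
  proof (rule sum.cong[OF refl])
    fix \<tau> assume \<tau>: "\<tau> \<in> T"
    have "(\<Sum>\<sigma> | \<sigma> permutes S. of_int (sign \<sigma>) * G \<sigma>) =
        (\<Sum>\<sigma> | \<sigma> permutes S. of_int (sign (\<sigma> \<circ> e \<tau>)) * G (\<sigma> \<circ> e \<tau>))"
      using assms(2)[OF \<tau>] by (rule sum_permutations_compose_right)
    also have "\<dots> = (\<Sum>\<sigma> | \<sigma> permutes S. of_int (sign \<sigma> * sign \<tau>) * G (\<sigma> \<circ> e \<tau>))"
      using assms(2,3)[OF \<tau>] sign_permutes_compose[OF assms(1)] by (intro sum.cong) auto
    finally show "(\<Sum>\<sigma> | \<sigma> permutes S. of_int (sign \<sigma> * sign \<tau>) * G (\<sigma> \<circ> e \<tau>)) =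
        (\<Sum>\<sigma> | \<sigma> permutes S. of_int (sign \<sigma>) * G \<sigma>)" ..
  qed
  finally show ?thesis
    by simp
qed

definition pairing_product :: "nat \<Rightarrow> ('v \<Rightarrow> 'v \<Rightarrow> 'k) \<Rightarrow> (nat \<Rightarrow> 'v) \<Rightarrow> 'k::field_char_0" where
  "pairing_product n \<omega> v = (\<Prod>i<n. \<omega> (v (2 * i)) (v (2 * i + 1)))"

text \<open>The recursive wedge power flattened to one sum over permutations, which is a multiple of
  the Pfaffian of the matrix \<open>\<omega> (v i) (v j)\<close>. The proof produces
  \<open>K = 1 / 2 ^ n\<close>, but only \<open>K \<noteq> 0\<close> matters for deciding where the
  form vanishes.\<close>

lemma wedge_power_two:
  fixes \<omega> :: "'v \<Rightarrow> 'v \<Rightarrow> 'k::field_char_0"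
  shows "\<exists>K. K \<noteq> 0 \<and> (\<forall>v. wedge_power 2 (\<lambda>v. \<omega> (v 0) (v 1)) n v =
    K * (\<Sum>\<sigma> | \<sigma> permutes {..<2 * n}. of_int (sign \<sigma>) * pairing_product n \<omega> (v \<circ> \<sigma>)))"
proof (induction n)
  case 0
  show ?case
    by (intro exI[of _ 1]) (simp add: pairing_product_def)
next
  case (Suc n)
  then obtain K where K: "K \<noteq> 0" and eq: "\<And>v. wedge_power 2 (\<lambda>v. \<omega> (v 0) (v 1)) n v =
      K * (\<Sum>\<sigma> | \<sigma> permutes {..<2 * n}. of_int (sign \<sigma>) * pairing_product n \<omega> (v \<circ> \<sigma>))"
    by blast
  let ?T = "{\<tau>. \<tau> permutes {..<2 * n}}"
  let ?c = "K * of_nat (card ?T) / (fact 2 * fact (2 * n))"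
  have shift: "\<omega> (v (\<sigma> 0)) (v (\<sigma> 1)) * pairing_product n \<omega> ((\<lambda>i. v (\<sigma> (2 + i))) \<circ> \<tau>) =
      pairing_product (Suc n) \<omega> (v \<circ> (\<sigma> \<circ> shift_perm 2 \<tau>))" for v \<sigma> \<tau>
    unfolding pairing_product_def prod.lessThan_Suc_shift by (simp add: shift_perm_def)
  have "card ?T = fact (2 * n)"
    by (rule card_permutations) simp_all
  then have c: "?c \<noteq> 0"
    using K by simp
  have "wedge_power 2 (\<lambda>v. \<omega> (v 0) (v 1)) (Suc n) v =
    ?c * (\<Sum>\<sigma> | \<sigma> permutes {..<2 * Suc n}. of_int (sign \<sigma>) * pairing_product (Suc n) \<omega> (v \<circ> \<sigma>))" for v
  proof -
    have "wedge_power 2 (\<lambda>v. \<omega> (v 0) (v 1)) (Suc n) v = (\<Sum>\<sigma> | \<sigma> permutes {..<2 + 2 * n}.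
        of_int (sign \<sigma>) * \<omega> (v (\<sigma> 0)) (v (\<sigma> 1)) * (K * (\<Sum>\<tau>\<in>?T. of_int (sign \<tau>) *
        pairing_product n \<omega> ((\<lambda>i. v (\<sigma> (2 + i))) \<circ> \<tau>)))) / (fact 2 * fact (2 * n))"
      unfolding wedge_power.simps wedge_def eq ..
    also have "\<dots> = (\<Sum>\<sigma> | \<sigma> permutes {..<2 + 2 * n}. K * (of_int (sign \<sigma>) *
        (\<Sum>\<tau>\<in>?T. of_int (sign \<tau>) * pairing_product (Suc n) \<omega> (v \<circ> (\<sigma> \<circ> shift_perm 2 \<tau>))))) /
        (fact 2 * fact (2 * n))"
      unfolding shift[symmetric] sum_distrib_left by (simp only: ac_simps)
    also have "\<dots> = K * (\<Sum>\<sigma> | \<sigma> permutes {..<2 + 2 * n}. of_int (sign \<sigma>) *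
        (\<Sum>\<tau>\<in>?T. of_int (sign \<tau>) * pairing_product (Suc n) \<omega> (v \<circ> (\<sigma> \<circ> shift_perm 2 \<tau>)))) /
        (fact 2 * fact (2 * n))"
      unfolding sum_distrib_left[of K, symmetric] ..
    also have "(\<Sum>\<sigma> | \<sigma> permutes {..<2 + 2 * n}. of_int (sign \<sigma>) *
        (\<Sum>\<tau>\<in>?T. of_int (sign \<tau>) * pairing_product (Suc n) \<omega> (v \<circ> (\<sigma> \<circ> shift_perm 2 \<tau>)))) =
        of_nat (card ?T) * (\<Sum>\<sigma> | \<sigma> permutes {..<2 + 2 * n}.
          of_int (sign \<sigma>) * pairing_product (Suc n) \<omega> (v \<circ> \<sigma>))"
      by (rule sum_perm_absorb) (simp_all only: finite_lessThan mem_Collect_eq shift_perm_permutes)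
    finally show ?thesis
      by simp
  qed
  then show ?case
    using c by blast
qed

lemma wedge_contact:
  fixes \<omega> :: "'v \<Rightarrow> 'v \<Rightarrow> 'k::field_char_0"
  shows "\<exists>K. K \<noteq> 0 \<and> (\<forall>v. wedge (2 * n) 1 (wedge_power 2 (\<lambda>v. \<omega> (v 0) (v 1)) n) (\<lambda>v. \<alpha> (v 0)) v =
    K * (\<Sum>\<sigma> | \<sigma> permutes {..<2 * n + 1}.
      of_int (sign \<sigma>) * (pairing_product n \<omega> (v \<circ> \<sigma>) * \<alpha> (v (\<sigma> (2 * n))))))"
proof -
  obtain K where K: "K \<noteq> 0" and eq: "\<And>v. wedge_power 2 (\<lambda>v. \<omega> (v 0) (v 1)) n v =
      K * (\<Sum>\<sigma> | \<sigma> permutes {..<2 * n}. of_int (sign \<sigma>) * pairing_product n \<omega> (v \<circ> \<sigma>))"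
    using wedge_power_two[of \<omega> n] by blast
  let ?T = "{\<tau>. \<tau> permutes {..<2 * n}}"
  let ?c = "K * of_nat (card ?T) / (fact (2 * n) * fact 1)"
  have "card ?T = fact (2 * n)"
    by (rule card_permutations) simp_all
  then have c: "?c \<noteq> 0"
    using K by simp
  have "wedge (2 * n) 1 (wedge_power 2 (\<lambda>v. \<omega> (v 0) (v 1)) n) (\<lambda>v. \<alpha> (v 0)) v =
    ?c * (\<Sum>\<sigma> | \<sigma> permutes {..<2 * n + 1}.
      of_int (sign \<sigma>) * (pairing_product n \<omega> (v \<circ> \<sigma>) * \<alpha> (v (\<sigma> (2 * n)))))" for v
  proof -
    define G where "G \<rho> = pairing_product n \<omega> (v \<circ> \<rho>) * \<alpha> (v (\<rho> (2 * n)))" for \<rho>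
    \<comment> \<open>Permutations of the first \<open>2 * n\<close> letters do not move the entry
      fed to \<open>\<alpha>\<close>, so that factor can be taken into the inner sum.\<close>
    have fix_last: "\<tau> (2 * n) = 2 * n" if "\<tau> \<in> ?T" for \<tau>
      using that permutes_not_in[of \<tau> "{..<2 * n}" "2 * n"] by simp
    have "wedge (2 * n) 1 (wedge_power 2 (\<lambda>v. \<omega> (v 0) (v 1)) n) (\<lambda>v. \<alpha> (v 0)) v =
        (\<Sum>\<sigma> | \<sigma> permutes {..<2 * n + 1}. of_int (sign \<sigma>) * (K * (\<Sum>\<tau>\<in>?T. of_int (sign \<tau>) *
        pairing_product n \<omega> ((\<lambda>i. v (\<sigma> i)) \<circ> \<tau>))) * \<alpha> (v (\<sigma> (2 * n + 0)))) / (fact (2 * n) * fact 1)"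
      unfolding wedge_def eq ..
    also have "\<dots> = (\<Sum>\<sigma> | \<sigma> permutes {..<2 * n + 1}. K * (of_int (sign \<sigma>) * (\<Sum>\<tau>\<in>?T. of_int (sign \<tau>) *
        (pairing_product n \<omega> (v \<circ> (\<sigma> \<circ> \<tau>)) * \<alpha> (v (\<sigma> (2 * n))))))) / (fact (2 * n) * fact 1)"
      by (simp add: sum_distrib_left sum_distrib_right o_def ac_simps)
    also have "\<dots> = K * (\<Sum>\<sigma> | \<sigma> permutes {..<2 * n + 1}. of_int (sign \<sigma>) * (\<Sum>\<tau>\<in>?T. of_int (sign \<tau>) *
        (pairing_product n \<omega> (v \<circ> (\<sigma> \<circ> \<tau>)) * \<alpha> (v (\<sigma> (2 * n)))))) / (fact (2 * n) * fact 1)"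
      unfolding sum_distrib_left[of K, symmetric] ..
    also have "\<dots> = K * (\<Sum>\<sigma> | \<sigma> permutes {..<2 * n + 1}. of_int (sign \<sigma>) * (\<Sum>\<tau>\<in>?T. of_int (sign \<tau>) *
        G (\<sigma> \<circ> id \<tau>))) / (fact (2 * n) * fact 1)"
      by (intro arg_cong2[where f = "(/)"] arg_cong2[where f = "(*)"] sum.cong refl)
        (simp add: G_def fix_last)
    also have "(\<Sum>\<sigma> | \<sigma> permutes {..<2 * n + 1}. of_int (sign \<sigma>) * (\<Sum>\<tau>\<in>?T. of_int (sign \<tau>) *
        G (\<sigma> \<circ> id \<tau>))) = of_nat (card ?T) * (\<Sum>\<sigma> | \<sigma> permutes {..<2 * n + 1}. of_int (sign \<sigma>) * G \<sigma>)"
      by (rule sum_perm_absorb) (auto intro: permutes_subset)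
    finally show ?thesis
      by (simp add: G_def)
  qed
  then show ?thesis
    using c by blast
qed

text \<open>The Gram matrix of a symplectic basis ordered in pairs. It has integer values although
  the forms are \<open>'k\<close>-valued: the sum of its Pfaffian terms is shown to be positive,
  which makes sense over the integers and gives a nonzero element in characteristic zero.\<close>

definition standard_form :: "nat \<Rightarrow> nat \<Rightarrow> int" where
  "standard_form i j = (if even i \<and> j = Suc i then 1 else if even j \<and> i = Suc j then -1 else 0)"

lemma standard_form_skew: "standard_form j i = - standard_form i j"
  by (auto simp: standard_form_def)

text \<open>
  The terms of the Pfaffian of the standard form: a permutation with nonzero product permutes the
  pairs \<open>{2i, 2i+1}\<close>, and its sign cancels the signs in the product.
\<close>

lemma standard_form_term:
  assumes "\<sigma> permutes {2 * m..<2 * n}"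
  shows "sign \<sigma> * (\<Prod>i\<in>{m..<n}. standard_form (\<sigma> (2 * i)) (\<sigma> (2 * i + 1))) \<in> {0, 1}"
  using assms
proof (induction "n - m" arbitrary: m \<sigma>)
  case 0
  then have "\<sigma> = id"
    by simp
  then show ?case
    using 0 by simp
next
  case (Suc d)
  let ?S = "{2 * m..<2 * n}"
  define t where "t \<rho> = sign \<rho> * (\<Prod>i\<in>{m..<n}. standard_form (\<rho> (2 * i)) (\<rho> (2 * i + 1)))" for \<rho>
  have ne: "2 * a \<noteq> 2 * b + 1" for a b :: nat
    by presburger
  have mn: "m < n"
    using Suc by simp
  \<comment> \<open>\<open>t\<close> does not change when the two positions of a pair are exchanged,
    as the sign and one factor both change sign; nor, by \<open>swap\<close> below, when two pairs
    are exchanged. With these moves the preimage of \<open>2 * m\<close> is brought to the position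
    \<open>2 * m\<close>, and the first pair splits off.\<close>
  have flip: "t (\<rho> \<circ> Transposition.transpose (2 * i) (2 * i + 1)) = t \<rho>"
    if \<rho>: "\<rho> permutes ?S" and i: "i \<in> {m..<n}" for \<rho> i
  proof -
    let ?\<tau> = "Transposition.transpose (2 * i) (2 * i + 1)"
    let ?g = "\<lambda>\<rho> k. standard_form (\<rho> (2 * k)) (\<rho> (2 * k + 1))"
    have "?\<tau> permutes ?S"
      using i by (intro permutes_swap_id) auto
    then have "sign (\<rho> \<circ> ?\<tau>) = - sign \<rho>"
      using sign_permutes_compose[OF _ \<rho>] by (simp add: sign_swap_id)
    moreover have "prod (?g (\<rho> \<circ> ?\<tau>)) {m..<n} = ?g (\<rho> \<circ> ?\<tau>) i * prod (?g (\<rho> \<circ> ?\<tau>)) ({m..<n} - {i})"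
      "prod (?g \<rho>) {m..<n} = ?g \<rho> i * prod (?g \<rho>) ({m..<n} - {i})"
      using i by (simp_all add: prod.remove)
    moreover have "prod (?g (\<rho> \<circ> ?\<tau>)) ({m..<n} - {i}) = prod (?g \<rho>) ({m..<n} - {i})"
      by (rule prod.cong) (auto simp: Transposition.transpose_def)
    moreover have "?g (\<rho> \<circ> ?\<tau>) i = - ?g \<rho> i"
      using standard_form_skew[of "\<rho> (2 * i + 1)" "\<rho> (2 * i)"] by simp
    ultimately show ?thesis
      by (simp add: t_def)
  qed
  have swap: "t (\<rho> \<circ> (Transposition.transpose (2 * m) (2 * i) \<circ>
      Transposition.transpose (2 * m + 1) (2 * i + 1))) = t \<rho>"
    if \<rho>: "\<rho> permutes ?S" and i: "i \<in> {m..<n}" "i \<noteq> m" for \<rho> i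
  proof -
    let ?\<tau> = "Transposition.transpose (2 * m) (2 * i)"
    let ?\<tau>' = "Transposition.transpose (2 * m + 1) (2 * i + 1)"
    have p: "?\<tau> permutes ?S" "?\<tau>' permutes ?S"
      using i by (auto intro!: permutes_swap_id)
    have sgn: "sign (\<rho> \<circ> (?\<tau> \<circ> ?\<tau>')) = sign \<rho>"
      using sign_permutes_compose[OF _ \<rho> permutes_compose[OF p(2,1)]]
        sign_permutes_compose[OF _ p] i(2) by (simp add: sign_swap_id)
    have "Transposition.transpose m i permutes {m..<n}"
      using i by (intro permutes_swap_id) auto
    then have "(\<Prod>k\<in>{m..<n}. standard_form (\<rho> (2 * k)) (\<rho> (2 * k + 1))) =
        prod ((\<lambda>k. standard_form (\<rho> (2 * k)) (\<rho> (2 * k + 1))) \<circ> Transposition.transpose m i) {m..<n}"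
      by (rule prod.permute)
    also have "\<dots> = (\<Prod>k\<in>{m..<n}. standard_form ((\<rho> \<circ> (?\<tau> \<circ> ?\<tau>')) (2 * k)) ((\<rho> \<circ> (?\<tau> \<circ> ?\<tau>')) (2 * k + 1)))"
    proof (rule prod.cong[OF refl])
      fix k
      have "(?\<tau> \<circ> ?\<tau>') (2 * k) = 2 * Transposition.transpose m i k"
        "(?\<tau> \<circ> ?\<tau>') (2 * k + 1) = 2 * Transposition.transpose m i k + 1"
        using ne ne[symmetric] unfolding o_def Transposition.transpose_def by auto
      then show "((\<lambda>k. standard_form (\<rho> (2 * k)) (\<rho> (2 * k + 1))) \<circ> Transposition.transpose m i) k =
          standard_form ((\<rho> \<circ> (?\<tau> \<circ> ?\<tau>')) (2 * k)) ((\<rho> \<circ> (?\<tau> \<circ> ?\<tau>')) (2 * k + 1))"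
        by simp
    qed
    finally show ?thesis
      by (simp only: t_def sgn)
  qed
  have final: "t \<rho> \<in> {0, 1}" if \<rho>: "\<rho> permutes ?S" "\<rho> (2 * m) = 2 * m" for \<rho>
  proof (cases "\<rho> (2 * m + 1) = 2 * m + 1")
    case True
    have "\<rho> permutes {2 * Suc m..<2 * n}"
    proof (rule permutes_superset[OF \<rho>(1)])
      fix x assume "x \<in> ?S - {2 * Suc m..<2 * n}"
      then have "x = 2 * m \<or> x = 2 * m + 1"
        by auto
      then show "\<rho> x = x"
        using True \<rho>(2) by auto
    qed
    then have "sign \<rho> * (\<Prod>i\<in>{Suc m..<n}. standard_form (\<rho> (2 * i)) (\<rho> (2 * i + 1))) \<in> {0, 1}"
      using Suc by (intro Suc.hyps(1)) simp_all
    moreover have "standard_form (\<rho> (2 * m)) (\<rho> (2 * m + 1)) = 1"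
      using True \<rho>(2) by (simp add: standard_form_def)
    ultimately show ?thesis
      using mn by (simp add: t_def prod.atLeast_Suc_lessThan)
  next
    case False
    then have "standard_form (\<rho> (2 * m)) (\<rho> (2 * m + 1)) = 0"
      unfolding \<rho>(2) standard_form_def by auto presburger
    then show ?thesis
      using mn by (simp add: t_def prod.atLeast_Suc_lessThan)
  qed
  define k where "k = inv_into UNIV \<sigma> (2 * m)"
  define i where "i = k div 2"
  have \<sigma>k: "\<sigma> k = 2 * m"
    unfolding k_def using permutes_inverses(1)[OF Suc.prems] by simp
  have "k \<in> ?S"
    using permutes_in_image[OF Suc.prems, of k] \<sigma>k mn by simp
  then have i: "i \<in> {m..<n}"
    unfolding i_def by auto
  obtain \<sigma>' where \<sigma>': "\<sigma>' permutes ?S" "t \<sigma>' = t \<sigma>" "\<sigma>' (2 * i) = 2 * m"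
  proof (cases "even k")
    case True
    then have "k = 2 * i"
      by (simp add: i_def)
    then show thesis
      using that[of \<sigma>] Suc.prems \<sigma>k by simp
  next
    case False
    then have "k = 2 * i + 1"
      by (simp add: i_def)
    moreover have "Transposition.transpose (2 * i) (2 * i + 1) permutes ?S"
      using i by (intro permutes_swap_id) auto
    ultimately show thesis
      using that[of "\<sigma> \<circ> Transposition.transpose (2 * i) (2 * i + 1)"] flip[OF Suc.prems i] \<sigma>k
        permutes_compose[OF _ Suc.prems] by simp
  qed
  have "t \<sigma>' \<in> {0, 1}"
  proof (cases "i = m")
    case True
    then show ?thesis
      using final[OF \<sigma>'(1)] \<sigma>'(3) by blast
  next
    case False
    let ?\<tau> = "Transposition.transpose (2 * m) (2 * i)"
    let ?\<tau>' = "Transposition.transpose (2 * m + 1) (2 * i + 1)"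
    have p: "?\<tau> permutes ?S" "?\<tau>' permutes ?S"
      using i by (auto intro!: permutes_swap_id)
    have "(?\<tau> \<circ> ?\<tau>') (2 * m) = 2 * i"
      using ne by (simp add: Transposition.transpose_def)
    then have "(\<sigma>' \<circ> (?\<tau> \<circ> ?\<tau>')) (2 * m) = 2 * m"
      using \<sigma>'(3) by simp
    then have "t (\<sigma>' \<circ> (?\<tau> \<circ> ?\<tau>')) \<in> {0, 1}"
      by (rule final[OF permutes_compose[OF permutes_compose[OF p(2,1)] \<sigma>'(1)]])
    then show ?thesis
      using swap[OF \<sigma>'(1) i False] by simp
  qed
  then have "t \<sigma> \<in> {0, 1}"
    unfolding \<sigma>'(2) .
  then show ?case
    unfolding t_def .
qed

text \<open>No cancellation can occur: the terms are 0 or 1 and the identity contributes 1. This is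
  why the contact volume does not vanish on a suitable Darboux basis.\<close>

lemma standard_form_sum_pos:
  "(\<Sum>\<sigma> | \<sigma> permutes {..<2 * n + 1}. sign \<sigma> *
     ((\<Prod>i<n. standard_form (\<sigma> (2 * i)) (\<sigma> (2 * i + 1))) * (if \<sigma> (2 * n) = 2 * n then 1 else 0))) > 0"
  (is "sum ?t ?S > 0")
proof (rule sum_pos2[of _ id])
  show "finite ?S"
    by (simp add: finite_permutations)
  show "id \<in> ?S"
    by (simp add: permutes_id)
  show "0 < ?t id"
    by (simp add: standard_form_def)
  fix \<sigma> assume \<sigma>: "\<sigma> \<in> ?S"
  show "0 \<le> ?t \<sigma>"
  proof (cases "\<sigma> (2 * n) = 2 * n")
    case True
    have "\<sigma> permutes {2 * 0..<2 * n}"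
    proof (rule permutes_superset)
      show "\<sigma> permutes {..<2 * n + 1}"
        using \<sigma> by simp
      fix x assume "x \<in> {..<2 * n + 1} - {2 * 0..<2 * n}"
      then have "x = 2 * n"
        by auto
      then show "\<sigma> x = x"
        using True by simp
    qed
    then have "sign \<sigma> * (\<Prod>i\<in>{0..<n}. standard_form (\<sigma> (2 * i)) (\<sigma> (2 * i + 1))) \<in> {0, 1}"
      by (rule standard_form_term)
    then have "0 \<le> sign \<sigma> * (\<Prod>i\<in>{0..<n}. standard_form (\<sigma> (2 * i)) (\<sigma> (2 * i + 1)))"
      by (elim insertE) (simp_all only: order_refl zero_le_one empty_iff)
    then show ?thesis
      using True by (simp add: lessThan_atLeast0)
  qed simp
qed

section \<open>Families of vectors and functionals on subspaces\<close>

context vector_space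
begin

text \<open>Arguments of forms are sequences, so independence is tested on indexed combinations;
  distinctness of the entries is needed to count them as a set.\<close>

lemma family_independent:
  fixes v :: "nat \<Rightarrow> 'b"
  assumes "\<And>c. (\<Sum>i<m. scale (c i) (v i)) = 0 \<Longrightarrow> \<forall>i<m. c i = 0"
  shows "inj_on v {..<m}" "independent (v ` {..<m})"
proof -
  show inj: "inj_on v {..<m}"
  proof (rule inj_onI, rule ccontr)
    fix i j assume ij: "i \<in> {..<m}" "j \<in> {..<m}" "v i = v j" "i \<noteq> j"
    define c :: "nat \<Rightarrow> 'a" where "c k = (if k = i then 1 else if k = j then - 1 else 0)" for k
    have "(\<Sum>k<m. scale (c k) (v k)) = (\<Sum>k\<in>{i, j}. scale (c k) (v k))"
      using ij by (intro sum.mono_neutral_right) (auto simp: c_def)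
    also have "\<dots> = 0"
      using ij by (simp add: c_def)
    finally have "c i = 0"
      using assms ij by blast
    then show False
      by (simp add: c_def)
  qed
  show "independent (v ` {..<m})"
  proof
    assume "dependent (v ` {..<m})"
    then obtain u where u: "\<exists>x\<in>v ` {..<m}. u x \<noteq> 0" "(\<Sum>x\<in>v ` {..<m}. scale (u x) x) = 0"
      by (auto simp: dependent_finite)
    then have "(\<Sum>i<m. scale (u (v i)) (v i)) = 0"
      by (simp add: sum.reindex[OF inj])
    from assms[OF this] u(1) show False
      by auto
  qed
qed

lemma span_family:
  assumes "x \<in> span (v ` {..<m::nat})" "inj_on v {..<m}"
  obtains c where "x = (\<Sum>i<m. scale (c i) (v i))"
proof -
  obtain u where "x = (\<Sum>y\<in>v ` {..<m}. scale (u y) y)"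
    using assms(1) span_finite[of "v ` {..<m}"] by auto
  then have "x = (\<Sum>i<m. scale (u (v i)) (v i))"
    by (simp add: sum.reindex[OF assms(2)])
  then show thesis
    by (rule that)
qed

lemma independent_card_eq_dim_spans:
  assumes B: "finite B" "V \<subseteq> span B" and C: "C \<subseteq> V" "independent C" "finite C" "card C = dim V"
  shows "V \<subseteq> span C"
proof
  fix x assume x: "x \<in> V"
  obtain D where D: "D \<subseteq> V" "independent D" "V \<subseteq> span D" "card D = dim V"
    by (rule basis_exists)
  have "finite D"
    using independent_span_bound[OF B(1) D(2)] D(1) B(2) by blast
  show "x \<in> span C"
  proof (rule ccontr)
    assume nx: "x \<notin> span C"
    then have "independent (insert x C)"
      using C(2) by (rule independent_insertI)
    then have "card (insert x C) \<le> card D"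
      using independent_span_bound[OF \<open>finite D\<close>] D(3) C(1) x by blast
    moreover have "x \<notin> C"
      using nx span_base by blast
    ultimately show False
      using C D(4) by simp
  qed
qed

text \<open>Induction on the number of functionals: the claim holds on the kernel of
  \<open>f j\<close>, and one vector \<open>z\<close> off this kernel determines the coefficient of
  \<open>f j\<close>. The subspace \<open>X\<close> may be infinite-dimensional.\<close>

lemma functional_in_span:
  fixes f :: "'i \<Rightarrow> 'b \<Rightarrow> 'a"
  assumes "finite I" "subspace X"
    and "\<And>i x y. i \<in> I \<Longrightarrow> x \<in> X \<Longrightarrow> y \<in> X \<Longrightarrow> f i (x + y) = f i x + f i y"
    and "\<And>i c x. i \<in> I \<Longrightarrow> x \<in> X \<Longrightarrow> f i (scale c x) = c * f i x"
    and "\<And>x y. x \<in> X \<Longrightarrow> y \<in> X \<Longrightarrow> g (x + y) = g x + g y"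
    and "\<And>c x. x \<in> X \<Longrightarrow> g (scale c x) = c * g x"
    and "\<And>x. x \<in> X \<Longrightarrow> (\<forall>i\<in>I. f i x = 0) \<Longrightarrow> g x = 0"
  shows "\<exists>c. \<forall>x\<in>X. g x = (\<Sum>i\<in>I. c i * f i x)"
  using assms
proof (induction I arbitrary: X g rule: finite_induct)
  case empty
  then show ?case
    by simp
next
  case (insert j I)
  note X = subspace_0[OF insert.prems(1)] subspace_add[OF insert.prems(1)] subspace_scale[OF insert.prems(1)]
  note fadd = insert.prems(2) and fscale = insert.prems(3) and gadd = insert.prems(4)
    and gscale = insert.prems(5) and ker = insert.prems(6)
  define Y where "Y = {x \<in> X. f j x = 0}"
  have "f j 0 = 0"
    using fscale[of j 0 0] X by simp
  then have Y: "subspace Y"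
    unfolding Y_def subspace_def using X fadd fscale by simp
  have "\<exists>c. \<forall>x\<in>Y. g x = (\<Sum>i\<in>I. c i * f i x)"
    using Y by (rule insert.IH) (use fadd fscale gadd gscale ker in \<open>auto simp: Y_def\<close>)
  then obtain c where c: "\<And>x. x \<in> Y \<Longrightarrow> g x = (\<Sum>i\<in>I. c i * f i x)"
    by blast
  show ?case
  proof (cases "\<forall>x\<in>X. f j x = 0")
    case True
    then have "\<forall>x\<in>X. g x = (\<Sum>i\<in>insert j I. c i * f i x)"
      using c insert.hyps by (simp add: Y_def)
    then show ?thesis
      by blast
  next
    case False
    then obtain z where z: "z \<in> X" "f j z \<noteq> 0"
      by blast
    \<comment> \<open>The value that makes both sides agree at \<open>z\<close>.\<close>
    define d where "d = (g z - (\<Sum>i\<in>I. c i * f i z)) / f j z"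
    have "g x = (\<Sum>i\<in>I. c i * f i x) + d * f j x" if x: "x \<in> X" for x
    proof -
      define a where "a = - (f j x / f j z)"
      define y where "y = x + scale a z"
      have yX: "y \<in> X"
        using x z X by (simp add: y_def)
      have "f j y = 0"
        using x z X by (simp add: y_def fadd fscale del: scale_minus_left) (simp add: a_def)
      with yX have "g y = (\<Sum>i\<in>I. c i * f i y)"
        by (intro c) (simp add: Y_def)
      moreover have "g y = g x + a * g z"
        using x z X by (simp add: y_def gadd gscale)
      moreover have "(\<Sum>i\<in>I. c i * f i y) = (\<Sum>i\<in>I. c i * f i x) + a * (\<Sum>i\<in>I. c i * f i z)"
        unfolding sum_distrib_left sum.distrib[symmetric]
        by (rule sum.cong) (use x z X in \<open>auto simp: y_def fadd fscale algebra_simps\<close>)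
      ultimately have "g x = (\<Sum>i\<in>I. c i * f i x) - a * (g z - (\<Sum>i\<in>I. c i * f i z))"
        by (simp add: algebra_simps)
      then show ?thesis
        by (simp add: a_def d_def)
    qed
    moreover have "(\<Sum>i\<in>I. (c(j := d)) i * f i x) = (\<Sum>i\<in>I. c i * f i x)" for x
      using insert.hyps by (intro sum.cong) auto
    ultimately have "\<forall>x\<in>X. g x = (\<Sum>i\<in>insert j I. (c(j := d)) i * f i x)"
      using insert.hyps by (simp add: add.commute)
    then show ?thesis
      by blast
  qed
qed

lemma functional_extend:
  assumes "subspace S" and add: "\<And>x y. x \<in> S \<Longrightarrow> y \<in> S \<Longrightarrow> \<phi> (x + y) = \<phi> x + \<phi> y"
    and scl: "\<And>c x. x \<in> S \<Longrightarrow> \<phi> (scale c x) = c * \<phi> x"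
  obtains g where "\<And>x y. g (x + y) = g x + g y" "\<And>c x. g (scale c x) = c * g x"
    "\<And>x. x \<in> S \<Longrightarrow> g x = \<phi> x"
proof -
  obtain B where B: "B \<subseteq> S" "independent B" "S \<subseteq> span B"
    by (rule maximal_independent_subset)
  interpret K: vector_space "(*) :: 'a \<Rightarrow> 'a \<Rightarrow> 'a"
    by unfold_locales (simp_all add: algebra_simps)
  interpret vector_space_pair scale "(*) :: 'a \<Rightarrow> 'a \<Rightarrow> 'a" ..
  obtain g where g: "Vector_Spaces.linear scale (*) g" "\<forall>x\<in>B. g x = \<phi> x"
    using linear_independent_extend[OF B(2)] by blast
  have gadd: "g (x + y) = g x + g y" and gscl: "g (scale c x) = c * g x" for x y c
    using linear_add[OF g(1)] linear_scale[OF g(1)] by auto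
  have "subspace {x \<in> S. g x = \<phi> x}"
    unfolding subspace_def
    using subspace_0[OF assms(1)] subspace_add[OF assms(1)] subspace_scale[OF assms(1)]
      gscl[of 0 0] scl[of 0 0] by (auto simp: gadd gscl add scl)
  then have "span B \<subseteq> {x \<in> S. g x = \<phi> x}"
    using B g(2) by (intro span_minimal) auto
  then show thesis
    using that gadd gscl B(3) by blast
qed

end

section \<open>Symplectic bases of skew forms\<close>

locale skew_form = vector_space scale
  for scale :: "'k::field_char_0 \<Rightarrow> 'v::ab_group_add \<Rightarrow> 'v" +
  fixes h :: "'v set" and \<omega> :: "'v \<Rightarrow> 'v \<Rightarrow> 'k"
  assumes h: "subspace h"
    and fin: "\<exists>B. finite B \<and> h \<subseteq> span B"
    and add_left: "\<And>x y z. x \<in> h \<Longrightarrow> y \<in> h \<Longrightarrow> z \<in> h \<Longrightarrow> \<omega> (x + y) z = \<omega> x z + \<omega> y z"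
    and scale_left: "\<And>c x z. x \<in> h \<Longrightarrow> z \<in> h \<Longrightarrow> \<omega> (scale c x) z = c * \<omega> x z"
    and skew: "\<And>x y. x \<in> h \<Longrightarrow> y \<in> h \<Longrightarrow> \<omega> y x = - \<omega> x y"
begin

lemmas h_closed = subspace_0[OF h] subspace_add[OF h] subspace_scale[OF h]

lemma self: "x \<in> h \<Longrightarrow> \<omega> x x = 0"
  using skew self_eq_minus_imp_zero by blast

lemma zero_left: "z \<in> h \<Longrightarrow> \<omega> 0 z = 0"
  using scale_left[of 0 z 0] h_closed by simp

lemma add_right: "x \<in> h \<Longrightarrow> y \<in> h \<Longrightarrow> z \<in> h \<Longrightarrow> \<omega> z (x + y) = \<omega> z x + \<omega> z y"
  using skew[of "x + y" z] skew[of x z] skew[of y z] h_closed by (simp add: add_left)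

lemma scale_right: "x \<in> h \<Longrightarrow> z \<in> h \<Longrightarrow> \<omega> z (scale c x) = c * \<omega> z x"
  using skew[of "scale c x" z] skew[of x z] h_closed by (simp add: scale_left)

lemma sum_left:
  "(\<And>i. i \<in> I \<Longrightarrow> f i \<in> h) \<Longrightarrow> z \<in> h \<Longrightarrow> \<omega> (\<Sum>i\<in>I. scale (c i) (f i)) z = (\<Sum>i\<in>I. c i * \<omega> (f i) z)"
proof (induction I rule: infinite_finite_induct)
  case (insert j I)
  then show ?case
    using h_closed subspace_sum[OF h, of I "\<lambda>i. scale (c i) (f i)"]
    by (simp add: add_left scale_left)
qed (simp_all add: zero_left)

definition darboux :: "nat \<Rightarrow> (nat \<Rightarrow> 'v) \<Rightarrow> bool" where
  "darboux n v \<longleftrightarrow> (\<forall>i<2 * n. v i \<in> h) \<and> (\<forall>i<2 * n. \<forall>j<2 * n. \<omega> (v i) (v j) = of_int (standard_form i j))"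

text \<open>The only index that \<open>standard_form\<close> pairs nontrivially with
  \<open>i\<close>.\<close>

definition partner :: "nat \<Rightarrow> nat" where
  "partner i = (if even i then Suc i else i - 1)"

lemma partner_less: "i < 2 * n \<Longrightarrow> partner i < 2 * n"
  unfolding partner_def by auto

lemma standard_form_partner:
  "standard_form i (partner j) = (if i = j then (if even j then 1 else - 1) else 0)"
proof -
  have "2 * a \<noteq> Suc (2 * b)" "Suc (2 * b) \<noteq> 2 * a" for a b :: nat
    by presburger+
  then show ?thesis
    unfolding standard_form_def partner_def by (auto elim!: oddE evenE)
qed

text \<open>Pairing the relation with \<open>v (partner k)\<close> isolates \<open>c k\<close>.
  Further entries, from \<open>2 * n\<close> on, may be appended if they are orthogonal to the
  family; this covers the extra vector that spans the kernel of \<open>d\<alpha>\<close> for a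
  contact form.\<close>

lemma darboux_coefficients:
  assumes v: "darboux n v" and m: "2 * n \<le> m" "\<And>i. 2 * n \<le> i \<Longrightarrow> i < m \<Longrightarrow> v i \<in> h"
    and rad: "\<And>i j. 2 * n \<le> i \<Longrightarrow> i < m \<Longrightarrow> j < 2 * n \<Longrightarrow> \<omega> (v i) (v j) = 0"
    and z: "(\<Sum>i<m. scale (c i) (v i)) = 0" and k: "k < 2 * n"
  shows "c k = 0"
proof -
  have vh: "v i \<in> h" if "i < m" for i
    using that v m unfolding darboux_def by (cases "i < 2 * n") auto
  have pk: "partner k < 2 * n"
    using k by (rule partner_less)
  have "0 = \<omega> (\<Sum>i<m. scale (c i) (v i)) (v (partner k))"
    unfolding z using vh pk m by (simp add: zero_left)
  also have "\<dots> = (\<Sum>i<m. c i * \<omega> (v i) (v (partner k)))"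
    using vh pk m by (intro sum_left) auto
  also have "\<dots> = (\<Sum>i\<in>{k}. c i * \<omega> (v i) (v (partner k)))"
  proof (rule sum.mono_neutral_right)
    show "\<forall>i\<in>{..<m} - {k}. c i * \<omega> (v i) (v (partner k)) = 0"
    proof
      fix i assume "i \<in> {..<m} - {k}"
      then show "c i * \<omega> (v i) (v (partner k)) = 0"
        using v pk rad[of i "partner k"] unfolding darboux_def
        by (cases "i < 2 * n") (auto simp: standard_form_partner)
    qed
  qed (use k m in auto)
  also have "\<dots> = c k * (if even k then 1 else - 1)"
    using v k pk unfolding darboux_def by (simp add: standard_form_partner)
  finally show ?thesis
    by (simp split: if_splits)
qed

text \<open>The symplectic version of subtracting an orthogonal projection.\<close>

lemma darboux_complement:
  assumes v: "darboux n v" and z: "z \<in> h"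
  obtains c where "(\<Sum>i<2 * n. scale (c i) (v i)) \<in> h"
    "\<And>j. j < 2 * n \<Longrightarrow> \<omega> (z + (\<Sum>i<2 * n. scale (c i) (v i))) (v j) = 0"
proof -
  have vh: "v i \<in> h" if "i < 2 * n" for i
    using v that unfolding darboux_def by blast
  define e where "e i = (if even i then 1 else - 1 :: 'k)" for i :: nat
  \<comment> \<open>Pairing \<open>s\<close> with \<open>v (partner i)\<close> picks out the
    coefficient of \<open>v i\<close> times \<open>e i\<close>, and \<open>e i\<close> is its own
    inverse.\<close>
  define s where "s = (\<Sum>i<2 * n. scale (- e i * \<omega> z (v (partner i))) (v i))"
  have sh: "s \<in> h"
    unfolding s_def using vh by (intro subspace_sum[OF h] subspace_scale[OF h]) auto
  have s_v: "\<omega> s (v j) = - \<omega> z (v j)" if j: "j < 2 * n" for j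
  proof -
    have jp: "j = partner (partner j)" "e (partner j) = - e j" "e j * e j = 1"
      unfolding partner_def e_def by (auto elim!: oddE)
    have pj: "partner j < 2 * n"
      using j by (rule partner_less)
    have "\<omega> s (v j) = (\<Sum>i<2 * n. - e i * \<omega> z (v (partner i)) * \<omega> (v i) (v j))"
      unfolding s_def by (rule sum_left) (use vh j in auto)
    also have "\<dots> = (\<Sum>i<2 * n. if i = partner j then - e i * \<omega> z (v (partner i)) * (e (partner j)) else 0)"
    proof (rule sum.cong[OF refl])
      fix i assume "i \<in> {..<2 * n}"
      then have "\<omega> (v i) (v j) = of_int (standard_form i (partner (partner j)))"
        using v j jp(1) unfolding darboux_def by simp
      then show "- e i * \<omega> z (v (partner i)) * \<omega> (v i) (v j) =
          (if i = partner j then - e i * \<omega> z (v (partner i)) * (e (partner j)) else 0)"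
        unfolding standard_form_partner e_def by simp
    qed
    also have "\<dots> = - e (partner j) * \<omega> z (v (partner (partner j))) * e (partner j)"
      using pj by simp
    finally show ?thesis
      using jp by (simp add: mult.assoc mult.left_commute)
  qed
  have "\<omega> (z + s) (v j) = 0" if "j < 2 * n" for j
    using that s_v vh sh z by (simp add: add_left)
  with sh show thesis
    unfolding s_def by (intro that)
qed

text \<open>A vector orthogonal to the family that is not in the radical yields one more hyperbolic
  pair, and in finite dimension this has to stop. So the radical is detected by finitely many
  vectors.\<close>

lemma darboux_exists:
  "\<exists>n v. darboux n v \<and> (\<forall>u\<in>h. (\<forall>i<2 * n. \<omega> u (v i) = 0) \<longrightarrow> (\<forall>z\<in>h. \<omega> u z = 0))"
proof (rule ccontr)
  assume "\<not> ?thesis"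
  then have step: "\<exists>u z. u \<in> h \<and> (\<forall>i<2 * n. \<omega> u (v i) = 0) \<and> z \<in> h \<and> \<omega> u z \<noteq> 0" if "darboux n v" for n v
    using that by blast
  have ex: "\<exists>v. darboux n v" for n
  proof (induction n)
    case 0
    show ?case
      by (simp add: darboux_def)
  next
    case (Suc n)
    then obtain v where v: "darboux n v" ..
    then obtain u z where u: "u \<in> h" "\<forall>i<2 * n. \<omega> u (v i) = 0" and z: "z \<in> h" "\<omega> u z \<noteq> 0"
      using step by blast
    have vh: "v i \<in> h" if "i < 2 * n" for i
      using v that unfolding darboux_def by blast
    obtain c where "(\<Sum>i<2 * n. scale (c i) (v i)) \<in> h"
      and "\<And>j. j < 2 * n \<Longrightarrow> \<omega> (z + (\<Sum>i<2 * n. scale (c i) (v i))) (v j) = 0"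
      using darboux_complement[OF v z(1)] by blast
    moreover define s where "s = (\<Sum>i<2 * n. scale (c i) (v i))"
    ultimately have sh: "s \<in> h" and s_v: "\<And>j. j < 2 * n \<Longrightarrow> \<omega> (z + s) (v j) = 0"
      by simp_all
    \<comment> \<open>The partner of \<open>u\<close>: \<open>z\<close> made orthogonal to the
      family and scaled to \<open>\<omega> u w = 1\<close>. The correction \<open>s\<close> does not
      disturb this, since \<open>u\<close> is already orthogonal to the family.\<close>
    define w where "w = scale (inverse (\<omega> u z)) (z + s)"
    have wh: "w \<in> h"
      unfolding w_def using sh z h_closed by simp
    have w_v: "\<omega> w (v j) = 0" if "j < 2 * n" for j
      unfolding w_def using that s_v vh sh z h_closed by (simp add: scale_left)
    have u_s: "\<omega> u s = 0"
    proof -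
      have "\<omega> s u = (\<Sum>i<2 * n. c i * \<omega> (v i) u)"
        unfolding s_def by (rule sum_left) (use vh u in auto)
      also have "\<dots> = 0"
        using u vh skew[of u "v i" for i] by (intro sum.neutral) simp
      finally show ?thesis
        using skew[OF sh u(1)] by simp
    qed
    have u_w: "\<omega> u w = 1"
      unfolding w_def using sh z u h_closed u_s by (simp add: scale_right add_right)
    define v' where "v' = v(2 * n := u, 2 * n + 1 := w)"
    have "darboux (Suc n) v'"
      unfolding darboux_def
    proof (intro conjI allI impI)
      fix i assume "i < 2 * Suc n"
      then show "v' i \<in> h"
        using vh u wh unfolding v'_def by auto
    next
      fix i j assume ij: "i < 2 * Suc n" "j < 2 * Suc n"
      have c: "k < 2 * n \<or> k = 2 * n \<or> k = 2 * n + 1" if "k < 2 * Suc n" for k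
        using that by auto
      have ne: "2 * a \<noteq> Suc (2 * b)" "Suc (2 * b) \<noteq> 2 * a" for a b :: nat
        by presburger+
      have sf: "standard_form k (2 * n) = 0" "standard_form k (2 * n + 1) = 0"
        "standard_form (2 * n) k = 0" "standard_form (2 * n + 1) k = 0" if "k < 2 * n" for k
        using that by (auto simp: standard_form_def ne)
      have sf': "standard_form (2 * n) (2 * n + 1) = 1" "standard_form (2 * n + 1) (2 * n) = - 1"
        "standard_form k k = 0" for k
        by (auto simp: standard_form_def)
      have v_w: "\<omega> (v k) w = 0" "\<omega> (v k) u = 0" if "k < 2 * n" for k
        using that skew[OF wh vh, of k] skew[OF u(1) vh, of k] w_v u(2) by simp_all
      show "\<omega> (v' i) (v' j) = of_int (standard_form i j)"
        using c[OF ij(1)] c[OF ij(2)] v u(2) w_v v_w u_w skew[OF u(1) wh] self[OF u(1)] self[OF wh]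
        unfolding v'_def darboux_def by (auto simp: sf sf'[simplified] sf[simplified])
    qed
    then show ?case
      by blast
  qed
  obtain B where B: "finite B" "h \<subseteq> span B"
    using fin by blast
  obtain v where v: "darboux (Suc (card B)) v"
    using ex by blast
  let ?m = "2 * Suc (card B)"
  have ind: "inj_on v {..<?m}" "independent (v ` {..<?m})"
    using family_independent[where m = ?m and v = v] darboux_coefficients[OF v, of ?m] by auto
  have "v ` {..<?m} \<subseteq> h"
    using v unfolding darboux_def by auto
  then have "card (v ` {..<?m}) \<le> card B"
    using independent_span_bound[OF B(1) ind(2)] B(2) by blast
  then show False
    using ind(1) by (simp add: card_image)
qed

text \<open>A Darboux family that detects the radical spans, because the orthogonal part of any
  vector is radical and hence 0. What is used later is the contrapositive: a skew form on an
  odd-dimensional space has a kernel.\<close>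

lemma nondegenerate_dim_even:
  assumes "\<And>u. u \<in> h \<Longrightarrow> (\<forall>y\<in>h. \<omega> u y = 0) \<Longrightarrow> u = 0"
  shows "even (dim h)"
proof -
  obtain n v where v: "darboux n v"
    and rad: "\<And>u z. u \<in> h \<Longrightarrow> (\<And>i. i < 2 * n \<Longrightarrow> \<omega> u (v i) = 0) \<Longrightarrow> z \<in> h \<Longrightarrow> \<omega> u z = 0"
    using darboux_exists by blast
  have ind: "inj_on v {..<2 * n}" "independent (v ` {..<2 * n})"
    using family_independent[where m = "2 * n" and v = v] darboux_coefficients[OF v, of "2 * n"] by auto
  have "h \<subseteq> span (v ` {..<2 * n})"
  proof
    fix u assume u: "u \<in> h"
    obtain c where c: "(\<Sum>i<2 * n. scale (c i) (v i)) \<in> h"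
      "\<And>j. j < 2 * n \<Longrightarrow> \<omega> (u + (\<Sum>i<2 * n. scale (c i) (v i))) (v j) = 0"
      using darboux_complement[OF v u] by blast
    have "u + (\<Sum>i<2 * n. scale (c i) (v i)) = 0"
      using u c h_closed rad by (intro assms) auto
    then have u_eq: "u = - (\<Sum>i<2 * n. scale (c i) (v i))"
      by (simp add: eq_neg_iff_add_eq_0)
    show "u \<in> span (v ` {..<2 * n})"
      unfolding u_eq by (intro span_neg span_sum span_scale span_base imageI)
  qed
  moreover have "v ` {..<2 * n} \<subseteq> h"
    using v unfolding darboux_def by auto
  ultimately have "dim h = card (v ` {..<2 * n})"
    using ind(2) basis_card_eq_dim by metis
  then show ?thesis
    using ind(1) by (simp add: card_image)
qed

end

section \<open>Contact forms in terms of the kernel of their differential\<close>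

locale fd_algebra = vector_space scale
  for scale :: "'k::field_char_0 \<Rightarrow> 'v::ab_group_add \<Rightarrow> 'v" +
  fixes br :: "'v \<Rightarrow> 'v \<Rightarrow> 'v" and h :: "'v set"
  assumes h: "subspace h"
    and fin: "\<exists>B. finite B \<and> h \<subseteq> span B"
    and br_closed: "\<And>x y. x \<in> h \<Longrightarrow> y \<in> h \<Longrightarrow> br x y \<in> h"
    and br_add_left: "\<And>x y z. x \<in> h \<Longrightarrow> y \<in> h \<Longrightarrow> z \<in> h \<Longrightarrow> br (x + y) z = br x z + br y z"
    and br_scale_left: "\<And>c x z. x \<in> h \<Longrightarrow> z \<in> h \<Longrightarrow> br (scale c x) z = scale c (br x z)"
    and br_skew: "\<And>x y. x \<in> h \<Longrightarrow> y \<in> h \<Longrightarrow> br y x = - br x y"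
begin

lemmas h_closed = subspace_0[OF h] subspace_add[OF h] subspace_scale[OF h]

lemma br_add_right: "x \<in> h \<Longrightarrow> y \<in> h \<Longrightarrow> z \<in> h \<Longrightarrow> br z (x + y) = br z x + br z y"
  using br_skew[of "x + y" z] br_skew[of x z] br_skew[of y z] h_closed by (simp add: br_add_left)

lemma br_scale_right: "x \<in> h \<Longrightarrow> z \<in> h \<Longrightarrow> br z (scale c x) = scale c (br z x)"
  using br_skew[of "scale c x" z] br_skew[of x z] h_closed by (simp add: br_scale_left)

lemma dualD:
  assumes "\<alpha> \<in> dual_space scale h"
  shows "x \<in> h \<Longrightarrow> y \<in> h \<Longrightarrow> \<alpha> (x + y) = \<alpha> x + \<alpha> y" "x \<in> h \<Longrightarrow> \<alpha> (scale c x) = c * \<alpha> x"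
    "\<alpha> 0 = 0" "x \<in> h \<Longrightarrow> \<alpha> (- x) = - \<alpha> x"
proof -
  have scl: "\<alpha> (scale c x) = c * \<alpha> x" if "x \<in> h" for c x
    using assms that unfolding dual_space_def by blast
  then show "x \<in> h \<Longrightarrow> \<alpha> (scale c x) = c * \<alpha> x" .
  show "x \<in> h \<Longrightarrow> y \<in> h \<Longrightarrow> \<alpha> (x + y) = \<alpha> x + \<alpha> y"
    using assms unfolding dual_space_def by blast
  show "\<alpha> 0 = 0"
    using scl[of 0 0] h_closed by simp
  show "x \<in> h \<Longrightarrow> \<alpha> (- x) = - \<alpha> x"
    using scl[of x "- 1"] by simp
qed

lemma skew_form_ce:
  assumes \<alpha>: "\<alpha> \<in> dual_space scale h"
  shows "skew_form scale h (\<lambda>x y. - \<alpha> (br x y))"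
  using h fin
  by unfold_locales
    (simp_all add: br_add_left br_scale_left dualD[OF \<alpha>] br_closed, metis br_skew br_closed dualD(4)[OF \<alpha>])

text \<open>\<open>z\<close> is the Reeb vector of \<open>\<alpha>\<close> up to scaling. It is an
  argument and not bound by a quantifier, because such vectors of a Lie algebra and of a subalgebra
  are compared later.\<close>

definition contact_functional :: "('v \<Rightarrow> 'k) \<Rightarrow> 'v \<Rightarrow> bool" where
  "contact_functional \<alpha> z \<longleftrightarrow> \<alpha> \<in> dual_space scale h \<and> z \<in> h \<and> \<alpha> z \<noteq> 0 \<and> (\<forall>y\<in>h. \<alpha> (br z y) = 0) \<and>
     (\<forall>x\<in>h. (\<forall>y\<in>h. \<alpha> (br x y) = 0) \<longrightarrow> (\<exists>c. x = scale c z))"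

abbreviation contact_volume :: "nat \<Rightarrow> ('v \<Rightarrow> 'k) \<Rightarrow> (nat \<Rightarrow> 'v) \<Rightarrow> 'k" where
  "contact_volume n \<alpha> \<equiv> wedge (2 * n) 1 (wedge_power 2 (ce_differential br \<alpha>) n) (\<lambda>v. \<alpha> (v 0))"

lemma contact_volume_multilinear:
  assumes \<alpha>: "\<alpha> \<in> dual_space scale h"
  shows "multilinear scale h (2 * n + 1) (contact_volume n \<alpha>)"
proof (rule multilinear_wedge)
  interpret skew_form scale h "\<lambda>x y. - \<alpha> (br x y)"
    using \<alpha> by (rule skew_form_ce)
  have "multilinear scale h 2 (ce_differential br \<alpha>)"
    unfolding multilinear_def ce_differential_def
  proof (intro conjI allI impI)
    fix v :: "nat \<Rightarrow> 'v" and j :: nat and x y assume "range v \<subseteq> h \<and> x \<in> h \<and> y \<in> h \<and> j < 2"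
    moreover then have "j = 0 \<or> j = 1"
      by auto
    ultimately show "- \<alpha> (br ((v(j := x + y)) 0) ((v(j := x + y)) 1)) =
        - \<alpha> (br ((v(j := x)) 0) ((v(j := x)) 1)) + - \<alpha> (br ((v(j := y)) 0) ((v(j := y)) 1))"
      using add_left[of x y "v 1"] add_right[of x y "v 0"] by (auto simp: image_subset_iff)
  next
    fix v :: "nat \<Rightarrow> 'v" and j :: nat and c x assume "range v \<subseteq> h \<and> x \<in> h \<and> j < 2"
    moreover then have "j = 0 \<or> j = 1"
      by auto
    ultimately show "- \<alpha> (br ((v(j := scale c x)) 0) ((v(j := scale c x)) 1)) =
        c * - \<alpha> (br ((v(j := x)) 0) ((v(j := x)) 1))"
      using scale_left[of x "v 1" c] scale_right[of x "v 0" c] by (auto simp: image_subset_iff)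
  qed auto
  then show "multilinear scale h (2 * n) (wedge_power 2 (ce_differential br \<alpha>) n)"
    by (rule multilinear_wedge_power)
  show "multilinear scale h 1 (\<lambda>v. \<alpha> (v 0))"
    unfolding multilinear_def using dualD[OF \<alpha>] by simp
qed

lemma contact_volume_annihilates:
  assumes \<alpha>: "\<alpha> \<in> dual_space scale h" and x: "x \<in> h" "\<forall>y\<in>h. \<alpha> (br x y) = 0" "\<alpha> x = 0"
    and v: "range v \<subseteq> h" "j < 2 * n + 1" "v j = x"
  shows "contact_volume n \<alpha> v = 0"
proof (rule wedge_annihilates[OF _ _ v])
  have "ce_differential br \<alpha> v = 0" if "range v \<subseteq> h" "i < 2" "v i = x" for v i
  proof -
    have "v 0 \<in> h" "v 1 \<in> h"
      using that by auto
    moreover have "i = 0 \<or> i = 1"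
      using that by auto
    moreover have "\<alpha> (br (v 0) x) = 0"
      using \<open>v 0 \<in> h\<close> x br_skew[of x "v 0"] dualD(4)[OF \<alpha>, of "br x (v 0)"] br_closed by simp
    ultimately show ?thesis
      using that x by (auto simp: ce_differential_def)
  qed
  then show "wedge_power 2 (ce_differential br \<alpha>) n v = 0" if "range v \<subseteq> h" "i < 2 * n" "v i = x" for v i
    using wedge_power_annihilates[where p = 2 and h = h and x = x and j = i] that by blast
  show "\<alpha> (v 0) = 0" if "range v \<subseteq> h" "i < 1" "v i = x" for v :: "nat \<Rightarrow> 'v" and i
    using that x by (simp only: less_one)
qed

text \<open>Put \<open>x\<close> into slot \<open>j\<close>. The volume becomes 0 because
  \<open>x\<close> is in the common kernel, and by expansion it is \<open>c j\<close> times the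
  nonzero volume of \<open>v\<close>, the other terms having a repeated entry. With
  \<open>x = 0\<close> this gives the independence of \<open>v\<close>.\<close>

lemma contact_volume_coefficients:
  assumes \<alpha>: "\<alpha> \<in> dual_space scale h" and v: "\<forall>i. v i \<in> h" and ne: "contact_volume n \<alpha> v \<noteq> 0"
    and x: "x = (\<Sum>i<2 * n + 1. scale (c i) (v i))" "\<forall>y\<in>h. \<alpha> (br x y) = 0" "\<alpha> x = 0"
    and j: "j < 2 * n + 1"
  shows "c j = 0"
proof -
  let ?\<Phi> = "contact_volume n \<alpha>"
  have rv: "range v \<subseteq> h"
    using v by auto
  note ml = contact_volume_multilinear[OF \<alpha>, of n]
  have addm: "?\<Phi> (v(j := x + y)) = ?\<Phi> (v(j := x)) + ?\<Phi> (v(j := y))" if "x \<in> h" "y \<in> h" for x y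
    using ml rv j that unfolding multilinear_def by blast
  have sclm: "?\<Phi> (v(j := scale c x)) = c * ?\<Phi> (v(j := x))" if "x \<in> h" for c x
    using ml rv j that unfolding multilinear_def by blast
  have sm: "?\<Phi> (v(j := (\<Sum>i\<in>I. scale (c i) (v i)))) = (\<Sum>i\<in>I. c i * ?\<Phi> (v(j := v i)))"
    if "finite I" for I
    using that
  proof (induction I rule: finite_induct)
    case empty
    have "?\<Phi> (v(j := 0)) = 0"
      using sclm[of 0 0] h_closed by (simp only: scale_zero_left mult_zero_left)
    then show ?case
      by (simp only: sum.empty)
  next
    case (insert i I)
    have sI: "(\<Sum>i\<in>I. scale (c i) (v i)) \<in> h"
      using v by (intro subspace_sum[OF h] subspace_scale[OF h]) auto
    have "v i \<in> h" "scale (c i) (v i) \<in> h"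
      using v h_closed by auto
    then show ?case
      by (simp only: sum.insert[OF insert.hyps] addm[OF _ sI] sclm insert.IH)
  qed
  have xh: "x \<in> h"
    unfolding x(1) using v by (intro subspace_sum[OF h] subspace_scale[OF h]) auto
  have "0 = ?\<Phi> (v(j := x))"
    using contact_volume_annihilates[OF \<alpha> xh x(2,3), of "v(j := x)" j n] rv xh j by auto
  also have "\<dots> = (\<Sum>i<2 * n + 1. c i * ?\<Phi> (v(j := v i)))"
    unfolding x(1) by (rule sm) simp
  also have "\<dots> = (\<Sum>i\<in>{j}. c i * ?\<Phi> (v(j := v i)))"
  proof (rule sum.mono_neutral_right)
    show "\<forall>i\<in>{..<2 * n + 1} - {j}. c i * ?\<Phi> (v(j := v i)) = 0"
    proof
      fix i assume i: "i \<in> {..<2 * n + 1} - {j}"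
      have "?\<Phi> (v(j := v i)) = 0"
        by (rule wedge_repeated[of i _ _ j]) (use i j in auto)
      then show "c i * ?\<Phi> (v(j := v i)) = 0"
        by (simp only: mult_zero_right)
    qed
  qed (use j in auto)
  finally show ?thesis
    using ne by simp
qed

text \<open>The \<open>2 * n + 1\<close> arguments of a nonzero volume form a basis, so the common
  kernel of \<open>\<alpha>\<close> and \<open>d\<alpha>\<close> is 0. Odd dimension gives
  \<open>d\<alpha>\<close> a kernel, and since \<open>\<alpha>\<close> is injective on it, it is a
  line.\<close>

lemma contact_imp_functional:
  assumes "dim h = 2 * n + 1" and \<alpha>: "\<alpha> \<in> dual_space scale h"
    and v: "\<forall>i. v i \<in> h" and ne: "contact_volume n \<alpha> v \<noteq> 0"
  shows "\<exists>z. contact_functional \<alpha> z"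
proof -
  interpret skew_form scale h "\<lambda>x y. - \<alpha> (br x y)"
    using \<alpha> by (rule skew_form_ce)
  let ?m = "2 * n + 1"
  note coeff = contact_volume_coefficients[OF \<alpha> v ne]
  have rad0: "\<forall>y\<in>h. \<alpha> (br 0 y) = 0" "\<alpha> 0 = 0"
    using zero_left dualD[OF \<alpha>] by auto
  have "\<forall>i<?m. c i = 0" if "(\<Sum>i<?m. scale (c i) (v i)) = 0" for c
    using coeff[OF that[symmetric] rad0] by blast
  note ind = family_independent[where m = ?m and v = v, OF this]
  obtain B where B: "finite B" "h \<subseteq> span B"
    using fin by blast
  have "card (v ` {..<?m}) = dim h"
    using assms(1) ind(1) by (simp add: card_image)
  then have sp: "h \<subseteq> span (v ` {..<?m})"
    using v ind by (intro independent_card_eq_dim_spans[OF B]) auto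
  have zero: "x = 0" if x: "x \<in> h" "\<forall>y\<in>h. \<alpha> (br x y) = 0" "\<alpha> x = 0" for x
  proof -
    obtain c where c: "x = (\<Sum>i<?m. scale (c i) (v i))"
      using span_family[of x v ?m] sp x ind by blast
    have "(\<Sum>i<?m. scale (c i) (v i)) = 0"
      using coeff[OF c x(2,3)] by (intro sum.neutral) simp
    with c show ?thesis
      by simp
  qed
  obtain z where z: "z \<in> h" "\<forall>y\<in>h. \<alpha> (br z y) = 0" "z \<noteq> 0"
    using nondegenerate_dim_even assms(1) by (auto simp del: One_nat_def)
  then have \<alpha>z: "\<alpha> z \<noteq> 0"
    using zero by blast
  have "x = scale (\<alpha> x / \<alpha> z) z" if x: "x \<in> h" "\<forall>y\<in>h. \<alpha> (br x y) = 0" for x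
  proof -
    let ?c = "- (\<alpha> x / \<alpha> z)"
    have cz: "scale ?c z \<in> h"
      using z(1) by (rule h_closed)
    have "x + scale ?c z = 0"
    proof (rule zero)
      show "x + scale ?c z \<in> h"
        using x(1) cz by (rule h_closed)
      show "\<forall>y\<in>h. \<alpha> (br (x + scale ?c z) y) = 0"
        using x z cz by (simp add: br_add_left br_scale_left dualD[OF \<alpha>] br_closed h_closed
            del: scale_minus_left)
      show "\<alpha> (x + scale ?c z) = 0"
        using x z cz \<alpha>z by (simp add: dualD[OF \<alpha>] del: scale_minus_left)
    qed
    then show ?thesis
      by simp
  qed
  then show ?thesis
    unfolding contact_functional_def using \<alpha> z \<alpha>z by blast
qed

text \<open>Project a Darboux family to the kernel of \<open>\<alpha>\<close> along \<open>z\<close>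
  and append the normalised \<open>z\<close>. Then \<open>d\<alpha>\<close> has the standard matrix,
  \<open>\<alpha>\<close> is the last coordinate, and the volume is a nonzero constant times a
  positive integer.\<close>

lemma functional_imp_contact:
  assumes "contact_functional \<alpha> z"
  shows "\<exists>n v. dim h = 2 * n + 1 \<and> (\<forall>i. v i \<in> h) \<and> contact_volume n \<alpha> v \<noteq> 0"
proof -
  have \<alpha>: "\<alpha> \<in> dual_space scale h" and z: "z \<in> h" "\<alpha> z \<noteq> 0" "\<And>y. y \<in> h \<Longrightarrow> \<alpha> (br z y) = 0"
    and ker: "\<And>x. x \<in> h \<Longrightarrow> (\<forall>y\<in>h. \<alpha> (br x y) = 0) \<Longrightarrow> \<exists>c. x = scale c z"
    using assms unfolding contact_functional_def by blast+
  interpret skew_form scale h "\<lambda>x y. - \<alpha> (br x y)"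
    using \<alpha> by (rule skew_form_ce)
  let ?\<omega> = "\<lambda>x y. - \<alpha> (br x y)"
  obtain n v where v: "darboux n v"
    and rad: "\<And>u z. u \<in> h \<Longrightarrow> (\<And>i. i < 2 * n \<Longrightarrow> ?\<omega> u (v i) = 0) \<Longrightarrow> z \<in> h \<Longrightarrow> ?\<omega> u z = 0"
    using darboux_exists by blast
  have vh: "v i \<in> h" if "i < 2 * n" for i
    using v that unfolding darboux_def by blast
  have zr: "\<alpha> (br y z) = 0" if "y \<in> h" for y
    using z(3)[OF that] skew[OF z(1) that] by simp
  \<comment> \<open>Adding a multiple of \<open>z\<close> leaves all pairings unchanged, as
    \<open>z\<close> is in the kernel of the form. The last vector is repeated for all
    \<open>i \<ge> 2 * n\<close>, so that every entry of the sequence lies in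
    \<open>h\<close>.\<close>
  define w where "w i = (if i < 2 * n then v i + scale (- (\<alpha> (v i) / \<alpha> z)) z else scale (1 / \<alpha> z) z)" for i
  have wh: "w i \<in> h" for i
    unfolding w_def using vh z(1) h_closed by (simp del: scale_minus_left)
  have \<alpha>w: "\<alpha> (w i) = (if i < 2 * n then 0 else 1)" for i
    unfolding w_def using vh z h_closed by (simp add: dualD[OF \<alpha>] del: scale_minus_left)
  have \<omega>w: "?\<omega> u (w i) = (if i < 2 * n then ?\<omega> u (v i) else 0)" if "u \<in> h" for u i
    unfolding w_def using that vh z zr h_closed
    by (simp add: br_add_right br_scale_right br_closed dualD[OF \<alpha>] del: scale_minus_left)
  have \<omega>w': "?\<omega> (w i) u = (if i < 2 * n then ?\<omega> (v i) u else 0)" if "u \<in> h" for u i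
    unfolding w_def using that vh z zr h_closed
    by (simp add: br_add_left br_scale_left br_closed dualD[OF \<alpha>] del: scale_minus_left)
  have form: "?\<omega> (w i) (w j) = of_int (standard_form i j)" if "i \<le> 2 * n" "j \<le> 2 * n" for i j
  proof (cases "i < 2 * n \<and> j < 2 * n")
    case True
    then show ?thesis
      using v wh vh \<omega>w[of "v i" j] \<omega>w'[of "w j" i] unfolding darboux_def by simp
  next
    case False
    \<comment> \<open>One index is \<open>2 * n\<close>, and its partner \<open>2 * n + 1\<close> is
      out of range.\<close>
    then have "standard_form i j = 0"
      using that unfolding standard_form_def by (auto elim!: evenE) presburger+
    then show ?thesis
      using False wh \<omega>w[of "w i" j] \<omega>w'[of "w j" i] by auto
  qed
  then have dw: "darboux n w"
    unfolding darboux_def using wh by simp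
  let ?m = "2 * n + 1"
  have "\<forall>i<?m. c i = 0" if s: "(\<Sum>i<?m. scale (c i) (w i)) = 0" for c
  proof -
    have c: "c k = 0" if "k < 2 * n" for k
    proof (rule darboux_coefficients[OF dw _ _ _ s that])
      fix i j assume "2 * n \<le> i" "i < ?m" "j < 2 * n"
      then show "?\<omega> (w i) (w j) = 0"
        using \<omega>w'[OF wh, of i j] by simp
    qed (use wh in auto)
    have "(\<Sum>i<?m. scale (c i) (w i)) = scale (c (2 * n)) (w (2 * n))"
      using c by simp
    then have "c (2 * n) * \<alpha> (w (2 * n)) = 0"
      using s dualD(2,3)[OF \<alpha>] wh by metis
    then show ?thesis
      using c \<alpha>w by (auto simp: less_Suc_eq)
  qed
  note ind = family_independent[where m = ?m and v = w, OF this]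
  have "h \<subseteq> span (w ` {..<?m})"
  proof
    fix u assume u: "u \<in> h"
    obtain c where c: "(\<Sum>i<2 * n. scale (c i) (w i)) \<in> h"
      "\<And>j. j < 2 * n \<Longrightarrow> ?\<omega> (u + (\<Sum>i<2 * n. scale (c i) (w i))) (w j) = 0"
      using darboux_complement[OF dw u] by blast
    let ?y = "u + (\<Sum>i<2 * n. scale (c i) (w i))"
    have y: "?y \<in> h"
      using u c(1) by (rule h_closed)
    have "\<forall>z\<in>h. ?\<omega> ?y z = 0"
      using rad[OF y] c(2) \<omega>w[OF y] by simp
    then obtain d where "?y = scale d z"
      using ker[OF y] by auto
    then have "?y = scale (d * \<alpha> z) (w (2 * n))"
      using z(2) by (simp add: w_def)
    then have u_eq: "u = scale (d * \<alpha> z) (w (2 * n)) - (\<Sum>i<2 * n. scale (c i) (w i))"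
      by (simp add: eq_diff_eq)
    show "u \<in> span (w ` {..<?m})"
      unfolding u_eq by (intro span_diff span_sum span_scale span_base imageI) auto
  qed
  then have dim: "dim h = ?m"
    using ind wh by (intro dim_unique[of "w ` {..<?m}"]) (auto simp: card_image)
  obtain K where K: "K \<noteq> 0" and vol: "\<And>v. contact_volume n \<alpha> v =
      K * (\<Sum>\<sigma> | \<sigma> permutes {..<?m}. of_int (sign \<sigma>) * (pairing_product n ?\<omega> (v \<circ> \<sigma>) * \<alpha> (v (\<sigma> (2 * n)))))"
    using wedge_contact[of n ?\<omega> \<alpha>] unfolding ce_differential_def[abs_def] by blast
  let ?t = "\<lambda>\<sigma>. sign \<sigma> * ((\<Prod>i<n. standard_form (\<sigma> (2 * i)) (\<sigma> (2 * i + 1))) * (if \<sigma> (2 * n) = 2 * n then 1 else 0))"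
  have "(\<Sum>\<sigma> | \<sigma> permutes {..<?m}. of_int (sign \<sigma>) * (pairing_product n ?\<omega> (w \<circ> \<sigma>) * \<alpha> (w (\<sigma> (2 * n))))) =
      (\<Sum>\<sigma> | \<sigma> permutes {..<?m}. of_int (?t \<sigma>))"
  proof (rule sum.cong[OF refl])
    fix \<sigma> assume "\<sigma> \<in> {\<sigma>. \<sigma> permutes {..<?m}}"
    then have lt: "\<sigma> i \<le> 2 * n" if "i \<le> 2 * n" for i
      using permutes_in_image[of \<sigma> "{..<?m}" i] that by (simp add: less_Suc_eq_le)
    have "pairing_product n ?\<omega> (w \<circ> \<sigma>) = of_int (\<Prod>i<n. standard_form (\<sigma> (2 * i)) (\<sigma> (2 * i + 1)))"
      unfolding pairing_product_def of_int_prod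
    proof (rule prod.cong[OF refl])
      fix i assume "i \<in> {..<n}"
      then show "?\<omega> ((w \<circ> \<sigma>) (2 * i)) ((w \<circ> \<sigma>) (2 * i + 1)) =
          of_int (standard_form (\<sigma> (2 * i)) (\<sigma> (2 * i + 1)))"
        using form[OF lt lt, of "2 * i" "2 * i + 1"] by simp
    qed
    moreover have "\<alpha> (w (\<sigma> (2 * n))) = of_int (if \<sigma> (2 * n) = 2 * n then 1 else 0)"
      using \<alpha>w lt[of "2 * n"] by auto
    ultimately show "of_int (sign \<sigma>) * (pairing_product n ?\<omega> (w \<circ> \<sigma>) * \<alpha> (w (\<sigma> (2 * n)))) = of_int (?t \<sigma>)"
      by (simp only: of_int_mult)
  qed
  also have "\<dots> = of_int (sum ?t {\<sigma>. \<sigma> permutes {..<?m}})"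
    by simp
  finally have "contact_volume n \<alpha> w = K * of_int (sum ?t {\<sigma>. \<sigma> permutes {..<?m}})"
    unfolding vol by simp
  then have "contact_volume n \<alpha> w \<noteq> 0"
    using K standard_form_sum_pos[of n] by (simp del: of_int_sum)
  then show ?thesis
    using dim wh by blast
qed

lemma contact_iff: "contact scale br h \<longleftrightarrow> (\<exists>\<alpha> z. contact_functional \<alpha> z)"
proof
  assume "contact scale br h"
  then obtain n \<alpha> v where "dim h = 2 * n + 1" "\<alpha> \<in> dual_space scale h" "\<forall>i. v i \<in> h" "contact_volume n \<alpha> v \<noteq> 0"
    unfolding contact_def by blast
  then show "\<exists>\<alpha> z. contact_functional \<alpha> z"
    using contact_imp_functional by blast
next
  assume "\<exists>\<alpha> z. contact_functional \<alpha> z"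
  then obtain \<alpha> z where c: "contact_functional \<alpha> z"
    by blast
  then have "\<alpha> \<in> dual_space scale h"
    by (simp add: contact_functional_def)
  with functional_imp_contact[OF c] show "contact scale br h"
    unfolding contact_def by blast
qed

end

section \<open>Abelian extensions with a nondegenerate functional\<close>

context vector_space
begin

text \<open>Duality for a pairing with finite-dimensional \<open>Y\<close>, obtained by applying
  \<open>functional_in_span\<close> to the functionals \<open>b _ y\<close> with \<open>y\<close> in
  a basis. It produces the element \<open>x\<^sub>0\<close>, the lifts of radical vectors, and the
  radical vector \<open>z\<close> found inside the line normaliser.\<close>

lemma functional_represented:
  assumes X: "subspace X" and Y: "subspace Y" and fin: "\<exists>B. finite B \<and> Y \<subseteq> span B"
    and b: "\<And>x x' y. x \<in> X \<Longrightarrow> x' \<in> X \<Longrightarrow> y \<in> Y \<Longrightarrow> b (x + x') y = b x y + b x' y"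
      "\<And>c x y. x \<in> X \<Longrightarrow> y \<in> Y \<Longrightarrow> b (scale c x) y = c * b x y"
      "\<And>x y y'. x \<in> X \<Longrightarrow> y \<in> Y \<Longrightarrow> y' \<in> Y \<Longrightarrow> b x (y + y') = b x y + b x y'"
      "\<And>c x y. x \<in> X \<Longrightarrow> y \<in> Y \<Longrightarrow> b x (scale c y) = c * b x y"
    and g: "\<And>x y. x \<in> X \<Longrightarrow> y \<in> X \<Longrightarrow> g (x + y) = g x + g y"
      "\<And>c x. x \<in> X \<Longrightarrow> g (scale c x) = c * g x"
    and ker: "\<And>x. x \<in> X \<Longrightarrow> (\<forall>y\<in>Y. b x y = 0) \<Longrightarrow> g x = 0"
  shows "\<exists>y\<in>Y. \<forall>x\<in>X. g x = b x y"
proof -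
  obtain B where B: "B \<subseteq> Y" "independent B" "Y \<subseteq> span B"
    by (rule maximal_independent_subset)
  then have fB: "finite B"
    using fin independent_span_bound by blast
  have b0: "b x 0 = 0" if "x \<in> X" for x
    using b(4)[of x 0 0] that subspace_0[OF Y] by simp
  have "g x = 0" if x: "x \<in> X" and z: "\<forall>y\<in>B. b x y = 0" for x
  proof (rule ker[OF x])
    have "subspace {y \<in> Y. b x y = 0}"
      unfolding subspace_def using x b0 subspace_0[OF Y] subspace_add[OF Y] subspace_scale[OF Y]
      by (simp add: b)
    then have "span B \<subseteq> {y \<in> Y. b x y = 0}"
      using B(1) z by (intro span_minimal) auto
    then show "\<forall>y\<in>Y. b x y = 0"
      using B(3) by blast
  qed
  then have "\<exists>c. \<forall>x\<in>X. g x = (\<Sum>y\<in>B. c y * b x y)"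
    using fB X B(1) b g by (intro functional_in_span[where f = "\<lambda>y x. b x y"]) (auto simp: subset_iff)
  then obtain c where c: "\<And>x. x \<in> X \<Longrightarrow> g x = (\<Sum>y\<in>B. c y * b x y)"
    by blast
  have sum: "(\<Sum>y\<in>B. scale (c y) y) \<in> Y \<and> b x (\<Sum>y\<in>B. scale (c y) y) = (\<Sum>y\<in>B. c y * b x y)" if "x \<in> X" for x
    using fB B(1)
  proof (induction B rule: finite_induct)
    case empty
    then show ?case
      using b0[OF that] subspace_0[OF Y] by simp
  next
    case (insert y B)
    then show ?case
      using that subspace_add[OF Y] subspace_scale[OF Y] by (simp add: b)
  qed
  have "(\<Sum>y\<in>B. scale (c y) y) \<in> Y"
    using B(1) by (intro subspace_sum[OF Y] subspace_scale[OF Y]) auto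
  then show ?thesis
    using sum c by (intro bexI[of _ "\<Sum>y\<in>B. scale (c y) y"]) auto
qed

end

context fd_algebra
begin

lemma dual_restrict:
  assumes "\<And>x y. x \<in> h \<Longrightarrow> y \<in> h \<Longrightarrow> g (x + y) = g x + g y" "\<And>c x. x \<in> h \<Longrightarrow> g (scale c x) = c * g x"
  shows "restr h g \<in> dual_space scale h"
  using assms h_closed unfolding dual_space_def by simp

text \<open>An infimum of naturals is attained. That dimension 0 means the zero space uses that
  \<open>h\<close> is finite-dimensional, as \<open>dim\<close> is 0 on infinite-dimensional spaces
  as well.\<close>

lemma lie_index_eq_0_iff:
  "lie_index scale br h = 0 \<longleftrightarrow>
     (\<exists>\<beta>\<in>dual_space scale h. \<forall>x\<in>h. (\<forall>y\<in>h. \<beta> (br x y) = 0) \<longrightarrow> x = 0)"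
proof -
  have dim0: "dim (coadjoint_stabiliser br h \<beta>) = 0 \<longleftrightarrow> (\<forall>x\<in>h. (\<forall>y\<in>h. \<beta> (br x y) = 0) \<longrightarrow> x = 0)"
    (is "dim ?S = 0 \<longleftrightarrow> ?R") for \<beta> :: "'v \<Rightarrow> 'k"
  proof
    assume d: "dim ?S = 0"
    obtain B where B: "B \<subseteq> ?S" "independent B" "?S \<subseteq> span B" "card B = dim ?S"
      by (rule basis_exists)
    have "B \<subseteq> h"
      using B(1) unfolding coadjoint_stabiliser_def by blast
    then have "finite B"
      using fin independent_span_bound[OF _ B(2)] by blast
    then have "B = {}"
      using B(4) d by simp
    then show ?R
      using B(3) unfolding coadjoint_stabiliser_def by auto
  next
    assume ?R
    then have "?S \<subseteq> {0}"
      unfolding coadjoint_stabiliser_def by auto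
    then show "dim ?S = 0"
      by (intro dim_unique[of "{}"]) (simp_all add: independent_empty)
  qed
  let ?D = "(\<lambda>\<beta>. dim (coadjoint_stabiliser br h \<beta>)) ` dual_space scale h"
  have "restr h (\<lambda>_. 0) \<in> dual_space scale h"
    by (rule dual_restrict) simp_all
  then have "?D \<noteq> {}"
    by blast
  then have "Inf ?D \<in> ?D"
    by (rule Inf_nat_def1)
  then have "Inf ?D = 0 \<longleftrightarrow> 0 \<in> ?D"
    by (metis bot_nat_0.extremum_uniqueI cInf_lower bdd_below_bot)
  also have "\<dots> \<longleftrightarrow> (\<exists>\<beta>\<in>dual_space scale h. dim (coadjoint_stabiliser br h \<beta>) = 0)"
    by force
  finally show ?thesis
    unfolding lie_index_def dim0 .
qed

end

text \<open>\<open>nondeg\<close> is the dual form of the surjectivity of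
  \<open>x \<mapsto> x \<cdot> \<gamma>\<close> from \<open>l\<close> to \<open>V\<^sup>*\<close>.
  The group enters the Lie-theoretic argument through this and, later, through the possibility of
  choosing a contact form on \<open>q\<close> that extends \<open>\<gamma>\<close>.\<close>

locale abelian_extension = fd_algebra scale br q
  for scale :: "'k::field_char_0 \<Rightarrow> 'v::ab_group_add \<Rightarrow> 'v" and br q +
  fixes l V :: "'v set" and \<gamma> :: "'v \<Rightarrow> 'k"
  assumes jacobi: "\<And>x y z. x \<in> q \<Longrightarrow> y \<in> q \<Longrightarrow> z \<in> q \<Longrightarrow> br (br x y) z = br x (br y z) - br y (br x z)"
    and l: "subspace l" "l \<subseteq> q" "\<And>x y. x \<in> l \<Longrightarrow> y \<in> l \<Longrightarrow> br x y \<in> l"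
    and V: "subspace V" "V \<subseteq> q" "\<And>x v. x \<in> q \<Longrightarrow> v \<in> V \<Longrightarrow> br x v \<in> V"
      "\<And>u v. u \<in> V \<Longrightarrow> v \<in> V \<Longrightarrow> br u v = 0"
    and decomp: "\<And>x. x \<in> q \<Longrightarrow> \<exists>y\<in>l. \<exists>v\<in>V. x = y + v" "\<And>x. x \<in> l \<Longrightarrow> x \<in> V \<Longrightarrow> x = 0"
    and \<gamma>: "\<gamma> \<in> dual_space scale V"
    and nondeg: "\<And>v. v \<in> V \<Longrightarrow> (\<forall>x\<in>l. \<gamma> (br x v) = 0) \<Longrightarrow> v = 0"
begin

definition stab :: "'v set" where
  "stab = {x \<in> l. \<forall>v\<in>V. \<gamma> (br x v) = 0}"

text \<open>The dual action is \<open>x \<cdot> \<gamma> = - \<gamma>[x, _]\<close>; the sign is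
  absorbed by \<open>c\<close>.\<close>

definition norm_line :: "'v set" where
  "norm_line = {x \<in> l. \<exists>c. \<forall>v\<in>V. \<gamma> (br x v) = c * \<gamma> v}"

lemma lq: "x \<in> l \<Longrightarrow> x \<in> q" and Vq: "v \<in> V \<Longrightarrow> v \<in> q"
  using l V by auto

lemmas l_closed = subspace_0[OF l(1)] subspace_add[OF l(1)] subspace_scale[OF l(1)]
  subspace_diff[OF l(1)] subspace_neg[OF l(1)]
lemmas V_closed = subspace_0[OF V(1)] subspace_add[OF V(1)] subspace_scale[OF V(1)]
  subspace_diff[OF V(1)] subspace_neg[OF V(1)]

lemma \<gamma>_add: "u \<in> V \<Longrightarrow> v \<in> V \<Longrightarrow> \<gamma> (u + v) = \<gamma> u + \<gamma> v"
  and \<gamma>_scale: "v \<in> V \<Longrightarrow> \<gamma> (scale c v) = c * \<gamma> v"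
  using \<gamma> unfolding dual_space_def by blast+

lemma \<gamma>_diff: "u \<in> V \<Longrightarrow> v \<in> V \<Longrightarrow> \<gamma> (u - v) = \<gamma> u - \<gamma> v"
  using \<gamma>_add[of u "scale (- 1) v"] \<gamma>_scale[of v "- 1"] V_closed by simp

lemma \<gamma>_0: "\<gamma> 0 = 0"
  using \<gamma>_scale[of 0 0] V_closed by simp

lemma sub_fd: "S \<subseteq> q \<Longrightarrow> \<exists>B. finite B \<and> S \<subseteq> span B"
  using fin by blast

lemma subalgebra:
  assumes "subspace S" "S \<subseteq> q" "\<And>x y. x \<in> S \<Longrightarrow> y \<in> S \<Longrightarrow> br x y \<in> S"
  shows "fd_algebra scale br S"
proof unfold_locales
  show "\<exists>B. finite B \<and> S \<subseteq> span B"
    using assms(2) by (rule sub_fd)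
  show "br y x = - br x y" if "x \<in> S" "y \<in> S" for x y
    using that assms(2) by (intro br_skew) auto
qed (use assms br_add_left br_scale_left in \<open>auto simp: subset_iff\<close>)

lemma pairing:
  "x \<in> l \<Longrightarrow> y \<in> l \<Longrightarrow> v \<in> V \<Longrightarrow> \<gamma> (br (x + y) v) = \<gamma> (br x v) + \<gamma> (br y v)"
  "x \<in> l \<Longrightarrow> v \<in> V \<Longrightarrow> \<gamma> (br (scale c x) v) = c * \<gamma> (br x v)"
  "x \<in> l \<Longrightarrow> u \<in> V \<Longrightarrow> v \<in> V \<Longrightarrow> \<gamma> (br x (u + v)) = \<gamma> (br x u) + \<gamma> (br x v)"
  "x \<in> l \<Longrightarrow> v \<in> V \<Longrightarrow> \<gamma> (br x (scale c v)) = c * \<gamma> (br x v)"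
  by (simp_all add: br_add_left br_scale_left br_add_right br_scale_right lq Vq V \<gamma>_add \<gamma>_scale)

lemma stab_subspace: "subspace stab"
  unfolding subspace_def stab_def using l_closed pairing(2)[of 0 _ 0] by (simp add: pairing)

lemma norm_line_subspace: "subspace norm_line"
  unfolding subspace_def
proof (intro conjI ballI allI)
  show "0 \<in> norm_line"
    unfolding norm_line_def using l_closed pairing(2)[of 0 _ 0] by (auto intro!: exI[of _ 0])
next
  fix x y assume x: "x \<in> norm_line" and y: "y \<in> norm_line"
  then obtain c d where "x \<in> l" "y \<in> l" "\<forall>v\<in>V. \<gamma> (br x v) = c * \<gamma> v" "\<forall>v\<in>V. \<gamma> (br y v) = d * \<gamma> v"
    unfolding norm_line_def by blast
  then show "x + y \<in> norm_line"
    unfolding norm_line_def using l_closed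
    by (auto intro!: exI[of _ "c + d"] simp: pairing algebra_simps)
next
  fix a x assume x: "x \<in> norm_line"
  then obtain c where "x \<in> l" "\<forall>v\<in>V. \<gamma> (br x v) = c * \<gamma> v"
    unfolding norm_line_def by blast
  then show "scale a x \<in> norm_line"
    unfolding norm_line_def using l_closed
    by (auto intro!: exI[of _ "a * c"] simp: pairing)
qed

text \<open>By the Jacobi identity a bracket acts on \<open>\<gamma>\<close> through a commutator,
  and the scalars by which \<open>x\<close> and \<open>y\<close> act commute. This one statement
  gives closure under the bracket for both \<open>stab\<close> and \<open>norm_line\<close>.\<close>

lemma br_norm_line:
  assumes "x \<in> norm_line" "y \<in> norm_line"
  shows "br x y \<in> stab"
proof -
  obtain c d where x: "x \<in> l" "\<And>v. v \<in> V \<Longrightarrow> \<gamma> (br x v) = c * \<gamma> v"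
    and y: "y \<in> l" "\<And>v. v \<in> V \<Longrightarrow> \<gamma> (br y v) = d * \<gamma> v"
    using assms unfolding norm_line_def by blast
  have "\<gamma> (br (br x y) v) = 0" if v: "v \<in> V" for v
  proof -
    have "\<gamma> (br (br x y) v) = \<gamma> (br x (br y v)) - \<gamma> (br y (br x v))"
      using x(1) y(1) v by (simp add: jacobi lq Vq \<gamma>_diff V)
    also have "\<dots> = 0"
      using x y v by (simp add: V lq)
    finally show ?thesis .
  qed
  then show ?thesis
    unfolding stab_def using l(3) x(1) y(1) by simp
qed

lemma stab_norm_line: "stab \<subseteq> norm_line"
  unfolding stab_def norm_line_def by (auto intro!: exI[of _ 0])

lemma stab_l: "x \<in> stab \<Longrightarrow> x \<in> l" and norm_line_l: "x \<in> norm_line \<Longrightarrow> x \<in> l"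
  unfolding stab_def norm_line_def by auto

lemma stab_algebra: "fd_algebra scale br stab"
  using stab_subspace br_norm_line stab_norm_line stab_l lq by (intro subalgebra) auto

lemma norm_line_algebra: "fd_algebra scale br norm_line"
  using norm_line_subspace br_norm_line stab_norm_line norm_line_l lq by (intro subalgebra) auto

lemma euler: "\<exists>x\<in>l. \<forall>v\<in>V. \<gamma> v = \<gamma> (br x v)"
proof (rule functional_represented[OF V(1) l(1) sub_fd[OF l(2)]])
  show "\<gamma> v = 0" if "v \<in> V" "\<forall>x\<in>l. \<gamma> (br x v) = 0" for v
    using nondeg[OF that] \<gamma>_0 by simp
qed (simp_all add: pairing \<gamma>_add \<gamma>_scale)

lemma extend_functional:
  assumes "\<And>x y. x \<in> l \<Longrightarrow> y \<in> l \<Longrightarrow> g (x + y) = g x + g y" "\<And>c x. x \<in> l \<Longrightarrow> g (scale c x) = c * g x"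
  shows "\<exists>\<phi>\<in>dual_space scale q. (\<forall>x\<in>l. \<phi> x = g x) \<and> (\<forall>v\<in>V. \<phi> v = \<gamma> v)"
proof -
  \<comment> \<open>The projection to \<open>l\<close> along \<open>V\<close>.\<close>
  define P where "P x = (SOME y. y \<in> l \<and> x - y \<in> V)" for x
  have P: "P x \<in> l \<and> x - P x \<in> V" if "x \<in> q" for x
    unfolding P_def by (rule someI_ex) (use decomp(1)[OF that] in \<open>force\<close>)
  have P_eq: "P x = y" if "x \<in> q" "y \<in> l" "x - y \<in> V" for x y
  proof -
    have "P x - y \<in> l"
      using P that l_closed by blast
    moreover have "P x - y = (x - y) - (x - P x)"
      by simp
    then have "P x - y \<in> V"
      using P that V_closed by metis
    ultimately show ?thesis
      using decomp(2) by fastforce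
  qed
  have P_add: "P (x + y) = P x + P y" if "x \<in> q" "y \<in> q" for x y
  proof (rule P_eq)
    have "x + y - (P x + P y) = (x - P x) + (y - P y)"
      by simp
    then show "x + y - (P x + P y) \<in> V"
      using P that V_closed by metis
  qed (use P that l_closed h_closed in auto)
  have P_scale: "P (scale c x) = scale c (P x)" if "x \<in> q" for c x
    using P that l_closed V_closed h_closed by (intro P_eq) (auto simp: scale_right_diff_distrib[symmetric])
  define \<psi> where "\<psi> x = g (P x) + \<gamma> (x - P x)" for x
  have "\<psi> (x + y) = \<psi> x + \<psi> y" if "x \<in> q" "y \<in> q" for x y
  proof -
    have "x + y - (P x + P y) = (x - P x) + (y - P y)"
      by simp
    then have "\<gamma> (x + y - (P x + P y)) = \<gamma> (x - P x) + \<gamma> (y - P y)"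
      using P that \<gamma>_add by metis
    then show ?thesis
      unfolding \<psi>_def P_add[OF that] using P that by (simp add: assms)
  qed
  moreover have "\<psi> (scale c x) = c * \<psi> x" if "x \<in> q" for c x
    unfolding \<psi>_def P_scale[OF that] using P that
    by (simp add: assms scale_right_diff_distrib[symmetric] \<gamma>_scale distrib_left)
  ultimately have "restr q \<psi> \<in> dual_space scale q"
    by (rule dual_restrict)
  moreover have "\<psi> x = g x" if "x \<in> l" for x
    using P_eq[of x x] that lq V_closed \<gamma>_0 by (simp add: \<psi>_def)
  moreover have "\<psi> v = \<gamma> v" if "v \<in> V" for v
    using P_eq[of v 0] that Vq l_closed assms(2)[of 0 0] by (simp add: \<psi>_def)
  ultimately show ?thesis
    using lq Vq by (intro bexI[of _ "restr q \<psi>"]) auto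
qed

end

section \<open>Radicals of a functional that extends \<open>\<gamma>\<close>\<close>

locale extended_functional = abelian_extension +
  fixes \<phi> x\<^sub>0
  assumes \<phi>: "\<phi> \<in> dual_space scale q" and \<phi>V: "\<And>v. v \<in> V \<Longrightarrow> \<phi> v = \<gamma> v"
    and x0: "x\<^sub>0 \<in> l" "\<And>v. v \<in> V \<Longrightarrow> \<gamma> (br x\<^sub>0 v) = \<gamma> v"
begin

lemmas \<phi>_simps = dualD[OF \<phi>]

lemma \<phi>_skew: "x \<in> q \<Longrightarrow> y \<in> q \<Longrightarrow> \<phi> (br y x) = - \<phi> (br x y)"
  using br_skew[of x y] \<phi>_simps br_closed by simp

lemma \<phi>_br:
  "x \<in> q \<Longrightarrow> y \<in> q \<Longrightarrow> z \<in> q \<Longrightarrow> \<phi> (br (x + y) z) = \<phi> (br x z) + \<phi> (br y z)"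
  "x \<in> q \<Longrightarrow> z \<in> q \<Longrightarrow> \<phi> (br (scale c x) z) = c * \<phi> (br x z)"
  "x \<in> q \<Longrightarrow> y \<in> q \<Longrightarrow> z \<in> q \<Longrightarrow> \<phi> (br z (x + y)) = \<phi> (br z x) + \<phi> (br z y)"
  "x \<in> q \<Longrightarrow> z \<in> q \<Longrightarrow> \<phi> (br z (scale c x)) = c * \<phi> (br z x)"
  by (simp_all add: br_add_left br_scale_left br_add_right br_scale_right br_closed \<phi>_simps)

lemma \<phi>_br_diff:
  "x \<in> q \<Longrightarrow> y \<in> q \<Longrightarrow> z \<in> q \<Longrightarrow> \<phi> (br (x - y) z) = \<phi> (br x z) - \<phi> (br y z)"
  using \<phi>_br(1)[of x "scale (- 1) y" z] \<phi>_br(2)[of y z "- 1"] h_closed subspace_neg[OF h] by simp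

definition radical :: "'b set \<Rightarrow> 'b set" where
  "radical S = {x \<in> S. \<forall>y\<in>S. \<phi> (br x y) = 0}"

text \<open>On \<open>V\<close> the radical condition is that of \<open>nondeg\<close>. Hence a
  radical vector of \<open>q\<close> is determined by its component in \<open>l\<close>, which makes
  lifts unique.\<close>

lemma radical_V: "v \<in> V \<Longrightarrow> v \<in> radical q \<Longrightarrow> v = 0"
proof (rule nondeg)
  assume v: "v \<in> V" "v \<in> radical q"
  show "\<forall>x\<in>l. \<gamma> (br x v) = 0"
  proof
    fix x assume x: "x \<in> l"
    then have "\<gamma> (br x v) = \<phi> (br x v)"
      using v by (simp add: \<phi>V V lq)
    also have "\<dots> = 0"
      using v x \<phi>_skew[of v x] unfolding radical_def by (simp add: lq)
    finally show "\<gamma> (br x v) = 0" .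
  qed
qed

text \<open>The functional \<open>\<phi>[z, _]\<close> on \<open>l\<close> vanishes on
  \<open>stab\<close>, the left kernel of the pairing \<open>\<gamma>[y, v]\<close>, so it is given
  by some \<open>v\<close>. This \<open>v\<close> cancels \<open>z\<close> on \<open>l\<close>,
  while on \<open>V\<close> both brackets already vanish. Evaluating at \<open>x\<^sub>0\<close>
  yields \<open>\<gamma> v = \<phi>[z, x\<^sub>0]\<close>.\<close>

lemma radical_lift:
  assumes z: "z \<in> radical stab"
  obtains v where "v \<in> V" "z + v \<in> radical q" "\<phi> (z + v) = \<phi> z + \<phi> (br z x\<^sub>0)"
proof -
  have zs: "z \<in> stab" and zl: "z \<in> l" and zr: "\<And>y. y \<in> stab \<Longrightarrow> \<phi> (br z y) = 0"
    using z stab_l unfolding radical_def by blast+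
  have "\<exists>v\<in>V. \<forall>y\<in>l. \<phi> (br z y) = \<gamma> (br y v)"
  proof (rule functional_represented[OF l(1) V(1) sub_fd[OF V(2)]])
    show "\<phi> (br z y) = 0" if "y \<in> l" "\<forall>v\<in>V. \<gamma> (br y v) = 0" for y
      using that by (intro zr) (simp add: stab_def)
  qed (simp_all add: pairing \<phi>_br zl lq)
  then obtain v where v: "v \<in> V" "\<And>y. y \<in> l \<Longrightarrow> \<phi> (br z y) = \<gamma> (br y v)"
    by blast
  have "\<phi> (br (z + v) u) = 0" if u: "u \<in> q" for u
  proof -
    obtain y w where yw: "y \<in> l" "w \<in> V" "u = y + w"
      using decomp(1)[OF u] by blast
    have "\<phi> (br v y) = - \<gamma> (br y v)"
      using yw v by (simp add: \<phi>_skew[of y v] lq Vq \<phi>V V)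
    moreover have "\<phi> (br z w) = 0"
      using zs yw(2) \<phi>V[of "br z w"] V(3)[OF lq[OF zl]] unfolding stab_def by simp
    moreover have "\<phi> (br v w) = 0"
      using V(4)[OF v(1) yw(2)] \<phi>_simps by simp
    ultimately show ?thesis
      unfolding yw(3) using yw v zl by (simp add: \<phi>_br lq Vq h_closed)
  qed
  then have "z + v \<in> radical q"
    unfolding radical_def using zl v(1) by (simp add: lq Vq h_closed)
  moreover have "\<phi> (z + v) = \<phi> z + \<phi> (br z x\<^sub>0)"
    using v zl x0 by (simp add: \<phi>_simps lq Vq \<phi>V)
  ultimately show thesis
    using that v(1) by blast
qed

lemma radical_project:
  assumes "x \<in> l" "v \<in> V" "x + v \<in> radical q"
  shows "x \<in> radical stab"
proof -
  have w: "\<phi> (br x u) + \<phi> (br v u) = 0" if "u \<in> q" for u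
    using assms that unfolding radical_def by (simp add: \<phi>_br lq Vq)
  have "\<gamma> (br x u) = 0" if "u \<in> V" for u
    using w[of u] that assms V(4)[of v u] \<phi>_simps \<phi>V[of "br x u"] V(3)[of x u] by (simp add: lq Vq)
  then have xs: "x \<in> stab"
    using assms by (simp add: stab_def)
  have "\<phi> (br x y) = 0" if y: "y \<in> stab" for y
  proof -
    have "\<phi> (br v y) = - \<gamma> (br y v)"
      using stab_l[OF y] assms by (simp add: \<phi>_skew[of y v] lq Vq \<phi>V V)
    also have "\<dots> = 0"
      using y assms by (simp add: stab_def)
    finally show ?thesis
      using w[of y] stab_l[OF y] lq by simp
  qed
  then show ?thesis
    using xs by (simp add: radical_def)
qed

lemma radical_diff: "x \<in> radical q \<Longrightarrow> y \<in> radical q \<Longrightarrow> x - y \<in> radical q"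
  unfolding radical_def using subspace_diff[OF h] by (simp add: \<phi>_br_diff)

lemma radical_scale: "x \<in> radical q \<Longrightarrow> scale c x \<in> radical q"
  unfolding radical_def using h_closed by (simp add: \<phi>_br)

text \<open>Projection to \<open>l\<close> and lifting are inverse bijections between the radicals
  of \<open>\<phi>\<close> on \<open>q\<close> and on \<open>stab\<close>, so one is spanned by a
  single vector exactly when the other is; \<open>contact_up\<close> treats the opposite
  direction.\<close>

lemma contact_down:
  assumes "w \<in> radical q" "\<forall>x\<in>radical q. \<exists>c. x = scale c w"
  obtains z where "z \<in> radical stab" "\<forall>x\<in>radical stab. \<exists>c. x = scale c z"
    "\<phi> w = \<phi> z + \<phi> (br z x\<^sub>0)"
proof -
  have "w \<in> q"
    using assms unfolding radical_def by blast
  then obtain z v where zv: "z \<in> l" "v \<in> V" "w = z + v"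
    using decomp(1) by blast
  then have z: "z \<in> radical stab"
    using assms radical_project by blast
  have "\<exists>c. x = scale c z" if x: "x \<in> radical stab" for x
  proof -
    obtain v' where v': "v' \<in> V" "x + v' \<in> radical q"
      using radical_lift[OF x] by blast
    then obtain c where c: "x + v' = scale c w"
      using assms(2) by blast
    have xl: "x \<in> l"
      using x stab_l unfolding radical_def by blast
    have eq: "x - scale c z = scale c v - v'"
      using c unfolding zv(3) scale_right_distrib
      by (metis add.commute add_diff_cancel_left' add_diff_eq diff_add_eq)
    have "x - scale c z = 0"
    proof (rule decomp(2))
      show "x - scale c z \<in> l"
        using xl zv(1) l_closed by simp
      show "x - scale c z \<in> V"
        unfolding eq using zv(2) v' V_closed by simp
    qed
    then show ?thesis
      by auto
  qed
  moreover have "\<phi> w = \<phi> z + \<phi> (br z x\<^sub>0)"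
  proof -
    obtain v' where v': "v' \<in> V" "z + v' \<in> radical q" "\<phi> (z + v') = \<phi> z + \<phi> (br z x\<^sub>0)"
      using radical_lift[OF z] by blast
    have "v - v' \<in> radical q"
      using radical_diff[OF assms(1) v'(2)] by (simp add: zv(3))
    then have "v = v'"
      using radical_V[of "v - v'"] zv(2) v'(1) V_closed by simp
    then show ?thesis
      using v'(3) zv(3) by simp
  qed
  ultimately show thesis
    using that z by blast
qed

lemma contact_up:
  assumes "z \<in> radical stab" "\<forall>x\<in>radical stab. \<exists>c. x = scale c z" "\<phi> z + \<phi> (br z x\<^sub>0) \<noteq> 0"
  shows "contact scale br q"
proof -
  obtain v where v: "v \<in> V" "z + v \<in> radical q" "\<phi> (z + v) = \<phi> z + \<phi> (br z x\<^sub>0)"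
    using radical_lift[OF assms(1)] by blast
  have "\<exists>c. x = scale c (z + v)" if x: "x \<in> radical q" for x
  proof -
    have "x \<in> q"
      using x unfolding radical_def by blast
    then obtain y u where yu: "y \<in> l" "u \<in> V" "x = y + u"
      using decomp(1) by blast
    then obtain c where c: "y = scale c z"
      using assms(2) radical_project x by blast
    have "u - scale c v = x - scale c (z + v)"
      unfolding yu(3) c scale_right_distrib by simp
    then have "u - scale c v \<in> radical q"
      using radical_diff[OF x radical_scale[OF v(2)]] by simp
    then have "u = scale c v"
      using radical_V[of "u - scale c v"] yu(2) v(1) V_closed by simp
    then show ?thesis
      using yu(3) c by (auto simp: scale_right_distrib)
  qed
  then have "contact_functional \<phi> (z + v)"
    unfolding contact_functional_def using v assms(3) \<phi> unfolding radical_def by auto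
  then show ?thesis
    using contact_iff by blast
qed

lemma contact_stab:
  assumes "z \<in> radical stab" "\<forall>x\<in>radical stab. \<exists>c. x = scale c z" "\<phi> z \<noteq> 0"
  shows "contact scale br stab"
proof -
  interpret S: fd_algebra scale br stab
    by (rule stab_algebra)
  have "restr stab \<phi> \<in> dual_space scale stab"
    by (rule S.dual_restrict) (simp_all add: \<phi>_simps stab_l lq)
  then have "S.contact_functional (restr stab \<phi>) z"
    unfolding S.contact_functional_def using assms S.br_closed unfolding radical_def by auto
  then show ?thesis
    using S.contact_iff by blast
qed

lemma norm_line_decomp:
  assumes "x \<in> norm_line"
  obtains c y where "y \<in> stab" "x = y + scale c x\<^sub>0"
proof -
  obtain c where x: "x \<in> l" "\<And>v. v \<in> V \<Longrightarrow> \<gamma> (br x v) = c * \<gamma> v"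
    using assms unfolding norm_line_def by blast
  have "\<gamma> (br (x + scale (- c) x\<^sub>0) v) = 0" if "v \<in> V" for v
    using that x x0 l_closed by (simp add: pairing del: scale_minus_left)
  then have "x + scale (- c) x\<^sub>0 \<in> stab"
    unfolding stab_def using x(1) x0(1) l_closed by (simp del: scale_minus_left)
  then show thesis
    by (rule that[of _ c]) simp
qed

lemma x0_norm_line: "x\<^sub>0 \<in> norm_line"
  unfolding norm_line_def using x0 by (auto intro!: exI[of _ 1])

text \<open>Write a radical vector of \<open>norm_line\<close> as \<open>y + c x\<^sub>0\<close>
  with \<open>y\<close> in \<open>stab\<close>. Pairing with \<open>z\<close> gives
  \<open>c = 0\<close>; then the vector is in the radical of \<open>stab\<close>, hence a multiple
  of \<open>z\<close>, and pairing with \<open>x\<^sub>0\<close> shows that it is 0.\<close>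

lemma index_norm_line:
  assumes z: "z \<in> radical stab" "\<forall>x\<in>radical stab. \<exists>c. x = scale c z" "\<phi> (br z x\<^sub>0) \<noteq> 0"
  shows "lie_index scale br norm_line = 0"
proof -
  interpret P: fd_algebra scale br norm_line
    by (rule norm_line_algebra)
  have zs: "z \<in> stab" "\<And>y. y \<in> stab \<Longrightarrow> \<phi> (br z y) = 0"
    using z unfolding radical_def by auto
  have q: "y \<in> q" if "y \<in> stab" for y
    using that stab_l lq by blast
  have "x = 0" if x: "x \<in> norm_line" "\<And>y. y \<in> norm_line \<Longrightarrow> \<phi> (br x y) = 0" for x
  proof -
    obtain c y where y: "y \<in> stab" "x = y + scale c x\<^sub>0"
      using norm_line_decomp[OF x(1)] by blast
    have "0 = \<phi> (br x z)"
      using x(2)[of z] zs(1) stab_norm_line by auto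
    also have "\<dots> = \<phi> (br y z) + c * \<phi> (br x\<^sub>0 z)"
      unfolding y(2) using y(1) x0(1) zs(1) by (simp add: \<phi>_br q lq h_closed)
    also have "\<dots> = - c * \<phi> (br z x\<^sub>0)"
      using zs y(1) x0(1) \<phi>_skew[of z y] \<phi>_skew[of z x\<^sub>0] by (simp add: q lq)
    finally have "c = 0"
      using z(3) by simp
    then have "x = y"
      using y(2) by simp
    then have "x \<in> radical stab"
      unfolding radical_def using y(1) x(2) stab_norm_line by auto
    then obtain d where d: "x = scale d z"
      using z(2) by blast
    then have "d * \<phi> (br z x\<^sub>0) = 0"
      using x(2)[OF x0_norm_line] zs(1) x0(1) by (simp add: \<phi>_br q lq)
    then show ?thesis
      using d z(3) by simp
  qed
  moreover have "restr norm_line \<phi> \<in> dual_space scale norm_line"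
    by (rule P.dual_restrict) (simp_all add: \<phi>_simps norm_line_l lq)
  ultimately show ?thesis
    unfolding P.lie_index_eq_0_iff using P.br_closed
    by (intro bexI[of _ "restr norm_line \<phi>"]) auto
qed

end

section \<open>The index of the line normaliser against the contact property\<close>

context abelian_extension
begin

text \<open>A nondegenerate skew form restricted to the hyperplane \<open>stab\<close> of
  \<open>norm_line\<close> has a one-dimensional radical \<open>Kz\<close>, and \<open>z\<close>
  pairs nontrivially with \<open>x\<^sub>0\<close>. So \<open>\<phi> z\<close> and
  \<open>\<phi> z + \<phi>[z, x\<^sub>0]\<close> are not both 0; a nonzero value of the first gives
  a contact form on \<open>stab\<close>, of the second one on \<open>q\<close>.\<close>

lemma index_norm_line_imp_contact:
  assumes "v\<^sub>1 \<in> V" "\<gamma> v\<^sub>1 \<noteq> 0" and idx: "lie_index scale br norm_line = 0"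
  shows "contact scale br stab \<or> contact scale br q"
proof -
  interpret P: fd_algebra scale br norm_line
    by (rule norm_line_algebra)
  obtain x\<^sub>0 where x0: "x\<^sub>0 \<in> l" "\<And>v. v \<in> V \<Longrightarrow> \<gamma> (br x\<^sub>0 v) = \<gamma> v"
    using euler by metis
  obtain \<beta> where \<beta>: "\<beta> \<in> dual_space scale norm_line"
    and nd: "\<And>x. x \<in> norm_line \<Longrightarrow> (\<forall>y\<in>norm_line. \<beta> (br x y) = 0) \<Longrightarrow> x = 0"
    using idx unfolding P.lie_index_eq_0_iff by blast
  note \<beta>D = P.dualD[OF \<beta>]
  obtain g where g: "\<And>x y. g (x + y) = g x + g y" "\<And>c x. g (scale c x) = c * g x"
    "\<And>x. x \<in> norm_line \<Longrightarrow> g x = \<beta> x"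
    using functional_extend[OF norm_line_subspace, of \<beta>] \<beta>D by blast
  then obtain \<phi> where ext: "\<phi> \<in> dual_space scale q" "\<And>x. x \<in> l \<Longrightarrow> \<phi> x = g x" "\<And>v. v \<in> V \<Longrightarrow> \<phi> v = \<gamma> v"
    using extend_functional[of g] by blast
  interpret extended_functional scale br q l V \<gamma> \<phi> x\<^sub>0
    using ext x0 by unfold_locales auto
  have \<phi>\<beta>: "\<phi> x = \<beta> x" if "x \<in> norm_line" for x
    using that ext(2) g(3) norm_line_l by simp
  \<comment> \<open>Up to sign the character by which \<open>norm_line\<close> acts on the line
    \<open>K\<gamma>\<close>, read off at \<open>v\<^sub>1\<close>; its kernel is
    \<open>stab\<close>. Representing it through \<open>\<beta>\<close> yields a vector orthogonal
    to \<open>stab\<close>, normalised by \<open>\<mu> x\<^sub>0 = 1\<close>.\<close>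
  define \<mu> where "\<mu> x = \<gamma> (br x v\<^sub>1) / \<gamma> v\<^sub>1" for x
  have "\<exists>z\<in>norm_line. \<forall>x\<in>norm_line. \<mu> x = \<beta> (br x z)"
  proof (rule functional_represented[OF norm_line_subspace norm_line_subspace P.fin])
    show "\<mu> x = 0" if "x \<in> norm_line" "\<forall>y\<in>norm_line. \<beta> (br x y) = 0" for x
      using nd[OF that] pairing(2)[of 0 v\<^sub>1 0] l_closed assms by (simp add: \<mu>_def)
  qed (simp_all add: \<beta>D P.br_closed P.br_add_left P.br_add_right P.br_scale_left P.br_scale_right
      \<mu>_def pairing norm_line_l assms add_divide_distrib)
  then obtain z where z: "z \<in> norm_line" "\<And>x. x \<in> norm_line \<Longrightarrow> \<mu> x = \<beta> (br x z)"
    by blast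
  \<comment> \<open>A vector is orthogonal to itself under a skew form, so \<open>z\<close> lies in
    the kernel \<open>stab\<close> of \<open>\<mu>\<close>.\<close>
  have "\<mu> z = 0"
    unfolding z(2)[OF z(1)] using \<beta>D(4)[of "br z z"] P.br_skew[OF z(1,1)] P.br_closed[OF z(1,1)]
    by (metis self_eq_minus_imp_zero)
  then have zs: "z \<in> stab"
    using z(1) assms unfolding \<mu>_def norm_line_def stab_def by auto
  have \<mu>s: "\<mu> x = 0" if "x \<in> stab" for x
    using that assms(1) unfolding stab_def \<mu>_def by simp
  have q: "x \<in> q" if "x \<in> norm_line" for x
    using that norm_line_l lq by blast
  have x0z: "\<phi> (br x\<^sub>0 z) = 1"
    using z(2)[OF x0_norm_line] \<phi>\<beta>[OF P.br_closed[OF x0_norm_line z(1)]] x0(2)[OF assms(1)] assms(2)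
    by (simp add: \<mu>_def)
  have sz: "\<phi> (br y z) = 0" if "y \<in> stab" for y
    using z(2)[of y] \<mu>s[OF that] \<phi>\<beta>[OF P.br_closed[OF _ z(1)], of y] that stab_norm_line by auto
  have zr: "z \<in> radical stab"
    unfolding radical_def
  proof (intro CollectI conjI ballI zs)
    fix y assume "y \<in> stab"
    then show "\<phi> (br z y) = 0"
      using sz[of y] \<phi>_skew[of y z] stab_norm_line q z(1) by auto
  qed
  have span: "\<forall>x\<in>radical stab. \<exists>c. x = scale c z"
  proof
    fix x assume "x \<in> radical stab"
    then have x: "x \<in> stab" "\<And>y. y \<in> stab \<Longrightarrow> \<phi> (br x y) = 0"
      unfolding radical_def by auto
    have xn: "x \<in> norm_line"
      using x(1) stab_norm_line by blast
    define c where "c = - \<phi> (br x x\<^sub>0)"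
    have cz: "scale (- c) z \<in> norm_line"
      using z(1) by (rule P.h_closed)
    have "x + scale (- c) z = 0"
    proof (rule nd)
      show n: "x + scale (- c) z \<in> norm_line"
        using xn cz by (rule P.h_closed)
      show "\<forall>y\<in>norm_line. \<beta> (br (x + scale (- c) z) y) = 0"
      proof
        fix y assume y: "y \<in> norm_line"
        then obtain d u where u: "u \<in> stab" "y = u + scale d x\<^sub>0"
          by (rule norm_line_decomp)
        have un: "u \<in> norm_line"
          using u(1) stab_norm_line by blast
        have "\<phi> (br x y) = - (d * c)"
          unfolding u(2) using x(2)[OF u(1)] xn un x0_norm_line h_closed by (simp add: \<phi>_br q c_def)
        moreover have "\<phi> (br z y) = - d"
          unfolding u(2) using \<phi>_skew[of u z] \<phi>_skew[of x\<^sub>0 z] sz[OF u(1)] x0z z(1) un x0_norm_line h_closed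
          by (simp add: \<phi>_br q)
        ultimately have "\<phi> (br (x + scale (- c) z) y) = 0"
          using xn z(1) y q h_closed by (simp add: \<phi>_br del: scale_minus_left)
        then show "\<beta> (br (x + scale (- c) z) y) = 0"
          using \<phi>\<beta>[OF P.br_closed[OF n y]] by simp
      qed
    qed
    then show "\<exists>c. x = scale c z"
      by auto
  qed
  have "\<phi> (br z x\<^sub>0) = - 1"
    using \<phi>_skew[of x\<^sub>0 z] x0z x0_norm_line z(1) q by simp
  then show ?thesis
    using contact_up[OF zr span] contact_stab[OF zr span] by (cases "\<phi> z = 0") auto
qed

theorem contact_extension:
  assumes gen: "contact scale br q \<Longrightarrow> \<exists>\<phi> w. contact_functional \<phi> w \<and> (\<forall>v\<in>V. \<phi> v = \<gamma> v)"
    and idx: "lie_index scale br q \<noteq> 0"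
  shows "(\<not> contact scale br stab \<longrightarrow> (contact scale br q \<longleftrightarrow> lie_index scale br norm_line = 0)) \<and>
    (contact scale br stab \<and> \<not> contact scale br q \<longrightarrow> lie_index scale br norm_line = 0)"
proof (cases "\<forall>v\<in>V. \<gamma> v = 0")
  case True
  \<comment> \<open>If \<open>\<gamma> = 0\<close>, nondegeneracy forces \<open>V = 0\<close>, and
    both subalgebras are \<open>q\<close> itself; the nonzero index of \<open>q\<close> then
    decides.\<close>
  have V0: "v = 0" if "v \<in> V" for v
    using that True V(3) lq by (intro nondeg) auto
  have "q \<subseteq> l"
    using decomp(1) V0 by fastforce
  then have "stab = q" "norm_line = q"
    unfolding stab_def norm_line_def using True l(2) V(3) lq by (auto intro!: exI[of _ 0])
  then show ?thesis
    using idx by auto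
next
  case False
  then obtain v\<^sub>1 where v1: "v\<^sub>1 \<in> V" "\<gamma> v\<^sub>1 \<noteq> 0"
    by blast
  interpret S: fd_algebra scale br stab
    by (rule stab_algebra)
  obtain x\<^sub>0 where x0: "x\<^sub>0 \<in> l" "\<And>v. v \<in> V \<Longrightarrow> \<gamma> (br x\<^sub>0 v) = \<gamma> v"
    using euler by metis
  have B: "lie_index scale br norm_line = 0" if c: "contact scale br q" and n: "\<not> contact scale br stab"
  proof -
    obtain \<phi> w where w: "contact_functional \<phi> w" "\<And>v. v \<in> V \<Longrightarrow> \<phi> v = \<gamma> v"
      using gen[OF c] by blast
    interpret extended_functional scale br q l V \<gamma> \<phi> x\<^sub>0
      using w x0 by unfold_locales (auto simp: contact_functional_def)
    have "w \<in> radical q" "\<forall>x\<in>radical q. \<exists>c. x = scale c w" "\<phi> w \<noteq> 0"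
      using w(1) unfolding contact_functional_def radical_def by auto
    then obtain z where z: "z \<in> radical stab" "\<forall>x\<in>radical stab. \<exists>c. x = scale c z"
      "\<phi> w = \<phi> z + \<phi> (br z x\<^sub>0)"
      using contact_down by blast
    have "\<phi> z = 0"
      using contact_stab[OF z(1,2)] n by blast
    then show ?thesis
      using index_norm_line[OF z(1,2)] z(3) \<open>\<phi> w \<noteq> 0\<close> by simp
  qed
  have C: "lie_index scale br norm_line = 0" if c: "contact scale br stab" and n: "\<not> contact scale br q"
  proof -
    obtain \<eta> z where z: "S.contact_functional \<eta> z"
      using c S.contact_iff by blast
    then have \<eta>: "\<eta> \<in> dual_space scale stab"
      unfolding S.contact_functional_def by blast
    \<comment> \<open>Any extension from \<open>stab\<close> to \<open>l\<close> will do: the value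
      on \<open>[z, x\<^sub>0]\<close> is forced by the failure of
      \<open>contact_up\<close>.\<close>
    obtain g where g: "\<And>x y. g (x + y) = g x + g y" "\<And>c x. g (scale c x) = c * g x"
      "\<And>x. x \<in> stab \<Longrightarrow> g x = \<eta> x"
      using functional_extend[OF stab_subspace, of \<eta>] S.dualD[OF \<eta>] by blast
    then obtain \<phi> where ext: "\<phi> \<in> dual_space scale q" "\<And>x. x \<in> l \<Longrightarrow> \<phi> x = g x" "\<And>v. v \<in> V \<Longrightarrow> \<phi> v = \<gamma> v"
      using extend_functional[of g] by blast
    interpret extended_functional scale br q l V \<gamma> \<phi> x\<^sub>0
      using ext x0 by unfold_locales auto
    have \<phi>\<eta>: "\<phi> x = \<eta> x" if "x \<in> stab" for x
      using that ext(2) g(3) stab_l by simp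
    have z': "z \<in> radical stab" "\<forall>x\<in>radical stab. \<exists>c. x = scale c z" "\<phi> z \<noteq> 0"
      using z S.br_closed unfolding S.contact_functional_def radical_def by (auto simp: \<phi>\<eta>)
    then have "\<phi> z + \<phi> (br z x\<^sub>0) = 0"
      using contact_up n by blast
    then have "\<phi> (br z x\<^sub>0) \<noteq> 0"
      using z'(3) by (metis add.right_neutral)
    then show ?thesis
      by (rule index_norm_line[OF z'(1,2)])
  qed
  show ?thesis
    using B C index_norm_line_imp_contact[OF v1] by blast
qed

end

section \<open>Extension of points and of tangent vectors\<close>

locale scalars =
  fixes \<kappa> :: "'k::{alg_closed_field, field_char_0} \<Rightarrow> 'r::comm_ring_1"
  assumes \<kappa>_add: "\<kappa> (a + b) = \<kappa> a + \<kappa> b" and \<kappa>_mult: "\<kappa> (a * b) = \<kappa> a * \<kappa> b"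
begin

text \<open>The unit \<open>\<kappa> 1\<close> of a subalgebra need not be the unit of the ambient ring.\<close>

definition subalg :: "'r set \<Rightarrow> bool" where
  "subalg B \<longleftrightarrow> range \<kappa> \<subseteq> B \<and> (\<forall>f\<in>B. \<forall>g\<in>B. f + g \<in> B \<and> f * g \<in> B) \<and> (\<forall>f\<in>B. \<kappa> 1 * f = f)"

definition alg_hom :: "'r set \<Rightarrow> ('r \<Rightarrow> 'k) \<Rightarrow> bool" where
  "alg_hom B \<phi> \<longleftrightarrow> (\<forall>c. \<phi> (\<kappa> c) = c) \<and>
     (\<forall>f\<in>B. \<forall>g\<in>B. \<phi> (f + g) = \<phi> f + \<phi> g \<and> \<phi> (f * g) = \<phi> f * \<phi> g)"

definition point_derivation :: "'r set \<Rightarrow> ('r \<Rightarrow> 'k) \<Rightarrow> ('r \<Rightarrow> 'k) \<Rightarrow> bool" where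
  "point_derivation B \<phi> \<delta> \<longleftrightarrow> (\<forall>c. \<delta> (\<kappa> c) = 0) \<and>
     (\<forall>f\<in>B. \<forall>g\<in>B. \<delta> (f + g) = \<delta> f + \<delta> g \<and> \<delta> (f * g) = \<delta> f * \<phi> g + \<phi> f * \<delta> g)"

definition alg_ideal :: "'r set \<Rightarrow> 'r set \<Rightarrow> bool" where
  "alg_ideal A P \<longleftrightarrow> P \<subseteq> A \<and> 0 \<in> P \<and> (\<forall>f\<in>P. \<forall>g\<in>P. f + g \<in> P) \<and> (\<forall>a\<in>A. \<forall>f\<in>P. a * f \<in> P)"

definition alg_prime :: "'r set \<Rightarrow> 'r set \<Rightarrow> bool" where
  "alg_prime A P \<longleftrightarrow> alg_ideal A P \<and> \<kappa> 1 \<notin> P \<and> (\<forall>f\<in>A. \<forall>g\<in>A. f * g \<in> P \<longrightarrow> f \<in> P \<or> g \<in> P)"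

definition adjoin :: "'r set \<Rightarrow> 'r \<Rightarrow> 'r set" where
  "adjoin B x = {poly p x | p. \<forall>i. coeff p i \<in> B}"

fun adjoin_list :: "'r set \<Rightarrow> 'r list \<Rightarrow> 'r set" where
  "adjoin_list B [] = B"
| "adjoin_list B (x # xs) = adjoin_list (adjoin B x) xs"

lemma \<kappa>_0: "\<kappa> 0 = 0"
  using \<kappa>_add[of 0 0] by simp

lemma \<kappa>_minus: "\<kappa> (- c) = - \<kappa> c"
  using \<kappa>_add[of c "- c"] by (simp add: \<kappa>_0 eq_neg_iff_add_eq_0 add.commute)

lemma subalgD:
  assumes "subalg B"
  shows "\<kappa> c \<in> B" "f \<in> B \<Longrightarrow> g \<in> B \<Longrightarrow> f + g \<in> B" "f \<in> B \<Longrightarrow> g \<in> B \<Longrightarrow> f * g \<in> B"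
    "f \<in> B \<Longrightarrow> \<kappa> 1 * f = f" "0 \<in> B" "f \<in> B \<Longrightarrow> - f \<in> B" "f \<in> B \<Longrightarrow> g \<in> B \<Longrightarrow> f - g \<in> B"
    "f \<in> B \<Longrightarrow> g \<in> B \<Longrightarrow> f ^ n * g \<in> B" "f \<in> B \<Longrightarrow> of_nat n * f = \<kappa> (of_nat n) * f"
    "f \<in> B \<Longrightarrow> of_nat n * f \<in> B"
proof -
  show k: "\<kappa> c \<in> B" for c
    using assms unfolding subalg_def by blast
  show add: "f \<in> B \<Longrightarrow> g \<in> B \<Longrightarrow> f + g \<in> B" for f g
    using assms unfolding subalg_def by blast
  show mult: "f \<in> B \<Longrightarrow> g \<in> B \<Longrightarrow> f * g \<in> B" for f g
    using assms unfolding subalg_def by blast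
  show unit: "f \<in> B \<Longrightarrow> \<kappa> 1 * f = f" for f
    using assms unfolding subalg_def by blast
  show "0 \<in> B"
    using k[of 0] by (simp add: \<kappa>_0)
  show neg: "f \<in> B \<Longrightarrow> - f \<in> B" for f
    using mult[OF k, of f "- 1"] unit[of f] by (simp add: \<kappa>_minus)
  show "f \<in> B \<Longrightarrow> g \<in> B \<Longrightarrow> f - g \<in> B"
    using add[OF _ neg, of f g] by simp
  show "f \<in> B \<Longrightarrow> g \<in> B \<Longrightarrow> f ^ n * g \<in> B"
    by (induction n) (simp_all add: mult mult.assoc)
  show nat: "f \<in> B \<Longrightarrow> of_nat n * f = \<kappa> (of_nat n) * f" for f
    by (induction n) (simp_all add: \<kappa>_0 \<kappa>_add distrib_right unit)
  show "f \<in> B \<Longrightarrow> of_nat n * f \<in> B"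
    by (simp add: nat mult k)
qed

lemma alg_homD:
  assumes "subalg B" "alg_hom B \<phi>"
  shows "\<phi> (\<kappa> c) = c" "f \<in> B \<Longrightarrow> g \<in> B \<Longrightarrow> \<phi> (f + g) = \<phi> f + \<phi> g"
    "f \<in> B \<Longrightarrow> g \<in> B \<Longrightarrow> \<phi> (f * g) = \<phi> f * \<phi> g" "\<phi> 0 = 0"
    "f \<in> B \<Longrightarrow> g \<in> B \<Longrightarrow> \<phi> (f - g) = \<phi> f - \<phi> g" "f \<in> B \<Longrightarrow> \<phi> (of_nat n * f) = of_nat n * \<phi> f"
proof -
  show k: "\<phi> (\<kappa> c) = c" for c
    using assms unfolding alg_hom_def by blast
  show add: "f \<in> B \<Longrightarrow> g \<in> B \<Longrightarrow> \<phi> (f + g) = \<phi> f + \<phi> g" for f g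
    using assms unfolding alg_hom_def by blast
  show mult: "f \<in> B \<Longrightarrow> g \<in> B \<Longrightarrow> \<phi> (f * g) = \<phi> f * \<phi> g" for f g
    using assms unfolding alg_hom_def by blast
  show "\<phi> 0 = 0"
    using k[of 0] by (simp add: \<kappa>_0)
  show "f \<in> B \<Longrightarrow> g \<in> B \<Longrightarrow> \<phi> (f - g) = \<phi> f - \<phi> g"
    using add[of "f - g" g] subalgD(7)[OF assms(1)] by simp
  show "f \<in> B \<Longrightarrow> \<phi> (of_nat n * f) = of_nat n * \<phi> f"
    by (simp add: subalgD[OF assms(1)] mult k)
qed

lemma point_derivationD:
  assumes "subalg B" "point_derivation B \<phi> \<delta>"
  shows "\<delta> (\<kappa> c) = 0" "f \<in> B \<Longrightarrow> g \<in> B \<Longrightarrow> \<delta> (f + g) = \<delta> f + \<delta> g"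
    "f \<in> B \<Longrightarrow> g \<in> B \<Longrightarrow> \<delta> (f * g) = \<delta> f * \<phi> g + \<phi> f * \<delta> g" "\<delta> 0 = 0"
    "f \<in> B \<Longrightarrow> g \<in> B \<Longrightarrow> \<delta> (f - g) = \<delta> f - \<delta> g"
proof -
  show k: "\<delta> (\<kappa> c) = 0" for c
    using assms unfolding point_derivation_def by blast
  show add: "f \<in> B \<Longrightarrow> g \<in> B \<Longrightarrow> \<delta> (f + g) = \<delta> f + \<delta> g" for f g
    using assms unfolding point_derivation_def by blast
  show "f \<in> B \<Longrightarrow> g \<in> B \<Longrightarrow> \<delta> (f * g) = \<delta> f * \<phi> g + \<phi> f * \<delta> g"
    using assms unfolding point_derivation_def by blast
  show "\<delta> 0 = 0"
    using k[of 0] by (simp add: \<kappa>_0)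
  show "f \<in> B \<Longrightarrow> g \<in> B \<Longrightarrow> \<delta> (f - g) = \<delta> f - \<delta> g"
    using add[of "f - g" g] subalgD(7)[OF assms(1)] by simp
qed

lemma alg_idealD:
  assumes "subalg A" "alg_ideal A P"
  shows "f \<in> P \<Longrightarrow> f \<in> A" "0 \<in> P" "f \<in> P \<Longrightarrow> g \<in> P \<Longrightarrow> f + g \<in> P" "a \<in> A \<Longrightarrow> f \<in> P \<Longrightarrow> a * f \<in> P"
    "f \<in> P \<Longrightarrow> - f \<in> P" "f \<in> P \<Longrightarrow> g \<in> P \<Longrightarrow> f - g \<in> P"
proof -
  show in_A: "f \<in> P \<Longrightarrow> f \<in> A" for f
    using assms unfolding alg_ideal_def by blast
  show "0 \<in> P"
    using assms unfolding alg_ideal_def by blast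
  show add: "f \<in> P \<Longrightarrow> g \<in> P \<Longrightarrow> f + g \<in> P" for f g
    using assms unfolding alg_ideal_def by blast
  show mult: "a \<in> A \<Longrightarrow> f \<in> P \<Longrightarrow> a * f \<in> P" for a f
    using assms unfolding alg_ideal_def by blast
  show neg: "f \<in> P \<Longrightarrow> - f \<in> P" for f
    using mult[OF subalgD(1)[OF assms(1)], of f "- 1"] subalgD(4)[OF assms(1) in_A, of f]
    by (simp add: \<kappa>_minus)
  show "f \<in> P \<Longrightarrow> g \<in> P \<Longrightarrow> f - g \<in> P"
    using add[OF _ neg, of f g] by simp
qed

section \<open>Polynomials over a subalgebra, evaluated at points and tangent vectors\<close>

definition poly_over :: "'r set \<Rightarrow> 'r poly \<Rightarrow> bool" where
  "poly_over B p \<longleftrightarrow> (\<forall>i. coeff p i \<in> B)"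

lemma poly_over_pCons: "poly_over B (pCons a p) \<longleftrightarrow> a \<in> B \<and> poly_over B p"
  unfolding poly_over_def by (metis coeff_pCons_0 coeff_pCons_Suc not0_implies_Suc)

lemma poly_over_induct [consumes 1, case_names 0 pCons]:
  assumes "poly_over B p" "Q 0"
    and "\<And>a p. a \<in> B \<Longrightarrow> poly_over B p \<Longrightarrow> Q p \<Longrightarrow> Q (pCons a p)"
  shows "Q p"
  using assms(1)
proof (induction p rule: pCons_induct)
  case (pCons a p)
  then show ?case
    using assms(3)[of a p] by (simp add: poly_over_pCons)
qed (rule assms(2))

lemma poly_over_closed:
  assumes B: "subalg B"
  shows "poly_over B 0" "poly_over B p \<Longrightarrow> poly_over B r \<Longrightarrow> poly_over B (p + r)"
    "poly_over B p \<Longrightarrow> poly_over B r \<Longrightarrow> poly_over B (p - r)"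
    "a \<in> B \<Longrightarrow> poly_over B p \<Longrightarrow> poly_over B (smult (a ^ n) p)"
    "poly_over B p \<Longrightarrow> poly_over B r \<Longrightarrow> poly_over B (p * r)"
    "a \<in> B \<Longrightarrow> poly_over B (monom a n)" "poly_over B p \<Longrightarrow> poly_over B (poly_cutoff n p)"
proof -
  note cl = subalgD[OF B]
  show "poly_over B 0" "poly_over B p \<Longrightarrow> poly_over B r \<Longrightarrow> poly_over B (p - r)"
    "a \<in> B \<Longrightarrow> poly_over B p \<Longrightarrow> poly_over B (smult (a ^ n) p)"
    "a \<in> B \<Longrightarrow> poly_over B (monom a n)" "poly_over B p \<Longrightarrow> poly_over B (poly_cutoff n p)"
    unfolding poly_over_def by (simp_all add: cl coeff_poly_cutoff)
  show add: "poly_over B p \<Longrightarrow> poly_over B r \<Longrightarrow> poly_over B (p + r)" for p r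
    unfolding poly_over_def by (simp add: cl)
  have sum: "(\<Sum>i\<in>I. f i) \<in> B" if "\<And>i. i \<in> I \<Longrightarrow> f i \<in> B" for f :: "nat \<Rightarrow> 'r" and I
    using that by (induction I rule: infinite_finite_induct) (simp_all add: cl)
  show "poly_over B p \<Longrightarrow> poly_over B r \<Longrightarrow> poly_over B (p * r)"
    unfolding poly_over_def coeff_mult using sum by (simp add: cl)
qed

lemma poly_in:
  assumes "subalg A" "B \<subseteq> A" "x \<in> A" "poly_over B p"
  shows "poly p x \<in> A"
proof -
  have "poly_over A p"
    using assms unfolding poly_over_def by blast
  then show ?thesis
    by (induction rule: poly_over_induct) (simp_all add: subalgD[OF assms(1)] assms(3))
qed

lemma subalg_adjoin:
  assumes A: "subalg A" "B \<subseteq> A" "x \<in> A" and B: "subalg B"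
  shows "subalg (adjoin B x)" "adjoin B x \<subseteq> A" "B \<subseteq> adjoin B x" "x \<in> adjoin B x"
proof -
  have eq: "adjoin B x = {poly p x | p. poly_over B p}"
    unfolding adjoin_def poly_over_def ..
  show sub: "adjoin B x \<subseteq> A"
    unfolding eq using poly_in[OF A] by blast
  show BC: "B \<subseteq> adjoin B x"
  proof
    fix b assume "b \<in> B"
    then have "poly_over B [:b:]" "poly [:b:] x = b"
      by (simp_all add: poly_over_pCons poly_over_closed[OF B])
    then show "b \<in> adjoin B x"
      unfolding eq by (metis (mono_tags, lifting) mem_Collect_eq)
  qed
  have "poly_over B [:0, \<kappa> 1:]" "poly [:0, \<kappa> 1:] x = x"
    using subalgD[OF B] subalgD(4)[OF A(1,3)]
    by (simp_all add: poly_over_pCons poly_over_closed[OF B] mult.commute)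
  then show "x \<in> adjoin B x"
    unfolding eq by (metis (mono_tags, lifting) mem_Collect_eq)
  show "subalg (adjoin B x)"
    unfolding subalg_def
  proof (intro conjI ballI)
    show "range \<kappa> \<subseteq> adjoin B x"
      using BC subalgD(1)[OF B] by blast
    fix f assume f: "f \<in> adjoin B x"
    then show "\<kappa> 1 * f = f"
      using sub subalgD(4)[OF A(1)] by blast
    fix g assume "g \<in> adjoin B x"
    with f obtain p r where "f = poly p x" "g = poly r x" "poly_over B p" "poly_over B r"
      unfolding eq by blast
    then show "f + g \<in> adjoin B x" "f * g \<in> adjoin B x"
      unfolding eq using poly_over_closed[OF B] by (metis (mono_tags, lifting) mem_Collect_eq poly_add poly_mult)+
  qed
qed

definition eval_hom :: "('r \<Rightarrow> 'k) \<Rightarrow> 'k \<Rightarrow> 'r poly \<Rightarrow> 'k" where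
  "eval_hom \<phi> \<xi> p = poly (map_poly \<phi> p) \<xi>"

text \<open>Over the dual numbers, this is the \<open>\<epsilon>\<close>-part of evaluating the
  polynomial with coefficients mapped by \<open>\<phi> + \<epsilon> \<delta>\<close> at
  \<open>\<xi> + \<epsilon> \<tau>\<close>. So \<open>\<tau>\<close> is the component of the tangent
  vector in the direction of the new variable.\<close>

definition eval_der :: "('r \<Rightarrow> 'k) \<Rightarrow> ('r \<Rightarrow> 'k) \<Rightarrow> 'k \<Rightarrow> 'k \<Rightarrow> 'r poly \<Rightarrow> 'k" where
  "eval_der \<phi> \<delta> \<xi> \<tau> p = poly (map_poly \<delta> p) \<xi> + \<tau> * poly (pderiv (map_poly \<phi> p)) \<xi>"

lemma eval_hom:
  assumes B: "subalg B" and \<phi>: "alg_hom B \<phi>"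
  shows "eval_hom \<phi> \<xi> 0 = 0"
    "a \<in> B \<Longrightarrow> poly_over B p \<Longrightarrow> eval_hom \<phi> \<xi> (pCons a p) = \<phi> a + \<xi> * eval_hom \<phi> \<xi> p"
    "poly_over B p \<Longrightarrow> poly_over B r \<Longrightarrow> eval_hom \<phi> \<xi> (p + r) = eval_hom \<phi> \<xi> p + eval_hom \<phi> \<xi> r"
    "poly_over B p \<Longrightarrow> poly_over B r \<Longrightarrow> eval_hom \<phi> \<xi> (p - r) = eval_hom \<phi> \<xi> p - eval_hom \<phi> \<xi> r"
    "a \<in> B \<Longrightarrow> poly_over B p \<Longrightarrow> eval_hom \<phi> \<xi> (smult a p) = \<phi> a * eval_hom \<phi> \<xi> p"
    "poly_over B p \<Longrightarrow> poly_over B r \<Longrightarrow> eval_hom \<phi> \<xi> (p * r) = eval_hom \<phi> \<xi> p * eval_hom \<phi> \<xi> r"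
proof -
  note h = alg_homD[OF B \<phi>]
  show zero: "eval_hom \<phi> \<xi> 0 = 0"
    by (simp add: eval_hom_def)
  show pC: "a \<in> B \<Longrightarrow> poly_over B p \<Longrightarrow> eval_hom \<phi> \<xi> (pCons a p) = \<phi> a + \<xi> * eval_hom \<phi> \<xi> p" for a p
    by (simp add: eval_hom_def map_poly_pCons h)
  show add: "poly_over B p \<Longrightarrow> poly_over B r \<Longrightarrow> eval_hom \<phi> \<xi> (p + r) = eval_hom \<phi> \<xi> p + eval_hom \<phi> \<xi> r" for p r
    unfolding eval_hom_def poly_add[symmetric] poly_over_def
    by (intro arg_cong2[where f = poly] poly_eqI refl) (simp add: coeff_map_poly h)
  show "poly_over B p \<Longrightarrow> poly_over B r \<Longrightarrow> eval_hom \<phi> \<xi> (p - r) = eval_hom \<phi> \<xi> p - eval_hom \<phi> \<xi> r"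
    unfolding eval_hom_def poly_diff[symmetric] poly_over_def
    by (intro arg_cong2[where f = poly] poly_eqI refl) (simp add: coeff_map_poly h)
  show smult: "a \<in> B \<Longrightarrow> poly_over B p \<Longrightarrow> eval_hom \<phi> \<xi> (smult a p) = \<phi> a * eval_hom \<phi> \<xi> p" for a p
    unfolding eval_hom_def poly_smult[symmetric] poly_over_def
    by (intro arg_cong2[where f = poly] poly_eqI refl) (simp add: coeff_map_poly h)
  show "poly_over B p \<Longrightarrow> poly_over B r \<Longrightarrow> eval_hom \<phi> \<xi> (p * r) = eval_hom \<phi> \<xi> p * eval_hom \<phi> \<xi> r"
  proof (induction p rule: poly_over_induct)
    case 0
    then show ?case by (simp add: zero)
  next
    case (pCons a p)
    have "poly_over B (smult a r)"
      using poly_over_closed(4)[OF B pCons(1), of r 1] pCons by simp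
    moreover have "poly_over B (pCons 0 (p * r))"
      using pCons by (simp add: poly_over_pCons poly_over_closed[OF B] subalgD[OF B])
    ultimately show ?case
      using pCons by (simp add: add smult pC h poly_over_closed[OF B] subalgD[OF B] algebra_simps)
  qed
qed

lemma eval_der:
  assumes B: "subalg B" and \<phi>: "alg_hom B \<phi>" and \<delta>: "point_derivation B \<phi> \<delta>"
  shows "eval_der \<phi> \<delta> \<xi> \<tau> 0 = 0"
    "a \<in> B \<Longrightarrow> poly_over B p \<Longrightarrow>
       eval_der \<phi> \<delta> \<xi> \<tau> (pCons a p) = \<delta> a + \<tau> * eval_hom \<phi> \<xi> p + \<xi> * eval_der \<phi> \<delta> \<xi> \<tau> p"
    "poly_over B p \<Longrightarrow> poly_over B r \<Longrightarrow> eval_der \<phi> \<delta> \<xi> \<tau> (p + r) = eval_der \<phi> \<delta> \<xi> \<tau> p + eval_der \<phi> \<delta> \<xi> \<tau> r"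
    "poly_over B p \<Longrightarrow> poly_over B r \<Longrightarrow> eval_der \<phi> \<delta> \<xi> \<tau> (p - r) = eval_der \<phi> \<delta> \<xi> \<tau> p - eval_der \<phi> \<delta> \<xi> \<tau> r"
    "a \<in> B \<Longrightarrow> poly_over B p \<Longrightarrow>
       eval_der \<phi> \<delta> \<xi> \<tau> (smult a p) = \<delta> a * eval_hom \<phi> \<xi> p + \<phi> a * eval_der \<phi> \<delta> \<xi> \<tau> p"
    "poly_over B p \<Longrightarrow> poly_over B r \<Longrightarrow> eval_der \<phi> \<delta> \<xi> \<tau> (p * r) =
       eval_der \<phi> \<delta> \<xi> \<tau> p * eval_hom \<phi> \<xi> r + eval_hom \<phi> \<xi> p * eval_der \<phi> \<delta> \<xi> \<tau> r"
proof -
  note h = alg_homD[OF B \<phi>] and d = point_derivationD[OF B \<delta>]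
  show zero: "eval_der \<phi> \<delta> \<xi> \<tau> 0 = 0"
    by (simp add: eval_der_def)
  show pC: "a \<in> B \<Longrightarrow> poly_over B p \<Longrightarrow>
      eval_der \<phi> \<delta> \<xi> \<tau> (pCons a p) = \<delta> a + \<tau> * eval_hom \<phi> \<xi> p + \<xi> * eval_der \<phi> \<delta> \<xi> \<tau> p" for a p
    by (simp add: eval_der_def eval_hom_def map_poly_pCons h d pderiv_pCons algebra_simps)
  have map_add: "map_poly \<phi> (p + r) = map_poly \<phi> p + map_poly \<phi> r" "map_poly \<delta> (p + r) = map_poly \<delta> p + map_poly \<delta> r"
    "map_poly \<phi> (p - r) = map_poly \<phi> p - map_poly \<phi> r" "map_poly \<delta> (p - r) = map_poly \<delta> p - map_poly \<delta> r"
    if "poly_over B p" "poly_over B r" for p r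
    using that unfolding poly_over_def by (auto intro!: poly_eqI simp: coeff_map_poly h d)
  show add: "poly_over B p \<Longrightarrow> poly_over B r \<Longrightarrow>
      eval_der \<phi> \<delta> \<xi> \<tau> (p + r) = eval_der \<phi> \<delta> \<xi> \<tau> p + eval_der \<phi> \<delta> \<xi> \<tau> r" for p r
    by (simp add: eval_der_def map_add pderiv_add algebra_simps)
  show "poly_over B p \<Longrightarrow> poly_over B r \<Longrightarrow>
      eval_der \<phi> \<delta> \<xi> \<tau> (p - r) = eval_der \<phi> \<delta> \<xi> \<tau> p - eval_der \<phi> \<delta> \<xi> \<tau> r"
    by (simp add: eval_der_def map_add pderiv_diff algebra_simps)
  show smult: "a \<in> B \<Longrightarrow> poly_over B p \<Longrightarrow>
      eval_der \<phi> \<delta> \<xi> \<tau> (smult a p) = \<delta> a * eval_hom \<phi> \<xi> p + \<phi> a * eval_der \<phi> \<delta> \<xi> \<tau> p" for a p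
  proof -
    assume *: "a \<in> B" "poly_over B p"
    have "map_poly \<phi> (smult a p) = smult (\<phi> a) (map_poly \<phi> p)"
      "map_poly \<delta> (smult a p) = smult (\<delta> a) (map_poly \<phi> p) + smult (\<phi> a) (map_poly \<delta> p)"
      using * unfolding poly_over_def by (auto intro!: poly_eqI simp: coeff_map_poly h d)
    then show ?thesis
      by (simp add: eval_der_def eval_hom_def pderiv_smult algebra_simps)
  qed
  show "poly_over B p \<Longrightarrow> poly_over B r \<Longrightarrow> eval_der \<phi> \<delta> \<xi> \<tau> (p * r) =
      eval_der \<phi> \<delta> \<xi> \<tau> p * eval_hom \<phi> \<xi> r + eval_hom \<phi> \<xi> p * eval_der \<phi> \<delta> \<xi> \<tau> r"
  proof (induction p rule: poly_over_induct)
    case 0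
    then show ?case by (simp add: zero eval_hom[OF B \<phi>])
  next
    case (pCons a p)
    have "poly_over B (smult a r)"
      using poly_over_closed(4)[OF B pCons(1), of r 1] pCons by simp
    moreover have "poly_over B (pCons 0 (p * r))"
      using pCons by (simp add: poly_over_pCons poly_over_closed[OF B] subalgD[OF B])
    ultimately show ?case
      using pCons by (simp add: add smult pC h d eval_hom[OF B \<phi>] poly_over_closed[OF B] subalgD[OF B] algebra_simps)
  qed
qed

lemma eval_vanish:
  assumes "\<phi> 0 = 0" "\<delta> 0 = 0" "\<And>i. \<phi> (coeff p i) = 0"
  shows "eval_hom \<phi> \<xi> p = 0" "(\<And>i. \<delta> (coeff p i) = 0) \<Longrightarrow> eval_der \<phi> \<delta> \<xi> \<tau> p = 0"
proof -
  have "map_poly \<phi> p = 0"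
    using assms by (intro poly_eqI) (simp add: coeff_map_poly)
  moreover have "(\<And>i. \<delta> (coeff p i) = 0) \<Longrightarrow> map_poly \<delta> p = 0"
    using assms by (intro poly_eqI) (simp add: coeff_map_poly)
  ultimately show "eval_hom \<phi> \<xi> p = 0" "(\<And>i. \<delta> (coeff p i) = 0) \<Longrightarrow> eval_der \<phi> \<delta> \<xi> \<tau> p = 0"
    by (simp_all add: eval_hom_def eval_der_def)
qed

text \<open>Descent of a map from polynomials to elements of \<open>B[x]\<close>, which may have
  many representing polynomials.\<close>

lemma quotient_choice:
  assumes "\<And>p r. poly_over B p \<Longrightarrow> poly_over B r \<Longrightarrow> poly p x = poly r x \<Longrightarrow> F p = F r"
  shows "\<exists>f. \<forall>p. poly_over B p \<longrightarrow> f (poly p x) = F p"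
proof (intro exI[of _ "\<lambda>y. F (SOME r. poly_over B r \<and> poly r x = y)"] allI impI)
  fix p assume p: "poly_over B p"
  let ?s = "SOME r. poly_over B r \<and> poly r x = poly p x"
  have "poly_over B ?s \<and> poly ?s x = poly p x"
    by (rule someI[of _ p]) (use p in simp)
  then show "F ?s = F p"
    using assms p by blast
qed

text \<open>\<open>\<phi>'\<close> is a point of \<open>C\<close> over the point
  \<open>\<phi>\<close> of \<open>B\<close> at which every tangent vector lifts, so the map of
  varieties is submersive there. Demanding that points and tangent vectors kill \<open>P\<close>
  replaces the passage to quotient rings.\<close>

definition lifts :: "'r set \<Rightarrow> 'r set \<Rightarrow> 'r set \<Rightarrow> ('r \<Rightarrow> 'k) \<Rightarrow> ('r \<Rightarrow> 'k) \<Rightarrow> bool" where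
  "lifts P B C \<phi> \<phi>' \<longleftrightarrow> alg_hom C \<phi>' \<and> (\<forall>p\<in>C \<inter> P. \<phi>' p = 0) \<and> (\<forall>f\<in>B. \<phi>' f = \<phi> f) \<and>
     (\<forall>\<delta>. point_derivation B \<phi> \<delta> \<longrightarrow> (\<forall>p\<in>B \<inter> P. \<delta> p = 0) \<longrightarrow>
        (\<exists>\<delta>'. point_derivation C \<phi>' \<delta>' \<and> (\<forall>p\<in>C \<inter> P. \<delta>' p = 0) \<and> (\<forall>f\<in>B. \<delta>' f = \<delta> f)))"

text \<open>
  Points of \<open>B\<close> off the hypersurface \<open>b = 0\<close> lift to points of \<open>C\<close> off \<open>c = 0\<close>, together
  with their tangent vectors; everything is understood modulo \<open>P\<close>.
\<close>

definition lifting :: "'r set \<Rightarrow> 'r set \<Rightarrow> 'r set \<Rightarrow> 'r \<Rightarrow> 'r \<Rightarrow> bool" where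
  "lifting P B C b c \<longleftrightarrow> (\<forall>\<phi>. alg_hom B \<phi> \<longrightarrow> (\<forall>p\<in>B \<inter> P. \<phi> p = 0) \<longrightarrow> \<phi> b \<noteq> 0 \<longrightarrow>
     (\<exists>\<phi>'. lifts P B C \<phi> \<phi>' \<and> \<phi>' c \<noteq> 0))"

lemma liftsD:
  assumes "lifts P B C \<phi> \<phi>'"
  shows "alg_hom C \<phi>'" "p \<in> C \<Longrightarrow> p \<in> P \<Longrightarrow> \<phi>' p = 0" "f \<in> B \<Longrightarrow> \<phi>' f = \<phi> f"
    "point_derivation B \<phi> \<delta> \<Longrightarrow> \<forall>p\<in>B \<inter> P. \<delta> p = 0 \<Longrightarrow>
      \<exists>\<delta>'. point_derivation C \<phi>' \<delta>' \<and> (\<forall>p\<in>C \<inter> P. \<delta>' p = 0) \<and> (\<forall>f\<in>B. \<delta>' f = \<delta> f)"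
  using assms unfolding lifts_def by blast+

lemma lifts_refl: "alg_hom B \<phi> \<Longrightarrow> \<forall>p\<in>B \<inter> P. \<phi> p = 0 \<Longrightarrow> lifts P B B \<phi> \<phi>"
  unfolding lifts_def by blast

lemma lifts_trans:
  assumes 1: "lifts P B C \<phi> \<phi>1" and 2: "lifts P C D \<phi>1 \<phi>2" and sub: "B \<subseteq> C"
  shows "lifts P B D \<phi> \<phi>2"
  unfolding lifts_def
proof (intro conjI allI impI)
  show "\<forall>f\<in>B. \<phi>2 f = \<phi> f"
    using liftsD(3)[OF 1] liftsD(3)[OF 2] sub by auto
  fix \<delta> assume \<delta>: "point_derivation B \<phi> \<delta>" "\<forall>p\<in>B \<inter> P. \<delta> p = 0"
  obtain \<delta>1 where \<delta>1: "point_derivation C \<phi>1 \<delta>1" "\<forall>p\<in>C \<inter> P. \<delta>1 p = 0" "\<forall>f\<in>B. \<delta>1 f = \<delta> f"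
    using liftsD(4)[OF 1 \<delta>] by auto
  obtain \<delta>2 where "point_derivation D \<phi>2 \<delta>2" "\<forall>p\<in>D \<inter> P. \<delta>2 p = 0" "\<forall>f\<in>C. \<delta>2 f = \<delta>1 f"
    using liftsD(4)[OF 2 \<delta>1(1,2)] by auto
  then show "\<exists>\<delta>'. point_derivation D \<phi>2 \<delta>' \<and> (\<forall>p\<in>D \<inter> P. \<delta>' p = 0) \<and> (\<forall>f\<in>B. \<delta>' f = \<delta> f)"
    using \<delta>1(3) sub by (intro exI[of _ \<delta>2]) auto
qed (use liftsD[OF 2] in auto)

lemma lifting_trans:
  assumes "lifting P B C b c" "lifting P C D c d" "B \<subseteq> C"
  shows "lifting P B D b d"
  unfolding lifting_def
proof (intro allI impI)
  fix \<phi> assume "alg_hom B \<phi>" "\<forall>p\<in>B \<inter> P. \<phi> p = 0" "\<phi> b \<noteq> 0"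
  then obtain \<phi>1 where 1: "lifts P B C \<phi> \<phi>1" "\<phi>1 c \<noteq> 0"
    using assms(1) unfolding lifting_def by blast
  moreover have "\<forall>p\<in>C \<inter> P. \<phi>1 p = 0"
    using liftsD(2)[OF 1(1)] by blast
  ultimately obtain \<phi>2 where "lifts P C D \<phi>1 \<phi>2" "\<phi>2 d \<noteq> 0"
    using assms(2) liftsD(1)[OF 1(1)] unfolding lifting_def by blast
  then show "\<exists>\<phi>'. lifts P B D \<phi> \<phi>' \<and> \<phi>' d \<noteq> 0"
    using lifts_trans[OF 1(1) _ assms(3)] by blast
qed

text \<open>A point of \<open>B[x]\<close> over \<open>\<phi>\<close> is a choice of
  \<open>\<xi>\<close>, the image of \<open>x\<close>, that respects all relations modulo
  \<open>P\<close>; lifting a tangent vector is a choice of its component \<open>\<tau>\<close>. As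
  0 lies in \<open>P\<close>, the same condition makes the values independent of the representing
  polynomial.\<close>

lemma lifting_adjoin:
  assumes B: "subalg B"
    and ev: "\<And>\<phi>. alg_hom B \<phi> \<Longrightarrow> (\<forall>p\<in>B \<inter> P. \<phi> p = 0) \<Longrightarrow> \<phi> b \<noteq> 0 \<Longrightarrow>
      \<exists>\<xi>. (\<forall>p. poly_over B p \<and> poly p x \<in> P \<longrightarrow> eval_hom \<phi> \<xi> p = 0) \<and> eval_hom \<phi> \<xi> h \<noteq> 0 \<and>
        (\<forall>\<delta>. point_derivation B \<phi> \<delta> \<longrightarrow> (\<forall>p\<in>B \<inter> P. \<delta> p = 0) \<longrightarrow>
          (\<exists>\<tau>. \<forall>p. poly_over B p \<and> poly p x \<in> P \<longrightarrow> eval_der \<phi> \<delta> \<xi> \<tau> p = 0))"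
    and h: "poly_over B h" and P0: "0 \<in> P"
  shows "lifting P B (adjoin B x) b (poly h x)"
  unfolding lifting_def
proof (intro allI impI)
  fix \<phi> assume \<phi>: "alg_hom B \<phi>" and asm: "\<forall>p\<in>B \<inter> P. \<phi> p = 0" "\<phi> b \<noteq> 0"
  obtain \<xi> where ob: "(\<forall>p. poly_over B p \<and> poly p x \<in> P \<longrightarrow> eval_hom \<phi> \<xi> p = 0) \<and> eval_hom \<phi> \<xi> h \<noteq> 0 \<and>
      (\<forall>\<delta>. point_derivation B \<phi> \<delta> \<longrightarrow> (\<forall>p\<in>B \<inter> P. \<delta> p = 0) \<longrightarrow>
        (\<exists>\<tau>. \<forall>p. poly_over B p \<and> poly p x \<in> P \<longrightarrow> eval_der \<phi> \<delta> \<xi> \<tau> p = 0))"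
    using ev[OF \<phi> asm] ..
  then have van: "\<And>p. poly_over B p \<Longrightarrow> poly p x \<in> P \<Longrightarrow> eval_hom \<phi> \<xi> p = 0" and ne: "eval_hom \<phi> \<xi> h \<noteq> 0"
    by blast+
  have der: "\<exists>\<tau>. \<forall>p. poly_over B p \<and> poly p x \<in> P \<longrightarrow> eval_der \<phi> \<delta> \<xi> \<tau> p = 0"
    if "point_derivation B \<phi> \<delta>" "\<forall>p\<in>B \<inter> P. \<delta> p = 0" for \<delta>
    using ob that by blast
  note ehom = eval_hom[OF B \<phi>] and cl = poly_over_closed[OF B]
  have const: "poly_over B [:f:]" "poly [:f:] x = f" if "f \<in> B" for f
    using that cl(1) by (simp_all add: poly_over_pCons)
  have C: "\<exists>p. poly_over B p \<and> f = poly p x" if "f \<in> adjoin B x" for f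
    using that unfolding adjoin_def poly_over_def by blast
  have "eval_hom \<phi> \<xi> p = eval_hom \<phi> \<xi> r" if "poly_over B p" "poly_over B r" "poly p x = poly r x" for p r
    using van[OF cl(3)[OF that(1,2)]] that P0 ehom(4)[OF that(1,2)] by simp
  then obtain \<phi>' where \<phi>': "\<And>p. poly_over B p \<Longrightarrow> \<phi>' (poly p x) = eval_hom \<phi> \<xi> p"
    using quotient_choice[of B x "eval_hom \<phi> \<xi>"] by blast
  have \<phi>'B: "\<phi>' f = \<phi> f" if "f \<in> B" for f
    using \<phi>'[OF const(1)[OF that]] that ehom cl(1) by simp
  have hom': "alg_hom (adjoin B x) \<phi>'"
    unfolding alg_hom_def
  proof (intro conjI allI ballI)
    show "\<phi>' (\<kappa> c) = c" for c
      using \<phi>'B[OF subalgD(1)[OF B]] alg_homD(1)[OF B \<phi>] by simp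
    fix f g assume "f \<in> adjoin B x" "g \<in> adjoin B x"
    then obtain p r where pr: "poly_over B p" "f = poly p x" "poly_over B r" "g = poly r x"
      using C by blast
    then show "\<phi>' (f + g) = \<phi>' f + \<phi>' g" "\<phi>' (f * g) = \<phi>' f * \<phi>' g"
      using \<phi>'[OF cl(2)[OF pr(1,3)]] \<phi>'[OF cl(5)[OF pr(1,3)]] by (simp_all add: \<phi>' ehom)
  qed
  have "lifts P B (adjoin B x) \<phi> \<phi>'"
    unfolding lifts_def
  proof (intro conjI allI impI hom')
    show "\<forall>p\<in>adjoin B x \<inter> P. \<phi>' p = 0"
      using C \<phi>' van by fastforce
    show "\<forall>f\<in>B. \<phi>' f = \<phi> f"
      using \<phi>'B by blast
    fix \<delta> assume \<delta>: "point_derivation B \<phi> \<delta>" "\<forall>p\<in>B \<inter> P. \<delta> p = 0"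
    obtain \<tau> where vand: "\<And>p. poly_over B p \<Longrightarrow> poly p x \<in> P \<Longrightarrow> eval_der \<phi> \<delta> \<xi> \<tau> p = 0"
      using der[OF \<delta>] by auto
    note eder = eval_der[OF B \<phi> \<delta>(1)]
    have "eval_der \<phi> \<delta> \<xi> \<tau> p = eval_der \<phi> \<delta> \<xi> \<tau> r"
      if "poly_over B p" "poly_over B r" "poly p x = poly r x" for p r
      using vand[OF cl(3)[OF that(1,2)]] that P0 eder(4)[OF that(1,2)] by simp
    then obtain \<delta>' where \<delta>': "\<And>p. poly_over B p \<Longrightarrow> \<delta>' (poly p x) = eval_der \<phi> \<delta> \<xi> \<tau> p"
      using quotient_choice[of B x "eval_der \<phi> \<delta> \<xi> \<tau>"] by blast
    have \<delta>'B: "\<delta>' f = \<delta> f" if "f \<in> B" for f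
      using \<delta>'[OF const(1)[OF that]] that eder ehom cl(1) by simp
    show "\<exists>\<delta>'. point_derivation (adjoin B x) \<phi>' \<delta>' \<and> (\<forall>p\<in>adjoin B x \<inter> P. \<delta>' p = 0) \<and> (\<forall>f\<in>B. \<delta>' f = \<delta> f)"
    proof (intro exI[of _ \<delta>'] conjI)
      show "point_derivation (adjoin B x) \<phi>' \<delta>'"
        unfolding point_derivation_def
      proof (intro conjI allI ballI)
        show "\<delta>' (\<kappa> c) = 0" for c
          using \<delta>'B[OF subalgD(1)[OF B]] point_derivationD(1)[OF B \<delta>(1)] by simp
        fix f g assume "f \<in> adjoin B x" "g \<in> adjoin B x"
        then obtain p r where pr: "poly_over B p" "f = poly p x" "poly_over B r" "g = poly r x"
          using C by blast
        then show "\<delta>' (f + g) = \<delta>' f + \<delta>' g" "\<delta>' (f * g) = \<delta>' f * \<phi>' g + \<phi>' f * \<delta>' g"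
          using \<delta>'[OF cl(2)[OF pr(1,3)]] \<delta>'[OF cl(5)[OF pr(1,3)]] by (simp_all add: \<phi>' \<delta>' eder)
      qed
      show "\<forall>p\<in>adjoin B x \<inter> P. \<delta>' p = 0"
        using C \<delta>' vand by fastforce
      show "\<forall>f\<in>B. \<delta>' f = \<delta> f"
        using \<delta>'B by blast
    qed
  qed
  then show "\<exists>\<phi>'. lifts P B (adjoin B x) \<phi> \<phi>' \<and> \<phi>' (poly h x) \<noteq> 0"
    using \<phi>'[OF h] ne by (intro exI[of _ \<phi>']) simp
qed

text \<open>Leading coefficients cannot be inverted in \<open>B\<close>, hence the power. The degree
  bound on \<open>q\<close> is recorded because it does not follow from the identity: the ambient
  ring may have zero divisors.\<close>

lemma pseudo_division:
  assumes B: "subalg B" and g: "poly_over B g" "degree g > 0" and h: "poly_over B h"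
  shows "\<exists>m q r. poly_over B q \<and> poly_over B r \<and> smult (lead_coeff g ^ m) h = g * q + r \<and>
    degree r < degree g \<and> (degree q + degree g \<le> degree h \<or> q = 0)"
  using h
proof (induction "degree h" arbitrary: h rule: less_induct)
  case less
  note cl = poly_over_closed[OF B]
  have lg: "lead_coeff g \<in> B" and lh: "lead_coeff h \<in> B"
    using g(1) less.prems unfolding poly_over_def by auto
  show ?case
  proof (cases "degree h < degree g")
    case True
    then show ?thesis
      using less.prems cl by (intro exI[of _ 0] exI[of _ 0] exI[of _ h]) simp
  next
    case False
    define t where "t = monom (lead_coeff h) (degree h - degree g)"
    define h' where "h' = smult (lead_coeff g) h - t * g"
    have t: "poly_over B t"
      unfolding t_def using lh by (rule cl)
    have h': "poly_over B h'"
      unfolding h'_def using cl(4)[OF lg less.prems, of 1] cl(5)[OF t g(1)] by (simp add: cl)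
    have "degree h' < degree h"
    proof (rule degree_lessI)
      show "h' \<noteq> 0 \<or> 0 < degree h"
        using False g(2) by simp
      show "\<forall>k\<ge>degree h. coeff h' k = 0"
      proof (intro allI impI)
        fix k assume k: "degree h \<le> k"
        have c: "coeff (t * g) k = lead_coeff h * coeff g (k - (degree h - degree g))"
          unfolding t_def coeff_monom_mult using k by simp
        show "coeff h' k = 0"
        proof (cases "k = degree h")
          case True
          then have "k - (degree h - degree g) = degree g"
            using False by simp
          with True c show ?thesis
            by (simp add: h'_def mult.commute)
        next
          case ne: False
          then have "degree g < k - (degree h - degree g)" "degree h < k"
            using False k by auto
          then show ?thesis
            using c by (simp add: h'_def coeff_eq_0)
        qed
      qed
    qed
    then obtain m q r where q: "poly_over B q" "poly_over B r" "smult (lead_coeff g ^ m) h' = g * q + r"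
      "degree r < degree g" "degree q + degree g \<le> degree h' \<or> q = 0"
      using less.hyps[OF _ h'] by blast
    have "smult (lead_coeff g ^ Suc m) h = g * (q + smult (lead_coeff g ^ m) t) + r"
    proof -
      have "smult (lead_coeff g ^ Suc m) h = smult (lead_coeff g ^ m) (h' + t * g)"
        by (simp add: h'_def mult.commute)
      also have "\<dots> = g * q + r + smult (lead_coeff g ^ m) (t * g)"
        by (simp only: smult_add_right q(3))
      finally show ?thesis
        by (simp add: algebra_simps)
    qed
    moreover have "poly_over B (q + smult (lead_coeff g ^ m) t)"
      using q(1) t lg by (intro cl)
    moreover have "degree (q + smult (lead_coeff g ^ m) t) + degree g \<le> degree h"
    proof -
      have "degree q \<le> degree h - degree g"
        using q(5) \<open>degree h' < degree h\<close> by auto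
      moreover have "degree (smult (lead_coeff g ^ m) t) \<le> degree h - degree g"
        unfolding t_def by (meson degree_monom_le degree_smult_le order_trans)
      ultimately have "degree (q + smult (lead_coeff g ^ m) t) \<le> degree h - degree g"
        by (rule degree_add_le)
      then show ?thesis
        using False by simp
    qed
    ultimately show ?thesis
      using q(2,4) by blast
  qed
qed

end

section \<open>Lifting through one new generator\<close>

context scalars
begin

lemma prime_power_cancel:
  assumes A: "subalg A" and P: "alg_prime A P" and a: "a \<in> A" "a \<notin> P" and f: "f \<in> A" "a ^ m * f \<in> P"
  shows "f \<in> P"
  using f(2)
proof (induction m)
  case (Suc m)
  have "a ^ m * f \<in> A"
    using a(1) f(1) by (rule subalgD(8)[OF A])
  then show ?case
    using Suc P a unfolding alg_prime_def by (auto simp: mult.assoc)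
qed simp

lemma poly_coeffs_in_ideal:
  assumes A: "subalg A" and P: "alg_ideal A P" and x: "x \<in> A" and p: "\<And>i. coeff p i \<in> P"
  shows "poly p x \<in> P"
proof -
  have "poly_over P p"
    unfolding poly_over_def using p by blast
  then show ?thesis
    by (induction rule: poly_over_induct) (simp_all add: alg_idealD[OF A P] x)
qed

text \<open>Degrees have to be measured modulo \<open>P\<close>: the terms above the last
  coefficient outside \<open>P\<close> are dropped, which changes the value at \<open>x\<close> only
  by an element of \<open>P\<close>.\<close>

lemma truncate:
  assumes B: "subalg B" "B \<subseteq> A" and A: "subalg A" and P: "alg_ideal A P" and x: "x \<in> A"
    and h: "poly_over B h" "coeff h i \<notin> P"
  obtains h' where "poly_over B h'" "lead_coeff h' \<notin> P" "degree h' \<le> degree h" "poly h x - poly h' x \<in> P"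
proof -
  define S where "S = {i. coeff h i \<notin> P}"
  have "S \<subseteq> {..degree h}"
    unfolding S_def using alg_idealD(2)[OF A P] by (auto simp: not_less[symmetric] coeff_eq_0)
  then have fin: "finite S"
    using finite_subset by blast
  have "S \<noteq> {}"
    using h(2) by (auto simp: S_def)
  define d where "d = Max S"
  have d: "d \<in> S" "\<And>i. i \<in> S \<Longrightarrow> i \<le> d"
    unfolding d_def using fin \<open>S \<noteq> {}\<close> by auto
  define h' where "h' = poly_cutoff (Suc d) h"
  have c: "coeff h' k = (if k \<le> d then coeff h k else 0)" for k
    unfolding h'_def by (simp add: coeff_poly_cutoff less_Suc_eq_le)
  have dn: "coeff h d \<notin> P"
    using d(1) by (simp add: S_def)
  then have "coeff h' d \<noteq> 0"
    using c alg_idealD(2)[OF A P] by auto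
  then have deg: "degree h' = d"
    using c by (intro antisym degree_le le_degree) auto
  have "coeff (h - h') k \<in> P" for k
    using c[of k] alg_idealD(2)[OF A P] d(2)[of k] by (auto simp: S_def)
  then have "poly (h - h') x \<in> P"
    by (rule poly_coeffs_in_ideal[OF A P x])
  moreover have "d \<le> degree h"
    using d(1) \<open>S \<subseteq> {..degree h}\<close> by auto
  ultimately show thesis
    using that[of h'] deg c dn poly_over_closed(7)[OF B(1) h(1), of "Suc d"] by (simp add: h'_def)
qed

text \<open>Without nontrivial relations modulo \<open>P\<close> every \<open>\<xi>\<close> is
  admissible, and \<open>\<tau> = 0\<close> lifts any tangent vector. It remains to avoid the roots
  of \<open>h\<close>, which are finitely many at \<open>\<phi>\<close> as soon as one coefficient
  of \<open>h\<close> is nonzero there; such a coefficient is \<open>b\<close>.\<close>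

lemma lifting_transcendental:
  assumes A: "subalg A" and P: "alg_prime A P" and B: "subalg B" "B \<subseteq> A" and x: "x \<in> A"
    and tr: "\<And>h i. poly_over B h \<Longrightarrow> poly h x \<in> P \<Longrightarrow> coeff h i \<in> P"
    and h: "poly_over B h" "poly h x \<notin> P"
  shows "\<exists>b\<in>B. b \<notin> P \<and> lifting P B (adjoin B x) b (poly h x)"
proof -
  have Pi: "alg_ideal A P"
    using P unfolding alg_prime_def by blast
  obtain i where i: "coeff h i \<notin> P"
    using h(2) poly_coeffs_in_ideal[OF A Pi x] by blast
  have "lifting P B (adjoin B x) (coeff h i) (poly h x)"
  proof (rule lifting_adjoin[OF B(1) _ h(1) alg_idealD(2)[OF A Pi]])
    fix \<phi> assume \<phi>: "alg_hom B \<phi>" "\<forall>p\<in>B \<inter> P. \<phi> p = 0" "\<phi> (coeff h i) \<noteq> 0"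
    have z: "\<phi> 0 = 0"
      by (rule alg_homD(4)[OF B(1) \<phi>(1)])
    have "map_poly \<phi> h \<noteq> 0"
      using \<phi>(3) coeff_map_poly[of \<phi> h i] z by auto
    then have "finite {\<xi>. poly (map_poly \<phi> h) \<xi> = 0}"
      by (rule poly_roots_finite)
    then obtain \<xi> where \<xi>: "poly (map_poly \<phi> h) \<xi> \<noteq> 0"
      using infinite_UNIV_char_0[where 'a = 'k] by (metis (mono_tags, lifting) UNIV_eq_I mem_Collect_eq)
    have van: "\<phi> (coeff p i) = 0" if "poly_over B p \<and> poly p x \<in> P" for p i
      using that tr[of p i] \<phi>(2) unfolding poly_over_def by auto
    have "eval_der \<phi> \<delta> \<xi> 0 p = 0"
      if "point_derivation B \<phi> \<delta>" "\<forall>p\<in>B \<inter> P. \<delta> p = 0" "poly_over B p \<and> poly p x \<in> P" for \<delta> p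
    proof (rule eval_vanish(2))
      show "\<delta> 0 = 0"
        by (rule point_derivationD(4)[OF B(1) that(1)])
      show "\<delta> (coeff p i) = 0" for i
        using that(2,3) tr[of p i] unfolding poly_over_def by auto
    qed (use z van[OF that(3)] in auto)
    moreover have "eval_hom \<phi> \<xi> p = 0" if "poly_over B p \<and> poly p x \<in> P" for p
      using z van[OF that] by (intro eval_vanish(1)[where \<delta> = \<phi>])
    ultimately show "\<exists>\<xi>. (\<forall>p. poly_over B p \<and> poly p x \<in> P \<longrightarrow> eval_hom \<phi> \<xi> p = 0) \<and> eval_hom \<phi> \<xi> h \<noteq> 0 \<and>
        (\<forall>\<delta>. point_derivation B \<phi> \<delta> \<longrightarrow> (\<forall>p\<in>B \<inter> P. \<delta> p = 0) \<longrightarrow>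
          (\<exists>\<tau>. \<forall>p. poly_over B p \<and> poly p x \<in> P \<longrightarrow> eval_der \<phi> \<delta> \<xi> \<tau> p = 0))"
      using \<xi> by (intro exI[of _ \<xi>] conjI allI impI exI[of _ 0]) (auto simp: eval_hom_def)
  qed
  then show ?thesis
    using h(1) i unfolding poly_over_def by blast
qed

text \<open>For a prime \<open>P\<close>, a minimal polynomial of \<open>x\<close> over the fraction
  field of \<open>B\<close> modulo \<open>P\<close>, with denominators cleared.\<close>

definition minimal_relation :: "'r set \<Rightarrow> 'r set \<Rightarrow> 'r \<Rightarrow> 'r poly \<Rightarrow> bool" where
  "minimal_relation P B x p \<longleftrightarrow> poly_over B p \<and> lead_coeff p \<notin> P \<and> poly p x \<in> P \<and> degree p > 0 \<and>
     (\<forall>r i. poly_over B r \<longrightarrow> degree r < degree p \<longrightarrow> poly r x \<in> P \<longrightarrow> coeff r i \<in> P)"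

lemma minimal_relation_exists:
  assumes A: "subalg A" and P: "alg_ideal A P" and B: "subalg B" "B \<subseteq> A" and x: "x \<in> A"
    and h: "poly_over B h" "poly h x \<in> P" "coeff h i \<notin> P"
  shows "\<exists>p. minimal_relation P B x p"
proof -
  define good where "good p \<longleftrightarrow> poly_over B p \<and> lead_coeff p \<notin> P \<and> poly p x \<in> P" for p
  have tr: "\<exists>h'. good h' \<and> degree h' \<le> degree h" if h: "poly_over B h" "poly h x \<in> P" "coeff h i \<notin> P" for h i
  proof -
    obtain h' where h': "poly_over B h'" "lead_coeff h' \<notin> P" "degree h' \<le> degree h" "poly h x - poly h' x \<in> P"
      using truncate[OF B A P x h(1,3)] by blast
    have "poly h x - (poly h x - poly h' x) \<in> P"
      using h(2) h'(4) by (rule alg_idealD(6)[OF A P])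
    then show ?thesis
      unfolding good_def using h' by auto
  qed
  then have "\<exists>p. good p"
    using h by blast
  then obtain p where p: "good p" "\<And>r. good r \<Longrightarrow> degree p \<le> degree r"
    using ex_has_least_nat[of good _ degree] by blast
  have "degree p > 0"
  proof (rule ccontr)
    assume "\<not> degree p > 0"
    then obtain a where "p = [:a:]"
      using degree_eq_zeroE by blast
    then show False
      using p(1) by (auto simp: good_def)
  qed
  then have "minimal_relation P B x p"
    unfolding minimal_relation_def using p tr unfolding good_def by (meson leD le_trans)
  then show ?thesis ..
qed

text \<open>This plays the role of the norm of \<open>c\<close>. Take \<open>g\<close> of least
  degree whose value at \<open>x\<close> is, modulo \<open>P\<close>, a nonzero multiple of
  \<open>c\<close>. If its degree were positive, dividing the minimal relation by \<open>g\<close>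
  would either produce a smaller such polynomial or factor the minimal relation.\<close>

lemma norm_exists:
  assumes A: "subalg A" and P: "alg_prime A P" and B: "subalg B" "B \<subseteq> A" and x: "x \<in> A"
    and p: "minimal_relation P B x p" and c: "c \<in> adjoin B x" "c \<notin> P"
  shows "\<exists>u\<in>adjoin B x. \<exists>d\<in>B. d \<notin> P \<and> d - c * u \<in> P"
proof -
  have Pi: "alg_ideal A P"
    using P unfolding alg_prime_def by blast
  note C = subalg_adjoin[OF A B(2) x B(1)] and I = alg_idealD[OF A Pi]
  note Ccl = subalgD[OF C(1)] and cl = poly_over_closed[OF B(1)]
  have ev: "poly h x \<in> adjoin B x" if "poly_over B h" for h
    using that unfolding adjoin_def poly_over_def by blast
  have pB: "poly_over B p" "lead_coeff p \<notin> P" "poly p x \<in> P" "degree p > 0"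
    and pmin: "\<And>r i. poly_over B r \<Longrightarrow> degree r < degree p \<Longrightarrow> poly r x \<in> P \<Longrightarrow> coeff r i \<in> P"
    using p unfolding minimal_relation_def by blast+
  have lc: "lead_coeff h \<in> B" "lead_coeff h \<in> A" if "poly_over B h" for h
    using that B(2) unfolding poly_over_def by auto
  define S where "S g \<longleftrightarrow> poly_over B g \<and> lead_coeff g \<notin> P \<and> poly g x \<notin> P \<and> degree g < degree p \<and>
    (\<exists>u\<in>adjoin B x. poly g x - c * u \<in> P)" for g
  have mk: "\<exists>g. S g \<and> degree g \<le> degree r"
    if r: "poly_over B r" "poly r x \<notin> P" "degree r < degree p" "u \<in> adjoin B x" "poly r x - c * u \<in> P" for r u
  proof -
    obtain i where "coeff r i \<notin> P"
      using r(2) poly_coeffs_in_ideal[OF A Pi x] by blast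
    then obtain g where g: "poly_over B g" "lead_coeff g \<notin> P" "degree g \<le> degree r" "poly r x - poly g x \<in> P"
      using truncate[OF B A Pi x r(1)] by blast
    have "poly g x \<notin> P"
      using I(3)[OF g(4)] r(2) by (metis diff_add_cancel)
    moreover have "(poly r x - c * u) - (poly r x - poly g x) \<in> P"
      using r(5) g(4) by (rule I(6))
    then have "poly g x - c * u \<in> P"
      by simp
    ultimately show ?thesis
      using g r unfolding S_def by (intro exI[of _ g]) auto
  qed
  have "\<exists>g. S g"
  proof -
    obtain h where h: "poly_over B h" "c = poly h x"
      using c(1) unfolding adjoin_def poly_over_def by blast
    obtain m q r where q: "poly_over B q" "poly_over B r" "smult (lead_coeff p ^ m) h = p * q + r" "degree r < degree p"
      using pseudo_division[OF B(1) pB(1,4) h(1)] by blast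
    have eq: "lead_coeff p ^ m * c = poly p x * poly q x + poly r x"
      using arg_cong[OF q(3), of "\<lambda>t. poly t x"] h(2) by simp
    have pq: "poly p x * poly q x \<in> P"
      using I(4)[OF _ pB(3), of "poly q x"] C(2) ev[OF q(1)] by (auto simp: mult.commute)
    have "lead_coeff p ^ m * c \<notin> P"
      using prime_power_cancel[OF A P lc(2)[OF pB(1)] pB(2)] c C(2) by blast
    then have "poly r x \<notin> P"
      using eq I(3)[OF pq] by auto
    moreover have u: "lead_coeff p ^ m * \<kappa> 1 \<in> adjoin B x"
      using subalgD(8)[OF B(1) lc(1)[OF pB(1)] subalgD(1)[OF B(1)]] C(3) by blast
    moreover have "c * (lead_coeff p ^ m * \<kappa> 1) = lead_coeff p ^ m * (\<kappa> 1 * c)"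
      by (simp only: ac_simps)
    then have "c * (lead_coeff p ^ m * \<kappa> 1) = lead_coeff p ^ m * c"
      unfolding Ccl(4)[OF c(1)] .
    then have "poly r x - c * (lead_coeff p ^ m * \<kappa> 1) = - (poly p x * poly q x)"
      using eq by simp
    then have "poly r x - c * (lead_coeff p ^ m * \<kappa> 1) \<in> P"
      using I(5)[OF pq] by simp
    ultimately show ?thesis
      using mk[OF q(2)] q(4) by blast
  qed
  then obtain g where g: "S g" "\<And>r. S r \<Longrightarrow> degree g \<le> degree r"
    using ex_has_least_nat[of S _ degree] by blast
  then have gB: "poly_over B g" "lead_coeff g \<notin> P" "poly g x \<notin> P" "degree g < degree p"
    unfolding S_def by blast+
  obtain u where u: "u \<in> adjoin B x" "poly g x - c * u \<in> P"
    using g(1) unfolding S_def by blast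
  have "degree g = 0"
  proof (rule ccontr)
    assume "degree g \<noteq> 0"
    then have dg: "degree g > 0"
      by simp
    obtain m q r where q: "poly_over B q" "poly_over B r" "smult (lead_coeff g ^ m) p = g * q + r" "degree r < degree g"
      "degree q + degree g \<le> degree p \<or> q = 0"
      using pseudo_division[OF B(1) gB(1) dg pB(1)] by blast
    have eq: "lead_coeff g ^ m * poly p x = poly g x * poly q x + poly r x"
      using arg_cong[OF q(3), of "\<lambda>t. poly t x"] by simp
    have gq: "poly g x \<in> A" "poly q x \<in> A"
      using ev[OF gB(1)] ev[OF q(1)] C(2) by auto
    have "lead_coeff g ^ m * \<kappa> 1 \<in> A"
      using subalgD(8)[OF B(1) lc(1)[OF gB(1)] subalgD(1)[OF B(1)]] B(2) by blast
    then have "(lead_coeff g ^ m * \<kappa> 1) * poly p x \<in> P"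
      using pB(3) by (rule I(4))
    then have lhs: "lead_coeff g ^ m * poly p x \<in> P"
      using subalgD(4)[OF A I(1)[OF pB(3)]] by (simp add: mult.assoc)
    have rP: "poly r x \<in> P"
    proof (rule ccontr)
      assume r: "poly r x \<notin> P"
      have "poly q x * (poly g x - c * u) \<in> P"
        using gq(2) u(2) by (rule I(4))
      then have "lead_coeff g ^ m * poly p x - poly q x * (poly g x - c * u) \<in> P"
        using lhs by (rule I(6)[rotated])
      moreover have "lead_coeff g ^ m * poly p x - poly q x * (poly g x - c * u) = poly r x - c * (- (u * poly q x))"
        unfolding eq by (simp add: algebra_simps)
      ultimately have "poly r x - c * (- (u * poly q x)) \<in> P"
        by simp
      moreover have "- (u * poly q x) \<in> adjoin B x"
        using u(1) ev[OF q(1)] by (intro Ccl)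
      ultimately obtain s where "S s" "degree s \<le> degree r"
        using mk[OF q(2) r] q(4) gB(4) by (meson less_trans)
      then show False
        using g(2)[of s] q(4) by simp
    qed
    have "poly g x * poly q x \<in> P"
      using I(6)[OF lhs rP] eq by simp
    then have "poly q x \<in> P"
      using P gq gB(3) unfolding alg_prime_def by blast
    moreover have "degree q < degree p"
      using q(5) dg gB(4) by auto
    ultimately have qP: "coeff q i \<in> P" for i
      using pmin[OF q(1)] by blast
    have rcP: "coeff r i \<in> P" for i
      using pmin[OF q(2) _ rP] q(4) gB(4) by simp
    have sum: "sum f J \<in> P" if "\<And>j. j \<in> J \<Longrightarrow> f j \<in> P" for f :: "nat \<Rightarrow> 'r" and J
      using that by (induction J rule: infinite_finite_induct) (simp_all add: I)
    have gA: "coeff g i \<in> A" for i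
      using gB(1) B(2) unfolding poly_over_def by auto
    have "coeff (g * q + r) (degree p) \<in> P"
      unfolding coeff_add coeff_mult by (intro I(3) sum I(4) gA qP rcP)
    then have "lead_coeff g ^ m * lead_coeff p \<in> P"
      unfolding q(3)[symmetric] by simp
    then show False
      using prime_power_cancel[OF A P lc(2)[OF gB(1)] gB(2) lc(2)[OF pB(1)]] pB(2) by blast
  qed
  then obtain d where "g = [:d:]"
    using degree_eq_zeroE by blast
  then have "d \<in> B" "d \<notin> P" "d - c * u \<in> P"
    using gB(1,2) u(2) by (auto simp: poly_over_pCons)
  then show ?thesis
    using u(1) by blast
qed

text \<open>Given through its coefficients, so that it makes sense over a ring with zero
  divisors.\<close>

definition formal_deriv :: "'r poly \<Rightarrow> 'r poly" where
  "formal_deriv p = (\<Sum>i<degree p. monom (of_nat (Suc i) * coeff p (Suc i)) i)"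

lemma coeff_formal_deriv: "coeff (formal_deriv p) n = of_nat (Suc n) * coeff p (Suc n)"
proof (cases "n < degree p")
  case True
  then show ?thesis
    by (simp add: formal_deriv_def coeff_sum sum.delta del: of_nat_Suc)
next
  case False
  then show ?thesis
    by (simp add: formal_deriv_def coeff_sum sum.delta coeff_eq_0 del: of_nat_Suc)
qed

text \<open>\<open>\<xi>\<close> has to be a root of the minimal relation at \<open>\<phi>\<close>,
  and a simple one for tangent vectors to lift. The element \<open>b\<close> is the leading
  coefficient, which keeps the degree positive at \<open>\<phi>\<close>, times a norm of the value
  at \<open>x\<close> of \<open>h\<close> times the derivative; where \<open>b\<close> is nonzero,
  neither \<open>h\<close> nor the derivative can vanish at such a root.\<close>

lemma lifting_algebraic:
  assumes A: "subalg A" and P: "alg_prime A P" and B: "subalg B" "B \<subseteq> A" and x: "x \<in> A"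
    and p: "minimal_relation P B x p" and h: "poly_over B h" "poly h x \<notin> P"
  shows "\<exists>b\<in>B. b \<notin> P \<and> lifting P B (adjoin B x) b (poly h x)"
proof -
  have Pi: "alg_ideal A P"
    using P unfolding alg_prime_def by blast
  note C = subalg_adjoin[OF A B(2) x B(1)] and I = alg_idealD[OF A Pi]
  note cl = poly_over_closed[OF B(1)]
  have ev: "poly h x \<in> adjoin B x" if "poly_over B h" for h
    using that unfolding adjoin_def poly_over_def by blast
  have pB: "poly_over B p" "lead_coeff p \<notin> P" "poly p x \<in> P" "degree p > 0"
    and pmin: "\<And>r i. poly_over B r \<Longrightarrow> degree r < degree p \<Longrightarrow> poly r x \<in> P \<Longrightarrow> coeff r i \<in> P"
    using p unfolding minimal_relation_def by blast+
  have lp: "lead_coeff p \<in> B" "lead_coeff p \<in> A"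
    using pB(1) B(2) unfolding poly_over_def by auto
  have dB: "poly_over B (formal_deriv p)"
    using pB(1) unfolding poly_over_def coeff_formal_deriv by (simp add: subalgD[OF B(1)] del: of_nat_Suc)
  \<comment> \<open>Separability: the derivative has smaller degree, so a value in \<open>P\<close>
    would put \<open>degree p\<close> times the leading coefficient into \<open>P\<close>, which is
    impossible in characteristic zero.\<close>
  have dP: "poly (formal_deriv p) x \<notin> P"
  proof
    assume a: "poly (formal_deriv p) x \<in> P"
    have "degree (formal_deriv p) < degree p"
      using pB(4) by (intro degree_lessI) (auto simp: coeff_formal_deriv coeff_eq_0)
    then have "coeff (formal_deriv p) (degree p - 1) \<in> P"
      using pmin[OF dB _ a] by blast
    then have "\<kappa> (of_nat (degree p)) * lead_coeff p \<in> P"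
      using pB(4) subalgD(9)[OF B(1) lp(1)] by (simp add: coeff_formal_deriv del: of_nat_Suc)
    then have "\<kappa> (inverse (of_nat (degree p))) * (\<kappa> (of_nat (degree p)) * lead_coeff p) \<in> P"
      by (rule I(4)[OF subalgD(1)[OF A]])
    then show False
      using pB(2,4) subalgD(4)[OF A lp(2)] by (simp add: mult.assoc[symmetric] \<kappa>_mult[symmetric])
  qed
  define h' where "h' = h * formal_deriv p"
  have h': "poly_over B h'" "poly h' x = poly h x * poly (formal_deriv p) x"
    unfolding h'_def using cl(5)[OF h(1) dB] by simp_all
  have "poly h' x \<notin> P"
    unfolding h'(2) using P h(2) dP ev[OF h(1)] ev[OF dB] C(2) unfolding alg_prime_def by blast
  then obtain u d where u: "u \<in> adjoin B x" and d: "d \<in> B" "d \<notin> P" "d - poly h' x * u \<in> P"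
    using norm_exists[OF A P B x p ev[OF h'(1)]] by blast
  obtain w where w: "poly_over B w" "u = poly w x"
    using u unfolding adjoin_def poly_over_def by blast
  define b where "b = lead_coeff p * d"
  have b: "b \<in> B" "b \<notin> P"
    unfolding b_def using subalgD(3)[OF B(1) lp(1) d(1)] P lp d B(2) pB(2) unfolding alg_prime_def by auto
  \<comment> \<open>Up to a power of the leading coefficient and a remainder with coefficients in
    \<open>P\<close>, every relation is a multiple of \<open>p\<close>; so only \<open>p\<close> has
    to be respected.\<close>
  have division: "\<exists>m q s. poly_over B q \<and> poly_over B s \<and> smult (lead_coeff p ^ m) r = p * q + s \<and> (\<forall>i. coeff s i \<in> B \<inter> P)"
    if r: "poly_over B r" "poly r x \<in> P" for r
  proof -
    obtain m q s where q: "poly_over B q" "poly_over B s" "smult (lead_coeff p ^ m) r = p * q + s" "degree s < degree p"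
      using pseudo_division[OF B(1) pB(1,4) r(1)] by blast
    have "lead_coeff p ^ m * \<kappa> 1 \<in> A"
      using subalgD(8)[OF A lp(2) subalgD(1)[OF A]] .
    then have "(lead_coeff p ^ m * \<kappa> 1) * poly r x \<in> P"
      using r(2) by (rule I(4))
    then have "lead_coeff p ^ m * poly r x \<in> P"
      using subalgD(4)[OF A I(1)[OF r(2)]] by (simp add: mult.assoc)
    moreover have "poly q x * poly p x \<in> P"
      using I(4)[OF _ pB(3)] ev[OF q(1)] C(2) by blast
    ultimately have "lead_coeff p ^ m * poly r x - poly q x * poly p x \<in> P"
      by (rule I(6))
    then have sP: "poly s x \<in> P"
      using arg_cong[OF q(3), of "\<lambda>t. poly t x"] by (simp add: algebra_simps)
    have "coeff s i \<in> B \<inter> P" for i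
      using pmin[OF q(2,4) sP] q(2) unfolding poly_over_def by auto
    then show ?thesis
      using q by blast
  qed
  have "lifting P B (adjoin B x) b (poly h x)"
  proof (rule lifting_adjoin[OF B(1) _ h(1) I(2)])
    fix \<phi> assume \<phi>: "alg_hom B \<phi>" "\<forall>p\<in>B \<inter> P. \<phi> p = 0" "\<phi> b \<noteq> 0"
    note hom = alg_homD[OF B(1) \<phi>(1)] and eh = eval_hom[OF B(1) \<phi>(1)]
    have nz: "\<phi> (lead_coeff p) \<noteq> 0" "\<phi> d \<noteq> 0"
      using \<phi>(3) unfolding b_def by (auto simp: hom lp d)
    have "degree (map_poly \<phi> p) > 0"
      using le_degree[of "map_poly \<phi> p" "degree p"] nz(1) pB(4) by (simp add: coeff_map_poly hom)
    then obtain \<xi> where \<xi>: "poly (map_poly \<phi> p) \<xi> = 0"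
      using alg_closed_imp_poly_has_root by blast
    have p0: "eval_hom \<phi> \<xi> p = 0"
      using \<xi> by (simp add: eval_hom_def)
    have pow: "eval_hom \<phi> \<xi> (smult (lead_coeff p ^ m) r) = \<phi> (lead_coeff p) ^ m * eval_hom \<phi> \<xi> r"
      if "poly_over B r" for m r
    proof (induction m)
      case (Suc m)
      then show ?case
        using eh(5)[OF lp(1) cl(4)[OF lp(1) that, of m]] by simp
    qed simp
    have van: "eval_hom \<phi> \<xi> r = 0" if r: "poly_over B r" "poly r x \<in> P" for r
    proof -
      obtain m q s where q: "poly_over B q" "poly_over B s" "smult (lead_coeff p ^ m) r = p * q + s"
        and s: "\<forall>i. coeff s i \<in> B \<inter> P"
        using division[OF r] by blast
      have "\<phi> (coeff s i) = 0" for i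
        using s \<phi>(2) by auto
      then have "eval_hom \<phi> \<xi> s = 0"
        using hom(4) by (intro eval_vanish(1)[where \<delta> = \<phi>])
      then have "\<phi> (lead_coeff p) ^ m * eval_hom \<phi> \<xi> r = 0"
        unfolding pow[OF r(1), symmetric] q(3) using eh(3)[OF cl(5)[OF pB(1) q(1)] q(2)] eh(6)[OF pB(1) q(1)] p0
        by simp
      then show ?thesis
        using nz(1) by simp
    qed
    have "eval_hom \<phi> \<xi> ([:d:] - h' * w) = 0"
      using d(3) w cl(5)[OF h'(1) w(1)] d(1) cl(1) by (intro van cl(3)) (simp_all add: poly_over_pCons)
    then have "\<phi> d = eval_hom \<phi> \<xi> h' * eval_hom \<phi> \<xi> w"
      using eh(4)[of "[:d:]" "h' * w"] cl(5)[OF h'(1) w(1)] eh(6)[OF h'(1) w(1)] d(1) cl(1) eh(1,2)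
      by (simp add: poly_over_pCons)
    then have "eval_hom \<phi> \<xi> h' \<noteq> 0"
      using nz(2) by auto
    then have hne: "eval_hom \<phi> \<xi> h \<noteq> 0" and dne: "eval_hom \<phi> \<xi> (formal_deriv p) \<noteq> 0"
      unfolding h'_def eh(6)[OF h(1) dB] by auto
    have pd: "eval_hom \<phi> \<xi> (formal_deriv p) = poly (pderiv (map_poly \<phi> p)) \<xi>"
      unfolding eval_hom_def using pB(1) unfolding poly_over_def
      by (intro arg_cong2[where f = poly] poly_eqI refl)
        (simp add: coeff_map_poly hom coeff_formal_deriv coeff_pderiv del: of_nat_Suc)
    have "\<exists>\<tau>. \<forall>r. poly_over B r \<and> poly r x \<in> P \<longrightarrow> eval_der \<phi> \<delta> \<xi> \<tau> r = 0"
      if \<delta>: "point_derivation B \<phi> \<delta>" "\<forall>p\<in>B \<inter> P. \<delta> p = 0" for \<delta>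
    proof -
      \<comment> \<open>Implicit differentiation of the relation \<open>p\<close> at the simple root
        \<open>\<xi>\<close>.\<close>
      define \<tau> where "\<tau> = - poly (map_poly \<delta> p) \<xi> / eval_hom \<phi> \<xi> (formal_deriv p)"
      note ed = eval_der[OF B(1) \<phi>(1) \<delta>(1)]
      have dp: "eval_der \<phi> \<delta> \<xi> \<tau> p = 0"
        unfolding eval_der_def \<tau>_def pd[symmetric] using dne by simp
      have powd: "eval_der \<phi> \<delta> \<xi> \<tau> (smult (lead_coeff p ^ m) r) = \<phi> (lead_coeff p) ^ m * eval_der \<phi> \<delta> \<xi> \<tau> r"
        if "poly_over B r" "eval_hom \<phi> \<xi> r = 0" for m r
      proof (induction m)
        case (Suc m)
        then show ?case
          using ed(5)[OF lp(1) cl(4)[OF lp(1) that(1), of m]] pow[OF that(1), of m] that(2) by simp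
      qed simp
      have "eval_der \<phi> \<delta> \<xi> \<tau> r = 0" if r: "poly_over B r" "poly r x \<in> P" for r
      proof -
        obtain m q s where q: "poly_over B q" "poly_over B s" "smult (lead_coeff p ^ m) r = p * q + s"
          and s: "\<forall>i. coeff s i \<in> B \<inter> P"
          using division[OF r] by blast
        have "eval_der \<phi> \<delta> \<xi> \<tau> s = 0"
          using s hom(4) point_derivationD(4)[OF B(1) \<delta>(1)] \<phi>(2) \<delta>(2) by (intro eval_vanish(2)) auto
        then have "\<phi> (lead_coeff p) ^ m * eval_der \<phi> \<delta> \<xi> \<tau> r = 0"
          unfolding powd[OF r(1) van[OF r], symmetric] q(3)
          using ed(3)[OF cl(5)[OF pB(1) q(1)] q(2)] ed(6)[OF pB(1) q(1)] p0 dp by simp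
        then show ?thesis
          using nz(1) by simp
      qed
      then show ?thesis
        by blast
    qed
    then show "\<exists>\<xi>. (\<forall>p. poly_over B p \<and> poly p x \<in> P \<longrightarrow> eval_hom \<phi> \<xi> p = 0) \<and> eval_hom \<phi> \<xi> h \<noteq> 0 \<and>
        (\<forall>\<delta>. point_derivation B \<phi> \<delta> \<longrightarrow> (\<forall>p\<in>B \<inter> P. \<delta> p = 0) \<longrightarrow>
          (\<exists>\<tau>. \<forall>p. poly_over B p \<and> poly p x \<in> P \<longrightarrow> eval_der \<phi> \<delta> \<xi> \<tau> p = 0))"
      using van hne by (intro exI[of _ \<xi>]) blast
  qed
  then show ?thesis
    using b by blast
qed

lemma lifting_adjoin_exists:
  assumes A: "subalg A" and P: "alg_prime A P" and B: "subalg B" "B \<subseteq> A" and x: "x \<in> A"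
    and c: "c \<in> adjoin B x" "c \<notin> P"
  shows "\<exists>b\<in>B. b \<notin> P \<and> lifting P B (adjoin B x) b c"
proof -
  have Pi: "alg_ideal A P"
    using P unfolding alg_prime_def by blast
  obtain h where h: "poly_over B h" "c = poly h x"
    using c(1) unfolding adjoin_def poly_over_def by blast
  show ?thesis
  proof (cases "\<forall>r i. poly_over B r \<longrightarrow> poly r x \<in> P \<longrightarrow> coeff r i \<in> P")
    case True
    then show ?thesis
      using lifting_transcendental[OF A P B x _ h(1)] c(2) h(2) by blast
  next
    case False
    then obtain p where "minimal_relation P B x p"
      using minimal_relation_exists[OF A Pi B x] by blast
    then show ?thesis
      using lifting_algebraic[OF A P B x _ h(1)] c(2) h(2) by blast
  qed
qed

section \<open>Lifting through finitely many generators and the Nullstellensatz\<close>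

lemma subalg_adjoin_list:
  assumes "subalg A" "B \<subseteq> A" "set xs \<subseteq> A" "subalg B"
  shows "subalg (adjoin_list B xs) \<and> adjoin_list B xs \<subseteq> A \<and> B \<subseteq> adjoin_list B xs \<and> set xs \<subseteq> adjoin_list B xs"
  using assms(2-)
proof (induction xs arbitrary: B)
  case (Cons x xs)
  have "x \<in> A"
    using Cons.prems by simp
  note C = subalg_adjoin[OF assms(1) Cons.prems(1) this Cons.prems(3)]
  show ?case
    using Cons.IH[OF C(2) _ C(1)] Cons.prems C by auto
qed simp

text \<open>The element to be kept nonzero is traced back from the last generator to the first. With
  the scalars as \<open>B\<close> this gives the Nullstellensatz, with the pulled back polynomial
  functions on \<open>V\<^sup>*\<close> the submersivity of the orbit map.\<close>

theorem lifting_exists: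
  assumes A: "subalg A" and P: "alg_prime A P" and B: "subalg B" "B \<subseteq> A" and xs: "set xs \<subseteq> A"
    and c: "c \<in> adjoin_list B xs" "c \<notin> P"
  shows "\<exists>b\<in>B. b \<notin> P \<and> lifting P B (adjoin_list B xs) b c"
  using B xs c
proof (induction xs arbitrary: B)
  case Nil
  have "lifting P B B c c"
    unfolding lifting_def using lifts_refl by blast
  then show ?case
    using Nil by auto
next
  case (Cons x xs)
  have x: "x \<in> A"
    using Cons.prems by simp
  note C = subalg_adjoin[OF A Cons.prems(2) x Cons.prems(1)]
  obtain b' where b': "b' \<in> adjoin B x" "b' \<notin> P" "lifting P (adjoin B x) (adjoin_list (adjoin B x) xs) b' c"
    using Cons.IH[OF C(1,2)] Cons.prems by auto
  obtain b where "b \<in> B" "b \<notin> P" "lifting P B (adjoin B x) b b'"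
    using lifting_adjoin_exists[OF A P Cons.prems(1,2) x b'(1,2)] by blast
  then show ?case
    using lifting_trans[OF _ b'(3) C(3)] by auto
qed

text \<open>An ideal maximal among those that contain \<open>J\<close> and avoid \<open>S\<close> is
  prime; this replaces localisation at \<open>S\<close>.\<close>

lemma prime_avoiding_exists:
  assumes A: "subalg A" and J: "alg_ideal A J" and S: "S \<subseteq> A" "S \<noteq> {}" "\<And>f g. f \<in> S \<Longrightarrow> g \<in> S \<Longrightarrow> f * g \<in> S"
    and disj: "J \<inter> S = {}"
  shows "\<exists>P. alg_prime A P \<and> J \<subseteq> P \<and> P \<inter> S = {}"
proof -
  define \<I> where "\<I> = {I. alg_ideal A I \<and> J \<subseteq> I \<and> I \<inter> S = {}}"
  have "\<exists>M\<in>\<I>. \<forall>X\<in>\<I>. M \<subseteq> X \<longrightarrow> X = M"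
  proof (rule subset_Zorn_nonempty)
    show "\<I> \<noteq> {}"
      using J disj unfolding \<I>_def by blast
    fix \<C> assume ne: "\<C> \<noteq> {}" and ch: "subset.chain \<I> \<C>"
    have \<C>: "\<And>I. I \<in> \<C> \<Longrightarrow> alg_ideal A I \<and> J \<subseteq> I \<and> I \<inter> S = {}"
      using ch unfolding subset.chain_def \<I>_def by blast
    have "alg_ideal A (\<Union>\<C>)"
      unfolding alg_ideal_def
    proof (intro conjI ballI)
      show "\<Union>\<C> \<subseteq> A" "0 \<in> \<Union>\<C>"
        using \<C> ne unfolding alg_ideal_def by blast+
      fix f g assume "f \<in> \<Union>\<C>" "g \<in> \<Union>\<C>"
      then obtain I I' where I: "I \<in> \<C>" "I' \<in> \<C>" "f \<in> I" "g \<in> I'"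
        by blast
      then have "I \<subseteq> I' \<or> I' \<subseteq> I"
        using ch unfolding subset.chain_def by blast
      then show "f + g \<in> \<Union>\<C>"
        using I \<C> unfolding alg_ideal_def by (metis UnionI subsetD)
    next
      fix a f assume "a \<in> A" "f \<in> \<Union>\<C>"
      then show "a * f \<in> \<Union>\<C>"
        using \<C> unfolding alg_ideal_def by blast
    qed
    then show "\<Union>\<C> \<in> \<I>"
      using \<C> ne unfolding \<I>_def by blast
  qed
  then obtain P where P: "P \<in> \<I>" and max: "\<And>X. X \<in> \<I> \<Longrightarrow> P \<subseteq> X \<Longrightarrow> X = P"
    by blast
  then have Pi: "alg_ideal A P" and JP: "J \<subseteq> P" and PS: "P \<inter> S = {}"
    unfolding \<I>_def by auto
  note I = alg_idealD[OF A Pi] and cl = subalgD[OF A]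
  have meets: "\<exists>p\<in>P. \<exists>a\<in>A. p + a * f \<in> S" if f: "f \<in> A" "f \<notin> P" for f
  proof -
    define X where "X = {p + a * f | p a. p \<in> P \<and> a \<in> A}"
    have "alg_ideal A X"
      unfolding alg_ideal_def
    proof (intro conjI ballI)
      show "X \<subseteq> A"
        unfolding X_def using f I cl by auto
      show "0 \<in> X"
        unfolding X_def using I(2) cl(5) by (auto intro!: exI[of _ 0])
    next
      fix u v assume "u \<in> X" "v \<in> X"
      then obtain p a q b where "p \<in> P" "a \<in> A" "q \<in> P" "b \<in> A" "u = p + a * f" "v = q + b * f"
        unfolding X_def by blast
      then have "u + v = (p + q) + (a + b) * f" "p + q \<in> P" "a + b \<in> A"
        using I(3) cl(2) by (simp_all add: algebra_simps)
      then show "u + v \<in> X"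
        unfolding X_def by blast
    next
      fix c u assume "c \<in> A" "u \<in> X"
      then obtain p a where "p \<in> P" "a \<in> A" "u = p + a * f"
        unfolding X_def by blast
      then have "c * u = c * p + (c * a) * f" "c * p \<in> P" "c * a \<in> A"
        using I(4) cl(3) \<open>c \<in> A\<close> by (simp_all add: algebra_simps)
      then show "c * u \<in> X"
        unfolding X_def by blast
    qed
    moreover have "P \<subseteq> X"
    proof
      fix p assume "p \<in> P"
      then have "p + 0 * f \<in> X"
        unfolding X_def using cl(5) by blast
      then show "p \<in> X"
        by simp
    qed
    moreover have "0 + \<kappa> 1 * f \<in> X"
      unfolding X_def using I(2) cl(1) by blast
    then have "f \<in> X"
      using cl(4)[OF f(1)] by simp
    ultimately have "X \<inter> S \<noteq> {}"
      using max[of X] JP f(2) unfolding \<I>_def by blast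
    then show ?thesis
      unfolding X_def by blast
  qed
  have "alg_prime A P"
    unfolding alg_prime_def
  proof (intro conjI ballI impI Pi)
    show "\<kappa> 1 \<notin> P"
    proof
      assume k: "\<kappa> 1 \<in> P"
      obtain s where s: "s \<in> S"
        using S(2) by blast
      have "s * \<kappa> 1 \<in> P"
        using S(1) s k by (intro I(4)) auto
      then show False
        using cl(4)[of s] s S(1) PS by (metis IntI empty_iff mult.commute subsetD)
    qed
    fix f g assume fg: "f \<in> A" "g \<in> A" "f * g \<in> P"
    show "f \<in> P \<or> g \<in> P"
    proof (rule ccontr)
      assume "\<not> (f \<in> P \<or> g \<in> P)"
      then obtain p a q b where s: "p \<in> P" "a \<in> A" "p + a * f \<in> S" "q \<in> P" "b \<in> A" "q + b * g \<in> S"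
        using meets fg(1,2) by meson
      have "(p + a * f) * (q + b * g) = (q + b * g) * p + (a * f) * q + (a * b) * (f * g)"
        by (simp add: algebra_simps)
      also have "\<dots> \<in> P"
      proof -
        have "q + b * g \<in> A" "a * f \<in> A" "a * b \<in> A"
          using s fg S(1) cl(3) by auto
        then show ?thesis
          using s fg(3) by (simp add: I)
      qed
      finally show False
        using S(3)[OF s(3,6)] PS by blast
    qed
  qed
  then show ?thesis
    using JP PS by blast
qed

text \<open>Take a prime over \<open>J\<close> that avoids the powers of \<open>f\<close> and lift
  from the scalars. These have a single point, and \<open>b\<close> is a nonzero scalar, so it
  excludes nothing.\<close>

theorem nullstellensatz:
  assumes A: "subalg A" "A = adjoin_list (range \<kappa>) xs" "set xs \<subseteq> A" and J: "alg_ideal A J"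
    and f: "f \<in> A" "\<And>n. f ^ Suc n \<notin> J"
  shows "\<exists>\<phi>. alg_hom A \<phi> \<and> (\<forall>p\<in>J. \<phi> p = 0) \<and> \<phi> f \<noteq> 0"
proof -
  \<comment> \<open>Powers start with exponent 1: \<open>f ^ 0\<close> is the unit of the ambient
    ring, which need not lie in \<open>A\<close>.\<close>
  let ?S = "range (\<lambda>n. f ^ Suc n)"
  have pow: "f ^ Suc n \<in> A" for n
    by (induction n) (use f(1) subalgD(3)[OF A(1)] in auto)
  have mult: "g * h \<in> ?S" if gh: "g \<in> ?S" "h \<in> ?S" for g h
  proof -
    obtain m where "g = f ^ Suc m"
      using gh(1) by (auto simp del: power_Suc)
    moreover obtain n where "h = f ^ Suc n"
      using gh(2) by (auto simp del: power_Suc)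
    ultimately have "g * h = f ^ Suc (m + Suc n)"
      by (simp add: power_add)
    then show ?thesis
      by blast
  qed
  have "\<exists>P. alg_prime A P \<and> J \<subseteq> P \<and> P \<inter> ?S = {}"
    by (rule prime_avoiding_exists[OF A(1) J]) (use pow mult f(2) in auto)
  then obtain P where P: "alg_prime A P" "J \<subseteq> P" "P \<inter> ?S = {}"
    by blast
  then have Pi: "alg_ideal A P" and k1: "\<kappa> 1 \<notin> P"
    unfolding alg_prime_def by auto
  have "f ^ Suc 0 \<in> ?S"
    by blast
  then have fP: "f \<notin> P"
    using P(3) by auto
  have unit: "\<kappa> c \<in> P \<Longrightarrow> c = 0" for c
    using alg_idealD(4)[OF A(1) Pi subalgD(1)[OF A(1)], of "\<kappa> c" "inverse c"] k1
    by (cases "c = 0") (auto simp: \<kappa>_mult[symmetric])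
  have inj: "\<kappa> c = \<kappa> d \<Longrightarrow> c = d" for c d
    using unit[of "c - d"] \<kappa>_add[of "c - d" d] alg_idealD(2)[OF A(1) Pi] by simp
  define \<phi> where "\<phi> = inv_into UNIV \<kappa>"
  have \<phi>: "\<phi> (\<kappa> c) = c" for c
    unfolding \<phi>_def by (rule inv_into_f_f) (use inj in \<open>auto simp: inj_on_def\<close>)
  have K: "subalg (range \<kappa>)" "range \<kappa> \<subseteq> A"
    unfolding subalg_def using subalgD(1)[OF A(1)]
    by (auto simp: \<kappa>_add[symmetric] \<kappa>_mult[symmetric])
  obtain b where b: "b \<in> range \<kappa>" "b \<notin> P" "lifting P (range \<kappa>) A b f"
    using lifting_exists[OF A(1) P(1) K A(3)] f(1) fP A(2) by blast
  obtain c where c: "b = \<kappa> c"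
    using b(1) by blast
  have "alg_hom (range \<kappa>) \<phi>"
    unfolding alg_hom_def using \<phi> by (auto simp: \<kappa>_add[symmetric] \<kappa>_mult[symmetric])
  moreover have "\<forall>p\<in>range \<kappa> \<inter> P. \<phi> p = 0"
    using \<phi> unit by auto
  moreover have "\<phi> b \<noteq> 0"
    using b(2) alg_idealD(2)[OF A(1) Pi] unfolding c \<phi> by (auto simp: \<kappa>_0)
  ultimately obtain \<phi>' where "lifts P (range \<kappa>) A \<phi> \<phi>'" "\<phi>' f \<noteq> 0"
    using b(3) unfolding lifting_def by blast
  then show ?thesis
    using liftsD(1,2) P(2) alg_idealD(1)[OF A(1) J] by (intro exI[of _ \<phi>']) (auto simp: subset_iff)
qed

end

section \<open>Affine algebraic groups and their Lie algebras\<close>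

text \<open>Each functional cuts the dimension by at most one, and all of them together leave
  nothing.\<close>

lemma (in vector_space) finite_dimensional_by_functionals:
  fixes f :: "'i \<Rightarrow> 'b \<Rightarrow> 'a"
  assumes "finite I" "subspace X"
    and "\<And>i x y. i \<in> I \<Longrightarrow> x \<in> X \<Longrightarrow> y \<in> X \<Longrightarrow> f i (x + y) = f i x + f i y"
    and "\<And>i c x. i \<in> I \<Longrightarrow> x \<in> X \<Longrightarrow> f i (scale c x) = c * f i x"
    and "\<And>x. x \<in> X \<Longrightarrow> (\<forall>i\<in>I. f i x = 0) \<Longrightarrow> x = 0"
  shows "\<exists>B. finite B \<and> X \<subseteq> span B"
  using assms
proof (induction I arbitrary: X rule: finite_induct)
  case empty
  then have "X \<subseteq> span {}"
    by auto
  then show ?case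
    by blast
next
  case (insert j I)
  note X = subspace_0[OF insert.prems(1)] subspace_add[OF insert.prems(1)] subspace_scale[OF insert.prems(1)]
  note fadd = insert.prems(2) and fscale = insert.prems(3) and ker = insert.prems(4)
  define Y where "Y = {x \<in> X. f j x = 0}"
  have "f j 0 = 0"
    using fscale[of j 0 0] X by simp
  then have "subspace Y"
    unfolding Y_def subspace_def using X fadd fscale by simp
  then have "\<exists>B. finite B \<and> Y \<subseteq> span B"
    by (rule insert.IH) (use fadd fscale ker in \<open>auto simp: Y_def\<close>)
  then obtain B where B: "finite B" "Y \<subseteq> span B"
    by blast
  show ?case
  proof (cases "\<forall>x\<in>X. f j x = 0")
    case True
    then show ?thesis
      using B by (auto simp: Y_def)
  next
    case False
    then obtain z where z: "z \<in> X" "f j z \<noteq> 0"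
      by blast
    have "X \<subseteq> span (insert z B)"
    proof
      fix x assume x: "x \<in> X"
      define c where "c = - (f j x / f j z)"
      have "f j (x + scale c z) = 0" "x + scale c z \<in> X"
        using x z X fadd[of j x "scale c z"] fscale[of j z c] by (simp_all add: c_def del: scale_minus_left)
      then have "x + scale c z \<in> span (insert z B)"
        using B(2) span_mono[of B "insert z B"] unfolding Y_def by blast
      then have "(x + scale c z) - scale c z \<in> span (insert z B)"
        by (intro span_diff span_scale) (auto intro: span_base)
      then show "x \<in> span (insert z B)"
        by simp
    qed
    then show ?thesis
      using B(1) by blast
  qed
qed

lemma zariski_basic_open:
  assumes F: "\<And>f g. f \<in> A \<Longrightarrow> g \<in> A \<Longrightarrow> f * g \<in> A"
    and U: "openin (zariski X A) U" and x: "x \<in> U"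
  shows "\<exists>f\<in>A. f x \<noteq> 0 \<and> {y \<in> X. f y \<noteq> 0} \<subseteq> U"
proof -
  have "generate_topology_on ((\<lambda>f. {x \<in> X. f x \<noteq> 0}) ` A) U"
    using U unfolding zariski_def by (rule openin_topology_generated_by)
  then show ?thesis
    using x
  proof (induction rule: generate_topology_on.induct)
    case (Int a b)
    then obtain f g where "f \<in> A" "f x \<noteq> 0" "{y \<in> X. f y \<noteq> 0} \<subseteq> a"
      "g \<in> A" "g x \<noteq> 0" "{y \<in> X. g y \<noteq> 0} \<subseteq> b"
      by blast
    then show ?case
      using F by (intro bexI[of _ "f * g"]) auto
  next
    case (UN K)
    then obtain k where k: "k \<in> K" "x \<in> k"
      by blast
    show ?case
      using UN.IH[OF k] k(1) by blast
  qed auto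
qed

locale algebraic_group =
  fixes G :: "'g monoid" (structure)
    and A :: "('g \<Rightarrow> 'k::{alg_closed_field, field_char_0}) set"
  assumes aff: "affine_algebraic_group G A"
begin

abbreviation X where "X \<equiv> carrier G"

sublocale group G
  using aff unfolding affine_algebraic_group_def by blast

lemma A_generated: "\<exists>F. finite F \<and> A = generated_algebra X F"
  using aff unfolding affine_algebraic_group_def affine_variety_def by blast

lemma A_const: "restr X (\<lambda>_. c) \<in> A"
  and A_add: "f \<in> A \<Longrightarrow> g \<in> A \<Longrightarrow> f + g \<in> A"
  and A_mult: "f \<in> A \<Longrightarrow> g \<in> A \<Longrightarrow> f * g \<in> A"
  and A_scale: "f \<in> A \<Longrightarrow> (\<lambda>x. c * f x) \<in> A"
  and A_diff: "f \<in> A \<Longrightarrow> g \<in> A \<Longrightarrow> f - g \<in> A"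
proof -
  obtain F where A: "A = generated_algebra X F"
    using A_generated by blast
  show "restr X (\<lambda>_. c) \<in> A" "f \<in> A \<Longrightarrow> g \<in> A \<Longrightarrow> f + g \<in> A" "f \<in> A \<Longrightarrow> g \<in> A \<Longrightarrow> f * g \<in> A"
    "f \<in> A \<Longrightarrow> (\<lambda>x. c * f x) \<in> A" "f \<in> A \<Longrightarrow> g \<in> A \<Longrightarrow> f - g \<in> A"
    unfolding A by (fact generated_algebra.const generated_algebra.add generated_algebra.mult
      generated_algebra_scale generated_algebra_diff)+
qed

lemma A_zero: "0 \<in> A"
  using A_const[of 0] by (simp add: zero_fun_def)

lemma A_outside: "f \<in> A \<Longrightarrow> x \<notin> X \<Longrightarrow> f x = 0"
proof -
  obtain F where A: "A = generated_algebra X F"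
    using A_generated by blast
  assume "f \<in> A" "x \<notin> X"
  then show "f x = 0"
    unfolding A by (induction rule: generated_algebra.induct) simp_all
qed

lemma A_restr: "f \<in> A \<Longrightarrow> restr X f = f"
  by (rule ext) (simp add: A_outside)

lemma A_eqI: "f \<in> A \<Longrightarrow> g \<in> A \<Longrightarrow> (\<And>x. x \<in> X \<Longrightarrow> f x = g x) \<Longrightarrow> f = g"
  by (rule ext) (metis A_outside)

lemma A_sum_outside:
  "(\<And>i. i < (n::nat) \<Longrightarrow> b i \<in> A) \<Longrightarrow> x \<notin> X \<Longrightarrow> (\<Sum>i<n. c i * b i x) = 0"
  by (simp add: A_outside)

lemma A_sum:
  assumes "\<And>i. i < (n::nat) \<Longrightarrow> f i \<in> A"
  shows "(\<lambda>x. \<Sum>i<n. c i * f i x) \<in> A"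
proof -
  obtain F where A: "A = generated_algebra X F"
    using A_generated by blast
  show ?thesis
    using assms unfolding A by (rule generated_algebra_sum)
qed

sublocale scalars "\<lambda>c::'k. restr X (\<lambda>_. c)"
  by unfold_locales (auto simp: fun_eq_iff)

lemma subalg_A: "subalg A"
  unfolding subalg_def using A_const A_add A_mult A_outside by (auto simp: fun_eq_iff)

lemma adjoin_generators:
  assumes "A = generated_algebra X F" "set xs = restr X ` F" "subalg B" "B \<subseteq> A"
  shows "adjoin_list B xs = A" "set xs \<subseteq> A"
proof -
  show xs: "set xs \<subseteq> A"
    using assms(1,2) generated_algebra.gen by fastforce
  note C = subalg_adjoin_list[OF subalg_A assms(4) xs assms(3)]
  have "f \<in> adjoin_list B xs" if "f \<in> generated_algebra X F" for f
    using that
  proof (induction rule: generated_algebra.induct)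
    case (const c)
    show ?case
      using C subalgD(1) by blast
  next
    case (gen f)
    then show ?case
      using C assms(2) by blast
  qed (use C subalgD(2,3) in blast)+
  then show "adjoin_list B xs = A"
    using C assms(1) by blast
qed

subsection \<open>Regular functions of two variables\<close>

text \<open>Membership in \<open>product_ring A A\<close>, with values off
  \<open>X \<times> X\<close> ignored so that composed functions need not be cut off.\<close>

definition biregular :: "('g \<Rightarrow> 'g \<Rightarrow> 'k) \<Rightarrow> bool" where
  "biregular F \<longleftrightarrow> (\<exists>(n::nat) a b. (\<forall>i<n. a i \<in> A \<and> b i \<in> A) \<and>
     (\<forall>x\<in>X. \<forall>y\<in>X. F x y = (\<Sum>i<n. a i x * b i y)))"

lemma biregularI:
  assumes "\<And>i. i < n \<Longrightarrow> a i \<in> A" "\<And>i. i < n \<Longrightarrow> b i \<in> A"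
    "\<And>x y. x \<in> X \<Longrightarrow> y \<in> X \<Longrightarrow> F x y = (\<Sum>i<(n::nat). a i x * b i y)"
  shows "biregular F"
  unfolding biregular_def using assms by blast

lemma biregularE:
  assumes "biregular F"
  obtains n :: nat and a b where "\<And>i. i < n \<Longrightarrow> a i \<in> A" "\<And>i. i < n \<Longrightarrow> b i \<in> A"
    "\<And>x y. x \<in> X \<Longrightarrow> y \<in> X \<Longrightarrow> F x y = (\<Sum>i<n. a i x * b i y)"
  using assms unfolding biregular_def by blast

lemma biregular_swap: "biregular F \<Longrightarrow> biregular (\<lambda>x y. F y x)"
proof (elim biregularE)
  fix n :: nat and a b
  assume "\<And>i. i < n \<Longrightarrow> a i \<in> A" "\<And>i. i < n \<Longrightarrow> b i \<in> A"
    "\<And>x y. x \<in> X \<Longrightarrow> y \<in> X \<Longrightarrow> F x y = (\<Sum>i<n. a i x * b i y)"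
  then show ?thesis
    by (intro biregularI[where a = b and b = a]) (auto simp: mult.commute)
qed

lemma inverse_regular: "f \<in> A \<Longrightarrow> restr X (\<lambda>x. f (inv x)) \<in> A"
  using aff unfolding affine_algebraic_group_def morphism_def by blast

lemma biregular_inverse: "biregular F \<Longrightarrow> biregular (\<lambda>x y. F (inv x) y)"
proof (elim biregularE)
  fix n :: nat and a b
  assume "\<And>i. i < n \<Longrightarrow> a i \<in> A" "\<And>i. i < n \<Longrightarrow> b i \<in> A"
    "\<And>x y. x \<in> X \<Longrightarrow> y \<in> X \<Longrightarrow> F x y = (\<Sum>i<n. a i x * b i y)"
  then show ?thesis
    using inverse_regular by (intro biregularI[where a = "\<lambda>i. restr X (\<lambda>x. a i (inv x))" and b = b]) auto
qed

lemma biregular_mult: "f \<in> A \<Longrightarrow> biregular (\<lambda>x y. f (x \<otimes> y))"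
proof -
  assume "f \<in> A"
  then have "restr (X \<times> X) (\<lambda>p. f ((\<lambda>(x, y). x \<otimes> y) p)) \<in> product_ring A A"
    using aff unfolding affine_algebraic_group_def morphism_def by blast
  then obtain n :: nat and a b where ab: "\<forall>i<n. a i \<in> A \<and> b i \<in> A"
    and eq: "restr (X \<times> X) (\<lambda>p. f ((\<lambda>(x, y). x \<otimes> y) p)) = (\<lambda>(x, y). \<Sum>i<n. a i x * b i y)"
    unfolding product_ring_def by blast
  show ?thesis
  proof (rule biregularI)
    show "f (x \<otimes> y) = (\<Sum>i<n. a i x * b i y)" if "x \<in> X" "y \<in> X" for x y
      using fun_cong[OF eq, of "(x, y)"] that by simp
  qed (use ab in auto)
qed

lemma biregular_left: "biregular F \<Longrightarrow> x \<in> X \<Longrightarrow> restr X (F x) \<in> A"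
proof (elim biregularE)
  fix n :: nat and a b
  assume x: "x \<in> X" and F: "\<And>i. i < n \<Longrightarrow> a i \<in> A" "\<And>i. i < n \<Longrightarrow> b i \<in> A"
    "\<And>x y. x \<in> X \<Longrightarrow> y \<in> X \<Longrightarrow> F x y = (\<Sum>i<n. a i x * b i y)"
  have "restr X (F x) = (\<lambda>y. \<Sum>i<n. a i x * b i y)"
    using x F A_sum_outside[OF F(2)] by (auto simp: fun_eq_iff)
  then show ?thesis
    using A_sum[of n b "\<lambda>i. a i x"] F by simp
qed

lemma biregular_right: "biregular F \<Longrightarrow> y \<in> X \<Longrightarrow> restr X (\<lambda>x. F x y) \<in> A"
  using biregular_left[of "\<lambda>x y. F y x" y] biregular_swap[of F] by simp

lemma biregular_diagonal: "biregular F \<Longrightarrow> restr X (\<lambda>x. F x x) \<in> A"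
proof (elim biregularE)
  fix n :: nat and a b
  assume F: "\<And>i. i < n \<Longrightarrow> a i \<in> A" "\<And>i. i < n \<Longrightarrow> b i \<in> A"
    "\<And>x y. x \<in> X \<Longrightarrow> y \<in> X \<Longrightarrow> F x y = (\<Sum>i<n. a i x * b i y)"
  have "restr X (\<lambda>x. F x x) = (\<lambda>x. \<Sum>i<n. 1 * (a i * b i) x)"
    using F A_sum_outside[OF F(2)] by (auto simp: fun_eq_iff)
  then show ?thesis
    using A_sum[of n "\<lambda>i. a i * b i" "\<lambda>_. 1"] F A_mult by simp
qed

definition linear_on_A :: "(('g \<Rightarrow> 'k) \<Rightarrow> 'k) \<Rightarrow> bool" where
  "linear_on_A t \<longleftrightarrow> (\<forall>f\<in>A. \<forall>g\<in>A. t (f + g) = t f + t g) \<and> (\<forall>c. \<forall>f\<in>A. t (\<lambda>x. c * f x) = c * t f)"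

definition tangent :: "'g \<Rightarrow> (('g \<Rightarrow> 'k) \<Rightarrow> 'k) \<Rightarrow> bool" where
  "tangent x t \<longleftrightarrow> linear_on_A t \<and> (\<forall>f\<in>A. \<forall>g\<in>A. t (f * g) = t f * g x + f x * t g)"

lemma linear_on_AD:
  assumes "linear_on_A t"
  shows "f \<in> A \<Longrightarrow> g \<in> A \<Longrightarrow> t (f + g) = t f + t g" "f \<in> A \<Longrightarrow> t (\<lambda>x. c * f x) = c * t f"
    "t 0 = 0" "f \<in> A \<Longrightarrow> g \<in> A \<Longrightarrow> t (f - g) = t f - t g"
proof -
  show add: "f \<in> A \<Longrightarrow> g \<in> A \<Longrightarrow> t (f + g) = t f + t g" for f g
    using assms unfolding linear_on_A_def by blast
  show "f \<in> A \<Longrightarrow> t (\<lambda>x. c * f x) = c * t f" for f c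
    using assms unfolding linear_on_A_def by blast
  show "t 0 = 0"
    using add[OF A_zero A_zero] by simp
  show "f \<in> A \<Longrightarrow> g \<in> A \<Longrightarrow> t (f - g) = t f - t g"
    using add[of "f - g" g] A_diff by simp
qed

lemma linear_on_A_sum:
  assumes t: "linear_on_A t" and f: "\<And>i. i < (n::nat) \<Longrightarrow> f i \<in> A"
  shows "t (\<lambda>x. \<Sum>i<n. c i * f i x) = (\<Sum>i<n. c i * t (f i))"
  using f
proof (induction n)
  case 0
  then show ?case
    using linear_on_AD(3)[OF t] by (simp add: zero_fun_def)
next
  case (Suc n)
  have "(\<lambda>x. \<Sum>i<Suc n. c i * f i x) = (\<lambda>x. \<Sum>i<n. c i * f i x) + (\<lambda>x. c n * f n x)"
    by (simp add: fun_eq_iff)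
  moreover have "(\<lambda>x. \<Sum>i<n. c i * f i x) \<in> A"
    using Suc.prems by (intro A_sum) simp
  moreover have "(\<lambda>x. c n * f n x) \<in> A"
    using Suc.prems by (intro A_scale) simp
  ultimately show ?case
    using Suc linear_on_AD(1,2)[OF t] by simp
qed

lemma biregular_apply:
  assumes t: "linear_on_A t" and ab: "\<And>i. i < n \<Longrightarrow> a i \<in> A" "\<And>i. i < n \<Longrightarrow> b i \<in> A"
    "\<And>x y. x \<in> X \<Longrightarrow> y \<in> X \<Longrightarrow> F x y = (\<Sum>i<(n::nat). a i x * b i y)" and x: "x \<in> X"
  shows "t (restr X (F x)) = (\<Sum>i<n. t (b i) * a i x)"
proof -
  have "restr X (F x) = (\<lambda>y. \<Sum>i<n. a i x * b i y)"
    using x ab A_sum_outside[OF ab(2)] by (auto simp: fun_eq_iff)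
  then show ?thesis
    using linear_on_A_sum[OF t, of n b "\<lambda>i. a i x"] ab by (simp add: mult.commute)
qed

lemma biregular_slice:
  assumes "biregular F" and t: "linear_on_A t"
  shows "restr X (\<lambda>x. t (restr X (F x))) \<in> A"
  using assms(1)
proof (elim biregularE)
  fix n :: nat and a b
  assume F: "\<And>i. i < n \<Longrightarrow> a i \<in> A" "\<And>i. i < n \<Longrightarrow> b i \<in> A"
    "\<And>x y. x \<in> X \<Longrightarrow> y \<in> X \<Longrightarrow> F x y = (\<Sum>i<n. a i x * b i y)"
  have "restr X (\<lambda>x. t (restr X (F x))) = (\<lambda>x. \<Sum>i<n. t (b i) * a i x)"
    using biregular_apply[OF t F] A_sum_outside[OF F(1)] by (auto simp: fun_eq_iff)
  then show ?thesis
    using A_sum[of n a "\<lambda>i. t (b i)"] F by simp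
qed

text \<open>Both sides are the sum of \<open>s (a i) * t (b i)\<close> for a representation of
  \<open>F\<close>.\<close>

lemma biregular_fubini:
  assumes "biregular F" and s: "linear_on_A s" and t: "linear_on_A t"
  shows "s (restr X (\<lambda>x. t (restr X (F x)))) = t (restr X (\<lambda>y. s (restr X (\<lambda>x. F x y))))"
  using assms(1)
proof (elim biregularE)
  fix n :: nat and a b
  assume F: "\<And>i. i < n \<Longrightarrow> a i \<in> A" "\<And>i. i < n \<Longrightarrow> b i \<in> A"
    "\<And>x y. x \<in> X \<Longrightarrow> y \<in> X \<Longrightarrow> F x y = (\<Sum>i<n. a i x * b i y)"
  then have F': "\<And>x y. x \<in> X \<Longrightarrow> y \<in> X \<Longrightarrow> F y x = (\<Sum>i<n. b i x * a i y)"
    by (simp add: mult.commute)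
  have 1: "restr X (\<lambda>x. t (restr X (F x))) = (\<lambda>x. \<Sum>i<n. t (b i) * a i x)"
    using biregular_apply[OF t F] A_sum_outside[OF F(1)] by (auto simp: fun_eq_iff)
  have 2: "restr X (\<lambda>y. s (restr X (\<lambda>x. F x y))) = (\<lambda>y. \<Sum>i<n. s (a i) * b i y)"
    using biregular_apply[OF s F(2,1) F'] A_sum_outside[OF F(2)] by (auto simp: fun_eq_iff)
  show ?thesis
  proof -
    have "s (\<lambda>x. \<Sum>i<n. t (b i) * a i x) = (\<Sum>i<n. t (b i) * s (a i))"
      using F(1) by (intro linear_on_A_sum[OF s])
    moreover have "t (\<lambda>y. \<Sum>i<n. s (a i) * b i y) = (\<Sum>i<n. s (a i) * t (b i))"
      using F(2) by (intro linear_on_A_sum[OF t])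
    ultimately show ?thesis
      unfolding 1 2 by (simp add: mult.commute)
  qed
qed

lemma tangentD:
  assumes "tangent x t"
  shows "linear_on_A t" "f \<in> A \<Longrightarrow> g \<in> A \<Longrightarrow> t (f * g) = t f * g x + f x * t g"
  using assms unfolding tangent_def by blast+

lemma tangent_const:
  assumes "tangent x t" "x \<in> X"
  shows "t (restr X (\<lambda>_. c)) = 0"
proof -
  have e: "restr X (\<lambda>_. 1) * restr X (\<lambda>_. 1) = (restr X (\<lambda>_. 1) :: 'g \<Rightarrow> 'k)"
    by (auto simp: fun_eq_iff)
  then have "t (restr X (\<lambda>_. 1)) = t (restr X (\<lambda>_. 1)) + t (restr X (\<lambda>_. 1))"
    using tangentD(2)[OF assms(1) A_const A_const, of 1 1] assms(2) by simp
  then have "t (restr X (\<lambda>_. 1)) = 0"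
    by simp
  moreover have "restr X (\<lambda>_. c) = (\<lambda>y. c * restr X (\<lambda>_. 1) y)"
    by (auto simp: fun_eq_iff)
  ultimately show ?thesis
    using linear_on_AD(2)[OF tangentD(1)[OF assms(1)] A_const] by simp
qed

text \<open>The sum of the two partial derivatives, from the Leibniz rule on each
  \<open>a i * b i\<close>. The derivatives of inversion, of the adjoint action and of the
  factorisation in a semi-direct product all come from this.\<close>

lemma tangent_diagonal:
  assumes "biregular F" and t: "tangent x t" and x: "x \<in> X"
  shows "t (restr X (\<lambda>y. F y y)) = t (restr X (\<lambda>y. F y x)) + t (restr X (F x))"
  using assms(1)
proof (elim biregularE)
  fix n :: nat and a b
  assume F: "\<And>i. i < n \<Longrightarrow> a i \<in> A" "\<And>i. i < n \<Longrightarrow> b i \<in> A"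
    "\<And>x y. x \<in> X \<Longrightarrow> y \<in> X \<Longrightarrow> F x y = (\<Sum>i<n. a i x * b i y)"
  then have F': "\<And>x y. x \<in> X \<Longrightarrow> y \<in> X \<Longrightarrow> F y x = (\<Sum>i<n. b i x * a i y)"
    by (simp add: mult.commute)
  note lin = tangentD(1)[OF t]
  have "restr X (\<lambda>x. F x x) = (\<lambda>x. \<Sum>i<n. 1 * (a i * b i) x)"
    using F A_sum_outside[OF F(2)] by (auto simp: fun_eq_iff)
  then have "t (restr X (\<lambda>y. F y y)) = (\<Sum>i<n. t (a i * b i))"
    using linear_on_A_sum[OF lin, of n "\<lambda>i. a i * b i" "\<lambda>_. 1"] F A_mult by simp
  also have "\<dots> = (\<Sum>i<n. t (a i) * b i x) + (\<Sum>i<n. t (b i) * a i x)"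
    unfolding sum.distrib[symmetric] by (rule sum.cong) (use F tangentD(2)[OF t] in \<open>auto simp: mult.commute\<close>)
  also have "\<dots> = t (restr X (\<lambda>y. F y x)) + t (restr X (F x))"
    using biregular_apply[OF lin F x] biregular_apply[OF lin F(2,1) F' x] by simp
  finally show ?thesis .
qed

text \<open>Differentiate the constant function \<open>f (inv y \<otimes> y)\<close>.\<close>

lemma tangent_inverse:
  assumes t: "tangent \<one> t" and f: "f \<in> A"
  shows "t (restr X (\<lambda>x. f (inv x))) = - t f"
proof -
  have "biregular (\<lambda>x y. f (inv x \<otimes> y))"
    using biregular_inverse[OF biregular_mult[OF f]] by simp
  then have "t (restr X (\<lambda>y. f (inv y \<otimes> y))) =
      t (restr X (\<lambda>y. f (inv y \<otimes> \<one>))) + t (restr X (\<lambda>y. f (inv \<one> \<otimes> y)))"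
    by (rule tangent_diagonal[OF _ t one_closed])
  moreover have "restr X (\<lambda>y. f (inv y \<otimes> y)) = restr X (\<lambda>_. f \<one>)"
    "restr X (\<lambda>y. f (inv y \<otimes> \<one>)) = restr X (\<lambda>y. f (inv y))"
    "restr X (\<lambda>y. f (inv \<one> \<otimes> y)) = restr X f"
    by (auto simp: fun_eq_iff)
  ultimately show ?thesis
    using tangent_const[OF t one_closed, of "f \<one>"] A_restr[OF f] by (simp add: eq_neg_iff_add_eq_0)
qed

subsection \<open>Left-invariant derivations\<close>

abbreviation "ltr x f \<equiv> restr X (\<lambda>y. f (x \<otimes> y))"
abbreviation "rtr \<equiv> right_translation G"
abbreviation "ctr x f \<equiv> restr X (\<lambda>y. f (x \<otimes> y \<otimes> inv x))"

lemma rtr_eq: "rtr x f = restr X (\<lambda>y. f (y \<otimes> x))"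
  by (simp add: right_translation_def)

lemma rtr_linear:
  "rtr x (f + g) = rtr x f + rtr x g" "rtr x (f - g) = rtr x f - (rtr x g :: 'g \<Rightarrow> 'k)"
  "rtr x (f * g) = rtr x f * rtr x g" "rtr x (\<lambda>y. c * f y) = (\<lambda>y. c * rtr x f y)"
  by (auto simp: rtr_eq fun_eq_iff)

lemma ltr_A: "f \<in> A \<Longrightarrow> x \<in> X \<Longrightarrow> ltr x f \<in> A"
  and rtr_A: "f \<in> A \<Longrightarrow> x \<in> X \<Longrightarrow> rtr x f \<in> A"
  using biregular_left[OF biregular_mult] biregular_right[OF biregular_mult] by (simp_all add: rtr_eq)

lemma ctr_eq: "x \<in> X \<Longrightarrow> ctr x f = ltr x (rtr (inv x) f)"
  by (auto simp: fun_eq_iff rtr_eq)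

lemma ctr_A: "f \<in> A \<Longrightarrow> x \<in> X \<Longrightarrow> ctr x f \<in> A"
  unfolding ctr_eq by (intro ltr_A rtr_A) auto

lemma LieD:
  assumes "D \<in> Lie G A"
  shows "f \<notin> A \<Longrightarrow> D f = 0" "f \<in> A \<Longrightarrow> D f \<in> A" "f \<in> A \<Longrightarrow> g \<in> A \<Longrightarrow> D (f + g) = D f + D g"
    "f \<in> A \<Longrightarrow> D (\<lambda>x. c * f x) = (\<lambda>x. c * D f x)" "f \<in> A \<Longrightarrow> g \<in> A \<Longrightarrow> D (f * g) = D f * g + f * D g"
    "x \<in> X \<Longrightarrow> f \<in> A \<Longrightarrow> D (ltr x f) = ltr x (D f)" "D 0 = 0"
    "f \<in> A \<Longrightarrow> g \<in> A \<Longrightarrow> D (f - g) = D f - D g"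
proof -
  show "f \<notin> A \<Longrightarrow> D f = 0" "f \<in> A \<Longrightarrow> D f \<in> A"
    "f \<in> A \<Longrightarrow> D (\<lambda>x. c * f x) = (\<lambda>x. c * D f x)" "f \<in> A \<Longrightarrow> g \<in> A \<Longrightarrow> D (f * g) = D f * g + f * D g"
    using assms unfolding Lie_def by blast+
  show add: "f \<in> A \<Longrightarrow> g \<in> A \<Longrightarrow> D (f + g) = D f + D g" for f g
    using assms unfolding Lie_def by blast
  show "D 0 = 0"
    using add[OF A_zero A_zero] by simp
  show "f \<in> A \<Longrightarrow> g \<in> A \<Longrightarrow> D (f - g) = D f - D g"
    using add[of "f - g" g] A_diff by simp
  assume x: "x \<in> X" and f: "f \<in> A"
  then have "D (left_translation G (inv x) f) = left_translation G (inv x) (D f)"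
    using assms unfolding Lie_def by blast
  moreover have "inv (inv x) = x"
    using x by simp
  ultimately show "D (ltr x f) = ltr x (D f)"
    by (simp only: left_translation_def)
qed

text \<open>Left invariance reduces everything to tangent vectors at 1: a derivation is determined
  by the functional \<open>D f \<one>\<close>, and by \<open>tangent_Lie\<close> every tangent
  vector at 1 occurs.\<close>

lemma Lie_value:
  assumes "D \<in> Lie G A" "x \<in> X" "f \<in> A"
  shows "D f x = D (ltr x f) \<one>"
  using LieD(6)[OF assms] assms(2) by simp

lemma Lie_eqI:
  assumes "D \<in> Lie G A" "E \<in> Lie G A" "\<And>f. f \<in> A \<Longrightarrow> D f \<one> = E f \<one>"
  shows "D = E"
proof
  fix f
  show "D f = E f"
  proof (cases "f \<in> A")
    case True
    show ?thesis
    proof (rule A_eqI)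
      fix x assume "x \<in> X"
      then show "D f x = E f x"
        using Lie_value[OF assms(1) _ True] Lie_value[OF assms(2) _ True] assms(3)[OF ltr_A[OF True]] by simp
    qed (use LieD(2) assms True in auto)
  next
    case False
    then show ?thesis
      using LieD(1) assms by simp
  qed
qed

lemma Lie_tangent:
  assumes "D \<in> Lie G A"
  shows "tangent \<one> (\<lambda>f. D f \<one>)"
  unfolding tangent_def linear_on_A_def using LieD[OF assms] by simp

lemmas Lie_linear = tangentD(1)[OF Lie_tangent]

text \<open>Spread \<open>t\<close> over the group by left translation. That the resulting operator
  maps \<open>A\<close> to \<open>A\<close> is \<open>biregular_slice\<close> for the
  multiplication.\<close>

lemma tangent_Lie:
  assumes t: "tangent \<one> t"
  shows "\<exists>D\<in>Lie G A. \<forall>f\<in>A. D f \<one> = t f"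
proof -
  note lin = tangentD(1)[OF t]
  define D where "D f = (if f \<in> A then restr X (\<lambda>x. t (ltr x f)) else 0)" for f
  have D_A: "D f \<in> A" if "f \<in> A" for f
    using biregular_slice[OF biregular_mult[OF that] lin] that by (simp add: D_def)
  have "D \<in> Lie G A"
    unfolding Lie_def
  proof (intro CollectI conjI allI ballI impI)
    show "D f = 0" if "f \<notin> A" for f
      using that by (simp add: D_def)
    show "D f \<in> A" if "f \<in> A" for f
      using that by (rule D_A)
  next
    fix f g assume fg: "f \<in> A" "g \<in> A"
    show "D (f + g) = D f + D g"
    proof (rule A_eqI)
      fix x assume x: "x \<in> X"
      have "ltr x (f + g) = ltr x f + ltr x g"
        by (auto simp: fun_eq_iff)
      then show "D (f + g) x = (D f + D g) x"
        using x fg linear_on_AD(1)[OF lin ltr_A ltr_A] by (simp add: D_def A_add)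
    qed (use fg D_A A_add in auto)
    show "D (f * g) = D f * g + f * D g"
    proof (rule A_eqI)
      fix x assume x: "x \<in> X"
      have "ltr x (f * g) = ltr x f * ltr x g"
        by (auto simp: fun_eq_iff)
      then show "D (f * g) x = (D f * g + f * D g) x"
        using x fg tangentD(2)[OF t ltr_A ltr_A] by (simp add: D_def A_mult)
    qed (use fg D_A A_add A_mult in auto)
  next
    fix c f assume f: "f \<in> A"
    show "D (\<lambda>x. c * f x) = (\<lambda>x. c * D f x)"
    proof (rule A_eqI)
      fix x assume x: "x \<in> X"
      have "ltr x (\<lambda>x. c * f x) = (\<lambda>y. c * ltr x f y)"
        by (auto simp: fun_eq_iff)
      then show "D (\<lambda>x. c * f x) x = c * D f x"
        using x f linear_on_AD(2)[OF lin ltr_A] by (simp add: D_def A_scale)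
    qed (use f D_A A_scale in auto)
  next
    fix x f assume x: "x \<in> X" and f: "f \<in> A"
    have lt: "left_translation G x h = ltr (inv x) h" for h
      by (simp add: left_translation_def)
    show "D (left_translation G x f) = left_translation G x (D f)"
      unfolding lt
    proof (rule A_eqI)
      fix y assume y: "y \<in> X"
      have "ltr y (ltr (inv x) f) = ltr (inv x \<otimes> y) f"
        using x y by (auto simp: fun_eq_iff m_assoc)
      then show "D (ltr (inv x) f) y = ltr (inv x) (D f) y"
        using x y f ltr_A by (simp add: D_def)
    qed (use x f D_A ltr_A in auto)
  qed
  moreover have "D f \<one> = t f" if "f \<in> A" for f
  proof -
    have "ltr \<one> f = f"
      using A_outside[OF that] by (auto simp: fun_eq_iff)
    then show ?thesis
      using that by (simp add: D_def)
  qed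
  ultimately show ?thesis
    by blast
qed

sublocale V: vector_space "op_scale :: 'k \<Rightarrow> ('g, 'k) operator \<Rightarrow> ('g, 'k) operator"
  by (rule vector_space_op_scale)

lemma Lie_subspace: "V.subspace (Lie G A)"
  unfolding V.subspace_def
proof (intro conjI ballI allI)
  show "0 \<in> Lie G A"
    unfolding Lie_def by (auto simp: A_zero left_translation_def fun_eq_iff)
next
  fix D E assume "D \<in> Lie G A" "E \<in> Lie G A"
  then show "D + E \<in> Lie G A"
    unfolding Lie_def by (auto simp: A_add left_translation_def fun_eq_iff algebra_simps)
next
  fix c and D :: "('g, 'k) operator" assume "D \<in> Lie G A"
  then show "op_scale c D \<in> Lie G A"
    unfolding Lie_def by (auto simp: A_scale op_scale_def left_translation_def fun_eq_iff algebra_simps)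
qed

text \<open>By the Leibniz rule a tangent vector at 1 is determined by its values on the finitely
  many generators.\<close>

lemma Lie_finite_dimensional: "\<exists>B. finite B \<and> Lie G A \<subseteq> V.span B"
proof -
  obtain F where F: "finite F" "A = generated_algebra X F"
    using A_generated by blast
  show ?thesis
  proof (rule V.finite_dimensional_by_functionals[where I = "restr X ` F" and f = "\<lambda>f D. D f \<one>"])
    fix D assume D: "D \<in> Lie G A" "\<forall>f\<in>restr X ` F. D f \<one> = 0"
    have "f \<in> A \<and> D f \<one> = 0" if "f \<in> generated_algebra X F" for f
      using that
    proof (induction rule: generated_algebra.induct)
      case (const c)
      show ?case
        using tangent_const[OF Lie_tangent[OF D(1)]] A_const by simp
    next
      case (gen f)
      then show ?case
        using D(2) F(2) generated_algebra.gen by blast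
    next
      case (add f g)
      then show ?case
        using LieD(3)[OF D(1), of f g] A_add[of f g] by (simp add: plus_fun_def)
    next
      case (mult f g)
      then show ?case
        using LieD(5)[OF D(1), of f g] A_mult[of f g] by (simp add: times_fun_def)
    qed
    then show "D = 0"
      using F(2) V.subspace_0[OF Lie_subspace] by (intro Lie_eqI[OF D(1)]) auto
  qed (use F(1) Lie_subspace in \<open>auto simp: op_scale_def\<close>)
qed

lemma commutator_closed:
  assumes "D \<in> Lie G A" "E \<in> Lie G A"
  shows "commutator D E \<in> Lie G A"
proof -
  obtain F where "A = generated_algebra X F"
    using A_generated by blast
  then show ?thesis
    using assms by (rule commutator_in_Lie)
qed

sublocale fd_algebra op_scale commutator "Lie G A"
proof unfold_locales
  fix D E T assume D: "D \<in> Lie G A" and E: "E \<in> Lie G A" and T: "T \<in> Lie G A"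
  show "commutator (D + E) T = commutator D T + commutator E T"
  proof
    fix f
    show "commutator (D + E) T f = (commutator D T + commutator E T) f"
      using LieD(3,7)[OF T] LieD(1,2)[OF D] LieD(1,2)[OF E] LieD(1)[OF T]
      by (cases "f \<in> A") (simp_all add: commutator_def algebra_simps)
  qed
next
  fix c D T assume D: "D \<in> Lie G A" and T: "T \<in> Lie G A"
  show "commutator (op_scale c D) T = op_scale c (commutator D T)"
  proof
    fix f
    show "commutator (op_scale c D) T f = op_scale c (commutator D T) f"
    proof (cases "f \<in> A")
      case True
      then show ?thesis
        using LieD(4)[OF T LieD(2)[OF D True], of c]
        by (simp add: commutator_def op_scale_def fun_eq_iff algebra_simps)
    next
      case False
      have op0: "op_scale c S g = 0" if "S g = 0" for S :: "('g, 'k) operator" and g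
        using that by (simp add: op_scale_def zero_fun_def)
      have "commutator D T f = 0"
        using LieD(1)[OF D False] LieD(1)[OF T False] LieD(7)[OF T] LieD(7)[OF D]
        by (simp add: commutator_def)
      then have "op_scale c (commutator D T) f = 0"
        by (rule op0)
      moreover have "commutator (op_scale c D) T f = 0"
        using op0[of D f] op0[of D 0] LieD(1)[OF D False] LieD(1)[OF T False] LieD(7)[OF T] LieD(7)[OF D]
        by (simp add: commutator_def)
      ultimately show ?thesis
        by simp
    qed
  qed
qed (use Lie_subspace Lie_finite_dimensional commutator_closed in \<open>auto simp: commutator_def fun_eq_iff\<close>)

lemma commutator_jacobi:
  assumes "D \<in> Lie G A" "E \<in> Lie G A" "T \<in> Lie G A"
  shows "commutator (commutator D E) T = commutator D (commutator E T) - commutator E (commutator D T)"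
proof
  fix f
  show "commutator (commutator D E) T f = (commutator D (commutator E T) - commutator E (commutator D T)) f"
  proof (cases "f \<in> A")
    case True
    then show ?thesis
      by (simp add: commutator_def LieD(2)[OF assms(1)] LieD(2)[OF assms(2)] LieD(2)[OF assms(3)]
        LieD(8)[OF assms(1)] LieD(8)[OF assms(2)] LieD(8)[OF assms(3)])
  next
    case False
    then show ?thesis
      using LieD(1,7)[OF assms(1)] LieD(1,7)[OF assms(2)] LieD(1,7)[OF assms(3)]
      by (simp add: commutator_def)
  qed
qed

text \<open>The bracket on tangent vectors at 1: \<open>D\<close> and \<open>E\<close> are applied
  to the two variables of \<open>f (x \<otimes> y)\<close>, in either order.\<close>

lemma commutator_value:
  assumes "D \<in> Lie G A" "E \<in> Lie G A" "f \<in> A"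
  shows "commutator D E f \<one> = D (restr X (\<lambda>x. E (ltr x f) \<one>)) \<one> - E (restr X (\<lambda>x. D (ltr x f) \<one>)) \<one>"
proof -
  have "D f = restr X (\<lambda>x. D (ltr x f) \<one>)" if "D \<in> Lie G A" for D
    using Lie_value[OF that _ assms(3)] A_outside[OF LieD(2)[OF that assms(3)]] by (auto simp: fun_eq_iff)
  then show ?thesis
    using assms(1,2) by (simp add: commutator_def)
qed

lemma Lie_subgroup_subspace: "V.subspace (Lie_subgroup G A H)"
  unfolding V.subspace_def Lie_subgroup_def
  using V.subspace_0[OF Lie_subspace] V.subspace_add[OF Lie_subspace] V.subspace_scale[OF Lie_subspace]
  by (auto simp: op_scale_def)

lemma Lie_subgroup_Lie: "D \<in> Lie_subgroup G A H \<Longrightarrow> D \<in> Lie G A"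
  unfolding Lie_subgroup_def by blast

lemma Lie_subgroupD: "D \<in> Lie_subgroup G A H \<Longrightarrow> f \<in> A \<Longrightarrow> (\<And>x. x \<in> H \<Longrightarrow> f x = 0) \<Longrightarrow> D f \<one> = 0"
  unfolding Lie_subgroup_def by blast

lemma Lie_subgroupI:
  "D \<in> Lie G A \<Longrightarrow> (\<And>f. f \<in> A \<Longrightarrow> \<forall>x\<in>H. f x = 0 \<Longrightarrow> D f \<one> = 0) \<Longrightarrow> D \<in> Lie_subgroup G A H"
  unfolding Lie_subgroup_def by blast

subsection \<open>The adjoint action\<close>

lemma Ad_eq: "f \<in> A \<Longrightarrow> Ad G A x D f = rtr x (D (rtr (inv x) f))"
  by (simp add: Ad_def)

lemma Ad_value:
  assumes "D \<in> Lie G A" "x \<in> X" "f \<in> A"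
  shows "Ad G A x D f \<one> = D (ctr x f) \<one>"
proof -
  have "Ad G A x D f \<one> = D (rtr (inv x) f) x"
    using assms by (simp add: Ad_eq rtr_eq[of x])
  also have "\<dots> = D (ltr x (rtr (inv x) f)) \<one>"
    using assms by (intro Lie_value rtr_A) auto
  finally show ?thesis
    unfolding ctr_eq[OF assms(2)] .
qed

lemma Ad_inv_value:
  assumes "D \<in> Lie G A" "x \<in> X" "f \<in> A"
  shows "Ad G A (inv x) D f \<one> = D (restr X (\<lambda>y. f (inv x \<otimes> y \<otimes> x))) \<one>"
proof -
  have "inv (inv x) = x"
    using assms by simp
  with Ad_value[OF assms(1) inv_closed[OF assms(2)] assms(3)] show ?thesis
    by (simp only:)
qed

lemma rtr_rtr: "x \<in> X \<Longrightarrow> y \<in> X \<Longrightarrow> rtr x (rtr y f) = rtr (x \<otimes> y) f"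
  by (auto simp: fun_eq_iff m_assoc rtr_eq)

lemma rtr_one: "f \<in> A \<Longrightarrow> rtr \<one> f = f"
  by (auto simp: fun_eq_iff rtr_eq A_outside)

lemma rtr_cancel: "f \<in> A \<Longrightarrow> x \<in> X \<Longrightarrow> rtr (inv x) (rtr x f) = f" "f \<in> A \<Longrightarrow> x \<in> X \<Longrightarrow> rtr x (rtr (inv x) f) = f"
  by (simp_all add: rtr_rtr rtr_one)

lemma Ad_Lie:
  assumes D: "D \<in> Lie G A" and x: "x \<in> X"
  shows "Ad G A x D \<in> Lie G A"
  unfolding Lie_def
proof (intro CollectI conjI allI ballI impI)
  have ix: "inv x \<in> X"
    using x by simp
  show "Ad G A x D f = 0" if "f \<notin> A" for f
    using that by (simp add: Ad_def)
  show "Ad G A x D f \<in> A" if "f \<in> A" for f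
    unfolding Ad_eq[OF that] by (intro rtr_A LieD(2)[OF D] that x ix)
next
  fix f g assume fg: "f \<in> A" "g \<in> A"
  have r: "rtr (inv x) f \<in> A" "rtr (inv x) g \<in> A"
    using fg x by (auto intro: rtr_A)
  show "Ad G A x D (f + g) = Ad G A x D f + Ad G A x D g"
    "Ad G A x D (f * g) = Ad G A x D f * g + f * Ad G A x D g"
    using fg rtr_cancel(2)[OF fg(1) x] rtr_cancel(2)[OF fg(2) x]
    by (simp_all add: Ad_eq A_add A_mult rtr_linear LieD(3,5)[OF D r])
next
  fix c f assume f: "f \<in> A"
  then have "rtr (inv x) f \<in> A"
    using x by (auto intro: rtr_A)
  then show "Ad G A x D (\<lambda>x. c * f x) = (\<lambda>y. c * Ad G A x D f y)"
    using f by (simp add: Ad_eq A_scale rtr_linear LieD(4)[OF D])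
next
  fix y f assume y: "y \<in> X" and f: "f \<in> A"
  have lt: "left_translation G y h = ltr (inv y) h" for h
    by (simp add: left_translation_def)
  have c: "rtr z (ltr (inv y) h) = ltr (inv y) (rtr z h)" if "z \<in> X" for z and h :: "'g \<Rightarrow> 'k"
    using that y by (auto simp: fun_eq_iff m_assoc rtr_eq)
  have d: "D (rtr (inv x) (ltr (inv y) f)) = ltr (inv y) (D (rtr (inv x) f))"
    unfolding c[OF inv_closed[OF x]] using x y f by (intro LieD(6)[OF D] rtr_A) auto
  show "Ad G A x D (left_translation G y f) = left_translation G y (Ad G A x D f)"
    unfolding lt Ad_eq[OF f] Ad_eq[OF ltr_A[OF f inv_closed[OF y]]] d c[OF x] ..
qed

lemma Ad_add:
  assumes "x \<in> X" "D \<in> Lie G A" "E \<in> Lie G A"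
  shows "Ad G A x (D + E) = Ad G A x D + Ad G A x E"
  by (rule ext) (simp add: Ad_def rtr_linear)

lemma Ad_scale:
  assumes "x \<in> X" "D \<in> Lie G A"
  shows "Ad G A x (op_scale c D) = op_scale c (Ad G A x D)"
  by (rule ext) (simp add: Ad_def op_scale_def rtr_linear zero_fun_def)

lemma Ad_Ad:
  assumes x: "x \<in> X" and y: "y \<in> X" and D: "D \<in> Lie G A"
  shows "Ad G A x (Ad G A y D) = Ad G A (x \<otimes> y) D"
proof
  fix f
  show "Ad G A x (Ad G A y D) f = Ad G A (x \<otimes> y) D f"
  proof (cases "f \<in> A")
    case True
    have "Ad G A x (Ad G A y D) f = rtr x (rtr y (D (rtr (inv y) (rtr (inv x) f))))"
      using True x y rtr_A[OF True, of "inv x"] by (simp add: Ad_eq)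
    also have "\<dots> = Ad G A (x \<otimes> y) D f"
      using True x y by (simp add: Ad_eq rtr_rtr inv_mult_group)
    finally show ?thesis .
  next
    case False
    then show ?thesis
      by (simp add: Ad_def)
  qed
qed

lemma Ad_one: "D \<in> Lie G A \<Longrightarrow> Ad G A \<one> D = D"
  by (rule ext) (simp add: Ad_def rtr_one LieD zero_fun_def)

lemma Ad_commutator:
  assumes x: "x \<in> X" and D: "D \<in> Lie G A" and E: "E \<in> Lie G A"
  shows "Ad G A x (commutator D E) = commutator (Ad G A x D) (Ad G A x E)"
proof
  fix f
  show "Ad G A x (commutator D E) f = commutator (Ad G A x D) (Ad G A x E) f"
  proof (cases "f \<in> A")
    case True
    have r: "rtr (inv x) f \<in> A"
      using x True by (intro rtr_A) auto
    have *: "Ad G A x D' (Ad G A x E' f) = rtr x (D' (E' (rtr (inv x) f)))"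
      if "D' \<in> Lie G A" "E' \<in> Lie G A" for D' E'
    proof -
      have "Ad G A x E' f \<in> A"
        using LieD(2)[OF Ad_Lie] that x True by blast
      then show ?thesis
        using rtr_cancel(1)[OF LieD(2)[OF that(2) r] x] True by (simp add: Ad_eq)
    qed
    show ?thesis
      using *[OF D E] *[OF E D] True by (simp add: commutator_def Ad_eq[of f _ "commutator D E"] rtr_linear)
        (simp add: Ad_eq commutator_def rtr_linear)
  next
    case False
    have "Ad G A x T f = 0" "T \<in> Lie G A \<Longrightarrow> Ad G A x T 0 = 0" for T
      using False LieD(7)[OF Ad_Lie[OF _ x], of T] by (auto simp: Ad_def)
    then show ?thesis
      using False D E by (simp add: commutator_def)
  qed
qed

text \<open>
  The derivative of \<open>Ad\<close> is \<open>ad\<close>: split \<open>h(g\<^sup>-\<^sup>1 y g)\<close> into its two dependencies on \<open>g\<close>.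
\<close>

lemma Ad_biregular:
  assumes v: "v \<in> Lie G A" and h: "h \<in> A"
  shows "biregular (\<lambda>x z. v (restr X (\<lambda>y. h (inv x \<otimes> y \<otimes> z))) \<one>)"
proof -
  obtain n :: nat and a b where F: "\<And>i. i < n \<Longrightarrow> a i \<in> A" "\<And>i. i < n \<Longrightarrow> b i \<in> A"
    "\<And>x y. x \<in> X \<Longrightarrow> y \<in> X \<Longrightarrow> h (x \<otimes> y) = (\<Sum>i<n. a i x * b i y)"
    using biregularE[OF biregular_mult[OF h]] by blast
  show ?thesis
  proof (rule biregularI[where a = "\<lambda>i. restr X (\<lambda>x. a i (inv x))" and b = "\<lambda>i. restr X (\<lambda>z. v (rtr z (b i)) \<one>)"])
    fix i assume i: "i < n"
    show "restr X (\<lambda>x. a i (inv x)) \<in> A"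
      using F(1)[OF i] by (rule inverse_regular)
    show "restr X (\<lambda>z. v (rtr z (b i)) \<one>) \<in> A"
      unfolding rtr_eq
      by (rule biregular_slice[OF biregular_swap[OF biregular_mult[OF F(2)[OF i]]] Lie_linear[OF v]])
  next
    fix x z assume xz: "x \<in> X" "z \<in> X"
    have "h (inv x \<otimes> y \<otimes> z) = (\<Sum>i<n. a i (inv x) * rtr z (b i) y)" if "y \<in> X" for y
      using F(3)[of "inv x" "y \<otimes> z"] xz that by (simp add: m_assoc rtr_eq)
    then have "restr X (\<lambda>y. h (inv x \<otimes> y \<otimes> z)) = (\<lambda>y. \<Sum>i<n. a i (inv x) * rtr z (b i) y)"
      by (auto simp: fun_eq_iff rtr_eq)
    then show "v (restr X (\<lambda>y. h (inv x \<otimes> y \<otimes> z))) \<one> =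
        (\<Sum>i<n. restr X (\<lambda>x. a i (inv x)) x * restr X (\<lambda>z. v (rtr z (b i)) \<one>) z)"
      using linear_on_A_sum[OF Lie_linear[OF v], of n "\<lambda>i. rtr z (b i)" "\<lambda>i. a i (inv x)"] F(2) xz rtr_A by simp
  qed
qed

lemma Ad_regular:
  assumes v: "v \<in> Lie G A" and h: "h \<in> A"
  shows "restr X (\<lambda>x. Ad G A (inv x) v h \<one>) \<in> A"
proof -
  have "restr X (\<lambda>x. Ad G A (inv x) v h \<one>) = restr X (\<lambda>x. v (restr X (\<lambda>y. h (inv x \<otimes> y \<otimes> x))) \<one>)"
    using Ad_inv_value[OF v _ h] by (simp add: fun_eq_iff)
  then show ?thesis
    using biregular_diagonal[OF Ad_biregular[OF v h]] by simp
qed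

text \<open>The first variable enters through an inverse, which gives a sign; in the second, Fubini
  exchanges \<open>x\<close> and \<open>v\<close>. The two partial derivatives are the negatives of
  the two terms of \<open>commutator_value\<close>.\<close>

lemma Ad_derivative:
  assumes x: "x \<in> Lie G A" and v: "v \<in> Lie G A" and h: "h \<in> A"
  shows "x (restr X (\<lambda>g. Ad G A (inv g) v h \<one>)) \<one> = - commutator x v h \<one>"
proof -
  let ?F = "\<lambda>g z. v (restr X (\<lambda>y. h (inv g \<otimes> y \<otimes> z))) \<one>"
  have "restr X (\<lambda>g. Ad G A (inv g) v h \<one>) = restr X (\<lambda>g. ?F g g)"
    using Ad_inv_value[OF v _ h] by (simp add: fun_eq_iff)
  then have "x (restr X (\<lambda>g. Ad G A (inv g) v h \<one>)) \<one> = x (restr X (\<lambda>g. ?F g \<one>)) \<one> + x (restr X (?F \<one>)) \<one>"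
    using tangent_diagonal[OF Ad_biregular[OF v h] Lie_tangent[OF x] one_closed] by simp
  moreover have "x (restr X (\<lambda>g. ?F g \<one>)) \<one> = - x (restr X (\<lambda>g. v (ltr g h) \<one>)) \<one>"
  proof -
    let ?f = "restr X (\<lambda>g. v (ltr g h) \<one>)"
    have "?F g \<one> = v (ltr (inv g) h) \<one>" if "g \<in> X" for g
    proof -
      have "restr X (\<lambda>y. h (inv g \<otimes> y \<otimes> \<one>)) = ltr (inv g) h"
        using that by (auto simp: fun_eq_iff)
      then show ?thesis
        by simp
    qed
    then have "restr X (\<lambda>g. ?F g \<one>) = restr X (\<lambda>g. ?f (inv g))"
      by (auto simp: fun_eq_iff)
    moreover have "?f \<in> A"
      by (rule biregular_slice[OF biregular_mult[OF h] Lie_linear[OF v]])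
    ultimately show ?thesis
      using tangent_inverse[OF Lie_tangent[OF x], of ?f] by simp
  qed
  moreover have "x (restr X (?F \<one>)) \<one> = v (restr X (\<lambda>g. x (ltr g h) \<one>)) \<one>"
  proof -
    have "?F \<one> z = v (rtr z h) \<one>" if "z \<in> X" for z
    proof -
      have "restr X (\<lambda>y. h (inv \<one> \<otimes> y \<otimes> z)) = rtr z h"
        using that by (auto simp: fun_eq_iff rtr_eq)
      then show ?thesis
        by simp
    qed
    then have "restr X (?F \<one>) = restr X (\<lambda>z. v (rtr z h) \<one>)"
      by (auto simp: fun_eq_iff)
    then have "x (restr X (?F \<one>)) \<one> = x (restr X (\<lambda>z. v (rtr z h) \<one>)) \<one>"
      by (rule arg_cong)
    also have "\<dots> = v (restr X (\<lambda>g. x (ltr g h) \<one>)) \<one>"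
      unfolding rtr_eq
      by (rule biregular_fubini[OF biregular_swap[OF biregular_mult[OF h]] Lie_linear[OF x] Lie_linear[OF v]])
    finally show ?thesis .
  qed
  ultimately show ?thesis
    using commutator_value[OF x v h] by simp
qed

end

section \<open>Lie algebras of stabilisers\<close>

context algebraic_group
begin

abbreviation \<kappa> :: "'k \<Rightarrow> 'g \<Rightarrow> 'k" where
  "\<kappa> c \<equiv> restr X (\<lambda>_. c)"

text \<open>The expansion in \<open>t\<close> of \<open>exp (t D) f\<close> at 1, that is, of
  \<open>f\<close> along the formal integral curve of \<open>D\<close> through 1.\<close>

definition taylor :: "(('g \<Rightarrow> 'k) \<Rightarrow> ('g \<Rightarrow> 'k)) \<Rightarrow> ('g \<Rightarrow> 'k) \<Rightarrow> 'k fps" where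
  "taylor D f = Abs_fps (\<lambda>n. (D ^^ n) f \<one> / fact n)"

lemma deriv_taylor: "fps_deriv (taylor D f) = taylor D (D f)"
proof (rule fps_ext)
  fix n
  have "of_nat (n + 1) * ((D ^^ (n + 1)) f \<one> / fact (n + 1)) = (D ^^ n) (D f) \<one> / (fact n :: 'k)"
    by (simp add: funpow_swap1 field_simps del: of_nat_Suc)
  then show "fps_nth (fps_deriv (taylor D f)) n = fps_nth (taylor D (D f)) n"
    by (simp add: taylor_def del: of_nat_Suc funpow.simps)
qed

lemma taylor_add:
  assumes "\<And>f. f \<in> A \<Longrightarrow> D f \<in> A" "\<And>f g. f \<in> A \<Longrightarrow> g \<in> A \<Longrightarrow> D (f + g) = D f + D g" "f \<in> A" "g \<in> A"
  shows "taylor D (f + g) = taylor D f + taylor D g"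
proof -
  have "(D ^^ n) f \<in> A" if "f \<in> A" for n f
    using that assms(1) by (induction n) auto
  then have "(D ^^ n) (f + g) = (D ^^ n) f + (D ^^ n) g" for n
    using assms by (induction n) auto
  then show ?thesis
    by (intro fps_ext) (simp add: taylor_def add_divide_distrib)
qed

text \<open>Both sides solve the same differential equation.\<close>

lemma taylor_mult:
  assumes D: "\<And>f. f \<in> A \<Longrightarrow> D f \<in> A" "\<And>f g. f \<in> A \<Longrightarrow> g \<in> A \<Longrightarrow> D (f + g) = D f + D g"
    "\<And>f g. f \<in> A \<Longrightarrow> g \<in> A \<Longrightarrow> D (f * g) = D f * g + f * D g" and fg: "f \<in> A" "g \<in> A"
  shows "taylor D (f * g) = taylor D f * taylor D g"
proof (rule fps_ext)
  fix n
  show "fps_nth (taylor D (f * g)) n = fps_nth (taylor D f * taylor D g) n"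
    using fg
  proof (induction n arbitrary: f g)
    case 0
    then show ?case
      by (simp add: taylor_def)
  next
    case (Suc n)
    note f = Suc.prems(1) and g = Suc.prems(2)
    have "fps_nth (fps_deriv (taylor D (f * g))) n = fps_nth (taylor D (D f * g) + taylor D (f * D g)) n"
      using taylor_add[of D "D f * g" "f * D g"] D f g A_mult by (simp add: deriv_taylor)
    also have "\<dots> = fps_nth (taylor D (D f) * taylor D g + taylor D f * taylor D (D g)) n"
      by (simp only: fps_add_nth Suc.IH[OF D(1)[OF f] g] Suc.IH[OF f D(1)[OF g]])
    also have "\<dots> = fps_nth (fps_deriv (taylor D f * taylor D g)) n"
      unfolding fps_deriv_mult deriv_taylor by (simp only: add.commute)
    finally have "of_nat (n + 1) * fps_nth (taylor D (f * g)) (n + 1) = of_nat (n + 1) * fps_nth (taylor D f * taylor D g) (n + 1)"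
      by (simp only: fps_deriv_nth)
    moreover have "of_nat (n + 1) \<noteq> (0 :: 'k)"
      by (simp del: of_nat_Suc)
    ultimately show ?case
      by (metis Suc_eq_plus1 mult_left_cancel)
  qed
qed

text \<open>Taylor expansion is multiplicative and maps \<open>J\<close> to 0. Power series over a
  field have no nilpotents, so the expansion of \<open>f\<close> is 0 as well, and its linear
  coefficient is \<open>D f \<one>\<close>. The division by factorials is where characteristic zero
  enters.\<close>

lemma derivation_zero_of_power:
  assumes D: "\<And>f. f \<in> A \<Longrightarrow> D f \<in> A" "\<And>f g. f \<in> A \<Longrightarrow> g \<in> A \<Longrightarrow> D (f + g) = D f + D g"
    "\<And>f g. f \<in> A \<Longrightarrow> g \<in> A \<Longrightarrow> D (f * g) = D f * g + f * D g"
    and J: "\<And>j. j \<in> J \<Longrightarrow> D j \<in> J" "\<And>j. j \<in> J \<Longrightarrow> j \<one> = 0"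
    and f: "f \<in> A" "f ^ Suc n \<in> J"
  shows "D f \<one> = 0"
proof -
  have pow: "f ^ Suc m \<in> A \<and> taylor D (f ^ Suc m) = taylor D f ^ Suc m" for m
  proof (induction m)
    case (Suc m)
    have "taylor D (f * f ^ Suc m) = taylor D f * taylor D (f ^ Suc m)"
      by (rule taylor_mult[OF D f(1) conjunct1[OF Suc]])
    then show ?case
      using A_mult[OF f(1) conjunct1[OF Suc]] Suc by (simp only: power_Suc[of _ "Suc m"])
  qed (use f(1) in simp)
  have "(D ^^ k) (f ^ Suc n) \<in> J" for k
    using f(2) J(1) by (induction k) auto
  then have "taylor D (f ^ Suc n) = 0"
    using J(2) by (intro fps_ext) (simp add: taylor_def)
  then have "taylor D f ^ Suc n = 0"
    using pow by simp
  then have "fps_nth (taylor D f) 1 = 0"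
    by (simp only: power_eq_0_iff) simp
  then show ?thesis
    by (simp add: taylor_def)
qed

section \<open>Ideals of functions and their zero sets\<close>

definition genideal :: "('g \<Rightarrow> 'k) set \<Rightarrow> ('g \<Rightarrow> 'k) set" where
  "genideal S = {f \<in> A. \<forall>I. alg_ideal A I \<longrightarrow> S \<subseteq> I \<longrightarrow> f \<in> I}"

lemma alg_ideal_genideal: "alg_ideal A (genideal S)"
  unfolding genideal_def alg_ideal_def using A_zero A_add A_mult by (auto simp: subset_iff)

lemma genideal_least: "alg_ideal A I \<Longrightarrow> S \<subseteq> I \<Longrightarrow> genideal S \<subseteq> I"
  unfolding genideal_def by blast

lemma genideal_base: "S \<subseteq> A \<Longrightarrow> S \<subseteq> genideal S"
  unfolding genideal_def by blast

lemma alg_ideal_zero_on: "alg_ideal A {f \<in> A. \<forall>x\<in>H. f x = 0}"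
  unfolding alg_ideal_def using A_zero A_add A_mult by auto

lemma alg_hom_point:
  assumes "alg_hom A \<phi>"
  shows "\<exists>x\<in>X. \<forall>f\<in>A. \<phi> f = f x"
proof -
  have "\<forall>\<phi>. (\<forall>c. \<phi> (\<kappa> c) = c) \<and> (\<forall>f\<in>A. \<forall>g\<in>A. \<phi> (f + g) = \<phi> f + \<phi> g \<and> \<phi> (f * g) = \<phi> f * \<phi> g) \<longrightarrow>
      (\<exists>x\<in>X. \<forall>f\<in>A. \<phi> f = f x)"
    using aff unfolding affine_algebraic_group_def affine_variety_def by blast
  then show ?thesis
    using assms unfolding alg_hom_def by blast
qed

lemma subalg_scalars: "subalg (range \<kappa>)" "range \<kappa> \<subseteq> A"
  unfolding subalg_def using A_const by (auto simp: \<kappa>_add[symmetric] \<kappa>_mult[symmetric])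

text \<open>The Nullstellensatz, with homomorphisms turned into points of the group by the defining
  property of an affine variety.\<close>

lemma power_in_ideal:
  assumes J: "alg_ideal A J" and f: "f \<in> A" "\<And>x. x \<in> X \<Longrightarrow> (\<forall>j\<in>J. j x = 0) \<Longrightarrow> f x = 0"
  shows "\<exists>n. f ^ Suc n \<in> J"
proof (rule ccontr)
  assume n: "\<not> ?thesis"
  obtain F where F: "finite F" "A = generated_algebra X F"
    using A_generated by blast
  then obtain xs where xs: "set xs = restr X ` F"
    using finite_list[of "restr X ` F"] by blast
  note gens = adjoin_generators[OF F(2) xs subalg_scalars]
  have "\<And>n. f ^ Suc n \<notin> J"
    using n by blast
  then have "\<exists>\<phi>. alg_hom A \<phi> \<and> (\<forall>p\<in>J. \<phi> p = 0) \<and> \<phi> f \<noteq> 0"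
    by (rule nullstellensatz[OF subalg_A gens(1)[symmetric] gens(2) J f(1)])
  then obtain \<phi> where \<phi>: "alg_hom A \<phi>" "\<forall>p\<in>J. \<phi> p = 0" "\<phi> f \<noteq> 0"
    by auto
  obtain x where x: "x \<in> X" "\<And>f. f \<in> A \<Longrightarrow> \<phi> f = f x"
    using alg_hom_point[OF \<phi>(1)] by auto
  have "\<forall>j\<in>J. j x = 0"
    using \<phi>(2) x(2) alg_idealD(1)[OF subalg_A J] by auto
  then show False
    using f(2)[OF x(1)] \<phi>(3) x(2)[OF f(1)] by simp
qed

text \<open>The right-invariant vector field with the same value at 1 as \<open>D\<close>. On a
  matrix coefficient of \<open>\<gamma>\<close> and \<open>v\<close> it acts by
  \<open>v \<mapsto> - [D, v]\<close> and keeps \<open>\<gamma>\<close>, which makes the stability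
  of the ideals of stabilisers easy to check.\<close>

definition right_derivation :: "('g, 'k) operator \<Rightarrow> ('g, 'k) operator" where
  "right_derivation D f = restr X (\<lambda>x. D (rtr x f) \<one>)"

lemma right_derivation:
  assumes D: "D \<in> Lie G A"
  shows "f \<in> A \<Longrightarrow> right_derivation D f \<in> A"
    "f \<in> A \<Longrightarrow> g \<in> A \<Longrightarrow> right_derivation D (f + g) = right_derivation D f + right_derivation D g"
    "f \<in> A \<Longrightarrow> g \<in> A \<Longrightarrow> right_derivation D (f - g) = right_derivation D f - right_derivation D g"
    "f \<in> A \<Longrightarrow> g \<in> A \<Longrightarrow> right_derivation D (f * g) = right_derivation D f * g + f * right_derivation D g"
    "right_derivation D (\<kappa> c) = 0" "f \<in> A \<Longrightarrow> right_derivation D f \<one> = D f \<one>"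
proof -
  note lin = linear_on_AD[OF Lie_linear[OF D]]
  show cl: "f \<in> A \<Longrightarrow> right_derivation D f \<in> A" for f
    unfolding right_derivation_def rtr_eq
    using biregular_slice[OF biregular_swap[OF biregular_mult] Lie_linear[OF D]] .
  show "right_derivation D (f + g) = right_derivation D f + right_derivation D g"
    "right_derivation D (f - g) = right_derivation D f - right_derivation D g" if "f \<in> A" "g \<in> A"
    using lin(1,4)[OF rtr_A[OF that(1)] rtr_A[OF that(2)]]
    by (auto simp: right_derivation_def rtr_linear fun_eq_iff)
  show "right_derivation D (f * g) = right_derivation D f * g + f * right_derivation D g" if fg: "f \<in> A" "g \<in> A"
  proof (rule A_eqI)
    fix x assume x: "x \<in> X"
    then have "rtr x f \<one> = f x" "rtr x g \<one> = g x"
      by (simp_all add: rtr_eq)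
    then show "right_derivation D (f * g) x = (right_derivation D f * g + f * right_derivation D g) x"
      using tangentD(2)[OF Lie_tangent[OF D] rtr_A[OF fg(1) x] rtr_A[OF fg(2) x]] x
      by (simp add: right_derivation_def rtr_linear)
  qed (use fg cl A_mult A_add in auto)
  have "rtr x (\<kappa> c) = \<kappa> c" if "x \<in> X" for x
    using that by (auto simp: rtr_eq fun_eq_iff)
  then show "right_derivation D (\<kappa> c) = 0"
    using tangent_const[OF Lie_tangent[OF D] one_closed, of c]
    by (simp add: right_derivation_def zero_fun_def cong: if_cong)
  show "f \<in> A \<Longrightarrow> right_derivation D f \<one> = D f \<one>"
    by (simp add: right_derivation_def rtr_one)
qed

text \<open>
  In characteristic zero the zero set of \<open>S\<close> has the Lie algebra cut out by the equations of its
  tangent space, if the latter acts on the ideal generated by \<open>S\<close> (Cartier).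
\<close>

lemma Lie_zero_set:
  assumes S: "S \<subseteq> A" "\<And>s. s \<in> S \<Longrightarrow> s \<one> = 0" and D: "D \<in> Lie G A"
    and inv: "\<And>s. s \<in> S \<Longrightarrow> right_derivation D s \<in> genideal S"
  shows "D \<in> Lie_subgroup G A {x \<in> X. \<forall>s\<in>S. s x = 0}"
proof (rule Lie_subgroupI[OF D])
  fix f assume f: "f \<in> A" "\<forall>x\<in>{x \<in> X. \<forall>s\<in>S. s x = 0}. f x = 0"
  note J = alg_ideal_genideal[of S]
  note I = alg_idealD[OF subalg_A J] and rd = right_derivation[OF D]
  \<comment> \<open>By the Leibniz rule the members of the ideal whose derivative stays in it form
    an ideal, so stability need be known on \<open>S\<close> only.\<close>
  have "alg_ideal A {f \<in> genideal S. right_derivation D f \<in> genideal S}"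
    unfolding alg_ideal_def
  proof (intro conjI ballI subsetI)
    have "right_derivation D 0 = 0"
      using rd(5)[of 0] by (simp add: zero_fun_def)
    then show "0 \<in> {f \<in> genideal S. right_derivation D f \<in> genideal S}"
      using I(2) by simp
  next
    fix a g assume a: "a \<in> A" and "g \<in> {f \<in> genideal S. right_derivation D f \<in> genideal S}"
    then have g: "g \<in> genideal S" "right_derivation D g \<in> genideal S" "g \<in> A"
      using I(1) by auto
    have "right_derivation D (a * g) = right_derivation D a * g + a * right_derivation D g"
      by (rule rd(4)[OF a g(3)])
    also have "\<dots> \<in> genideal S"
      using I(3)[OF I(4)[OF rd(1)[OF a] g(1)] I(4)[OF a g(2)]] .
    finally show "a * g \<in> {f \<in> genideal S. right_derivation D f \<in> genideal S}"
      using I(4)[OF a g(1)] by simp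
  qed (use I rd in auto)
  then have stable: "right_derivation D j \<in> genideal S" if "j \<in> genideal S" for j
    using genideal_least[of _ S] genideal_base[OF S(1)] inv that by blast
  have one: "j \<one> = 0" if "j \<in> genideal S" for j
    using genideal_least[OF alg_ideal_zero_on[of "{\<one>}"], of S] S that by auto
  have "f x = 0" if "x \<in> X" "\<forall>j\<in>genideal S. j x = 0" for x
    using f(2) that genideal_base[OF S(1)] by blast
  \<comment> \<open>A function that vanishes on the zero set need not lie in the ideal; the
    Nullstellensatz gives only a power of it.\<close>
  then obtain n where n: "f ^ Suc n \<in> genideal S"
    using power_in_ideal[OF J f(1)] by blast
  have "right_derivation D f \<one> = 0"
    by (rule derivation_zero_of_power[of "right_derivation D" "genideal S" f n, OF _ _ _ _ _ f(1) n])
      (simp_all only: rd(1,2,4) stable one)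
  then show "D f \<one> = 0"
    using rd(6)[OF f(1)] by simp
qed

lemma closed_subgroup_zero_set:
  assumes H: "closed_subgroup G A H" and x: "x \<in> X" "x \<notin> H"
  shows "\<exists>f\<in>A. f x \<noteq> 0 \<and> (\<forall>y\<in>H. f y = 0)"
proof -
  obtain F where A: "A = generated_algebra X F"
    using A_generated by blast
  have top: "topspace (zariski X A) = X"
    unfolding A by (rule topspace_zariski)
  have "closedin (zariski X A) H" "H \<subseteq> X"
    using H subgroup.subset unfolding closed_subgroup_def by blast+
  then have "openin (zariski X A) (X - H)"
    unfolding closedin_def top by blast
  then obtain f where "f \<in> A" "f x \<noteq> 0" "{y \<in> X. f y \<noteq> 0} \<subseteq> X - H"
    using zariski_basic_open[OF A_mult, of X "X - H" x] x by blast
  then show ?thesis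
    using \<open>H \<subseteq> X\<close> by blast
qed

end

section \<open>Semi-direct products\<close>

locale semidirect_group = algebraic_group +
  fixes L N :: "'a set"
  assumes sd: "semidirect_product G A L N"
    and N_comm: "\<And>x y. x \<in> N \<Longrightarrow> y \<in> N \<Longrightarrow> x \<otimes> y = y \<otimes> x"
begin

abbreviation "\<ll> \<equiv> Lie_subgroup G A L"
abbreviation "\<nn> \<equiv> Lie_subgroup G A N"

lemma L: "closed_subgroup G A L" "subgroup L G" "L \<subseteq> X"
  and N: "closed_subgroup G A N" "subgroup N G" "N \<subseteq> X" "N \<lhd> G"
  using sd subgroup.subset unfolding semidirect_product_def closed_subgroup_def by blast+

text \<open>Multiplication \<open>L \<times> N \<rightarrow> G\<close> is an isomorphism of
  varieties, so both components of its inverse are regular.\<close>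

lemma projections:
  obtains \<pi> \<nu> where "\<And>x. x \<in> X \<Longrightarrow> \<pi> x \<in> L \<and> \<nu> x \<in> N \<and> \<pi> x \<otimes> \<nu> x = x"
    "\<And>x. x \<in> L \<Longrightarrow> \<pi> x = x \<and> \<nu> x = \<one>" "\<And>x. x \<in> N \<Longrightarrow> \<pi> x = \<one> \<and> \<nu> x = x"
    "\<And>f. f \<in> A \<Longrightarrow> restr X (\<lambda>x. f (\<pi> x)) \<in> A" "\<And>f. f \<in> A \<Longrightarrow> restr X (\<lambda>x. f (\<nu> x)) \<in> A"
proof -
  let ?R = "product_ring (restr L ` A) (restr N ` A)"
  have "\<exists>\<psi>. morphism X A (L \<times> N) ?R \<psi> \<and> (\<forall>p\<in>L \<times> N. \<psi> ((\<lambda>(l, n). l \<otimes> n) p) = p) \<and>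
      (\<forall>x\<in>X. (\<lambda>(l, n). l \<otimes> n) (\<psi> x) = x)"
    using sd unfolding semidirect_product_def isomorphism_def by blast
  then obtain \<psi> where mor: "morphism X A (L \<times> N) ?R \<psi>"
    and inv1: "\<And>l n. l \<in> L \<Longrightarrow> n \<in> N \<Longrightarrow> \<psi> (l \<otimes> n) = (l, n)"
    and inv2: "\<And>x. x \<in> X \<Longrightarrow> fst (\<psi> x) \<otimes> snd (\<psi> x) = x"
    by (force simp: case_prod_beta)
  have im: "\<psi> x \<in> L \<times> N" if "x \<in> X" for x
    using mor that unfolding morphism_def by blast
  have one: "\<one> \<in> L" "\<one> \<in> N"
    using L(2) N(2) subgroup.one_closed by blast+
  have reg: "restr X (\<lambda>x. g (\<psi> x)) \<in> A" if "g \<in> ?R" for g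
    using mor that unfolding morphism_def by blast
  have prod: "(\<lambda>(x, y). restr L f x * restr N g y) \<in> ?R" if "f \<in> A" "g \<in> A" for f g
    unfolding product_ring_def
    by (rule CollectI, rule exI[of _ 1], rule exI[of _ "\<lambda>_. restr L f"], rule exI[of _ "\<lambda>_. restr N g"])
      (use that in simp)
  show thesis
  proof (rule that[of "\<lambda>x. fst (\<psi> x)" "\<lambda>x. snd (\<psi> x)"])
    fix x assume x: "x \<in> X"
    then show "fst (\<psi> x) \<in> L \<and> snd (\<psi> x) \<in> N \<and> fst (\<psi> x) \<otimes> snd (\<psi> x) = x"
      using im[OF x] inv2 by (auto simp: mem_Times_iff)
  next
    fix x assume x: "x \<in> L"
    then show "fst (\<psi> x) = x \<and> snd (\<psi> x) = \<one>"
      using inv1[OF x one(2)] L(3) by auto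
  next
    fix x assume x: "x \<in> N"
    then show "fst (\<psi> x) = \<one> \<and> snd (\<psi> x) = x"
      using inv1[OF one(1) x] N(3) by auto
  next
    fix f assume f: "f \<in> A"
    have "restr X (\<lambda>x. f (fst (\<psi> x))) = restr X (\<lambda>x. (\<lambda>(x, y). restr L f x * restr N (\<kappa> 1) y) (\<psi> x))"
      using im N(3) by (auto simp: fun_eq_iff mem_Times_iff case_prod_beta)
    then show "restr X (\<lambda>x. f (fst (\<psi> x))) \<in> A"
      using reg[OF prod[OF f A_const]] by simp
    have "restr X (\<lambda>x. f (snd (\<psi> x))) = restr X (\<lambda>x. (\<lambda>(x, y). restr L (\<kappa> 1) x * restr N f y) (\<psi> x))"
      using im L(3) by (auto simp: fun_eq_iff mem_Times_iff case_prod_beta)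
    then show "restr X (\<lambda>x. f (snd (\<psi> x))) \<in> A"
      using reg[OF prod[OF A_const f]] by simp
  qed
qed

lemma tangent_pullback:
  assumes t: "tangent \<one> t" and \<pi>: "\<And>f. f \<in> A \<Longrightarrow> restr X (\<lambda>x. f (\<pi> x)) \<in> A" "\<pi> \<one> = \<one>"
  shows "tangent \<one> (\<lambda>f. t (restr X (\<lambda>x. f (\<pi> x))))"
proof -
  note lin = linear_on_AD[OF tangentD(1)[OF t]]
  have "restr X (\<lambda>x. (f + g) (\<pi> x)) = restr X (\<lambda>x. f (\<pi> x)) + restr X (\<lambda>x. g (\<pi> x))"
    "restr X (\<lambda>x. (f * g) (\<pi> x)) = restr X (\<lambda>x. f (\<pi> x)) * restr X (\<lambda>x. g (\<pi> x))"
    "restr X (\<lambda>x. c * f (\<pi> x)) = (\<lambda>x. c * restr X (\<lambda>x. f (\<pi> x)) x)" for f g :: "'a \<Rightarrow> 'b" and c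
    by (auto simp: fun_eq_iff)
  then show ?thesis
    unfolding tangent_def linear_on_A_def using \<pi> lin(1)[OF \<pi>(1) \<pi>(1)] lin(2)[OF \<pi>(1)]
      tangentD(2)[OF t \<pi>(1) \<pi>(1)] by simp
qed

text \<open>Differentiate \<open>x = \<pi> x \<otimes> \<nu> x\<close> at 1 with
  \<open>tangent_diagonal\<close>; the two partial derivatives are tangent to \<open>L\<close> and
  to \<open>N\<close>.\<close>

lemma Lie_decomposition:
  assumes D: "D \<in> Lie G A"
  shows "\<exists>E\<in>\<ll>. \<exists>T\<in>\<nn>. D = E + T"
proof -
  obtain \<pi> \<nu> where pr: "\<And>x. x \<in> X \<Longrightarrow> \<pi> x \<in> L \<and> \<nu> x \<in> N \<and> \<pi> x \<otimes> \<nu> x = x"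
    "\<And>x. x \<in> L \<Longrightarrow> \<pi> x = x \<and> \<nu> x = \<one>" "\<And>x. x \<in> N \<Longrightarrow> \<pi> x = \<one> \<and> \<nu> x = x"
    "\<And>f. f \<in> A \<Longrightarrow> restr X (\<lambda>x. f (\<pi> x)) \<in> A" "\<And>f. f \<in> A \<Longrightarrow> restr X (\<lambda>x. f (\<nu> x)) \<in> A"
    by (rule projections) blast
  have one: "\<pi> \<one> = \<one>" "\<nu> \<one> = \<one>"
    using pr(2)[OF subgroup.one_closed[OF L(2)]] by auto
  note t = Lie_tangent[OF D]
  obtain E where E: "E \<in> Lie G A" "\<And>f. f \<in> A \<Longrightarrow> E f \<one> = D (restr X (\<lambda>x. f (\<pi> x))) \<one>"
    using tangent_Lie[OF tangent_pullback[where \<pi> = \<pi>, OF t pr(4) one(1)]] by blast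
  obtain T where T: "T \<in> Lie G A" "\<And>f. f \<in> A \<Longrightarrow> T f \<one> = D (restr X (\<lambda>x. f (\<nu> x))) \<one>"
    using tangent_Lie[OF tangent_pullback[where \<pi> = \<nu>, OF t pr(5) one(2)]] by blast
  have zero: "D (restr X (\<lambda>x. 0)) \<one> = 0"
    using tangent_const[OF t one_closed, of 0] .
  have "E \<in> \<ll>"
  proof (rule Lie_subgroupI[OF E(1)])
    fix f assume f: "f \<in> A" "\<forall>x\<in>L. f x = 0"
    then have "restr X (\<lambda>x. f (\<pi> x)) = restr X (\<lambda>x. 0)"
      using pr(1) by (auto simp: fun_eq_iff)
    then show "E f \<one> = 0"
      using E(2)[OF f(1)] zero by simp
  qed
  moreover have "T \<in> \<nn>"
  proof (rule Lie_subgroupI[OF T(1)])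
    fix f assume f: "f \<in> A" "\<forall>x\<in>N. f x = 0"
    then have "restr X (\<lambda>x. f (\<nu> x)) = restr X (\<lambda>x. 0)"
      using pr(1) by (auto simp: fun_eq_iff)
    then show "T f \<one> = 0"
      using T(2)[OF f(1)] zero by simp
  qed
  moreover have "D = E + T"
  proof (rule Lie_eqI[OF D])
    show "E + T \<in> Lie G A"
      using E(1) T(1) by (rule h_closed)
    fix f assume f: "f \<in> A"
    obtain n :: nat and a b where F: "\<And>i. i < n \<Longrightarrow> a i \<in> A" "\<And>i. i < n \<Longrightarrow> b i \<in> A"
      "\<And>x y. x \<in> X \<Longrightarrow> y \<in> X \<Longrightarrow> f (x \<otimes> y) = (\<Sum>i<n. a i x * b i y)"
      using biregularE[OF biregular_mult[OF f]] by blast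
    have mem: "\<pi> x \<in> X" "\<nu> x \<in> X" if "x \<in> X" for x
      using pr(1)[OF that] L(3) N(3) by auto
    have "biregular (\<lambda>x y. f (\<pi> x \<otimes> \<nu> y))"
    proof (rule biregularI[where a = "\<lambda>i. restr X (\<lambda>x. a i (\<pi> x))" and b = "\<lambda>i. restr X (\<lambda>x. b i (\<nu> x))"])
      show "f (\<pi> x \<otimes> \<nu> y) = (\<Sum>i<n. restr X (\<lambda>x. a i (\<pi> x)) x * restr X (\<lambda>x. b i (\<nu> x)) y)"
        if "x \<in> X" "y \<in> X" for x y
        using F(3)[OF mem(1)[OF that(1)] mem(2)[OF that(2)]] that by simp
    qed (use F pr(4,5) in auto)
    then have "D (restr X (\<lambda>x. f (\<pi> x \<otimes> \<nu> x))) \<one> =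
        D (restr X (\<lambda>x. f (\<pi> x \<otimes> \<nu> \<one>))) \<one> + D (restr X (\<lambda>x. f (\<pi> \<one> \<otimes> \<nu> x))) \<one>"
      by (rule tangent_diagonal[OF _ t one_closed])
    moreover have "restr X (\<lambda>x. f (\<pi> x \<otimes> \<nu> x)) = f" "restr X (\<lambda>x. f (\<pi> x \<otimes> \<nu> \<one>)) = restr X (\<lambda>x. f (\<pi> x))"
      "restr X (\<lambda>x. f (\<pi> \<one> \<otimes> \<nu> x)) = restr X (\<lambda>x. f (\<nu> x))"
      using pr(1) mem one A_outside[OF f] by (auto simp: fun_eq_iff)
    ultimately show "D f \<one> = (E + T) f \<one>"
      using E(2)[OF f] T(2)[OF f] by simp
  qed
  ultimately show ?thesis
    by blast
qed

text \<open>Split \<open>f\<close> into \<open>f - f \<circ> \<pi>\<close>, which vanishes on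
  \<open>L\<close>, then \<open>f \<circ> \<pi> - f \<one>\<close>, which vanishes on
  \<open>N\<close>, and a constant.\<close>

lemma Lie_disjoint:
  assumes "D \<in> \<ll>" "D \<in> \<nn>"
  shows "D = 0"
proof -
  obtain \<pi> \<nu> where pr: "\<And>x. x \<in> X \<Longrightarrow> \<pi> x \<in> L \<and> \<nu> x \<in> N \<and> \<pi> x \<otimes> \<nu> x = x"
    "\<And>x. x \<in> L \<Longrightarrow> \<pi> x = x \<and> \<nu> x = \<one>" "\<And>x. x \<in> N \<Longrightarrow> \<pi> x = \<one> \<and> \<nu> x = x"
    "\<And>f. f \<in> A \<Longrightarrow> restr X (\<lambda>x. f (\<pi> x)) \<in> A" "\<And>f. f \<in> A \<Longrightarrow> restr X (\<lambda>x. f (\<nu> x)) \<in> A"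
    by (rule projections) blast
  have D: "D \<in> Lie G A"
    using assms(1) by (rule Lie_subgroup_Lie)
  note lin = linear_on_AD[OF Lie_linear[OF D]]
  have "D f \<one> = 0" if f: "f \<in> A" for f
  proof -
    let ?g = "restr X (\<lambda>x. f (\<pi> x))"
    have "D (f - ?g) \<one> = 0"
      by (rule Lie_subgroupD[OF assms(1)]) (use f pr(2,4) A_diff L(3) in auto)
    moreover have "D (?g - \<kappa> (f \<one>)) \<one> = 0"
      by (rule Lie_subgroupD[OF assms(2)]) (use f pr(3,4) A_diff A_const N(3) in auto)
    ultimately show ?thesis
      using lin(4)[OF f pr(4)[OF f]] lin(4)[OF pr(4)[OF f] A_const, of "f \<one>"]
        tangent_const[OF Lie_tangent[OF D] one_closed, of "f \<one>"] by simp
  qed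
  then show ?thesis
    using V.subspace_0[OF Lie_subspace] by (intro Lie_eqI[OF D]) auto
qed

text \<open>Commutativity makes \<open>f (x \<otimes> y) - f (y \<otimes> x)\<close> vanish for
  \<open>x\<close> and \<open>y\<close> in \<open>N\<close>, so applying \<open>v\<close> in one
  variable and \<open>u\<close> in the other gives 0. Fubini identifies the swapped term with the
  second half of the commutator.\<close>

lemma \<nn>_abelian:
  assumes u: "u \<in> \<nn>" and v: "v \<in> \<nn>"
  shows "commutator u v = 0"
proof (rule Lie_eqI)
  have uL: "u \<in> Lie G A" and vL: "v \<in> Lie G A"
    using u v Lie_subgroup_Lie by auto
  then show "commutator u v \<in> Lie G A"
    by (rule commutator_closed)
  show "0 \<in> Lie G A"
    by (rule V.subspace_0[OF Lie_subspace])
  fix f assume f: "f \<in> A"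
  note linu = linear_on_AD[OF Lie_linear[OF uL]] and linv = linear_on_AD[OF Lie_linear[OF vL]]
  let ?a = "restr X (\<lambda>x. v (ltr x f) \<one>)" and ?b = "restr X (\<lambda>x. v (rtr x f) \<one>)"
  have a: "?a \<in> A"
    by (rule biregular_slice[OF biregular_mult[OF f] Lie_linear[OF vL]])
  have b: "?b \<in> A"
    unfolding rtr_eq by (rule biregular_slice[OF biregular_swap[OF biregular_mult[OF f]] Lie_linear[OF vL]])
  have fub: "v (restr X (\<lambda>x. u (ltr x f) \<one>)) \<one> = u ?b \<one>"
    unfolding rtr_eq by (rule biregular_fubini[OF biregular_mult[OF f] Lie_linear[OF vL] Lie_linear[OF uL]])
  have "u (?a - ?b) \<one> = 0"
  proof (rule Lie_subgroupD[OF u A_diff[OF a b]])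
    fix x assume x: "x \<in> N"
    then have xX: "x \<in> X"
      using N(3) by auto
    have "v (ltr x f - rtr x f) \<one> = 0"
      using x xX N(3) N_comm by (intro Lie_subgroupD[OF v] A_diff ltr_A rtr_A f) (auto simp: rtr_eq)
    then show "(?a - ?b) x = 0"
      using linv(4)[OF ltr_A[OF f xX] rtr_A[OF f xX]] xX by simp
  qed
  then have "u ?a \<one> - v (restr X (\<lambda>x. u (ltr x f) \<one>)) \<one> = 0"
    unfolding fub using linu(4)[OF a b] by simp
  then show "commutator u v f \<one> = 0 f \<one>"
    using commutator_value[OF uL vL f] by simp
qed

text \<open>The infinitesimal form of normality: for \<open>f\<close> vanishing on \<open>N\<close>
  the function that sends \<open>g\<close> to \<open>Ad G A (inv g) v f \<one>\<close> is
  identically 0 on the group, and its derivative at 1 is the commutator up to sign.\<close>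

lemma \<nn>_ideal:
  assumes x: "x \<in> Lie G A" and v: "v \<in> \<nn>"
  shows "commutator x v \<in> \<nn>"
proof (rule Lie_subgroupI)
  have vL: "v \<in> Lie G A"
    using v by (rule Lie_subgroup_Lie)
  show "commutator x v \<in> Lie G A"
    using x vL by (rule commutator_closed)
  fix f assume f: "f \<in> A" "\<forall>x\<in>N. f x = 0"
  have "Ad G A (inv g) v f \<one> = 0" if g: "g \<in> X" for g
  proof -
    have "v (ctr (inv g) f) \<one> = 0"
    proof (rule Lie_subgroupD[OF v ctr_A[OF f(1) inv_closed[OF g]]])
      fix y assume y: "y \<in> N"
      then show "ctr (inv g) f y = 0"
        using f(2) normal.inv_op_closed1[OF N(4) g y] g by auto
    qed
    then show ?thesis
      using Ad_value[OF vL inv_closed[OF g] f(1)] by simp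
  qed
  then have "restr X (\<lambda>g. Ad G A (inv g) v f \<one>) = \<kappa> 0"
    by (auto simp: fun_eq_iff)
  then show "commutator x v f \<one> = 0"
    using Ad_derivative[OF x vL f(1)] tangent_const[OF Lie_tangent[OF x] one_closed, of 0] by simp
qed

lemma Ad_\<nn>:
  assumes g: "g \<in> X" and v: "v \<in> \<nn>"
  shows "Ad G A g v \<in> \<nn>"
proof (rule Lie_subgroupI)
  have vL: "v \<in> Lie G A"
    using v by (rule Lie_subgroup_Lie)
  then show "Ad G A g v \<in> Lie G A"
    using g by (rule Ad_Lie)
  fix f assume f: "f \<in> A" "\<forall>x\<in>N. f x = 0"
  have "v (ctr g f) \<one> = 0"
  proof (rule Lie_subgroupD[OF v ctr_A[OF f(1) g]])
    fix y assume y: "y \<in> N"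
    then show "ctr g f y = 0"
      using f(2) normal.inv_op_closed2[OF N(4) g y] by auto
  qed
  then show "Ad G A g v f \<one> = 0"
    using Ad_value[OF vL g f(1)] by simp
qed

abbreviation "\<nn>\<^sub>d \<equiv> dual_space op_scale \<nn>"

lemma \<nn>_closed: "0 \<in> \<nn>" "u \<in> \<nn> \<Longrightarrow> v \<in> \<nn> \<Longrightarrow> u + v \<in> \<nn>" "v \<in> \<nn> \<Longrightarrow> op_scale c v \<in> \<nn>"
  using V.subspace_0[OF Lie_subgroup_subspace] V.subspace_add[OF Lie_subgroup_subspace]
    V.subspace_scale[OF Lie_subgroup_subspace] by blast+

lemma \<nn>\<^sub>dD:
  assumes "\<gamma> \<in> \<nn>\<^sub>d"
  shows "u \<in> \<nn> \<Longrightarrow> v \<in> \<nn> \<Longrightarrow> \<gamma> (u + v) = \<gamma> u + \<gamma> v" "v \<in> \<nn> \<Longrightarrow> \<gamma> (op_scale c v) = c * \<gamma> v"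
    "v \<notin> \<nn> \<Longrightarrow> \<gamma> v = 0" "\<gamma> 0 = 0"
proof -
  show "u \<in> \<nn> \<Longrightarrow> v \<in> \<nn> \<Longrightarrow> \<gamma> (u + v) = \<gamma> u + \<gamma> v" "v \<notin> \<nn> \<Longrightarrow> \<gamma> v = 0"
    using assms unfolding dual_space_def by blast+
  show scl: "v \<in> \<nn> \<Longrightarrow> \<gamma> (op_scale c v) = c * \<gamma> v" for v c
    using assms unfolding dual_space_def by blast
  show "\<gamma> 0 = 0"
    using scl[OF \<nn>_closed(1), of 0] V.scale_zero_left[of 0] by simp
qed

text \<open>The functionals \<open>v \<mapsto> v f \<one>\<close> for generators \<open>f\<close>
  have common kernel 0, so they span the dual. Once \<open>\<gamma>\<close> is given by a single
  function \<open>h\<close>, regularity and derivatives of its matrix coefficients reduce to those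
  of \<open>Ad\<close>.\<close>

lemma dual_represented:
  assumes \<gamma>: "\<gamma> \<in> \<nn>\<^sub>d"
  shows "\<exists>h\<in>A. \<forall>v\<in>\<nn>. \<gamma> v = v h \<one>"
proof -
  obtain F where F: "finite F" "A = generated_algebra X F"
    using A_generated by blast
  let ?I = "restr X ` F"
  have IA: "?I \<subseteq> A"
    using F(2) generated_algebra.gen by fastforce
  have "\<exists>c. \<forall>v\<in>\<nn>. \<gamma> v = (\<Sum>i\<in>?I. c i * v i \<one>)"
  proof (rule V.functional_in_span)
    fix v assume v: "v \<in> \<nn>" "\<forall>f\<in>?I. v f \<one> = 0"
    have vL: "v \<in> Lie G A"
      using v(1) by (rule Lie_subgroup_Lie)
    have "f \<in> A \<and> v f \<one> = 0" if "f \<in> generated_algebra X F" for f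
      using that
    proof (induction rule: generated_algebra.induct)
      case (const c)
      show ?case
        using tangent_const[OF Lie_tangent[OF vL]] A_const by simp
    next
      case (gen f)
      then show ?case
        using v(2) IA by blast
    next
      case (add f g)
      then show ?case
        using LieD(3)[OF vL, of f g] A_add[of f g] by (simp add: plus_fun_def)
    next
      case (mult f g)
      then show ?case
        using LieD(5)[OF vL, of f g] A_mult[of f g] by (simp add: times_fun_def)
    qed
    then have "v = 0"
      using F(2) V.subspace_0[OF Lie_subspace] by (intro Lie_eqI[OF vL]) auto
    then show "\<gamma> v = 0"
      using \<nn>\<^sub>dD(4)[OF \<gamma>] by simp
  qed (use F(1) Lie_subgroup_subspace \<nn>\<^sub>dD[OF \<gamma>] in \<open>auto simp: op_scale_def\<close>)
  then obtain c where c: "\<And>v. v \<in> \<nn> \<Longrightarrow> \<gamma> v = (\<Sum>i\<in>?I. c i * v i \<one>)"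
    by blast
  have "\<exists>h\<in>A. \<forall>v\<in>\<nn>. (\<Sum>i\<in>I. c i * v i \<one>) = v h \<one>" if "finite I" "I \<subseteq> A" for I
    using that
  proof (induction I rule: finite_induct)
    case empty
    show ?case
    proof (intro bexI[of _ 0] ballI A_zero)
      fix v assume "v \<in> \<nn>"
      then show "(\<Sum>i\<in>{}. c i * v i \<one>) = v 0 \<one>"
        by (simp only: sum.empty linear_on_AD(3)[OF Lie_linear[OF Lie_subgroup_Lie]])
    qed
  next
    case (insert i I)
    then obtain h where h: "h \<in> A" "\<And>v. v \<in> \<nn> \<Longrightarrow> (\<Sum>i\<in>I. c i * v i \<one>) = v h \<one>"
      by auto
    let ?h = "(\<lambda>x. c i * i x) + h"
    have i: "i \<in> A"
      using insert.prems by simp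
    have "?h \<in> A"
      using A_add[OF A_scale[OF i] h(1)] .
    moreover have "(\<Sum>i\<in>insert i I. c i * v i \<one>) = v ?h \<one>" if "v \<in> \<nn>" for v
    proof -
      note lin = linear_on_AD[OF Lie_linear[OF Lie_subgroup_Lie[OF that]]]
      have "v ?h \<one> = c i * v i \<one> + v h \<one>"
        using lin(1)[OF A_scale[OF i, of "c i"] h(1)] lin(2)[OF i, of "c i"] by simp
      then show ?thesis
        using insert.hyps h(2)[OF that] by simp
    qed
    ultimately show ?case
      by blast
  qed
  then show ?thesis
    using c F(1) IA by auto
qed

subsection \<open>Matrix coefficients of the dual action\<close>

definition coefficient :: "(('a, 'b) operator \<Rightarrow> 'b) \<Rightarrow> ('a, 'b) operator \<Rightarrow> 'a \<Rightarrow> 'b" where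
  "coefficient \<gamma> v = restr X (\<lambda>g. \<gamma> (Ad G A (inv g) v))"

abbreviation "orb \<gamma> g \<equiv> dual_action G A \<nn> g \<gamma>"

lemma coefficient_represented:
  assumes \<gamma>: "\<gamma> \<in> \<nn>\<^sub>d" and v: "v \<in> \<nn>"
  obtains h where "h \<in> A" "coefficient \<gamma> v = restr X (\<lambda>g. Ad G A (inv g) v h \<one>)"
    "\<And>u. u \<in> \<nn> \<Longrightarrow> \<gamma> u = u h \<one>"
proof -
  obtain h where h: "h \<in> A" "\<And>u. u \<in> \<nn> \<Longrightarrow> \<gamma> u = u h \<one>"
    using dual_represented[OF \<gamma>] by blast
  have "coefficient \<gamma> v = restr X (\<lambda>g. Ad G A (inv g) v h \<one>)"
    unfolding coefficient_def using h(2)[OF Ad_\<nn>[OF _ v]] by (auto simp: fun_eq_iff)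
  then show thesis
    using that h by blast
qed

lemma coefficient_A: "\<gamma> \<in> \<nn>\<^sub>d \<Longrightarrow> v \<in> \<nn> \<Longrightarrow> coefficient \<gamma> v \<in> A"
  by (erule (1) coefficient_represented) (simp only: Ad_regular[OF Lie_subgroup_Lie])

lemma coefficient_derivative:
  assumes "\<gamma> \<in> \<nn>\<^sub>d" "v \<in> \<nn>" "x \<in> Lie G A"
  shows "x (coefficient \<gamma> v) \<one> = - \<gamma> (commutator x v)"
proof -
  obtain h where h: "h \<in> A" "coefficient \<gamma> v = restr X (\<lambda>g. Ad G A (inv g) v h \<one>)"
    "\<And>u. u \<in> \<nn> \<Longrightarrow> \<gamma> u = u h \<one>"
    using coefficient_represented[OF assms(1,2)] by blast
  show ?thesis
    unfolding h(2) Ad_derivative[OF assms(3) Lie_subgroup_Lie[OF assms(2)] h(1)]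
    using h(3)[OF \<nn>_ideal[OF assms(3,2)]] by simp
qed

lemma orb_\<nn>\<^sub>d:
  assumes \<gamma>: "\<gamma> \<in> \<nn>\<^sub>d" and g: "g \<in> X"
  shows "orb \<gamma> g \<in> \<nn>\<^sub>d"
  unfolding dual_action_def dual_space_def
  using \<nn>_closed \<nn>\<^sub>dD[OF \<gamma>] Ad_\<nn>[OF inv_closed[OF g]] Lie_subgroup_Lie g
  by (simp add: Ad_add Ad_scale)

lemma orb_apply: "v \<in> \<nn> \<Longrightarrow> g \<in> X \<Longrightarrow> orb \<gamma> g v = coefficient \<gamma> v g"
  by (simp add: dual_action_def coefficient_def)

lemma coefficient_one: "v \<in> \<nn> \<Longrightarrow> coefficient \<gamma> v \<one> = \<gamma> v"
  by (simp add: coefficient_def Ad_one[OF Lie_subgroup_Lie])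

lemma rtr_coefficient:
  assumes v: "v \<in> \<nn>" and g: "g \<in> X"
  shows "rtr g (coefficient \<gamma> v) = coefficient (orb \<gamma> g) v"
proof
  fix x
  show "rtr g (coefficient \<gamma> v) x = coefficient (orb \<gamma> g) v x"
  proof (cases "x \<in> X")
    case True
    then show ?thesis
      using g v Ad_Ad[OF inv_closed[OF g] inv_closed[OF True] Lie_subgroup_Lie[OF v]] Ad_\<nn>[OF inv_closed[OF True] v]
      by (simp add: rtr_eq coefficient_def dual_action_def inv_mult_group)
  next
    case False
    then show ?thesis
      by (simp add: rtr_eq coefficient_def)
  qed
qed

lemma ltr_coefficient:
  assumes v: "v \<in> \<nn>" and g: "g \<in> X"
  shows "ltr g (coefficient \<gamma> v) = coefficient \<gamma> (Ad G A (inv g) v)"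
proof
  fix x
  show "ltr g (coefficient \<gamma> v) x = coefficient \<gamma> (Ad G A (inv g) v) x"
    using g Ad_Ad[OF _ inv_closed[OF g] Lie_subgroup_Lie[OF v], of "inv x"]
    by (simp add: coefficient_def inv_mult_group)
qed

lemma right_derivation_coefficient:
  assumes \<gamma>: "\<gamma> \<in> \<nn>\<^sub>d" and v: "v \<in> \<nn>" and x: "x \<in> Lie G A"
  shows "right_derivation x (coefficient \<gamma> v) = - coefficient \<gamma> (commutator x v)"
proof
  fix g
  show "right_derivation x (coefficient \<gamma> v) g = (- coefficient \<gamma> (commutator x v)) g"
  proof (cases "g \<in> X")
    case True
    then show ?thesis
      using coefficient_derivative[OF orb_\<nn>\<^sub>d[OF \<gamma> True] v x] orb_apply[OF \<nn>_ideal[OF x v] True]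
      by (simp add: right_derivation_def rtr_coefficient[OF v])
  next
    case False
    then show ?thesis
      by (simp add: right_derivation_def coefficient_def)
  qed
qed

lemma right_derivation_L:
  assumes x: "x \<in> \<ll>" and f: "f \<in> A" "\<forall>y\<in>L. f y = 0"
  shows "right_derivation x f \<in> A \<and> (\<forall>y\<in>L. right_derivation x f y = 0)"
proof (intro conjI ballI)
  show "right_derivation x f \<in> A"
    by (rule right_derivation(1)[OF Lie_subgroup_Lie[OF x] f(1)])
  fix y assume y: "y \<in> L"
  then have yX: "y \<in> X"
    using L(3) by blast
  have "x (rtr y f) \<one> = 0"
  proof (rule Lie_subgroupD[OF x rtr_A[OF f(1) yX]])
    fix z assume "z \<in> L"
    then show "rtr y f z = 0"
      using f(2) y subgroup.m_closed[OF L(2)] by (simp add: rtr_eq)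
  qed
  then show "right_derivation x f y = 0"
    using yX by (simp add: right_derivation_def)
qed

abbreviation "I\<^sub>L \<equiv> {f \<in> A. \<forall>y\<in>L. f y = 0}"

lemma L_zero_set: "L = {x \<in> X. \<forall>f\<in>I\<^sub>L. f x = 0}"
  using closed_subgroup_zero_set[OF L(1)] L(3) by blast

text \<open>Differentiating the equations of the stabiliser gives one inclusion. The other is
  \<open>Lie_zero_set\<close>: if \<open>\<gamma>\<close> kills all \<open>[x, v]\<close>, the right
  derivation along \<open>x\<close> turns the equation for \<open>v\<close> into minus the equation
  for \<open>[x, v]\<close>.\<close>

lemma Lie_stabiliser:
  assumes \<gamma>: "\<gamma> \<in> \<nn>\<^sub>d"
  shows "Lie_subgroup G A (point_stabiliser G A L \<nn> \<gamma>) = {x \<in> \<ll>. \<forall>v\<in>\<nn>. \<gamma> (commutator x v) = 0}"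
proof -
  define S where "S = I\<^sub>L \<union> (\<lambda>v. coefficient \<gamma> v - \<kappa> (\<gamma> v)) ` \<nn>"
  have SA: "S \<subseteq> A"
    unfolding S_def using coefficient_A[OF \<gamma>] A_diff A_const by auto
  have fix_iff: "orb \<gamma> g = \<gamma> \<longleftrightarrow> (\<forall>v\<in>\<nn>. coefficient \<gamma> v g = \<gamma> v)" if "g \<in> X" for g
    using orb_apply[OF _ that, of _ \<gamma>] \<nn>\<^sub>dD(3)[OF \<gamma>]
    by (auto simp: fun_eq_iff dual_action_def coefficient_def that)
  have stab_sub: "point_stabiliser G A L \<nn> \<gamma> \<subseteq> L"
    unfolding point_stabiliser_def by blast
  have Z: "{x \<in> X. \<forall>s\<in>S. s x = 0} = point_stabiliser G A L \<nn> \<gamma>"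
  proof -
    have "(\<forall>s\<in>S. s x = 0) \<longleftrightarrow> x \<in> L \<and> (\<forall>v\<in>\<nn>. coefficient \<gamma> v x = \<gamma> v)" if "x \<in> X" for x
    proof -
      have "(\<forall>s\<in>I\<^sub>L. s x = 0) \<longleftrightarrow> x \<in> L"
        using L_zero_set that by blast
      then show ?thesis
        unfolding S_def ball_Un using that by simp
    qed
    then have "{x \<in> X. \<forall>s\<in>S. s x = 0} = {x \<in> L. \<forall>v\<in>\<nn>. coefficient \<gamma> v x = \<gamma> v}"
      using L(3) by auto
    then show ?thesis
      unfolding point_stabiliser_def using fix_iff L(3) by auto
  qed
  show ?thesis
  proof (intro equalityI subsetI)
    fix x assume x: "x \<in> Lie_subgroup G A (point_stabiliser G A L \<nn> \<gamma>)"
    then have xL: "x \<in> Lie G A"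
      by (rule Lie_subgroup_Lie)
    have "x \<in> \<ll>"
      using stab_sub by (intro Lie_subgroupI[OF xL] Lie_subgroupD[OF x]) auto
    moreover have "\<gamma> (commutator x v) = 0" if v: "v \<in> \<nn>" for v
    proof -
      have "x (coefficient \<gamma> v - \<kappa> (\<gamma> v)) \<one> = 0"
      proof (rule Lie_subgroupD[OF x])
        have sS: "coefficient \<gamma> v - \<kappa> (\<gamma> v) \<in> S"
          unfolding S_def using v by blast
        then show "coefficient \<gamma> v - \<kappa> (\<gamma> v) \<in> A"
          using SA by blast
        fix y assume "y \<in> point_stabiliser G A L \<nn> \<gamma>"
        then show "(coefficient \<gamma> v - \<kappa> (\<gamma> v)) y = 0"
          unfolding Z[symmetric] using sS by blast
      qed
      then show ?thesis
        using linear_on_AD(4)[OF Lie_linear[OF xL] coefficient_A[OF \<gamma> v] A_const, of "\<gamma> v"]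
          tangent_const[OF Lie_tangent[OF xL] one_closed, of "\<gamma> v"] coefficient_derivative[OF \<gamma> v xL] by simp
    qed
    ultimately show "x \<in> {x \<in> \<ll>. \<forall>v\<in>\<nn>. \<gamma> (commutator x v) = 0}"
      by blast
  next
    fix x assume "x \<in> {x \<in> \<ll>. \<forall>v\<in>\<nn>. \<gamma> (commutator x v) = 0}"
    then have x: "x \<in> \<ll>" "\<And>v. v \<in> \<nn> \<Longrightarrow> \<gamma> (commutator x v) = 0"
      by auto
    have xL: "x \<in> Lie G A"
      using x(1) by (rule Lie_subgroup_Lie)
    have "x \<in> Lie_subgroup G A {x \<in> X. \<forall>s\<in>S. s x = 0}"
    proof (rule Lie_zero_set[OF SA _ xL])
      show "s \<one> = 0" if "s \<in> S" for s
        using that subgroup.one_closed[OF L(2)] coefficient_one unfolding S_def by auto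
      fix s assume "s \<in> S"
      then consider "s \<in> I\<^sub>L" | v where "v \<in> \<nn>" "s = coefficient \<gamma> v - \<kappa> (\<gamma> v)"
        unfolding S_def by blast
      then show "right_derivation x s \<in> genideal S"
      proof cases
        case 1
        then have "right_derivation x s \<in> S"
          using right_derivation_L[OF x(1)] unfolding S_def by blast
        then show ?thesis
          using genideal_base[OF SA] by blast
      next
        case (2 v)
        let ?w = "commutator x v"
        have w: "?w \<in> \<nn>"
          using xL 2(1) by (rule \<nn>_ideal)
        have "coefficient \<gamma> ?w - \<kappa> (\<gamma> ?w) \<in> genideal S"
          using genideal_base[OF SA] w unfolding S_def by blast
        moreover have "\<kappa> (\<gamma> ?w) = 0"
          using x(2)[OF 2(1)] by (auto simp: fun_eq_iff)
        ultimately have "- coefficient \<gamma> ?w \<in> genideal S"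
          using alg_idealD(5)[OF subalg_A alg_ideal_genideal] by simp
        moreover have "right_derivation x s = - coefficient \<gamma> ?w"
          unfolding 2(2) using right_derivation(3)[OF xL coefficient_A[OF \<gamma> 2(1)] A_const, of "\<gamma> v"]
            right_derivation(5)[OF xL] right_derivation_coefficient[OF \<gamma> 2(1) xL] by simp
        ultimately show ?thesis
          by simp
      qed
    qed
    then show "x \<in> Lie_subgroup G A (point_stabiliser G A L \<nn> \<gamma>)"
      unfolding Z .
  qed
qed

lemma multiple_of_functional:
  assumes \<gamma>: "\<gamma> \<in> \<nn>\<^sub>d" and add: "\<And>u v. u \<in> \<nn> \<Longrightarrow> v \<in> \<nn> \<Longrightarrow> \<phi> (u + v) = \<phi> u + \<phi> v"
    and scl: "\<And>c v. v \<in> \<nn> \<Longrightarrow> \<phi> (op_scale c v) = c * \<phi> v"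
    and ker: "\<And>v. v \<in> \<nn> \<Longrightarrow> \<gamma> v = 0 \<Longrightarrow> \<phi> v = 0"
  shows "\<exists>c. \<forall>v\<in>\<nn>. \<phi> v = c * \<gamma> v"
proof -
  have "\<exists>c. \<forall>v\<in>\<nn>. \<phi> v = (\<Sum>i\<in>{()}. c i * \<gamma> v)"
    by (rule V.functional_in_span) (use Lie_subgroup_subspace \<nn>\<^sub>dD[OF \<gamma>] assms in auto)
  then show ?thesis
    by auto
qed

text \<open>The unknown scalar is eliminated: \<open>g\<close> preserves the line iff
  \<open>g\<gamma>\<close> vanishes on the kernel of \<open>\<gamma>\<close>, which gives one
  equation for each \<open>v\<close> in this kernel. If \<open>x\<close> acts on
  \<open>\<gamma>\<close> by a scalar, \<open>[x, v]\<close> stays in the kernel, so these equations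
  are stable under the right derivation along \<open>x\<close>.\<close>

lemma Lie_line_normaliser:
  assumes \<gamma>: "\<gamma> \<in> \<nn>\<^sub>d"
  shows "Lie_subgroup G A (line_normaliser G A L \<nn> \<gamma>) =
    {x \<in> \<ll>. \<exists>c. \<forall>v\<in>\<nn>. \<gamma> (commutator x v) = c * \<gamma> v}"
proof -
  define S where "S = I\<^sub>L \<union> coefficient \<gamma> ` {v \<in> \<nn>. \<gamma> v = 0}"
  have SA: "S \<subseteq> A"
    unfolding S_def using coefficient_A[OF \<gamma>] by auto
  have norm_iff: "(\<exists>c. orb \<gamma> g = (\<lambda>v. c * \<gamma> v)) \<longleftrightarrow> (\<forall>v\<in>\<nn>. \<gamma> v = 0 \<longrightarrow> coefficient \<gamma> v g = 0)" if g: "g \<in> X" for g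
  proof
    assume "\<exists>c. orb \<gamma> g = (\<lambda>v. c * \<gamma> v)"
    then obtain c where "orb \<gamma> g = (\<lambda>v. c * \<gamma> v)" ..
    then show "\<forall>v\<in>\<nn>. \<gamma> v = 0 \<longrightarrow> coefficient \<gamma> v g = 0"
      using orb_apply[OF _ g, of _ \<gamma>] by fastforce
  next
    assume a: "\<forall>v\<in>\<nn>. \<gamma> v = 0 \<longrightarrow> coefficient \<gamma> v g = 0"
    have "\<exists>c. \<forall>v\<in>\<nn>. orb \<gamma> g v = c * \<gamma> v"
      by (rule multiple_of_functional[OF \<gamma>]) (use a orb_apply[OF _ g, of _ \<gamma>] \<nn>\<^sub>dD[OF orb_\<nn>\<^sub>d[OF \<gamma> g]] in auto)
    then obtain c where c: "\<And>v. v \<in> \<nn> \<Longrightarrow> orb \<gamma> g v = c * \<gamma> v"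
      by blast
    have "orb \<gamma> g v = c * \<gamma> v" for v
      using c[of v] \<nn>\<^sub>dD(3)[OF \<gamma>, of v] \<nn>\<^sub>dD(3)[OF orb_\<nn>\<^sub>d[OF \<gamma> g], of v] by (cases "v \<in> \<nn>") auto
    then show "\<exists>c. orb \<gamma> g = (\<lambda>v. c * \<gamma> v)"
      by blast
  qed
  have norm_sub: "line_normaliser G A L \<nn> \<gamma> \<subseteq> L"
    unfolding line_normaliser_def by blast
  have Z: "{x \<in> X. \<forall>s\<in>S. s x = 0} = line_normaliser G A L \<nn> \<gamma>"
  proof -
    have "(\<forall>s\<in>S. s x = 0) \<longleftrightarrow> x \<in> L \<and> (\<forall>v\<in>\<nn>. \<gamma> v = 0 \<longrightarrow> coefficient \<gamma> v x = 0)" if "x \<in> X" for x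
    proof -
      have "(\<forall>s\<in>I\<^sub>L. s x = 0) \<longleftrightarrow> x \<in> L"
        using L_zero_set that by blast
      then show ?thesis
        unfolding S_def by auto
    qed
    then have "{x \<in> X. \<forall>s\<in>S. s x = 0} = {x \<in> L. \<forall>v\<in>\<nn>. \<gamma> v = 0 \<longrightarrow> coefficient \<gamma> v x = 0}"
      using L(3) by auto
    then show ?thesis
      unfolding line_normaliser_def using norm_iff L(3) by auto
  qed
  show ?thesis
  proof (intro equalityI subsetI)
    fix x assume x: "x \<in> Lie_subgroup G A (line_normaliser G A L \<nn> \<gamma>)"
    then have xL: "x \<in> Lie G A"
      by (rule Lie_subgroup_Lie)
    have "x \<in> \<ll>"
      using norm_sub by (intro Lie_subgroupI[OF xL] Lie_subgroupD[OF x]) auto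
    moreover have "\<exists>c. \<forall>v\<in>\<nn>. \<gamma> (commutator x v) = c * \<gamma> v"
    proof (rule multiple_of_functional[OF \<gamma>])
      fix v assume v: "v \<in> \<nn>" "\<gamma> v = 0"
      have "x (coefficient \<gamma> v) \<one> = 0"
      proof (rule Lie_subgroupD[OF x coefficient_A[OF \<gamma> v(1)]])
        have sS: "coefficient \<gamma> v \<in> S"
          unfolding S_def using v by blast
        fix y assume "y \<in> line_normaliser G A L \<nn> \<gamma>"
        then show "coefficient \<gamma> v y = 0"
          unfolding Z[symmetric] using sS by blast
      qed
      then show "\<gamma> (commutator x v) = 0"
        using coefficient_derivative[OF \<gamma> v(1) xL] by simp
    qed (simp_all add: br_add_right[OF _ _ xL] br_scale_right[OF _ xL] Lie_subgroup_Lie \<nn>\<^sub>dD[OF \<gamma>] \<nn>_ideal[OF xL])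
    ultimately show "x \<in> {x \<in> \<ll>. \<exists>c. \<forall>v\<in>\<nn>. \<gamma> (commutator x v) = c * \<gamma> v}"
      by blast
  next
    fix x assume "x \<in> {x \<in> \<ll>. \<exists>c. \<forall>v\<in>\<nn>. \<gamma> (commutator x v) = c * \<gamma> v}"
    then obtain c where x: "x \<in> \<ll>" "\<And>v. v \<in> \<nn> \<Longrightarrow> \<gamma> (commutator x v) = c * \<gamma> v"
      by auto
    have xL: "x \<in> Lie G A"
      using x(1) by (rule Lie_subgroup_Lie)
    have "x \<in> Lie_subgroup G A {x \<in> X. \<forall>s\<in>S. s x = 0}"
    proof (rule Lie_zero_set[OF SA _ xL])
      show "s \<one> = 0" if "s \<in> S" for s
        using that subgroup.one_closed[OF L(2)] coefficient_one unfolding S_def by auto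
      fix s assume "s \<in> S"
      then consider "s \<in> I\<^sub>L" | v where "v \<in> \<nn>" "\<gamma> v = 0" "s = coefficient \<gamma> v"
        unfolding S_def by blast
      then show "right_derivation x s \<in> genideal S"
      proof cases
        case 1
        then have "right_derivation x s \<in> S"
          using right_derivation_L[OF x(1)] unfolding S_def by blast
        then show ?thesis
          using genideal_base[OF SA] by blast
      next
        case (2 v)
        have "commutator x v \<in> \<nn>" "\<gamma> (commutator x v) = 0"
          using \<nn>_ideal[OF xL 2(1)] x(2)[OF 2(1)] 2(2) by simp_all
        then have "coefficient \<gamma> (commutator x v) \<in> genideal S"
          using genideal_base[OF SA] unfolding S_def by blast
        then show ?thesis
          unfolding 2(3) right_derivation_coefficient[OF \<gamma> 2(1) xL]
          by (rule alg_idealD(5)[OF subalg_A alg_ideal_genideal])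
      qed
    qed
    then show "x \<in> Lie_subgroup G A (line_normaliser G A L \<nn> \<gamma>)"
      unfolding Z .
  qed
qed

end

section \<open>Open orbits\<close>

definition polynomial_function :: "('k::field_char_0 \<Rightarrow> 'k) \<Rightarrow> bool" where
  "polynomial_function h \<longleftrightarrow> (\<exists>P. \<forall>t. h t = poly P t)"

lemma polynomial_function_intros:
  "polynomial_function (\<lambda>_. c)" "polynomial_function (\<lambda>t. a + t * b)"
  "polynomial_function g \<Longrightarrow> polynomial_function h \<Longrightarrow> polynomial_function (\<lambda>t. g t + h t)"
  "polynomial_function g \<Longrightarrow> polynomial_function h \<Longrightarrow> polynomial_function (\<lambda>t. g t * h t)"
  "polynomial_function g \<Longrightarrow> polynomial_function (\<lambda>t. - g t)"
  "polynomial_function g \<Longrightarrow> polynomial_function (\<lambda>t. g t / c)"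
proof -
  show "polynomial_function (\<lambda>_. c)"
    unfolding polynomial_function_def by (rule exI[of _ "[:c:]"]) simp
  show "polynomial_function (\<lambda>t. a + t * b)"
    unfolding polynomial_function_def by (rule exI[of _ "[:a, b:]"]) simp
  show "polynomial_function g \<Longrightarrow> polynomial_function h \<Longrightarrow> polynomial_function (\<lambda>t. g t + h t)"
    "polynomial_function g \<Longrightarrow> polynomial_function h \<Longrightarrow> polynomial_function (\<lambda>t. g t * h t)"
    unfolding polynomial_function_def by (metis poly_add, metis poly_mult)
  show "polynomial_function g \<Longrightarrow> polynomial_function (\<lambda>t. - g t)"
    unfolding polynomial_function_def by (metis poly_minus)
  show "polynomial_function g \<Longrightarrow> polynomial_function (\<lambda>t. g t / c)"
    unfolding polynomial_function_def by (metis poly_smult divide_inverse mult.commute)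
qed

lemma polynomial_function_sum:
  "(\<And>i. i \<in> I \<Longrightarrow> polynomial_function (g i)) \<Longrightarrow> polynomial_function (\<lambda>t. \<Sum>i\<in>I. g i t)"
  by (induction I rule: infinite_finite_induct) (simp_all add: polynomial_function_intros)

lemma polynomial_function_wedge:
  assumes "\<And>v. polynomial_function (\<lambda>t. \<omega> t v)" "\<And>v. polynomial_function (\<lambda>t. \<eta> t v)"
  shows "polynomial_function (\<lambda>t. wedge p q (\<omega> t) (\<eta> t) v)"
  unfolding wedge_def
  by (intro polynomial_function_intros polynomial_function_sum assms)

text \<open>Irreducibility of the affine line: two nonempty open subsets meet. Density arguments on
  \<open>V\<^sup>*\<close> and on \<open>q\<^sup>*\<close> are reduced to it by joining two points
  by a line.\<close>

lemma polynomial_functions_nonzero: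
  fixes g h :: "'k::field_char_0 \<Rightarrow> 'k"
  assumes "polynomial_function g" "polynomial_function h" "g a \<noteq> 0" "h b \<noteq> 0"
  shows "\<exists>t. g t \<noteq> 0 \<and> h t \<noteq> 0"
proof -
  obtain P Q where P: "\<And>t. g t = poly P t" "\<And>t. h t = poly Q t"
    using assms(1,2) unfolding polynomial_function_def by blast
  then have "P * Q \<noteq> 0"
    using assms(3,4) by auto
  then have "finite {t. poly (P * Q) t = 0}"
    by (rule poly_roots_finite)
  then obtain t where "poly (P * Q) t \<noteq> 0"
    using infinite_UNIV_char_0[where 'a = 'k] by (metis (mono_tags, lifting) UNIV_eq_I mem_Collect_eq)
  then show ?thesis
    using P by auto
qed

context semidirect_group
begin

abbreviation "polys \<equiv> generated_algebra \<nn>\<^sub>d ((\<lambda>v \<phi>. \<phi> v) ` \<nn>)"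

definition line :: "(('a, 'b) operator \<Rightarrow> 'b) \<Rightarrow> (('a, 'b) operator \<Rightarrow> 'b) \<Rightarrow> 'b \<Rightarrow> ('a, 'b) operator \<Rightarrow> 'b" where
  "line a u t = (\<lambda>v. a v + t * u v)"

lemma line_dual: "a \<in> \<nn>\<^sub>d \<Longrightarrow> u \<in> \<nn>\<^sub>d \<Longrightarrow> line a u t \<in> \<nn>\<^sub>d"
  unfolding line_def dual_space_def by (auto simp: algebra_simps)

lemma polys_line:
  assumes "p \<in> polys" "a \<in> \<nn>\<^sub>d" "u \<in> \<nn>\<^sub>d"
  shows "polynomial_function (\<lambda>t. p (line a u t))"
  using assms(1)
proof (induction rule: generated_algebra.induct)
  case (const c)
  show ?case
    using line_dual[OF assms(2,3)] by (simp add: polynomial_function_intros)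
next
  case (gen f)
  then obtain v where "f = (\<lambda>\<phi>. \<phi> v)"
    by blast
  then show ?case
    using line_dual[OF assms(2,3)] by (simp add: line_def polynomial_function_intros)
qed (simp_all add: polynomial_function_intros)

lemma polys_common_nonzero:
  assumes "p \<in> polys" "q \<in> polys" "a \<in> \<nn>\<^sub>d" "b \<in> \<nn>\<^sub>d" "p a \<noteq> 0" "q b \<noteq> 0"
  shows "\<exists>w\<in>\<nn>\<^sub>d. p w \<noteq> 0 \<and> q w \<noteq> 0"
proof -
  \<comment> \<open>The direction \<open>b - a\<close>, so that the line is at \<open>a\<close> for
    parameter 0 and at \<open>b\<close> for parameter 1.\<close>
  define u where "u = line b a (- 1)"
  have u: "u \<in> \<nn>\<^sub>d"
    unfolding u_def using assms(4,3) by (rule line_dual)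
  have "line a u 0 = a" "line a u 1 = b"
    by (auto simp: line_def u_def)
  then have "\<exists>t. p (line a u t) \<noteq> 0 \<and> q (line a u t) \<noteq> 0"
    using polynomial_functions_nonzero[OF polys_line[OF assms(1,3) u] polys_line[OF assms(2,3) u], of 0 1] assms(5,6)
    by simp
  then show ?thesis
    using line_dual[OF assms(3) u] by blast
qed

lemma \<nn>_separated:
  assumes v: "v \<in> \<nn>" and z: "\<And>u. u \<in> \<nn>\<^sub>d \<Longrightarrow> u v = 0"
  shows "v = 0"
proof (rule Lie_eqI)
  show "v \<in> Lie G A"
    using v by (rule Lie_subgroup_Lie)
  show "0 \<in> Lie G A"
    by (rule V.subspace_0[OF Lie_subspace])
  fix f assume "f \<in> A"
  have "restr \<nn> (\<lambda>D. D f \<one>) \<in> \<nn>\<^sub>d"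
    unfolding dual_space_def using \<nn>_closed by (simp add: op_scale_def)
  from z[OF this] show "v f \<one> = 0 f \<one>"
    using v by simp
qed

end

section \<open>The orbit map of \<open>\<gamma>\<close> and its differential\<close>

locale open_orbit = semidirect_group +
  fixes \<gamma>
  assumes \<gamma>_dual: "\<gamma> \<in> \<nn>\<^sub>d"
    and orbit_open: "openin (zariski_dual op_scale \<nn>) ((\<lambda>g. dual_action G A \<nn> g \<gamma>) ` L)"
begin

lemma orbit_basic: "\<exists>f\<in>polys. f \<gamma> \<noteq> 0 \<and> {w \<in> \<nn>\<^sub>d. f w \<noteq> 0} \<subseteq> orb \<gamma> ` L"
proof -
  have "orb \<gamma> \<one> = \<gamma>"
  proof
    fix v
    show "orb \<gamma> \<one> v = \<gamma> v"
      using \<nn>\<^sub>dD(3)[OF \<gamma>_dual, of v] Ad_one[OF Lie_subgroup_Lie[of v N]]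
      by (cases "v \<in> \<nn>") (simp_all add: dual_action_def)
  qed
  then have "\<gamma> \<in> orb \<gamma> ` L"
    using subgroup.one_closed[OF L(2)] by (metis imageI)
  then show ?thesis
    by (intro zariski_basic_open[OF generated_algebra.mult orbit_open[unfolded zariski_dual_def]])
qed

text \<open>The equation of a principal open neighbourhood of \<open>\<gamma>\<close> inside the
  orbit; \<open>\<Delta> w \<noteq> 0\<close> certifies that \<open>w\<close> lies in the
  orbit.\<close>

definition orbit_denominator :: "(('a, 'b) operator \<Rightarrow> 'b) \<Rightarrow> 'b" ("\<Delta>") where
  "\<Delta> = (SOME f. f \<in> polys \<and> f \<gamma> \<noteq> 0 \<and> {w \<in> \<nn>\<^sub>d. f w \<noteq> 0} \<subseteq> orb \<gamma> ` L)"

lemma orbit_denominator_props: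
  "\<Delta> \<in> polys \<and> \<Delta> \<gamma> \<noteq> 0 \<and> {w \<in> \<nn>\<^sub>d. \<Delta> w \<noteq> 0} \<subseteq> orb \<gamma> ` L"
  unfolding orbit_denominator_def by (rule someI_ex[OF orbit_basic[unfolded Bex_def]])

lemmas orbit_denominator_poly = conjunct1[OF orbit_denominator_props]
lemmas orbit_denominator_nonzero = conjunct1[OF conjunct2[OF orbit_denominator_props]]

lemma orbit_denominator_orbit:
  assumes "w \<in> \<nn>\<^sub>d" "\<Delta> w \<noteq> 0"
  shows "\<exists>g\<in>L. w = orb \<gamma> g"
proof -
  have "w \<in> {w \<in> \<nn>\<^sub>d. \<Delta> w \<noteq> 0}"
    using assms by simp
  then have "w \<in> orb \<gamma> ` L"
    by (rule subsetD[OF conjunct2[OF conjunct2[OF orbit_denominator_props]]])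
  then show ?thesis
    by (rule imageE) (rule bexI)
qed

text \<open>The comorphism of the orbit map, taken on the whole group because \<open>A\<close> is
  the coordinate ring of the whole group. The restriction to \<open>L\<close> is made later by a
  prime ideal that contains \<open>I\<^sub>L\<close>.\<close>

definition pull :: "((('a, 'b) operator \<Rightarrow> 'b) \<Rightarrow> 'b) \<Rightarrow> 'a \<Rightarrow> 'b" where
  "pull p = restr X (\<lambda>g. p (orb \<gamma> g))"

lemma orb_dual: "g \<in> X \<Longrightarrow> orb \<gamma> g \<in> \<nn>\<^sub>d"
  using orb_\<nn>\<^sub>d[OF \<gamma>_dual] .

lemma pull_simps:
  "pull (p + q) = pull p + pull q" "pull (p * q) = pull p * pull q" "pull (restr \<nn>\<^sub>d (\<lambda>_. c)) = \<kappa> c"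
  "v \<in> \<nn> \<Longrightarrow> pull (restr \<nn>\<^sub>d (\<lambda>\<phi>. \<phi> v)) = coefficient \<gamma> v" "g \<in> X \<Longrightarrow> pull p g = p (orb \<gamma> g)"
  using orb_dual by (auto simp: pull_def fun_eq_iff orb_apply coefficient_def dual_action_def)

lemma pull_A: "p \<in> polys \<Longrightarrow> pull p \<in> A"
proof (induction rule: generated_algebra.induct)
  case (const c)
  show ?case
    unfolding pull_simps by (rule A_const)
next
  case (gen f)
  then obtain v where v: "v \<in> \<nn>" "f = (\<lambda>\<phi>. \<phi> v)"
    by blast
  show ?case
    unfolding v(2) pull_simps(4)[OF v(1)] by (rule coefficient_A[OF \<gamma>_dual v(1)])
next
  case (add f g)
  then show ?case
    unfolding pull_simps[unfolded plus_fun_def] pull_simps by (intro A_add)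
next
  case (mult f g)
  then show ?case
    unfolding pull_simps by (intro A_mult)
qed

lemma subalg_pull: "subalg (pull ` polys)" "pull ` polys \<subseteq> A"
proof -
  show sub: "pull ` polys \<subseteq> A"
    using pull_A by blast
  show "subalg (pull ` polys)"
    unfolding subalg_def
  proof (intro conjI ballI)
    show "range \<kappa> \<subseteq> pull ` polys"
    proof
      fix f assume "f \<in> range \<kappa>"
      then obtain c where f: "f = \<kappa> c"
        by blast
      show "f \<in> pull ` polys"
        unfolding f pull_simps(3)[symmetric] by (intro imageI generated_algebra.const)
    qed
    fix f assume f: "f \<in> pull ` polys"
    then show "\<kappa> 1 * f = f"
      using sub subalgD(4)[OF subalg_A] by blast
    fix g assume "g \<in> pull ` polys"
    with f obtain p q where pq: "p \<in> polys" "q \<in> polys" "f = pull p" "g = pull q"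
      by blast
    show "f + g \<in> pull ` polys"
      unfolding pq(3,4) pull_simps(1)[symmetric] using pq(1,2) by (intro imageI generated_algebra.add)
    show "f * g \<in> pull ` polys"
      unfolding pq(3,4) pull_simps(2)[symmetric] using pq(1,2) by (intro imageI generated_algebra.mult)
  qed
qed

text \<open>Dominance of the orbit map on \<open>L\<close>: by irreducibility of
  \<open>V\<^sup>*\<close>, a nonzero \<open>p\<close> is nonzero somewhere in the open
  orbit.\<close>

lemma pull_zero_on_L:
  assumes p: "p \<in> polys" and z: "\<forall>g\<in>L. pull p g = 0"
  shows "w \<in> \<nn>\<^sub>d \<Longrightarrow> p w = 0"
proof (rule ccontr)
  assume w: "w \<in> \<nn>\<^sub>d" "p w \<noteq> 0"
  obtain w' where w': "w' \<in> \<nn>\<^sub>d" "p w' \<noteq> 0" "\<Delta> w' \<noteq> 0"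
    using polys_common_nonzero[of p \<Delta> w \<gamma>] p orbit_denominator_poly w \<gamma>_dual orbit_denominator_nonzero by auto
  obtain g where g: "g \<in> L" "w' = orb \<gamma> g"
    using orbit_denominator_orbit[OF w'(1,3)] by (elim bexE) (rule that)
  have "g \<in> X"
    using g(1) L(3) by (rule subsetD[rotated])
  then have "pull p g = p w'"
    unfolding g(2) by (rule pull_simps)
  with z g(1) w'(2) show False
    by simp
qed

text \<open>The directional derivative at \<open>w\<close> along \<open>u\<close>, carried over to
  pulled back functions. It is well defined because \<open>pull p\<close> determines
  \<open>p\<close> on \<open>V\<^sup>*\<close>, by \<open>pull_zero_on_L\<close>.\<close>

definition pull_derivation :: "(('a, 'b) operator \<Rightarrow> 'b) \<Rightarrow> (('a, 'b) operator \<Rightarrow> 'b) \<Rightarrow> ('a \<Rightarrow> 'b) \<Rightarrow> 'b" where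
  "pull_derivation w u b =
     (THE d. \<exists>p\<in>polys. b = pull p \<and> (\<exists>P. (\<forall>t. p (line w u t) = poly P t) \<and> d = coeff P 1))"

lemma pull_derivation_eq:
  assumes w: "w \<in> \<nn>\<^sub>d" and u: "u \<in> \<nn>\<^sub>d" and p: "p \<in> polys" and P: "\<And>t. p (line w u t) = poly P t"
  shows "pull_derivation w u (pull p) = coeff P 1"
  unfolding pull_derivation_def
proof (rule the_equality)
  show "\<exists>q\<in>polys. pull p = pull q \<and> (\<exists>Q. (\<forall>t. q (line w u t) = poly Q t) \<and> coeff P 1 = coeff Q 1)"
    using p P by blast
  fix d assume "\<exists>q\<in>polys. pull p = pull q \<and> (\<exists>Q. (\<forall>t. q (line w u t) = poly Q t) \<and> d = coeff Q 1)"
  then obtain q Q where q: "q \<in> polys" "pull p = pull q" "\<And>t. q (line w u t) = poly Q t" "d = coeff Q 1"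
    by blast
  have "p - q \<in> polys"
    using p q(1) by (rule generated_algebra_diff)
  moreover have "pull (p - q) g = 0" if "g \<in> X" for g
    using that fun_cong[OF q(2), of g] by (simp add: pull_simps)
  ultimately have "(p - q) (line w u t) = 0" for t
    using L(3) line_dual[OF w u] by (intro pull_zero_on_L[of "p - q"]) auto
  then have "poly P = poly Q"
    using P q(3) by (auto simp: fun_eq_iff)
  then show "d = coeff P 1"
    using q(4) by (simp add: poly_eq_poly_eq_iff)
qed

lemma point_derivation_pull:
  assumes w: "w \<in> \<nn>\<^sub>d" and u: "u \<in> \<nn>\<^sub>d" and g: "g \<in> X" "w = orb \<gamma> g"
  shows "point_derivation (pull ` polys) (\<lambda>f. f g) (pull_derivation w u)"
  unfolding point_derivation_def
proof (intro conjI allI ballI)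
  fix c
  have "pull_derivation w u (pull (restr \<nn>\<^sub>d (\<lambda>_. c))) = coeff [:c:] 1"
    by (rule pull_derivation_eq[OF w u generated_algebra.const]) (simp add: line_dual[OF w u])
  then show "pull_derivation w u (\<kappa> c) = 0"
    unfolding pull_simps by simp
next
  fix a b assume "a \<in> pull ` polys" "b \<in> pull ` polys"
  then obtain p q where pq: "p \<in> polys" "q \<in> polys" "a = pull p" "b = pull q"
    by blast
  obtain P Q where P: "\<And>t. p (line w u t) = poly P t" and Q: "\<And>t. q (line w u t) = poly Q t"
    using polys_line[OF pq(1) w u] polys_line[OF pq(2) w u] unfolding polynomial_function_def by blast
  note dP = pull_derivation_eq[of w u p P, OF w u pq(1) P] and dQ = pull_derivation_eq[of w u q Q, OF w u pq(2) Q]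
  have "line w u 0 = w"
    by (simp add: line_def)
  then have ev: "pull p g = coeff P 0" "pull q g = coeff Q 0"
    using P[of 0] Q[of 0] g by (simp_all add: pull_simps poly_0_coeff_0)
  have "pull_derivation w u (pull (p + q)) = coeff (P + Q) 1"
    by (rule pull_derivation_eq[OF w u generated_algebra.add[OF pq(1,2)]]) (simp add: P Q)
  then show "pull_derivation w u (a + b) = pull_derivation w u a + pull_derivation w u b"
    unfolding pq(3,4) pull_simps(1)[symmetric] dP dQ by simp
  have "pull_derivation w u (pull (p * q)) = coeff (P * Q) 1"
    by (rule pull_derivation_eq[OF w u generated_algebra.mult[OF pq(1,2)]]) (simp add: P Q)
  then show "pull_derivation w u (a * b) = pull_derivation w u a * b g + a g * pull_derivation w u b"
    unfolding pq(3,4) pull_simps(2)[symmetric] dP dQ ev by (simp add: coeff_mult)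
qed

text \<open>
  The orbit map is dominant, so tangent vectors lift at a general point of \<open>L\<close>, and by homogeneity
  everywhere.
\<close>

theorem orbit_map_submersive:
  assumes v: "v \<in> \<nn>" and z: "\<forall>x\<in>\<ll>. \<gamma> (commutator x v) = 0"
  shows "v = 0"
proof -
  let ?B = "pull ` polys"
  define S where "S = {pull p | p. p \<in> polys \<and> (\<exists>w\<in>\<nn>\<^sub>d. p w \<noteq> 0)}"
  have S_I: "pull p \<in> S" if "p \<in> polys" "w \<in> \<nn>\<^sub>d" "p w \<noteq> 0" for p w
    unfolding S_def using that by (intro CollectI exI[of _ p] conjI refl bexI[of _ w])
  have S_E: "\<exists>p w. p \<in> polys \<and> b = pull p \<and> w \<in> \<nn>\<^sub>d \<and> p w \<noteq> 0" if "b \<in> S" for b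
    using that unfolding S_def by auto
  \<comment> \<open>Such a prime stands for an irreducible closed subset of \<open>L\<close> that
    still dominates \<open>V\<^sup>*\<close>; \<open>L\<close> itself may be reducible.\<close>
  have "\<exists>P. alg_prime A P \<and> I\<^sub>L \<subseteq> P \<and> P \<inter> S = {}"
  proof (rule prime_avoiding_exists[OF subalg_A alg_ideal_zero_on])
    show "S \<subseteq> A"
      using S_E pull_A by auto
    have "restr \<nn>\<^sub>d (\<lambda>_. 1) \<in> polys" "restr \<nn>\<^sub>d (\<lambda>_. 1) \<gamma> \<noteq> (0 :: 'b)"
      using generated_algebra.const \<gamma>_dual by auto
    then show "S \<noteq> {}"
      using S_I[OF _ \<gamma>_dual, of "restr \<nn>\<^sub>d (\<lambda>_. 1)"] by auto
    show "I\<^sub>L \<inter> S = {}"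
    proof (intro equals0I, elim IntE)
      fix b assume b: "b \<in> I\<^sub>L" "b \<in> S"
      then obtain p w where "p \<in> polys" "b = pull p" "w \<in> \<nn>\<^sub>d" "p w \<noteq> 0"
        using S_E[of b] by auto
      then show False
        using b(1) pull_zero_on_L[of p w] by simp
    qed
    fix a b assume "a \<in> S" "b \<in> S"
    then obtain p q w w' where pq: "p \<in> polys" "q \<in> polys" "a = pull p" "b = pull q"
      "w \<in> \<nn>\<^sub>d" "p w \<noteq> 0" "w' \<in> \<nn>\<^sub>d" "q w' \<noteq> 0"
      using S_E[of a] S_E[of b] by auto
    then obtain y where y: "y \<in> \<nn>\<^sub>d" "p y \<noteq> 0" "q y \<noteq> 0"
      using polys_common_nonzero[of p q w w'] by auto
    have "p * q \<in> polys"
      using pq(1,2) by (rule generated_algebra.mult)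
    then show "a * b \<in> S"
      unfolding pq(3,4) pull_simps(2)[symmetric] using y by (intro S_I[of "p * q" y]) simp_all
  qed
  then obtain P where P: "alg_prime A P" "I\<^sub>L \<subseteq> P" "P \<inter> S = {}"
    by blast
  have Pi: "alg_ideal A P" and k1: "\<kappa> 1 \<notin> P"
    using P(1) unfolding alg_prime_def by auto
  have PB: "p w = 0" if "p \<in> polys" "pull p \<in> P" "w \<in> \<nn>\<^sub>d" for p w
    using P(3) S_I[of p w] that by auto
  obtain F where F: "finite F" "A = generated_algebra X F"
    using A_generated by blast
  then obtain xs where xs: "set xs = restr X ` F"
    using finite_list[of "restr X ` F"] by blast
  note gens = adjoin_generators[OF F(2) xs subalg_pull]
  \<comment> \<open>The condition \<open>\<kappa> 1 \<noteq> 0\<close> upstairs is vacuous: any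
    lifted point will do.\<close>
  obtain b where b: "b \<in> ?B" "b \<notin> P" "lifting P ?B A b (\<kappa> 1)"
    using lifting_exists[OF subalg_A P(1) subalg_pull gens(2), of "\<kappa> 1"] A_const k1 unfolding gens(1) by blast
  then obtain p where p: "p \<in> polys" "b = pull p"
    by (elim imageE)
  have "\<exists>w\<in>\<nn>\<^sub>d. p w \<noteq> 0"
  proof (rule ccontr)
    assume "\<not> ?thesis"
    then have "pull p = 0"
      using orb_dual by (auto simp: pull_def fun_eq_iff)
    then show False
      using b(2) p(2) alg_idealD(2)[OF subalg_A Pi] by simp
  qed
  then obtain w0 where w0: "w0 \<in> \<nn>\<^sub>d" "p w0 \<noteq> 0"
    by (elim bexE) (rule that)
  \<comment> \<open>A point of the orbit off the exceptional hypersurface \<open>b = 0\<close>. The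
    point \<open>g\<close> over it need not be the one at which tangent vectors lift; that one is
    \<open>g'\<close> below.\<close>
  obtain w where w: "w \<in> \<nn>\<^sub>d" "p w \<noteq> 0" "\<Delta> w \<noteq> 0"
    using polys_common_nonzero[of p \<Delta> w0 \<gamma>] p(1) orbit_denominator_poly w0 \<gamma>_dual orbit_denominator_nonzero by auto
  obtain g where g: "g \<in> L" "w = orb \<gamma> g"
    using orbit_denominator_orbit[OF w(1,3)] by (elim bexE) (rule that)
  have gX: "g \<in> X"
    using g(1) L(3) by blast
  let ?\<phi> = "\<lambda>f. f g"
  have hom: "alg_hom ?B ?\<phi>"
    unfolding alg_hom_def using gX by simp
  moreover have "\<forall>q\<in>?B \<inter> P. ?\<phi> q = 0"
    using PB orb_dual[OF gX] pull_simps(5)[OF gX] by auto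
  moreover have "?\<phi> b \<noteq> 0"
    unfolding p(2) using w(2) g(2) gX by (simp add: pull_simps)
  ultimately obtain \<phi>' where \<phi>': "lifts P ?B A ?\<phi> \<phi>'"
    using b(3) unfolding lifting_def by blast
  obtain g' where g': "g' \<in> X" "\<And>f. f \<in> A \<Longrightarrow> \<phi>' f = f g'"
    using alg_hom_point[OF liftsD(1)[OF \<phi>']] by blast
  have "g' \<in> L"
  proof -
    have "f g' = 0" if "f \<in> I\<^sub>L" for f
      using that P(2) liftsD(2)[OF \<phi>', of f] g'(2)[of f] by auto
    then show ?thesis
      using L_zero_set g'(1) by blast
  qed
  \<comment> \<open>Tangent vectors are lifted at \<open>g'\<close>; translating them to 1 makes
    this the vector on which directions \<open>u\<close> are tested.\<close>
  define v' where "v' = Ad G A g' v"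
  have v': "v' \<in> \<nn>"
    unfolding v'_def using g'(1) v by (rule Ad_\<nn>)
  have "u v' = 0" if u: "u \<in> \<nn>\<^sub>d" for u
  proof -
    have pd: "point_derivation ?B ?\<phi> (pull_derivation w u)"
      using w(1) u gX g(2) by (rule point_derivation_pull)
    have "\<forall>q\<in>?B \<inter> P. pull_derivation w u q = 0"
    proof
      fix q assume "q \<in> ?B \<inter> P"
      then obtain r where r: "r \<in> polys" "q = pull r" "pull r \<in> P"
        by auto
      have "pull_derivation w u (pull r) = coeff 0 1"
        by (rule pull_derivation_eq[OF w(1) u r(1)]) (simp add: PB[OF r(1,3) line_dual[OF w(1) u]])
      then show "pull_derivation w u q = 0"
        unfolding r(2) by simp
    qed
    then obtain \<delta> where \<delta>: "point_derivation A \<phi>' \<delta>" "\<forall>q\<in>A \<inter> P. \<delta> q = 0" "\<forall>f\<in>?B. \<delta> f = pull_derivation w u f"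
      using liftsD(4)[OF \<phi>' pd] by auto
    note der = point_derivationD[OF subalg_A \<delta>(1)] and hom' = alg_homD[OF subalg_A liftsD(1)[OF \<phi>']]
    have scl: "\<delta> (\<lambda>x. c * f x) = c * \<delta> f" if f: "f \<in> A" for c f
    proof -
      have "(\<lambda>x. c * f x) = \<kappa> c * f"
        using A_outside[OF f] by (auto simp: fun_eq_iff)
      then show ?thesis
        using der(3)[OF A_const f, of c] der(1)[of c] hom'(1)[of c] by simp
    qed
    \<comment> \<open>The lift \<open>\<delta>\<close> at \<open>g'\<close>, moved to 1 by left
      translation. It becomes tangent to \<open>L\<close>, because \<open>g'\<close> lies in
      \<open>L\<close> and \<open>\<delta>\<close> kills \<open>I\<^sub>L\<close>.\<close>
    have "tangent \<one> (\<lambda>f. \<delta> (ltr (inv g') f))"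
      unfolding tangent_def linear_on_A_def
    proof (intro conjI ballI allI)
      have ig: "inv g' \<in> X"
        using g'(1) by simp
      fix f h assume fh: "f \<in> A" "h \<in> A"
      have "ltr (inv g') (f + h) = ltr (inv g') f + ltr (inv g') h"
        by (auto simp: fun_eq_iff)
      then show "\<delta> (ltr (inv g') (f + h)) = \<delta> (ltr (inv g') f) + \<delta> (ltr (inv g') h)"
        using der(2)[OF ltr_A[OF fh(1) ig] ltr_A[OF fh(2) ig]] by simp
      have "ltr (inv g') (f * h) = ltr (inv g') f * ltr (inv g') h"
        by (auto simp: fun_eq_iff)
      then show "\<delta> (ltr (inv g') (f * h)) = \<delta> (ltr (inv g') f) * h \<one> + f \<one> * \<delta> (ltr (inv g') h)"
        using der(3)[OF ltr_A[OF fh(1) ig] ltr_A[OF fh(2) ig]] g'(2)[OF ltr_A[OF fh(1) ig]] g'(2)[OF ltr_A[OF fh(2) ig]] g'(1)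
        by simp
    next
      fix c f assume f: "f \<in> A"
      have "ltr (inv g') (\<lambda>x. c * f x) = (\<lambda>x. c * ltr (inv g') f x)"
        by (auto simp: fun_eq_iff)
      then show "\<delta> (ltr (inv g') (\<lambda>x. c * f x)) = c * \<delta> (ltr (inv g') f)"
        using scl[OF ltr_A[OF f inv_closed[OF g'(1)]], of c] by simp
    qed
    then obtain x where x: "x \<in> Lie G A" "\<And>f. f \<in> A \<Longrightarrow> x f \<one> = \<delta> (ltr (inv g') f)"
      using tangent_Lie by blast
    have "x \<in> \<ll>"
    proof (rule Lie_subgroupI[OF x(1)])
      fix f assume f: "f \<in> A" "\<forall>y\<in>L. f y = 0"
      have lA: "ltr (inv g') f \<in> A"
        using f(1) g'(1) by (intro ltr_A) auto
      have "ltr (inv g') f y = 0" if "y \<in> L" for y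
        using f(2) subgroup.m_closed[OF L(2) subgroup.m_inv_closed[OF L(2) \<open>g' \<in> L\<close>] that] by simp
      then have "ltr (inv g') f \<in> A \<inter> P"
        using lA P(2) by blast
      then show "x f \<one> = 0"
        using x(2)[OF f(1)] \<delta>(2) by simp
    qed
    then have "x (coefficient \<gamma> v) \<one> = 0"
      using coefficient_derivative[OF \<gamma>_dual v x(1)] z by simp
    moreover have "ltr (inv g') (coefficient \<gamma> v) = coefficient \<gamma> v'"
      unfolding v'_def using ltr_coefficient[OF v inv_closed[OF g'(1)]] g'(1) by simp
    ultimately have "\<delta> (coefficient \<gamma> v') = 0"
      using x(2)[OF coefficient_A[OF \<gamma>_dual v]] by simp
    moreover have gen: "restr \<nn>\<^sub>d (\<lambda>\<phi>. \<phi> v') \<in> polys"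
      using v' by (intro generated_algebra.gen) blast
    then have "\<delta> (coefficient \<gamma> v') = pull_derivation w u (coefficient \<gamma> v')"
      using bspec[OF \<delta>(3) imageI[OF gen, of pull]] unfolding pull_simps(4)[OF v'] by simp
    moreover have "pull_derivation w u (coefficient \<gamma> v') = coeff [:w v', u v':] 1"
      unfolding pull_simps(4)[OF v', symmetric]
      by (rule pull_derivation_eq[OF w(1) u gen]) (use line_dual[OF w(1) u] in \<open>simp add: line_def\<close>)
    ultimately show ?thesis
      by simp
  qed
  then have "v' = 0"
    by (rule \<nn>_separated[OF v'])
  have "v = Ad G A (inv g') v'"
    unfolding v'_def using Ad_Ad[OF inv_closed[OF g'(1)] g'(1) Lie_subgroup_Lie[OF v]] g'(1)
      Ad_one[OF Lie_subgroup_Lie[OF v]] by simp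
  also have "\<dots> = 0"
    using Ad_scale[OF inv_closed[OF g'(1)] V.subspace_0[OF Lie_subspace], of 0] \<open>v' = 0\<close> by simp
  finally show ?thesis .
qed

sublocale abelian_extension op_scale commutator "Lie G A" \<ll> \<nn> \<gamma>
proof unfold_locales
  show "commutator (commutator x y) z = commutator x (commutator y z) - commutator y (commutator x z)"
    if "x \<in> Lie G A" "y \<in> Lie G A" "z \<in> Lie G A" for x y z
    using that by (rule commutator_jacobi)
  show "commutator x y \<in> \<ll>" if "x \<in> \<ll>" "y \<in> \<ll>" for x y
    using aff L(2) that by (rule commutator_in_Lie_subgroup)
  show "\<exists>y\<in>\<ll>. \<exists>v\<in>\<nn>. x = y + v" if "x \<in> Lie G A" for x
    using that by (rule Lie_decomposition)
  show "v = 0" if "v \<in> \<nn>" "\<forall>x\<in>\<ll>. \<gamma> (commutator x v) = 0" for v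
    using that by (rule orbit_map_submersive)
qed (use Lie_subgroup_subspace Lie_subgroup_Lie \<nn>_ideal \<nn>_abelian Lie_disjoint \<gamma>_dual in auto)

text \<open>\<open>Ad G A g\<close> is an automorphism of the Lie algebra, and composing
  \<open>\<phi>\<close> with it turns the restriction \<open>orb \<gamma> g\<close> back into
  \<open>\<gamma>\<close>.\<close>

lemma contact_functional_conjugate:
  assumes c: "contact_functional \<phi> z" and g: "g \<in> X" and \<phi>: "\<And>v. v \<in> \<nn> \<Longrightarrow> \<phi> v = orb \<gamma> g v"
  shows "\<exists>\<phi> w. contact_functional \<phi> w \<and> (\<forall>v\<in>\<nn>. \<phi> v = \<gamma> v)"
proof -
  have ig: "inv g \<in> X"
    using g by simp
  have canc: "Ad G A g (Ad G A (inv g) x) = x" "Ad G A (inv g) (Ad G A g x) = x" if "x \<in> Lie G A" for x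
    using Ad_Ad[OF g ig that] Ad_Ad[OF ig g that] Ad_one[OF that] g by simp_all
  have \<phi>d: "\<phi> \<in> dual_space op_scale (Lie G A)" and z: "z \<in> Lie G A" "\<phi> z \<noteq> 0" "\<And>y. y \<in> Lie G A \<Longrightarrow> \<phi> (commutator z y) = 0"
    and ker: "\<And>x. x \<in> Lie G A \<Longrightarrow> (\<forall>y\<in>Lie G A. \<phi> (commutator x y) = 0) \<Longrightarrow> \<exists>c. x = op_scale c z"
    using c unfolding contact_functional_def by blast+
  define \<phi>' where "\<phi>' = restr (Lie G A) (\<lambda>x. \<phi> (Ad G A g x))"
  define z' where "z' = Ad G A (inv g) z"
  have z': "z' \<in> Lie G A" "Ad G A g z' = z"
    unfolding z'_def using Ad_Lie[OF z(1) ig] canc z(1) by auto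
  have \<phi>'_br: "\<phi>' (commutator x y) = \<phi> (commutator (Ad G A g x) (Ad G A g y))"
    if "x \<in> Lie G A" "y \<in> Lie G A" for x y
    unfolding \<phi>'_def using commutator_closed[OF that] Ad_commutator[OF g that] by simp
  have "contact_functional \<phi>' z'"
    unfolding contact_functional_def
  proof (intro conjI ballI impI z')
    show "\<phi>' \<in> dual_space op_scale (Lie G A)"
      unfolding \<phi>'_def
      by (rule dual_restrict) (simp_all add: Ad_add[OF g] Ad_scale[OF g] dualD[OF \<phi>d] Ad_Lie[OF _ g])
    show "\<phi>' z' \<noteq> 0"
      unfolding \<phi>'_def using z' z(2) by simp
    show "\<phi>' (commutator z' y) = 0" if "y \<in> Lie G A" for y
      using \<phi>'_br[OF z'(1) that] z'(2) z(3)[OF Ad_Lie[OF that g]] by simp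
    fix x assume x: "x \<in> Lie G A" "\<forall>y\<in>Lie G A. \<phi>' (commutator x y) = 0"
    have "\<phi> (commutator (Ad G A g x) y) = 0" if y: "y \<in> Lie G A" for y
      using x(2) Ad_Lie[OF y ig] \<phi>'_br[OF x(1) Ad_Lie[OF y ig]] canc(1)[OF y] by simp
    then obtain c where "Ad G A g x = op_scale c z"
      using ker[OF Ad_Lie[OF x(1) g]] by blast
    then have "x = op_scale c z'"
      using canc(2)[OF x(1)] Ad_scale[OF ig z(1), of c] unfolding z'_def by simp
    then show "\<exists>c. x = op_scale c z'"
      by blast
  qed
  moreover have "\<phi>' v = \<gamma> v" if v: "v \<in> \<nn>" for v
    unfolding \<phi>'_def using Lie_subgroup_Lie[OF v] \<phi>[OF Ad_\<nn>[OF g v]] Ad_\<nn>[OF g v] canc(2)[OF Lie_subgroup_Lie[OF v]]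
    by (simp add: dual_action_def)
  ultimately show ?thesis
    by blast
qed

lemma contact_functional_extending:
  assumes "contact op_scale commutator (Lie G A)"
  shows "\<exists>\<phi> w. contact_functional \<phi> w \<and> (\<forall>v\<in>\<nn>. \<phi> v = \<gamma> v)"
proof -
  obtain \<phi>0 z0 where c0: "contact_functional \<phi>0 z0"
    using assms contact_iff by blast
  then have \<phi>0: "\<phi>0 \<in> dual_space op_scale (Lie G A)"
    unfolding contact_functional_def by blast
  obtain n vs where vs: "V.dim (Lie G A) = 2 * n + 1" "\<forall>i. vs i \<in> Lie G A" "contact_volume n \<phi>0 vs \<noteq> 0"
    using functional_imp_contact[OF c0] by blast
  obtain \<phi>1 where \<phi>1: "\<phi>1 \<in> dual_space op_scale (Lie G A)" "\<And>v. v \<in> \<nn> \<Longrightarrow> \<phi>1 v = \<gamma> v"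
    using extend_functional[of "\<lambda>_. 0"] by auto
  \<comment> \<open>The line from a contact form, at \<open>t = 0\<close>, to an extension of
    \<open>\<gamma>\<close>, at \<open>t = 1\<close>. The contact volume on the fixed vectors
    \<open>vs\<close> and the value of \<open>\<Delta>\<close> on the restriction are polynomials in
    \<open>t\<close>, nonzero at 0 and at 1 respectively, so some \<open>t\<close> suits
    both.\<close>
  define \<phi> where "\<phi> t x = \<phi>0 x + t * (\<phi>1 x - \<phi>0 x)" for t x
  have \<phi>: "\<phi> t \<in> dual_space op_scale (Lie G A)" for t
    using \<phi>0 \<phi>1(1) unfolding dual_space_def \<phi>_def by (auto simp: algebra_simps)
  have restr_dual: "restr \<nn> \<psi> \<in> \<nn>\<^sub>d" if "\<psi> \<in> dual_space op_scale (Lie G A)" for \<psi>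
    unfolding dual_space_def using dualD[OF that] \<nn>_closed Lie_subgroup_Lie by simp
  define a where "a = restr \<nn> \<phi>0"
  define u where "u = line \<gamma> a (- 1)"
  have a: "a \<in> \<nn>\<^sub>d"
    unfolding a_def using \<phi>0 by (rule restr_dual)
  have u: "u \<in> \<nn>\<^sub>d"
    unfolding u_def using \<gamma>_dual a by (rule line_dual)
  have line: "line a u t v = \<phi> t v" if "v \<in> \<nn>" for t v
    using that \<phi>1(2) by (simp add: line_def u_def a_def \<phi>_def)
  have line1: "line a u 1 = \<gamma>"
    by (simp add: line_def u_def)
  have lin: "polynomial_function (\<lambda>t. \<phi> t x)" for x
    unfolding \<phi>_def by (rule polynomial_function_intros)
  have "polynomial_function (\<lambda>t. wedge_power 2 (ce_differential commutator (\<phi> t)) m v)" for m v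
  proof (induction m arbitrary: v)
    case 0
    show ?case
      by (simp add: polynomial_function_intros)
  next
    case (Suc m)
    show ?case
      unfolding wedge_power.simps
      by (intro polynomial_function_wedge Suc) (simp add: ce_differential_def lin polynomial_function_intros)
  qed
  then have "polynomial_function (\<lambda>t. contact_volume n (\<phi> t) vs)"
    using lin by (intro polynomial_function_wedge)
  moreover have "contact_volume n (\<phi> 0) vs \<noteq> 0"
  proof -
    have "\<phi> 0 = \<phi>0"
      by (simp add: \<phi>_def fun_eq_iff)
    then show ?thesis
      using vs(3) by simp
  qed
  ultimately obtain t where t: "contact_volume n (\<phi> t) vs \<noteq> 0" "\<Delta> (line a u t) \<noteq> 0"
    using polynomial_functions_nonzero[OF _ polys_line[OF orbit_denominator_poly a u], of _ 0 1] orbit_denominator_nonzero line1 by fastforce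
  obtain z where z: "contact_functional (\<phi> t) z"
    using contact_imp_functional[OF vs(1) \<phi> vs(2) t(1)] by blast
  obtain g where g: "g \<in> L" "line a u t = orb \<gamma> g"
    using orbit_denominator_orbit[OF line_dual[OF a u] t(2)] by (elim bexE) (rule that)
  show ?thesis
    by (rule contact_functional_conjugate[OF z, of g]) (use g L(3) line[of _ t] in auto)
qed

end

theorem theorem2p8:
  fixes Q :: "'g monoid"
    and A :: "('g \<Rightarrow> 'k::{alg_closed_field, field_char_0}) set"
    and L N :: "'g set"
    and V l\<^sub>\<gamma> l\<^sub>n :: "('g, 'k) operator set"
    and \<gamma> :: "('g, 'k) operator \<Rightarrow> 'k"
  assumes "affine_algebraic_group Q A"
    and "connected_space (zariski (carrier Q) A)"
    and "semidirect_product Q A L N"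
    and "\<forall>x\<in>N. \<forall>y\<in>N. x \<otimes>\<^bsub>Q\<^esub> y = y \<otimes>\<^bsub>Q\<^esub> x"
    and "unipotent_subgroup Q A N"
    and "V = Lie_subgroup Q A N"
    and "lie_index op_scale commutator (Lie Q A) = 1"
    and "\<gamma> \<in> dual_space op_scale V"
    and "openin (zariski_dual op_scale V) ((\<lambda>g. dual_action Q A V g \<gamma>) ` L)"
    and "l\<^sub>\<gamma> = Lie_subgroup Q A (point_stabiliser Q A L V \<gamma>)"
    and "l\<^sub>n = Lie_subgroup Q A (line_normaliser Q A L V \<gamma>)"
  shows "(\<not> contact op_scale commutator l\<^sub>\<gamma> \<longrightarrow>
            (contact op_scale commutator (Lie Q A) \<longleftrightarrow> lie_index op_scale commutator l\<^sub>n = 0)) \<and>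
         (contact op_scale commutator l\<^sub>\<gamma> \<and> \<not> contact op_scale commutator (Lie Q A) \<longrightarrow>
            lie_index op_scale commutator l\<^sub>n = 0)"
proof -
  interpret open_orbit Q A L N \<gamma>
    using assms by unfold_locales auto
  have "l\<^sub>\<gamma> = stab" "l\<^sub>n = norm_line"
    unfolding assms(6,10,11) stab_def norm_line_def by (rule Lie_stabiliser Lie_line_normaliser, rule \<gamma>_dual)+
  then show ?thesis
    using contact_extension[OF contact_functional_extending] assms(7) by simp
qed

end
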